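(* Let $n,m\ge 1$, $\alpha>0$, and for $t>0$ let $\Psi_t=(\Psi_t^1,\dots,\Psi_t^m):\mathbb{R}^n\times\mathbb{R}^n\to\mathbb{C}^m$ satisfy $$|\Psi_t(x,y)|\le C\frac{t^{\alpha}}{(t+|x-y|)^{n+\alpha}},$$ $$|\Psi_t(x,y+h)-\Psi_t(x,y)|+|\Psi_t(x+h,y)-\Psi_t(x,y)|\le C\frac{|h|^{\alpha}}{(t+|x-y|)^{n+\alpha}}\quad\text{whenever } |h|\le t/2,$$ with $C$ independent of $t,x,y,h$. Let $\Theta_t$ be the associated operator (acting on $\mathbb{C}^m$-valued and on $m\times m$ matrix-valued functions as defined in the context). Suppose that there exist constants $\delta>0$ and $C_0<\infty$, an exponent $p>1$, and a system $\{b_Q\}\subset L^p(\mathbb{R}^n,\mathbb{M}^m)$, indexed by the dyadic cubes $Q\subset\mathbb{R}^n$, such that for each dyadic cube $Q$: $$\int_{\mathbb{R}^n}|b_Q(x)|^p\,dx\le C_0|Q|,$$ $$\int_Q\left(\int_0^{\ell(Q)}|\Theta_tb_Q(x)|^2\frac{dt}{t}\right)^{p/2}dx\le C_0|Q|,$$ $$\delta|\xi|^2\le \mathrm{Re}\left(\xi\cdot\Big(\frac1{|Q|}\int_Qb_Q(x)\,dx\Big)\bar{\xi}\right)\qquad\forall\,\xi\in\mathbb{C}^m.$$ Then there is a constant $C'$, depending only on $n,m,p$ and the constants in the hypotheses, such that for all $f\in L^2(\mathbb{R}^n,\mathbb{C}^m)$ $$\iint_{\mathbb{R}^{n+1}_+}|\Theta_tf(x)|^2\frac{dx\,dt}{t}\le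 C'\|f\|_{L^2(\mathbb{R}^n)}^2.$$
   Context: $\mathbb{M}^m$ denotes the $m\times m$ complex matrices, with any fixed norm (e.g. Hilbert–Schmidt). $\mathbb{R}^{n+1}_+=\mathbb{R}^n\times(0,\infty)$. Dyadic cubes are the standard closed dyadic cubes of $\mathbb{R}^n$; $\ell(Q)$ is the side length and $|Q|$ the Lebesgue measure of $Q$. For $z,w\in\mathbb{C}^m$, $z\cdot w=\sum_j z_jw_j$ (no conjugation). For $f:\mathbb{R}^n\to\mathbb{C}^m$, $$\Theta_tf(x)=\int_{\mathbb{R}^n}\Psi_t(x,y)\cdot f(y)\,dy=\sum_{j=1}^m\int_{\mathbb{R}^n}\Psi_t^j(x,y)f_j(y)\,dy.$$ For matrix-valued $b=(b_{ij})_{1\le i,j\le m}:\mathbb{R}^n\to\mathbb{M}^m$, $\Theta_tb$ is the $\mathbb{C}^m$-valued function $$\Theta_tb(x)=\Big(\sum_{i=1}^m\int_{\mathbb{R}^n}\Psi_t^i(x,y)b_{ij}(y)\,dy\Big)_{1\le j\le m}.$$ The kernel $\Psi_t(x,y)$ is understood to be jointly measurable in $(x,y,t)$, so that the displayed integrals make sense. *)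

theory Defs
  imports "HOL-Analysis.Analysis"
begin

text \<open>
  Vectors \<open>complex ^ 'm\<close> carry the Euclidean norm and matrices \<open>complex ^ 'm ^ 'm\<close> the
  Hilbert--Schmidt norm; the entry \<open>B\<^sub>i\<^sub>j\<close> is \<open>B $ i $ j\<close>. Measurability is in the sense of
  Lebesgue throughout.
\<close>

text \<open>The bilinear (conjugation-free) product on complex vectors; \<open>inner\<close> on this type is the
  real inner product.\<close>

definition cdot :: "complex ^ 'm \<Rightarrow> complex ^ 'm \<Rightarrow> complex"
  where "cdot z w = (\<Sum>j\<in>UNIV. z $ j * w $ j)"

definition vec_cnj :: "complex ^ 'm \<Rightarrow> complex ^ 'm"
  where "vec_cnj z = (\<chi> j. cnj (z $ j))"

definition Lp_space :: "real \<Rightarrow> ('a::euclidean_space \<Rightarrow> 'b::euclidean_space) set"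
  where "Lp_space p = {f. f \<in> borel_measurable lebesgue \<and>
           integrable lebesgue (\<lambda>x. norm (f x) powr p)}"

definition Lp_norm :: "real \<Rightarrow> ('a::euclidean_space \<Rightarrow> 'b::euclidean_space) \<Rightarrow> real"
  where "Lp_norm p f = (LINT x|lebesgue. norm (f x) powr p) powr (1 / p)"

text \<open>The closed dyadic cube with side length \<open>2 powi j\<close> and lower corner \<open>2 powi j * k\<close>;
  the pair \<open>(j, k)\<close> is determined by the cube.\<close>

definition dyadic_cube :: "int \<Rightarrow> int ^ 'n \<Rightarrow> (real ^ 'n) set"
  where "dyadic_cube j k =
    cbox (\<chi> i. 2 powi j * of_int (k $ i)) (\<chi> i. 2 powi j * (of_int (k $ i) + 1))"

text \<open>Positive powers on \<open>[0, \<infinity>]\<close>, so that a divergent inner integral counts as \<open>\<infinity>\<close>.\<close>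

definition ennreal_powr :: "ennreal \<Rightarrow> real \<Rightarrow> ennreal"
  where "ennreal_powr u a = (if u = \<infinity> then \<infinity> else ennreal (enn2real u powr a))"

definition square_function_kernel ::
    "real \<Rightarrow> real \<Rightarrow> (real \<Rightarrow> real ^ 'n \<Rightarrow> real ^ 'n \<Rightarrow> complex ^ 'm) \<Rightarrow> bool"
  where "square_function_kernel \<alpha> C \<Psi> \<longleftrightarrow>
    (\<lambda>(x, y, t). \<Psi> t x y) \<in> borel_measurable (lebesgue_on (UNIV \<times> UNIV \<times> {0<..})) \<and>
    (\<forall>t>0. \<forall>x y. norm (\<Psi> t x y) \<le>
       C * (t powr \<alpha> / (t + norm (x - y)) powr (real CARD('n) + \<alpha>))) \<and>
    (\<forall>t>0. \<forall>x y h. norm h \<le> t / 2 \<longrightarrow>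
       norm (\<Psi> t x (y + h) - \<Psi> t x y) + norm (\<Psi> t (x + h) y - \<Psi> t x y) \<le>
       C * (norm h powr \<alpha> / (t + norm (x - y)) powr (real CARD('n) + \<alpha>)))"

definition Theta_vec ::
    "(real \<Rightarrow> real ^ 'n \<Rightarrow> real ^ 'n \<Rightarrow> complex ^ 'm) \<Rightarrow> real \<Rightarrow>
     (real ^ 'n \<Rightarrow> complex ^ 'm) \<Rightarrow> real ^ 'n \<Rightarrow> complex"
  where "Theta_vec \<Psi> t f x = (LINT y|lebesgue. cdot (\<Psi> t x y) (f y))"

definition Theta_mat ::
    "(real \<Rightarrow> real ^ 'n \<Rightarrow> real ^ 'n \<Rightarrow> complex ^ 'm) \<Rightarrow> real \<Rightarrow>
     (real ^ 'n \<Rightarrow> complex ^ 'm ^ 'm) \<Rightarrow> real ^ 'n \<Rightarrow> complex ^ 'm"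
  where "Theta_mat \<Psi> t b x =
    (\<chi> j. \<Sum>i\<in>UNIV. LINT y|lebesgue. \<Psi> t x y $ i * b y $ i $ j)"

definition dyadic_testing_system ::
    "real \<Rightarrow> real \<Rightarrow> real \<Rightarrow> (real \<Rightarrow> real ^ 'n \<Rightarrow> real ^ 'n \<Rightarrow> complex ^ 'm) \<Rightarrow>
     ((real ^ 'n) set \<Rightarrow> real ^ 'n \<Rightarrow> complex ^ 'm ^ 'm) \<Rightarrow> bool"
  where "dyadic_testing_system p \<delta> C\<^sub>0 \<Psi> b \<longleftrightarrow>
    (\<forall>j k. let Q = dyadic_cube j k; l = 2 powi j in
      b Q \<in> Lp_space p \<and>
      (LINT x|lebesgue. norm (b Q x) powr p) \<le> C\<^sub>0 * measure lebesgue Q \<and>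
      (\<integral>\<^sup>+x\<in>Q. ennreal_powr
          (\<integral>\<^sup>+t\<in>{0<..<l}. ennreal ((norm (Theta_mat \<Psi> t (b Q) x))\<^sup>2 / t) \<partial>lebesgue)
          (p / 2) \<partial>lebesgue)
        \<le> ennreal (C\<^sub>0 * measure lebesgue Q) \<and>
      (\<forall>\<xi>. \<delta> * (norm \<xi>)\<^sup>2 \<le>
        Re (cdot \<xi> (((1 / measure lebesgue Q) *\<^sub>R (LINT x:Q|lebesgue. b Q x)) *v vec_cnj \<xi>))))"

end

theory Submission
  imports Defs
begin

text \<open>
  Write \<open>\<gamma>\<^sub>t = \<Theta>\<^sub>t 1\<close> and let \<open>A\<^sub>t\<close> be the average over the dyadic cube of side comparable to \<open>t\<close>.
  Cancellation shows that \<open>\<Theta>\<^sub>t - \<gamma>\<^sub>t A\<^sub>t\<close> satisfies the square function estimate, so by the Carleson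
  embedding theorem it remains to show that \<open>|\<gamma>\<^sub>t|\<^sup>2 dx dt/t\<close> is a Carleson measure. Covering the
  unit sphere by finitely many narrow cones, it suffices to treat the part of \<open>\<gamma>\<^sub>t\<close> in a cone around a
  unit vector \<open>v\<close>; this part is Hoelder continuous at scale \<open>t\<close>, so a John--Nirenberg argument reduces
  the Carleson bound to finding, in each cube \<open>Q\<close>, a fixed proportion of points where its square
  function is bounded. Accretivity in the direction \<open>v\<close> supplies such points outside the cubes
  where the average of \<open>|b\<^sub>Q|\<close> is large or that of \<open>Re (v \<cdot> b\<^sub>Q v\<^sup>*)\<close> is small: there \<open>|\<gamma>\<^sub>t|\<close> is
  dominated by \<open>|\<gamma>\<^sub>t A\<^sub>t b\<^sub>Q|\<close>, hence by \<open>|\<Theta>\<^sub>t b\<^sub>Q|\<close> plus the error terms of a Calderon--Zygmund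
  decomposition of \<open>b\<^sub>Q\<close>. The latter makes sense for all \<open>p > 1\<close>, because the good part is bounded
  and the atoms are controlled pointwise where a Marcinkiewicz integral is small.
\<close>

section \<open>Half-open dyadic cubes and averages\<close>

text \<open>The obstacle is that the remainder \<Theta>_t - \<gamma>_t A_t is controlled in L^2
  only, whereas the test functions lie in L^p with p possibly below 2. Hence b_Q is cut at a height
  \<open>K\<close>, the L^2 bound is applied to the bounded part alone, and the atoms are estimated
  pointwise off a small set. After stopping, accretivity survives only in the chosen direction v,
  since the discarded cubes depend on v. It bounds the row v A_t b_Q from below, and the cone keeps
  \<gamma>_t close to a multiple of v. All stopping constructions run over finitely many levels
  \<open>l..q\<close>, with bounds uniform in \<open>l\<close>; the Carleson norm is thus never
  assumed finite, and the truncation disappears only when blocks of levels exhaust the integers.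
  Replacing \<alpha> by min \<alpha> 1 lets powers of a ratio of scales absorb the linear measure
  estimate for boundary layers of cubes. All constants are fixed before the kernel, because the
  theorem asks for a uniform one.\<close>

definition cube_index :: "int \<Rightarrow> real ^ 'n \<Rightarrow> int ^ 'n"
  where "cube_index j x = (\<chi> i. \<lfloor>x $ i / 2 powi j\<rfloor>)"

text \<open>A cube is addressed by any of its points, so that averages become functions of x;
  half-open cubes make the cubes of one level a partition.\<close>

definition cube_of :: "int \<Rightarrow> real ^ 'n \<Rightarrow> (real ^ 'n) set"
  where "cube_of j x = {y. cube_index j y = cube_index j x}"

definition cvol :: "nat \<Rightarrow> int \<Rightarrow> real"
  where "cvol n j = (2 powi j) ^ n"

lemma cvol_pos [simp]: "cvol n j > 0" "cvol n j \<noteq> 0" "cvol n j \<ge> 0"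
  by (simp_all add: cvol_def)

lemma measurable_cube_index [measurable]:
  "cube_index j \<in> measurable borel (count_space (UNIV :: (int ^ 'n) set))"
proof -
  have [measurable]: "(\<lambda>x::real ^ 'n. x $ i) \<in> borel_measurable borel" for i
    by (intro borel_measurable_continuous_onI continuous_intros)
  have "cube_index j -` {a} \<in> sets borel" for a :: "int ^ 'n"
  proof -
    have "cube_index j -` {a} = {x. \<forall>i. \<lfloor>x $ i / 2 powi j\<rfloor> = a $ i}"
      by (auto simp: cube_index_def vec_eq_iff)
    also have "\<dots> \<in> sets borel"
      by measurable
    finally show ?thesis .
  qed
  then show ?thesis
    by (subst measurable_count_space_eq2_countable) auto
qed

lemma sets_cube_of [measurable]: "cube_of j x \<in> sets borel"
proof -
  have "{y \<in> space borel. cube_index j y = cube_index j x} \<in> sets borel"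
    by measurable
  then show ?thesis by (simp add: cube_of_def)
qed

lemma cube_of_iff: "y \<in> cube_of j x \<longleftrightarrow> cube_index j y = cube_index j x"
  by (simp add: cube_of_def)

text \<open>Nesting: dividing by a further \<open>2 ^ m\<close> before taking floors amounts to an
  integer division of the finer index, so the coarse index is a function of the fine one.\<close>

lemma cube_index_mono:
  fixes x y :: "real ^ 'n"
  assumes "cube_index i x = cube_index i y" "i \<le> j"
  shows "cube_index j x = cube_index j y"
proof -
  define m where "m = nat (j - i)"
  have j: "j = i + int m" using assms(2) by (simp add: m_def)
  have p: "(2::real) powi j = 2 powi i * 2 ^ m"
    unfolding j by (simp add: power_int_add)
  have "\<lfloor>z / 2 powi j\<rfloor> = \<lfloor>z / 2 powi i\<rfloor> div 2 ^ m" for z :: real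
    using floor_divide_real_eq_div[of "2 ^ m" "z / 2 powi i"] by (simp add: p)
  with assms(1) show ?thesis
    by (simp add: cube_index_def vec_eq_iff)
qed

lemma norm_diff_cube_index:
  fixes x y :: "real ^ 'n"
  assumes "cube_index j x = cube_index j y"
  shows "norm (x - y) \<le> real CARD('n) * 2 powi j"
proof -
  have "\<bar>(x - y) $ i\<bar> \<le> 2 powi j" for i
  proof -
    have "\<lfloor>x $ i / 2 powi j\<rfloor> = \<lfloor>y $ i / 2 powi j\<rfloor>"
      using assms by (simp add: cube_index_def vec_eq_iff)
    then have "\<bar>x $ i / 2 powi j - y $ i / 2 powi j\<bar> \<le> 1" by linarith
    then have "\<bar>x $ i - y $ i\<bar> / 2 powi j \<le> 1"
      by (simp add: diff_divide_distrib [symmetric])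
    then show ?thesis by (simp add: field_simps)
  qed
  then have "(\<Sum>i\<in>UNIV. \<bar>(x - y) $ i\<bar>) \<le> (\<Sum>i\<in>(UNIV::'n set). 2 powi j)"
    by (intro sum_mono)
  then show ?thesis
    using norm_le_l1_cart[of "x - y"] by simp
qed

lemma cube_of_box:
  fixes x :: "real ^ 'n" and j :: int
  defines "a \<equiv> (\<chi> i. 2 powi j * of_int (cube_index j x $ i)) :: real ^ 'n"
  defines "b \<equiv> (\<chi> i. 2 powi j * (of_int (cube_index j x $ i) + 1)) :: real ^ 'n"
  shows "cube_of j x = {y. \<forall>i. a $ i \<le> y $ i \<and> y $ i < b $ i}"
proof -
  have "\<lfloor>z / 2 powi j\<rfloor> = k \<longleftrightarrow> 2 powi j * of_int k \<le> z \<and> z < 2 powi j * (of_int k + 1)" for z :: real and k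
    by (simp add: floor_eq_iff field_simps)
  then show ?thesis
    unfolding cube_of_def a_def b_def by (auto simp: cube_index_def vec_eq_iff)
qed

lemma emeasure_box_eq_cbox: "emeasure lborel (box a b) = emeasure lborel (cbox a b)"
  for a b :: "'a::euclidean_space"
  by (simp add: emeasure_lborel_box_eq emeasure_lborel_cbox_eq)

lemma emeasure_cbox_cart:
  fixes a b :: "real ^ 'n"
  assumes "\<And>i. a $ i \<le> b $ i"
  shows "emeasure lborel (cbox a b) = ennreal (\<Prod>i\<in>UNIV. b $ i - a $ i)"
proof -
  have "cbox a b \<noteq> {}" using assms by (simp add: interval_ne_empty_cart)
  then show ?thesis
    using content_cbox_cart[of a b] emeasure_lborel_cbox_finite[of a b]
    by (simp add: emeasure_eq_ennreal_measure)
qed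

lemma emeasure_dyadic_cube: "emeasure lborel (dyadic_cube j (k :: int ^ 'n)) = ennreal (cvol CARD('n) j)"
  unfolding dyadic_cube_def
  by (subst emeasure_cbox_cart) (simp_all add: algebra_simps cvol_def)

text \<open>The half-open cube lies between an open and a closed box of equal measure, which
  determines its measure.\<close>

lemma box_cube_of_cbox:
  fixes x :: "real ^ 'n"
  shows "box (\<chi> i. 2 powi j * of_int (cube_index j x $ i)) (\<chi> i. 2 powi j * (of_int (cube_index j x $ i) + 1))
      \<subseteq> cube_of j x"
    and "cube_of j x \<subseteq> dyadic_cube j (cube_index j x)"
  unfolding dyadic_cube_def by (subst cube_of_box; auto simp: mem_box_cart less_imp_le)+

lemma emeasure_cube_of [simp]:
  "emeasure lborel (cube_of j (x :: real ^ 'n)) = ennreal (cvol CARD('n) j)"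
proof (rule antisym)
  show "emeasure lborel (cube_of j x) \<le> ennreal (cvol CARD('n) j)"
    using emeasure_mono[OF box_cube_of_cbox(2)[of j x], of lborel]
    by (simp add: emeasure_dyadic_cube) (simp add: dyadic_cube_def)
  show "ennreal (cvol CARD('n) j) \<le> emeasure lborel (cube_of j x)"
    using emeasure_mono[OF box_cube_of_cbox(1)[of j x], of lborel]
    by (simp add: emeasure_box_eq_cbox dyadic_cube_def [symmetric] emeasure_dyadic_cube)
qed

text \<open>The dyadic conditional expectation on [0, \<infinity>], where Fubini and the algebraic
  rules hold without integrability conditions.\<close>

definition avn :: "int \<Rightarrow> (real ^ 'n \<Rightarrow> ennreal) \<Rightarrow> real ^ 'n \<Rightarrow> ennreal"
  where "avn j u x = ennreal (1 / cvol CARD('n) j) * (\<integral>\<^sup>+y. indicator (cube_of j x) y * u y \<partial>lborel)"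

lemma avn_cong: "cube_index j x = cube_index j y \<Longrightarrow> avn j u x = avn j u y"
  by (simp add: avn_def cube_of_def)

text \<open>Such a function factors through the index, which takes values in a countable discrete
  space; a chosen representative of each cube gives the factor.\<close>

lemma measurable_cube_index_fun:
  fixes f :: "real ^ 'n \<Rightarrow> 'b::topological_space"
  assumes "\<And>x y. cube_index j x = cube_index j (y :: real ^ 'n) \<Longrightarrow> f x = f y"
  shows "f \<in> measurable borel borel"
proof -
  have "f = (\<lambda>k. f (SOME x. cube_index j x = k)) \<circ> cube_index j"
  proof
    fix x :: "real ^ 'n"
    have "cube_index j (SOME y. cube_index j y = cube_index j x) = cube_index j x"
      by (rule someI) simp
    then have "f (SOME y. cube_index j y = cube_index j x) = f x" by (rule assms)
    then show "f x = ((\<lambda>k. f (SOME x. cube_index j x = k)) \<circ> cube_index j) x"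
      by simp
  qed
  also have "\<dots> \<in> measurable borel borel"
    by (rule measurable_comp[OF measurable_cube_index]) simp
  finally show ?thesis .
qed

lemma avn_measurable [measurable]: "avn j u \<in> borel_measurable borel"
  by (rule measurable_cube_index_fun) (rule avn_cong)

lemma indicator_cube_of_sym: "indicator (cube_of j x) y = indicator (cube_of j y) x"
  by (auto simp: indicator_def cube_of_def)

lemma measurable_indicator_cube_of [measurable (raw)]:
  fixes f g :: "_ \<Rightarrow> real ^ 'n"
  assumes [measurable]: "f \<in> borel_measurable M" "g \<in> borel_measurable M"
  shows "(\<lambda>x. indicator (cube_of j (f x)) (g x) :: 'b::{zero_neq_one,topological_space}) \<in> borel_measurable M"
proof -
  have "(\<lambda>x. indicator (cube_of j (f x)) (g x) :: 'b) =
      (\<lambda>x. if cube_index j (g x) = cube_index j (f x) then 1 else 0)"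
    by (auto simp: indicator_def cube_of_def)
  then show ?thesis by simp
qed

text \<open>The kernel of the averaging operator, the indicator of lying in the same cube, is
  symmetric; Fubini does the rest.\<close>

lemma avn_selfadjoint:
  fixes u v :: "real ^ 'n \<Rightarrow> ennreal"
  assumes [measurable]: "u \<in> borel_measurable borel" "v \<in> borel_measurable borel"
  shows "(\<integral>\<^sup>+x. u x * avn j v x \<partial>lborel) = (\<integral>\<^sup>+x. avn j u x * v x \<partial>lborel)"
proof -
  let ?c = "ennreal (1 / cvol CARD('n) j)"
  have "(\<integral>\<^sup>+x. u x * avn j v x \<partial>lborel) =
      (\<integral>\<^sup>+x. (\<integral>\<^sup>+y. ?c * u x * v y * indicator (cube_of j x) y \<partial>lborel) \<partial>lborel)"
    unfolding avn_def
    by (intro nn_integral_cong, subst nn_integral_cmult[symmetric], measurable,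
        subst nn_integral_cmult[symmetric], measurable) (simp add: mult_ac)
  also have "\<dots> = (\<integral>\<^sup>+y. (\<integral>\<^sup>+x. ?c * u x * v y * indicator (cube_of j x) y \<partial>lborel) \<partial>lborel)"
    by (rule lborel_pair.Fubini') measurable
  also have "\<dots> = (\<integral>\<^sup>+x. avn j u x * v x \<partial>lborel)"
    unfolding avn_def
    by (intro nn_integral_cong, subst nn_integral_cmult[symmetric], measurable,
        subst nn_integral_multc[symmetric], measurable) (simp add: mult_ac indicator_cube_of_sym)
  finally show ?thesis .
qed

lemma avn_cmult:
  fixes u :: "real ^ 'n \<Rightarrow> ennreal"
  assumes [measurable]: "u \<in> borel_measurable borel"
  shows "avn j (\<lambda>y. c * u y) x = c * avn j u x"
proof -
  have "(\<integral>\<^sup>+y. indicator (cube_of j x) y * (c * u y) \<partial>lborel) =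
      (\<integral>\<^sup>+y. c * (indicator (cube_of j x) y * u y) \<partial>lborel)"
    by (simp add: mult_ac)
  then show ?thesis
    unfolding avn_def by (simp add: nn_integral_cmult mult_ac)
qed

lemma avn_cong_fun: "(\<And>y. cube_index j y = cube_index j x \<Longrightarrow> u y = v y) \<Longrightarrow> avn j u x = avn j v x"
  unfolding avn_def
  by (rule arg_cong2[where f="(*)"], rule refl, rule nn_integral_cong) (auto simp: indicator_def cube_of_def)

lemma avn_mono: "(\<And>y. cube_index j y = cube_index j x \<Longrightarrow> u y \<le> v y) \<Longrightarrow> avn j u x \<le> avn j v x"
  unfolding avn_def
  by (rule mult_left_mono, rule nn_integral_mono) (auto simp: indicator_def cube_of_def)

lemma avn_pull:
  fixes u :: "real ^ 'n \<Rightarrow> ennreal"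
  assumes [measurable]: "u \<in> borel_measurable borel"
    and "\<And>y. cube_index j y = cube_index j x \<Longrightarrow> c y = c x"
  shows "avn j (\<lambda>y. c y * u y) x = c x * avn j u x"
proof -
  have "avn j (\<lambda>y. c y * u y) x = avn j (\<lambda>y. c x * u y) x"
    by (rule avn_cong_fun) (metis assms(2))
  then show ?thesis by (simp add: avn_cmult)
qed

lemma avn_one [simp]: "avn j (\<lambda>_. 1) (x :: real ^ 'n) = 1"
  unfolding avn_def by (simp add: ennreal_mult[symmetric])

lemma avn_const [simp]: "avn j (\<lambda>_. c) (x :: real ^ 'n) = c"
  using avn_cmult[of "\<lambda>_. 1" j c x] by simp

lemma avn_level:
  assumes "\<And>y. cube_index j y = cube_index j x \<Longrightarrow> c y = c x"
  shows "avn j c x = c x"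
proof -
  have "avn j c x = avn j (\<lambda>_. c x) x"
    by (rule avn_cong_fun) (rule assms)
  then show ?thesis by simp
qed

lemma avn_add:
  fixes u :: "real ^ 'n \<Rightarrow> ennreal"
  assumes [measurable]: "u \<in> borel_measurable borel" "v \<in> borel_measurable borel"
  shows "avn j (\<lambda>y. u y + v y) x = avn j u x + avn j v x"
  unfolding avn_def
  by (simp add: distrib_left nn_integral_add)

text \<open>Self-adjointness moves the average onto the weight, which it fixes. This is how a
  density is exchanged for its averages on any union of cubes of one level.\<close>

lemma nn_integral_avn_weight:
  fixes u c :: "real ^ 'n \<Rightarrow> ennreal"
  assumes [measurable]: "u \<in> borel_measurable borel"
    and c: "\<And>x y. cube_index j x = cube_index j y \<Longrightarrow> c x = c y"
  shows "(\<integral>\<^sup>+x. c x * avn j u x \<partial>lborel) = (\<integral>\<^sup>+x. c x * u x \<partial>lborel)"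
proof -
  have [measurable]: "c \<in> borel_measurable borel"
    by (rule measurable_cube_index_fun[OF c])
  have "avn j c x = c x" for x by (rule avn_level) (rule c)
  then show ?thesis by (simp add: avn_selfadjoint)
qed

lemma nn_integral_avn:
  fixes u :: "real ^ 'n \<Rightarrow> ennreal"
  assumes "u \<in> borel_measurable borel"
  shows "(\<integral>\<^sup>+x. avn j u x \<partial>lborel) = (\<integral>\<^sup>+x. u x \<partial>lborel)"
  using nn_integral_avn_weight[OF assms, of j "\<lambda>_. 1"] by simp

lemma avn_tower:
  fixes u :: "real ^ 'n \<Rightarrow> ennreal"
  assumes [measurable]: "u \<in> borel_measurable borel" and "j \<le> i"
  shows "avn i (avn j u) x = avn i u x"
  unfolding avn_def[of i]
  by (subst nn_integral_avn_weight)
     (auto simp: indicator_def cube_of_def dest: cube_index_mono[OF _ assms(2)])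

section \<open>Poisson-type weights\<close>

text \<open>The size condition as a convolution kernel; for \<open>b > 0\<close> its mass is the
  same at every scale \<open>t\<close>.\<close>

definition wt :: "real \<Rightarrow> real \<Rightarrow> real ^ 'n \<Rightarrow> real"
  where "wt b t h = t powr b / (t + norm h) powr (real CARD('n) + b)"

text \<open>A sum over dyadic shells: \<open>2 powr (n + b)\<close> is lost in bounding t + |h| from
  below, \<open>2 ^ n\<close> comes from cubes of half-side \<open>2 ^ k * t\<close>, and the
  geometric series has ratio \<open>2 powr (- b)\<close>.\<close>

definition Wc :: "nat \<Rightarrow> real \<Rightarrow> real"
  where "Wc n b = 2 powr (real n + b) * 2 ^ n / (1 - 2 powr (- b))"

lemma wt_nonneg [simp]: "wt b t h \<ge> 0"
  by (simp add: wt_def)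

lemma wt_minus [simp]: "wt b t (- h) = wt b t h"
  by (simp add: wt_def)

lemma wt_sym: "wt b t (x - y) = wt b t (y - x)"
  by (simp add: wt_def norm_minus_commute)

lemma measurable_wt [measurable]:
  assumes [measurable]: "f \<in> borel_measurable M" "g \<in> borel_measurable M"
  shows "(\<lambda>x. wt b (f x) (g x :: real ^ 'n)) \<in> borel_measurable M"
  unfolding wt_def by measurable

lemma two_powr_less_one: "b > 0 \<Longrightarrow> 2 powr (- b) < (1::real)"
  using powr_less_mono[of "- b" 0 2] by simp

lemma Wc_pos: "b > 0 \<Longrightarrow> Wc n b > 0"
  unfolding Wc_def using two_powr_less_one[of b] by simp

lemma add_norm_pos [simp]: "t > 0 \<Longrightarrow> 0 < t + norm h" "t > 0 \<Longrightarrow> t + norm h \<noteq> 0"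
  using norm_ge_zero[of h] by linarith+

text \<open>For the least k with |h| \<le> 2^k t, minimality gives t + |h| \<ge> 2^(k-1) t; for k =
  0 this is trivial.\<close>

lemma wt_le_sum:
  fixes h :: "real ^ 'n"
  assumes "t > 0" "b > 0"
  shows "\<exists>k::nat. norm h \<le> 2 ^ k * t \<and>
    wt b t h \<le> 2 powr (real CARD('n) + b) * 2 powr (- (real k * (real CARD('n) + b))) / t ^ CARD('n)"
proof -
  let ?P = "\<lambda>k::nat. norm h \<le> 2 ^ k * t"
  let ?s = "real CARD('n) + b"
  obtain k0 where "norm h / t < 2 ^ k0" using real_arch_pow[of 2 "norm h / t"] by auto
  then have "?P k0" using assms by (simp add: field_simps)
  define k where "k = (LEAST k. ?P k)"
  have k: "?P k" unfolding k_def by (rule LeastI) fact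
  have lb: "t + norm h \<ge> 2 powr (real k - 1) * t"
  proof (cases k)
    case 0
    have "2 powr (real k - 1) * t \<le> 1 * t"
      using assms 0 by (intro mult_right_mono) (auto simp: powr_minus)
    then show ?thesis using norm_ge_zero[of h] by linarith
  next
    case (Suc l)
    then have "\<not> ?P l" using not_less_Least[of l ?P] unfolding k_def by simp
    moreover have "2 powr (real k - 1) = (2::real) ^ l" using Suc by (simp add: powr_realpow)
    ultimately show ?thesis using assms by simp
  qed
  have "wt b t h \<le> t powr b / (2 powr (real k - 1) * t) powr ?s"
    unfolding wt_def using lb assms
    by (intro divide_left_mono powr_mono2 mult_pos_pos) (auto simp: less_imp_neq[symmetric])
  also have "(2 powr (real k - 1) * t) powr ?s = 2 powr ((real k - 1) * ?s) * t powr ?s"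
    by (simp only: powr_mult powr_powr)
  also have "t powr b / (2 powr ((real k - 1) * ?s) * t powr ?s) = 2 powr (- ((real k - 1) * ?s)) * (t powr b / t powr ?s)"
    by (simp only: powr_minus divide_inverse inverse_mult_distrib mult_ac)
  also have "t powr b / t powr ?s = 1 / t ^ CARD('n)"
    using assms by (simp add: powr_add powr_realpow)
  also have "2 powr (- ((real k - 1) * ?s)) = 2 powr ?s * 2 powr (- (real k * ?s))"
    by (subst powr_add[symmetric]) (simp add: algebra_simps)
  finally show ?thesis using k by auto
qed

lemma nn_integral_wt:
  fixes x :: "real ^ 'n"
  assumes "t > 0" "b > 0"
  shows "(\<integral>\<^sup>+y. ennreal (wt b t (x - y)) \<partial>lborel) \<le> ennreal (Wc CARD('n) b)"
proof -
  let ?n = "CARD('n)"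
  let ?s = "real ?n + b"
  define c where "c k = 2 powr ?s * 2 powr (- (real k * ?s)) / t ^ ?n" for k :: nat
  define B where "B k = cbox (x - (\<chi> i. 2 ^ k * t)) (x + (\<chi> i. 2 ^ k * t))" for k :: nat
  have [measurable]: "B k \<in> sets borel" for k by (simp add: B_def)
  have mB: "emeasure lborel (B k) = ennreal ((2 * 2 ^ k * t) ^ ?n)" for k
    unfolding B_def using assms by (subst emeasure_cbox_cart) (auto simp: algebra_simps)
  have c0: "c k \<ge> 0" for k unfolding c_def using assms by simp
  have "ennreal (wt b t (x - y)) \<le> (\<Sum>k. ennreal (c k) * indicator (B k) y)" for y
  proof -
    obtain k where k: "norm (x - y) \<le> 2 ^ k * t" "wt b t (x - y) \<le> c k"
      using wt_le_sum[OF assms, of "x - y"] unfolding c_def by auto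
    have "\<bar>(x - y) $ i\<bar> \<le> 2 ^ k * t" for i
      using component_le_norm_cart[of "x - y" i] k(1) by linarith
    then have "y \<in> B k" unfolding B_def mem_box_cart by (auto simp: abs_le_iff) (smt (verit))+
    then have "ennreal (wt b t (x - y)) \<le> (\<Sum>k\<in>{k}. ennreal (c k) * indicator (B k) y)"
      using k by (simp add: ennreal_leI)
    also have "\<dots> \<le> (\<Sum>k. ennreal (c k) * indicator (B k) y)"
      by (intro sum_le_suminf) auto
    finally show ?thesis .
  qed
  then have "(\<integral>\<^sup>+y. ennreal (wt b t (x - y)) \<partial>lborel) \<le> (\<integral>\<^sup>+y. (\<Sum>k. ennreal (c k) * indicator (B k) y) \<partial>lborel)"
    by (rule nn_integral_mono)
  also have "\<dots> = (\<Sum>k. \<integral>\<^sup>+y. ennreal (c k) * indicator (B k) y \<partial>lborel)"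
    by (rule nn_integral_suminf) measurable
  also have "\<dots> = (\<Sum>k. ennreal (c k * (2 * 2 ^ k * t) ^ ?n))"
    using c0 assms by (simp add: nn_integral_cmult_indicator mB ennreal_mult')
  also have "\<dots> = (\<Sum>k. ennreal (2 powr ?s * 2 ^ ?n * (2 powr (- b)) ^ k))"
  proof (intro suminf_cong arg_cong[where f=ennreal])
    fix k :: nat
    have "2 powr (- (real k * ?s)) * (2 ^ k) ^ ?n = 2 powr (- (real k * ?s)) * 2 powr (real k * real ?n)"
      by (simp add: powr_realpow[symmetric] powr_powr)
    also have "\<dots> = 2 powr (- b * real k)"
      by (subst powr_add[symmetric]) (simp add: algebra_simps)
    also have "\<dots> = (2 powr (- b)) ^ k"
      by (simp add: powr_realpow[symmetric] powr_powr)
    finally show "c k * (2 * 2 ^ k * t) ^ ?n = 2 powr ?s * 2 ^ ?n * (2 powr (- b)) ^ k"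
      unfolding c_def using assms by (simp add: power_mult_distrib mult_ac)
  qed
  also have "\<dots> = ennreal (Wc ?n b)"
  proof -
    have "2 powr (- b) < (1::real)" using assms(2) by (rule two_powr_less_one)
    then have "(\<lambda>k. 2 powr ?s * 2 ^ ?n * (2 powr (- b)) ^ k) sums (2 powr ?s * 2 ^ ?n * (1 / (1 - 2 powr (- b))))"
      by (intro sums_mult geometric_sums) simp
    then show ?thesis
      unfolding Wc_def by (intro suminf_ennreal_eq) auto
  qed
  finally show ?thesis .
qed

text \<open>The quotient is a nonnegative power of t / (t + |h|) \<le> 1. It permits lowering the
  exponent \<alpha> to at most 1.\<close>

lemma wt_mono_exponent:
  assumes "t > 0" "b \<le> a"
  shows "wt a t h \<le> wt b t (h :: real ^ 'n)"
proof -
  have "wt a t h = (t / (t + norm h)) powr (a - b) * wt b t h"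
    unfolding wt_def using assms by (simp add: powr_divide powr_diff powr_add field_simps)
  also have "\<dots> \<le> 1 * wt b t h"
    using assms by (intro mult_right_mono powr_le1) (auto simp: field_simps add_pos_nonneg)
  finally show ?thesis by simp
qed

text \<open>A factor |h|^b is paid for with \<open>b\<close> units of decay; what is left is still
  integrable as long as b < a.\<close>

lemma wt_mult_norm:
  assumes "t > 0" "0 < b" "b \<le> a"
  shows "wt a t h * norm h powr b \<le> t powr b * wt (a - b) t (h :: real ^ 'n)"
proof -
  have "wt a t h * norm h powr b \<le> wt a t h * (t + norm h) powr b"
    using assms by (intro mult_left_mono powr_mono2) auto
  also have "\<dots> = t powr b * wt (a - b) t h"
    unfolding wt_def using assms
    by (simp add: powr_add powr_diff field_simps add_pos_nonneg less_imp_neq[symmetric])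
  finally show ?thesis .
qed

text \<open>Moving the argument by at most D t changes t + |h| by at most the factor 1 + D, so the
  weight is essentially constant on a cube of side comparable to \<open>t\<close>.\<close>

lemma wt_shift:
  assumes "t > 0" "D \<ge> 0" "norm (h - h') \<le> D * t" "b > 0"
  shows "wt b t h \<le> (1 + D) powr (real CARD('n) + b) * wt b t (h' :: real ^ 'n)"
proof -
  have "norm h' \<le> norm h + norm (h - h')"
    using norm_triangle_ineq2[of h' h] by (simp add: norm_minus_commute)
  moreover have "0 \<le> D * norm h" using assms by simp
  ultimately have "t + norm h' \<le> (1 + D) * (t + norm h)"
    using assms(3) by (simp add: algebra_simps)
  then have "(t + norm h') powr (real CARD('n) + b) \<le> ((1 + D) * (t + norm h)) powr (real CARD('n) + b)"
    using assms by (intro powr_mono2) auto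
  also have "\<dots> = (1 + D) powr (real CARD('n) + b) * (t + norm h) powr (real CARD('n) + b)"
    using assms by (simp add: powr_mult)
  finally have *: "(t + norm h') powr (real CARD('n) + b) \<le> \<dots>" .
  have p: "u > 0 \<Longrightarrow> u powr (real CARD('n) + b) > 0" for u by simp
  from * show ?thesis
    unfolding wt_def using assms p[OF add_norm_pos(1), of t h] p[OF add_norm_pos(1), of t h']
    by (simp add: divide_simps mult_ac)
qed

lemma wt_le_inverse: "t > 0 \<Longrightarrow> b > 0 \<Longrightarrow> wt b t h \<le> 1 / t ^ CARD('n)" for h :: "real ^ 'n"
proof -
  assume t: "t > 0" "b > 0"
  have "wt b t h \<le> t powr b / t powr (real CARD('n) + b)"
    unfolding wt_def using t by (intro divide_left_mono powr_mono2) (auto simp: less_imp_neq[symmetric])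
  also have "\<dots> = 1 / t ^ CARD('n)" using t by (simp add: powr_add powr_realpow)
  finally show ?thesis .
qed

lemma wt_CS:
  fixes F :: "real ^ 'n \<Rightarrow> ennreal"
  assumes "t > 0" "b > 0" and [measurable]: "F \<in> borel_measurable borel"
  shows "(\<integral>\<^sup>+y. ennreal (wt b t (x - y)) * F y \<partial>lborel)\<^sup>2
    \<le> ennreal (Wc CARD('n) b) * (\<integral>\<^sup>+y. ennreal (wt b t (x - y)) * (F y)\<^sup>2 \<partial>lborel)"
proof -
  have s: "ennreal (wt b t h) = ennreal (sqrt (wt b t h)) * ennreal (sqrt (wt b t h))" for h :: "real ^ 'n"
    by (simp add: ennreal_mult[symmetric])
  have "(\<integral>\<^sup>+y. ennreal (wt b t (x - y)) * F y \<partial>lborel)\<^sup>2 =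
      (\<integral>\<^sup>+y. ennreal (sqrt (wt b t (x - y))) * (ennreal (sqrt (wt b t (x - y))) * F y) \<partial>lborel)\<^sup>2"
    by (subst s) (simp add: mult_ac)
  also have "\<dots> \<le> (\<integral>\<^sup>+y. (ennreal (sqrt (wt b t (x - y))))\<^sup>2 \<partial>lborel) *
      (\<integral>\<^sup>+y. (ennreal (sqrt (wt b t (x - y))) * F y)\<^sup>2 \<partial>lborel)"
    by (rule Cauchy_Schwarz_nn_integral) measurable
  also have "\<dots> = (\<integral>\<^sup>+y. ennreal (wt b t (x - y)) \<partial>lborel) *
      (\<integral>\<^sup>+y. ennreal (wt b t (x - y)) * (F y)\<^sup>2 \<partial>lborel)"
    by (simp add: power_mult_distrib ennreal_power)
  also have "\<dots> \<le> ennreal (Wc CARD('n) b) * (\<integral>\<^sup>+y. ennreal (wt b t (x - y)) * (F y)\<^sup>2 \<partial>lborel)"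
    by (intro mult_right_mono nn_integral_wt assms) simp
  finally show ?thesis .
qed

text \<open>Schur's test for the symmetric weight: Cauchy--Schwarz costs one factor
  \<open>Wc\<close>, Fubini the other.\<close>

lemma Schur_wt:
  fixes F :: "real ^ 'n \<Rightarrow> ennreal"
  assumes "t > 0" "b > 0" and [measurable]: "F \<in> borel_measurable borel"
  shows "(\<integral>\<^sup>+x. (\<integral>\<^sup>+y. ennreal (wt b t (x - y)) * F y \<partial>lborel)\<^sup>2 \<partial>lborel)
    \<le> ennreal ((Wc CARD('n) b)\<^sup>2) * (\<integral>\<^sup>+x. (F x)\<^sup>2 \<partial>lborel)"
proof -
  let ?W = "ennreal (Wc CARD('n) b)"
  have "(\<integral>\<^sup>+y. ennreal (wt b t (x - y)) * F y \<partial>lborel)\<^sup>2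
      \<le> ?W * (\<integral>\<^sup>+y. ennreal (wt b t (x - y)) * (F y)\<^sup>2 \<partial>lborel)" for x
    by (rule wt_CS) (use assms in auto)
  then have "(\<integral>\<^sup>+x. (\<integral>\<^sup>+y. ennreal (wt b t (x - y)) * F y \<partial>lborel)\<^sup>2 \<partial>lborel)
      \<le> (\<integral>\<^sup>+x. ?W * (\<integral>\<^sup>+y. ennreal (wt b t (x - y)) * (F y)\<^sup>2 \<partial>lborel) \<partial>lborel)"
    by (rule nn_integral_mono)
  also have "\<dots> = ?W * (\<integral>\<^sup>+x. (\<integral>\<^sup>+y. ennreal (wt b t (x - y)) * (F y)\<^sup>2 \<partial>lborel) \<partial>lborel)"
    by (rule nn_integral_cmult) measurable
  also have "(\<integral>\<^sup>+x. (\<integral>\<^sup>+y. ennreal (wt b t (x - y)) * (F y)\<^sup>2 \<partial>lborel) \<partial>lborel)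
      = (\<integral>\<^sup>+y. (\<integral>\<^sup>+x. ennreal (wt b t (x - y)) * (F y)\<^sup>2 \<partial>lborel) \<partial>lborel)"
    by (rule lborel_pair.Fubini') measurable
  also have "\<dots> = (\<integral>\<^sup>+y. (\<integral>\<^sup>+x. ennreal (wt b t (y - x)) \<partial>lborel) * (F y)\<^sup>2 \<partial>lborel)"
    by (subst wt_sym) (simp add: nn_integral_multc)
  also have "\<dots> \<le> (\<integral>\<^sup>+y. ?W * (F y)\<^sup>2 \<partial>lborel)"
    by (intro nn_integral_mono mult_right_mono nn_integral_wt assms) simp
  also have "\<dots> = ?W * (\<integral>\<^sup>+y. (F y)\<^sup>2 \<partial>lborel)"
    by (rule nn_integral_cmult) measurable
  finally have "(\<integral>\<^sup>+x. (\<integral>\<^sup>+y. ennreal (wt b t (x - y)) * F y \<partial>lborel)\<^sup>2 \<partial>lborel)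
      \<le> ?W * (?W * (\<integral>\<^sup>+y. (F y)\<^sup>2 \<partial>lborel))"
    by (simp add: mult_left_mono)
  also have "\<dots> = ennreal ((Wc CARD('n) b)\<^sup>2) * (\<integral>\<^sup>+y. (F y)\<^sup>2 \<partial>lborel)"
    using Wc_pos[OF assms(2), of "CARD('n)"]
    by (simp add: power2_eq_square ennreal_mult mult.assoc)
  finally show ?thesis .
qed

lemma avn_CS:
  fixes u :: "real ^ 'n \<Rightarrow> ennreal"
  assumes [measurable]: "u \<in> borel_measurable borel"
  shows "(avn j u x)\<^sup>2 \<le> avn j (\<lambda>y. (u y)\<^sup>2) x"
proof -
  let ?c = "ennreal (1 / cvol CARD('n) j)"
  have "(\<integral>\<^sup>+y. indicator (cube_of j x) y * u y \<partial>lborel)\<^sup>2 =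
      (\<integral>\<^sup>+y. indicator (cube_of j x) y * (indicator (cube_of j x) y * u y) \<partial>lborel)\<^sup>2"
    by (intro arg_cong[where f="\<lambda>z. z\<^sup>2"] nn_integral_cong) (auto simp: indicator_def)
  also have "\<dots> \<le> (\<integral>\<^sup>+y. (indicator (cube_of j x) y)\<^sup>2 \<partial>lborel) * (\<integral>\<^sup>+y. (indicator (cube_of j x) y * u y)\<^sup>2 \<partial>lborel)"
    by (rule Cauchy_Schwarz_nn_integral) measurable
  also have "(\<integral>\<^sup>+y. (indicator (cube_of j x) y)\<^sup>2 \<partial>lborel) = ennreal (cvol CARD('n) j)"
    by (simp add: power2_eq_square indicator_inter_arith[symmetric])
  also have "(\<integral>\<^sup>+y. (indicator (cube_of j x) y * u y)\<^sup>2 \<partial>lborel) = (\<integral>\<^sup>+y. indicator (cube_of j x) y * (u y)\<^sup>2 \<partial>lborel)"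
    by (intro nn_integral_cong) (auto simp: indicator_def)
  finally have "(avn j u x)\<^sup>2 \<le> ?c\<^sup>2 * (ennreal (cvol CARD('n) j) * (\<integral>\<^sup>+y. indicator (cube_of j x) y * (u y)\<^sup>2 \<partial>lborel))"
    unfolding avn_def power_mult_distrib by (rule mult_left_mono) simp
  also have "\<dots> = ?c * (?c * ennreal (cvol CARD('n) j)) * (\<integral>\<^sup>+y. indicator (cube_of j x) y * (u y)\<^sup>2 \<partial>lborel)"
    by (simp add: power2_eq_square mult_ac)
  also have "?c * ennreal (cvol CARD('n) j) = 1"
    by (simp add: ennreal_mult[symmetric])
  finally show ?thesis unfolding avn_def by simp
qed

section \<open>Averages of vector-valued functions\<close>

definition avg :: "int \<Rightarrow> (real ^ 'n \<Rightarrow> 'b::{banach,second_countable_topology}) \<Rightarrow> real ^ 'n \<Rightarrow> 'b"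
  where "avg j f x = (1 / cvol CARD('n) j) *\<^sub>R (LINT y|lborel. indicator (cube_of j x) y *\<^sub>R f y)"

text \<open>Local integrability, stated through \<open>avn\<close> so that the averaging rules on
  [0, \<infinity>] deliver it.\<close>

definition locint :: "(real ^ 'n \<Rightarrow> 'b::{banach,second_countable_topology}) \<Rightarrow> bool"
  where "locint f \<longleftrightarrow> f \<in> borel_measurable borel \<and> (\<forall>j x. avn j (\<lambda>y. ennreal (norm (f y))) x < \<infinity>)"

lemma avg_cong: "cube_index j x = cube_index j y \<Longrightarrow> avg j f x = avg j f y"
  by (simp add: avg_def cube_of_def)

lemma measurable_avg [measurable]: "avg j f \<in> borel_measurable borel"
  by (rule measurable_cube_index_fun) (rule avg_cong)

lemma norm_integral_le_nn:
  fixes f :: "'a \<Rightarrow> 'b::{banach,second_countable_topology}"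
  shows "ennreal (norm (LINT x|M. f x)) \<le> (\<integral>\<^sup>+x. ennreal (norm (f x)) \<partial>M)"
  by (cases "integrable M f") (auto simp: integral_norm_bound_ennreal not_integrable_integral_eq)

lemma norm_avg_le: "ennreal (norm (avg j f x)) \<le> avn j (\<lambda>y. ennreal (norm (f y))) x"
  for f :: "real ^ 'n \<Rightarrow> 'b::{banach,second_countable_topology}"
proof -
  have "ennreal (norm (LINT y|lborel. indicator (cube_of j x) y *\<^sub>R f y))
      \<le> (\<integral>\<^sup>+y. ennreal (norm (indicator (cube_of j x) y *\<^sub>R f y)) \<partial>lborel)"
    by (rule norm_integral_le_nn)
  also have "\<dots> = (\<integral>\<^sup>+y. indicator (cube_of j x) y * ennreal (norm (f y)) \<partial>lborel)"
    by (intro nn_integral_cong) (auto simp: indicator_def)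
  finally show ?thesis
    unfolding avg_def avn_def norm_scaleR ennreal_mult'[OF abs_ge_zero]
    by (simp add: mult_left_mono)
qed

lemma locint_integrable:
  fixes f :: "real ^ 'n \<Rightarrow> 'b::{banach,second_countable_topology}"
  assumes "locint f"
  shows "integrable lborel (\<lambda>y. indicator (cube_of j x) y *\<^sub>R f y)"
proof (rule integrableI_bounded)
  have [measurable]: "f \<in> borel_measurable borel" using assms by (simp add: locint_def)
  show "(\<lambda>y. indicator (cube_of j x) y *\<^sub>R f y) \<in> borel_measurable lborel" by measurable
  have "avn j (\<lambda>y. ennreal (norm (f y))) x < \<infinity>" using assms by (simp add: locint_def)
  moreover have "(\<integral>\<^sup>+y. ennreal (norm (indicator (cube_of j x) y *\<^sub>R f y)) \<partial>lborel)
      = (\<integral>\<^sup>+y. indicator (cube_of j x) y * ennreal (norm (f y)) \<partial>lborel)"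
    by (intro nn_integral_cong) (auto simp: indicator_def)
  ultimately show "(\<integral>\<^sup>+y. ennreal (norm (indicator (cube_of j x) y *\<^sub>R f y)) \<partial>lborel) < \<infinity>"
    unfolding avn_def by (auto simp: ennreal_mult_less_top)
qed

lemma avg_diff_fun:
  assumes "locint f" "locint g"
  shows "avg j (\<lambda>y. f y - g y) x = avg j f x - avg j g x"
  using locint_integrable[OF assms(1), of j x] locint_integrable[OF assms(2), of j x]
  unfolding avg_def by (simp add: scaleR_diff_right)

lemma avg_cong_fun: "(\<And>y. cube_index j y = cube_index j x \<Longrightarrow> f y = g y) \<Longrightarrow> avg j f x = avg j g x"
  unfolding avg_def
  by (rule arg_cong2[where f="(*\<^sub>R)"], rule refl, rule Bochner_Integration.integral_cong)
     (auto simp: indicator_def cube_of_def)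

lemma avg_const [simp]: "avg j (\<lambda>_. c) (x :: real ^ 'n) = c"
  unfolding avg_def by (simp add: measure_def)

lemma avg_level:
  assumes "\<And>y. cube_index j y = cube_index j x \<Longrightarrow> c y = c x"
  shows "avg j c x = c x"
proof -
  have "avg j c x = avg j (\<lambda>_. c x) x"
    by (rule avg_cong_fun) (rule assms)
  then show ?thesis by simp
qed

text \<open>\<open>fin\<close> is exactly the absolute convergence of the double integral, so both
  orders of integration are legitimate.\<close>

lemma avg_selfadjoint:
  fixes u v :: "real ^ 'n \<Rightarrow> 'b::{real_normed_field,banach,second_countable_topology}"
  assumes [measurable]: "u \<in> borel_measurable borel" "v \<in> borel_measurable borel"
    and fin: "(\<integral>\<^sup>+x. ennreal (norm (u x)) * avn j (\<lambda>y. ennreal (norm (v y))) x \<partial>lborel) < \<infinity>"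
  shows "integrable lborel (\<lambda>x. u x * avg j v x)"
    and "integrable lborel (\<lambda>x. avg j u x * v x)"
    and "(LINT x|lborel. u x * avg j v x) = (LINT x|lborel. avg j u x * v x)"
proof -
  let ?c = "1 / cvol CARD('n) j"
  define H where "H x y = u x * (?c *\<^sub>R (indicator (cube_of j x) y *\<^sub>R v y))" for x y
  have [measurable]: "case_prod H \<in> borel_measurable (lborel \<Otimes>\<^sub>M lborel)"
    unfolding H_def by measurable
  have H: "integrable (lborel \<Otimes>\<^sub>M lborel) (case_prod H)"
  proof (rule integrableI_bounded)
    have "(\<integral>\<^sup>+z. ennreal (norm (case_prod H z)) \<partial>(lborel \<Otimes>\<^sub>M lborel)) =
        (\<integral>\<^sup>+x. \<integral>\<^sup>+y. ennreal (norm (H x y)) \<partial>lborel \<partial>lborel)"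
      by (subst lborel.nn_integral_fst[symmetric]) auto
    also have "\<dots> = (\<integral>\<^sup>+x. ennreal (norm (u x)) * avn j (\<lambda>y. ennreal (norm (v y))) x \<partial>lborel)"
    proof (rule nn_integral_cong)
      fix x
      have "(\<integral>\<^sup>+y. ennreal (norm (H x y)) \<partial>lborel) =
          (\<integral>\<^sup>+y. ennreal (norm (u x)) * (ennreal ?c * (indicator (cube_of j x) y * ennreal (norm (v y)))) \<partial>lborel)"
        unfolding H_def by (intro nn_integral_cong) (auto simp: indicator_def norm_mult ennreal_mult[symmetric])
      then show "(\<integral>\<^sup>+y. ennreal (norm (H x y)) \<partial>lborel) = ennreal (norm (u x)) * avn j (\<lambda>y. ennreal (norm (v y))) x"
        unfolding avn_def by (simp add: nn_integral_cmult)
    qed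
    finally show "(\<integral>\<^sup>+z. ennreal (norm (case_prod H z)) \<partial>(lborel \<Otimes>\<^sub>M lborel)) < \<infinity>" using fin by simp
  qed measurable
  have 1: "(LINT y|lborel. H x y) = u x * avg j v x" for x
    unfolding H_def avg_def by (simp only: integral_mult_right_zero integral_scaleR_right)
  have 2: "(LINT x|lborel. H x y) = avg j u y * v y" for y
  proof -
    have "H x y = ?c *\<^sub>R ((indicator (cube_of j y) x *\<^sub>R u x) * v y)" for x
      unfolding H_def by (simp add: indicator_cube_of_sym[of j x y])
    then have "(LINT x|lborel. H x y) = ?c *\<^sub>R ((LINT x|lborel. indicator (cube_of j y) x *\<^sub>R u x) * v y)"
      by (simp only: integral_mult_left_zero integral_scaleR_right)
    then show ?thesis
      unfolding avg_def by (simp only: mult_scaleR_left)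
  qed
  show "integrable lborel (\<lambda>x. u x * avg j v x)"
    using lborel_pair.integrable_fst[OF H] by (simp add: 1)
  show "integrable lborel (\<lambda>x. avg j u x * v x)"
    using lborel_pair.integrable_snd[OF H] by (simp add: 2)
  show "(LINT x|lborel. u x * avg j v x) = (LINT x|lborel. avg j u x * v x)"
    using lborel_pair.Fubini_integral[OF H] by (simp add: 1 2)
qed

text \<open>On cubes of level at least \<open>j\<close> the tower property applies; on smaller ones
  the averages are constant.\<close>

lemma locint_avg:
  fixes f :: "real ^ 'n \<Rightarrow> 'b::{banach,second_countable_topology}"
  assumes "locint f"
  shows "locint (avg j f)"
  unfolding locint_def
proof (intro conjI allI)
  fix i and x :: "real ^ 'n"
  have [measurable]: "f \<in> borel_measurable borel" using assms by (simp add: locint_def)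
  let ?N = "\<lambda>y. ennreal (norm (f y))"
  have "avn i (\<lambda>y. ennreal (norm (avg j f y))) x \<le> avn i (avn j ?N) x"
    by (rule avn_mono) (rule norm_avg_le)
  also have "\<dots> < \<infinity>"
  proof (cases "j \<le> i")
    case True
    then show ?thesis using assms by (simp add: avn_tower locint_def)
  next
    case False
    have "avn i (avn j ?N) x = avn j ?N x"
      by (rule avn_level) (rule avn_cong, rule cube_index_mono, use False in auto)
    then show ?thesis using assms by (simp add: locint_def)
  qed
  finally show "avn i (\<lambda>y. ennreal (norm (avg j f y))) x < \<infinity>" .
qed simp

text \<open>Test against the indicator of the coarse cube, which averaging at the finer level leaves
  unchanged.\<close>

lemma avg_tower:
  fixes f :: "real ^ 'n \<Rightarrow> 'b::{real_normed_field,banach,second_countable_topology}"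
  assumes f: "locint f" and "j \<le> i"
  shows "avg i (avg j f) x = avg i f x"
proof -
  have [measurable]: "f \<in> borel_measurable borel" using f by (simp add: locint_def)
  let ?u = "\<lambda>y. indicator (cube_of i x) y :: 'b"
  have lev: "cube_index j y = cube_index j z \<Longrightarrow> ?u y = ?u z" for y z
    using cube_index_mono[OF _ assms(2), of y z] by (auto simp: indicator_def cube_of_def)
  have "(\<integral>\<^sup>+y. ennreal (norm (?u y)) * avn j (\<lambda>y. ennreal (norm (f y))) y \<partial>lborel)
      = (\<integral>\<^sup>+y. ennreal (norm (?u y)) * ennreal (norm (f y)) \<partial>lborel)"
    by (rule nn_integral_avn_weight) (measurable, metis lev)
  also have "\<dots> = (\<integral>\<^sup>+y. ennreal (norm (indicator (cube_of i x) y *\<^sub>R f y)) \<partial>lborel)"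
    by (intro nn_integral_cong) (auto simp: indicator_def)
  also have "\<dots> < \<infinity>"
    using locint_integrable[OF f, of i x] unfolding integrable_iff_bounded by simp
  finally have "(LINT y|lborel. ?u y * avg j f y) = (LINT y|lborel. avg j ?u y * f y)"
    by (intro avg_selfadjoint(3)) measurable
  moreover have "avg j ?u y = ?u y" for y
    by (rule avg_level) (rule lev)
  ultimately have "(LINT y|lborel. ?u y * avg j f y) = (LINT y|lborel. ?u y * f y)" by simp
  moreover have "?u y * z = indicator (cube_of i x) y *\<^sub>R z" for y z
    by (auto simp: indicator_def)
  ultimately show ?thesis unfolding avg_def[of i] by simp
qed

section \<open>Square norms and martingale differences\<close>

definition sqn :: "('a::euclidean_space \<Rightarrow> 'b::real_normed_vector) \<Rightarrow> ennreal"
  where "sqn f = (\<integral>\<^sup>+x. (ennreal (norm (f x)))\<^sup>2 \<partial>lborel)"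

definition L2 :: "('a::euclidean_space \<Rightarrow> 'b::real_normed_vector) \<Rightarrow> bool"
  where "L2 f \<longleftrightarrow> f \<in> borel_measurable borel \<and> sqn f < \<infinity>"

text \<open>It turns square integrability into local integrability where only finiteness
  matters.\<close>

lemma ennreal_le_one_plus_sq: "a \<le> 1 + a\<^sup>2" for a :: ennreal
proof (cases a)
  case (real r)
  have "r \<le> 1 + r\<^sup>2" using zero_le_power2[of "r - 1/2"] by (simp add: power2_eq_square algebra_simps)
  then have "ennreal r \<le> ennreal (1 + r\<^sup>2)" by (rule ennreal_leI)
  also have "\<dots> = 1 + (ennreal r)\<^sup>2" using real by (simp add: ennreal_power)
  finally show ?thesis using real by simp
qed simp

lemma L2_measurable [measurable_dest]: "L2 f \<Longrightarrow> f \<in> borel_measurable borel"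
  by (simp add: L2_def)

lemma L2_locint:
  fixes f :: "real ^ 'n \<Rightarrow> 'b::{banach,second_countable_topology}"
  assumes "L2 f"
  shows "locint f"
  unfolding locint_def
proof (intro conjI allI)
  show [measurable]: "f \<in> borel_measurable borel" using assms by (simp add: L2_def)
  fix j and x :: "real ^ 'n"
  have "avn j (\<lambda>y. ennreal (norm (f y))) x \<le> avn j (\<lambda>y. 1 + (ennreal (norm (f y)))\<^sup>2) x"
    by (rule avn_mono) (rule ennreal_le_one_plus_sq)
  also have "\<dots> = 1 + avn j (\<lambda>y. (ennreal (norm (f y)))\<^sup>2) x"
    by (subst avn_add) auto
  also have "\<dots> < \<infinity>"
  proof -
    have "(\<integral>\<^sup>+y. indicator (cube_of j x) y * (ennreal (norm (f y)))\<^sup>2 \<partial>lborel) \<le> sqn f"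
      unfolding sqn_def by (intro nn_integral_mono) (auto simp: indicator_def)
    then show ?thesis
      using assms unfolding avn_def L2_def by (auto simp: ennreal_mult_less_top)
  qed
  finally show "avn j (\<lambda>y. ennreal (norm (f y))) x < \<infinity>" .
qed

lemma sqn_avg_le:
  fixes f :: "real ^ 'n \<Rightarrow> 'b::{banach,second_countable_topology}"
  assumes [measurable]: "f \<in> borel_measurable borel"
  shows "sqn (avg j f) \<le> sqn f"
proof -
  have "sqn (avg j f) \<le> (\<integral>\<^sup>+x. (avn j (\<lambda>y. ennreal (norm (f y))) x)\<^sup>2 \<partial>lborel)"
    unfolding sqn_def by (intro nn_integral_mono power_mono norm_avg_le) simp
  also have "\<dots> \<le> (\<integral>\<^sup>+x. avn j (\<lambda>y. (ennreal (norm (f y)))\<^sup>2) x \<partial>lborel)"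
    by (intro nn_integral_mono avn_CS) measurable
  also have "\<dots> = sqn f"
    unfolding sqn_def by (rule nn_integral_avn) measurable
  finally show ?thesis .
qed

lemma L2_avg: "L2 f \<Longrightarrow> L2 (avg j f)"
  for f :: "real ^ 'n \<Rightarrow> 'b::{banach,second_countable_topology}"
  unfolding L2_def using sqn_avg_le[of f j] by auto

lemma ennreal_add_sq_le: "(a + b)\<^sup>2 \<le> 2 * a\<^sup>2 + 2 * b\<^sup>2" for a b :: ennreal
proof (cases "a = top \<or> b = top")
  case True
  then show ?thesis by (auto simp: ennreal_mult_eq_top_iff)
next
  case False
  then obtain r s where rs: "a = ennreal r" "b = ennreal s" "r \<ge> 0" "s \<ge> 0"
    by (cases a; cases b) auto
  have "(r + s)\<^sup>2 \<le> 2 * r\<^sup>2 + 2 * s\<^sup>2"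
    using sum_squares_bound[of r s] by (simp add: power2_sum)
  then have "ennreal ((r + s)\<^sup>2) \<le> ennreal (2 * r\<^sup>2 + 2 * s\<^sup>2)" by (rule ennreal_leI)
  also have "\<dots> = 2 * ennreal (r\<^sup>2) + 2 * ennreal (s\<^sup>2)" by (simp add: ennreal_mult')
  finally show ?thesis
    using rs by (simp add: ennreal_power ennreal_plus[symmetric] del: ennreal_plus)
qed

lemma norm_diff_sq_le:
  "(ennreal (norm (a - b)))\<^sup>2 \<le> 2 * (ennreal (norm a))\<^sup>2 + 2 * (ennreal (norm b))\<^sup>2"
proof -
  have "ennreal (norm (a - b)) \<le> ennreal (norm a) + ennreal (norm b)"
    by (simp add: ennreal_plus[symmetric] norm_triangle_ineq4 ennreal_leI del: ennreal_plus)
  then have "(ennreal (norm (a - b)))\<^sup>2 \<le> (ennreal (norm a) + ennreal (norm b))\<^sup>2"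
    by (rule power_mono) simp
  also note ennreal_add_sq_le
  finally show ?thesis .
qed

lemma L2_diff:
  fixes f g :: "real ^ 'n \<Rightarrow> 'b::{banach,second_countable_topology}"
  assumes "L2 f" "L2 g"
  shows "L2 (\<lambda>x. f x - g x)"
proof -
  have [measurable]: "f \<in> borel_measurable borel" "g \<in> borel_measurable borel"
    using assms by (auto simp: L2_def)
  have "sqn (\<lambda>x. f x - g x) \<le> (\<integral>\<^sup>+x. 2 * (ennreal (norm (f x)))\<^sup>2 + 2 * (ennreal (norm (g x)))\<^sup>2 \<partial>lborel)"
    unfolding sqn_def by (intro nn_integral_mono norm_diff_sq_le)
  also have "\<dots> = 2 * sqn f + 2 * sqn g"
    unfolding sqn_def by (subst nn_integral_add) (auto simp: nn_integral_cmult)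
  also have "\<dots> < \<infinity>" using assms by (auto simp: L2_def ennreal_mult_less_top)
  finally show ?thesis by (simp add: L2_def)
qed

lemma L2_integrable_sq:
  assumes "L2 f"
  shows "integrable lborel (\<lambda>x. (norm (f x))\<^sup>2)" "ennreal (LINT x|lborel. (norm (f x))\<^sup>2) = sqn f"
proof -
  have [measurable]: "f \<in> borel_measurable borel" using assms by (auto simp: L2_def)
  have e: "sqn f = (\<integral>\<^sup>+x. ennreal ((norm (f x))\<^sup>2) \<partial>lborel)"
    unfolding sqn_def by (simp add: ennreal_power)
  show i: "integrable lborel (\<lambda>x. (norm (f x))\<^sup>2)"
    using assms by (intro integrableI_bounded) (auto simp: L2_def e)
  show "ennreal (LINT x|lborel. (norm (f x))\<^sup>2) = sqn f"
    unfolding e by (rule nn_integral_eq_integral[OF i, symmetric]) simp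
qed

lemma measurable_cnj [measurable (raw)]:
  "f \<in> borel_measurable M \<Longrightarrow> (\<lambda>x. cnj (f x)) \<in> borel_measurable M"
  by (rule measurable_compose[OF _ borel_measurable_continuous_onI]) (auto intro!: continuous_intros)

text \<open>The martingale difference: the projection of an L^2 function onto the Haar functions of
  the cubes of level \<open>j + 1\<close>.\<close>

definition mdiff :: "int \<Rightarrow> (real ^ 'n \<Rightarrow> complex) \<Rightarrow> real ^ 'n \<Rightarrow> complex"
  where "mdiff j f x = avg j f x - avg (j + 1) f x"

text \<open>Pythagoras: averaging the finer average gives the coarser one, so the cross term equals
  the square norm of the latter. The additive form avoids a difference in
  \<open>ennreal\<close>.\<close>

lemma sqn_mdiff:
  fixes f :: "real ^ 'n \<Rightarrow> complex"
  assumes f: "L2 f"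
  shows "sqn (mdiff j f) + sqn (avg (j + 1) f) = sqn (avg j f)"
proof -
  define A where "A = avg j f"
  define B where "B = avg (j + 1) f"
  have A: "L2 A" and B: "L2 B" and D: "L2 (\<lambda>x. A x - B x)"
    unfolding A_def B_def by (auto intro!: L2_avg L2_diff f)
  note [measurable] = L2_measurable[OF A] L2_measurable[OF B]
  have AB: "avg (j + 1) A x = B x" for x
    unfolding A_def B_def by (rule avg_tower[OF L2_locint[OF f]]) simp
  have "(\<integral>\<^sup>+x. ennreal (norm (cnj (B x))) * avn (j + 1) (\<lambda>y. ennreal (norm (A y))) x \<partial>lborel)
      = (\<integral>\<^sup>+x. ennreal (norm (cnj (B x))) * ennreal (norm (A x)) \<partial>lborel)"
    by (rule nn_integral_avn_weight) (auto simp: B_def dest: avg_cong[of "j + 1" _ _ f])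
  also have "\<dots> \<le> (\<integral>\<^sup>+x. ennreal ((norm (B x))\<^sup>2) + ennreal ((norm (A x))\<^sup>2) \<partial>lborel)"
  proof (intro nn_integral_mono)
    fix x
    have "norm (B x) * norm (A x) \<le> (norm (B x))\<^sup>2 + (norm (A x))\<^sup>2"
      using sum_squares_bound[of "norm (B x)" "norm (A x)"] zero_le_power2[of "norm (B x)"] zero_le_power2[of "norm (A x)"]
        mult_nonneg_nonneg[OF norm_ge_zero norm_ge_zero, of "B x" "A x"] by linarith
    then show "ennreal (norm (cnj (B x))) * ennreal (norm (A x)) \<le> ennreal ((norm (B x))\<^sup>2) + ennreal ((norm (A x))\<^sup>2)"
      by (simp add: ennreal_mult[symmetric] ennreal_plus[symmetric] ennreal_leI del: ennreal_plus)
  qed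
  also have "\<dots> = sqn B + sqn A"
    unfolding sqn_def by (subst nn_integral_add) (auto simp: ennreal_power)
  also have "\<dots> < \<infinity>" using A B by (auto simp: L2_def)
  finally have fin: "(\<integral>\<^sup>+x. ennreal (norm (cnj (B x))) * avn (j + 1) (\<lambda>y. ennreal (norm (A y))) x \<partial>lborel) < \<infinity>" .
  have cB: "avg (j + 1) (\<lambda>x. cnj (B x)) x = cnj (B x)" for x
    by (rule avg_level) (unfold B_def, metis avg_cong)
  note sa = avg_selfadjoint[where u="\<lambda>x. cnj (B x)" and v=A and j="j+1", OF _ _ fin, unfolded cB AB, simplified]
  define G where "G x = Re (cnj (B x) * A x)" for x
  have i1: "integrable lborel (\<lambda>x. Re (cnj (B x) * A x))"
    using sa(2) by (rule integrable_Re)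
  have "(LINT x|lborel. Re (cnj (B x) * A x)) = Re (LINT x|lborel. cnj (B x) * A x)"
    by (rule integral_Re[OF sa(2)])
  also have "\<dots> = Re (LINT x|lborel. cnj (B x) * B x)"
    using sa(3) by simp
  also have "\<dots> = (LINT x|lborel. Re (cnj (B x) * B x))"
    by (rule integral_Re[OF sa(1), symmetric])
  also have "\<dots> = (LINT x|lborel. (norm (B x))\<^sup>2)"
    by (simp add: cmod_power2) (simp add: power2_eq_square)
  finally have eq: "(LINT x|lborel. Re (cnj (B x) * A x)) = (LINT x|lborel. (norm (B x))\<^sup>2)" .
  have "(norm (A x - B x))\<^sup>2 = (norm (A x))\<^sup>2 - 2 * Re (cnj (B x) * A x) + (norm (B x))\<^sup>2" for x
    unfolding cmod_power2 by (simp add: power2_eq_square algebra_simps)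
  then have "(LINT x|lborel. (norm (A x - B x))\<^sup>2)
      = (LINT x|lborel. (norm (A x))\<^sup>2 - 2 * Re (cnj (B x) * A x) + (norm (B x))\<^sup>2)" by simp
  also have "\<dots> = (LINT x|lborel. (norm (A x))\<^sup>2) - 2 * (LINT x|lborel. Re (cnj (B x) * A x)) + (LINT x|lborel. (norm (B x))\<^sup>2)"
    using L2_integrable_sq(1)[OF A] L2_integrable_sq(1)[OF B] i1 unfolding G_def[symmetric] by simp
  finally have "(LINT x|lborel. (norm (A x - B x))\<^sup>2) + (LINT x|lborel. (norm (B x))\<^sup>2) = (LINT x|lborel. (norm (A x))\<^sup>2)"
    using eq by simp
  then have "ennreal (LINT x|lborel. (norm (A x - B x))\<^sup>2) + ennreal (LINT x|lborel. (norm (B x))\<^sup>2) = ennreal (LINT x|lborel. (norm (A x))\<^sup>2)"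
    by (simp add: ennreal_plus[symmetric] del: ennreal_plus)
  then show ?thesis
    unfolding L2_integrable_sq(2)[OF A] L2_integrable_sq(2)[OF B] L2_integrable_sq(2)[OF D]
    by (simp add: mdiff_def[abs_def] A_def B_def)
qed

text \<open>Finite blocks exhaust the integers by monotone convergence. Bounds uniform in the
  truncation of the levels become global here.\<close>

lemma nn_integral_count_space_int_le:
  fixes G :: "int \<Rightarrow> ennreal"
  assumes "\<And>a N. (\<Sum>i<N. G (a + int i)) \<le> c"
  shows "(\<integral>\<^sup>+k. G k \<partial>count_space UNIV) \<le> c"
proof -
  let ?I = "\<lambda>N::nat. {- int N..<int N}"
  have "(\<integral>\<^sup>+k. G k \<partial>count_space UNIV) = (\<integral>\<^sup>+k. (SUP N. G k * indicator (?I N) k) \<partial>count_space UNIV)"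
  proof (rule nn_integral_cong)
    fix k
    show "G k = (SUP N. G k * indicator (?I N) k)"
    proof (rule antisym)
      show "G k \<le> (SUP N. G k * indicator (?I N) k)"
        by (rule SUP_upper2[of "nat \<bar>k\<bar> + 1"]) (auto simp: indicator_def)
    qed (auto intro!: SUP_least simp: indicator_def)
  qed
  also have "\<dots> = (SUP N. \<integral>\<^sup>+k. G k * indicator (?I N) k \<partial>count_space UNIV)"
    by (rule nn_integral_monotone_convergence_SUP)
       (auto simp: incseq_def le_fun_def indicator_def)
  also have "\<dots> \<le> c"
  proof (rule SUP_least)
    fix N :: nat
    have "(\<integral>\<^sup>+k. G k * indicator (?I N) k \<partial>count_space UNIV) = (\<integral>\<^sup>+k. G k \<partial>count_space (?I N))"
      by (rule nn_integral_count_space_indicator[symmetric]) simp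
    also have "\<dots> = (\<Sum>k\<in>?I N. G k)"
      by (simp add: nn_integral_count_space_finite)
    also have "\<dots> = (\<Sum>i<2 * N. G (- int N + int i))"
      by (rule sum.reindex_bij_witness[of _ "\<lambda>i. - int N + int i" "\<lambda>k. nat (k + int N)"]) auto
    also have "\<dots> \<le> c" by (rule assms)
    finally show "(\<integral>\<^sup>+k. G k * indicator (?I N) k \<partial>count_space UNIV) \<le> c" .
  qed
  finally show ?thesis .
qed

text \<open>Bessel's inequality: the Pythagorean identities telescope over a block of
  levels.\<close>

lemma mdiff_square_sum:
  fixes f :: "real ^ 'n \<Rightarrow> complex"
  assumes f: "L2 f"
  shows "(\<integral>\<^sup>+k. sqn (mdiff k f) \<partial>count_space UNIV) \<le> sqn f"
proof (rule nn_integral_count_space_int_le)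
  fix a :: int and N :: nat
  have "(\<Sum>i<N. sqn (mdiff (a + int i) f)) + sqn (avg (a + int N) f) = sqn (avg a f)"
  proof (induction N)
    case (Suc N)
    have "sqn (mdiff (a + int N) f) + sqn (avg (a + int (Suc N)) f) = sqn (avg (a + int N) f)"
      using sqn_mdiff[OF f, of "a + int N"] by (simp add: add_ac)
    then show ?case
      by (simp only: sum.lessThan_Suc add.assoc Suc)
  qed simp
  then have "(\<Sum>i<N. sqn (mdiff (a + int i) f)) \<le> sqn (avg a f)"
    by (metis le_iff_add)
  also have "\<dots> \<le> sqn f"
    using f by (intro sqn_avg_le) (simp add: L2_def)
  finally show "(\<Sum>i<N. sqn (mdiff (a + int i) f)) \<le> sqn f" .
qed

text \<open>The part of a cube that a translation by \<open>h\<close> pushes out lies in one slab of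
  thickness |h_i| per coordinate. If |h| exceeds the side, the right-hand side already exceeds the
  measure of the cube.\<close>

lemma emeasure_cube_shift:
  fixes x h :: "real ^ 'n"
  shows "(\<integral>\<^sup>+y. indicator (cube_of j x) y * indicator (- cube_of j x) (y + h) \<partial>lborel)
    \<le> ennreal (real CARD('n) * (norm h / 2 powi j) * cvol CARD('n) j)"
proof (cases "norm h \<le> 2 powi j")
  case False
  have "cvol CARD('n) j \<le> real CARD('n) * (norm h / 2 powi j) * cvol CARD('n) j"
  proof -
    have "1 * 1 \<le> real CARD('n) * (norm h / 2 powi j)"
      using False by (intro mult_mono) (auto simp: Suc_le_eq)
    then show ?thesis
      using mult_right_mono[of 1 "real CARD('n) * (norm h / 2 powi j)" "cvol CARD('n) j"] by simp
  qed
  have "(\<integral>\<^sup>+y. indicator (cube_of j x) y * indicator (- cube_of j x) (y + h) \<partial>lborel) \<le> (\<integral>\<^sup>+y. indicator (cube_of j x) y \<partial>lborel)"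
    by (intro nn_integral_mono) (auto simp: indicator_def)
  also have "\<dots> = ennreal (cvol CARD('n) j)" by simp
  also have "\<dots> \<le> ennreal (real CARD('n) * (norm h / 2 powi j) * cvol CARD('n) j)"
    by (rule ennreal_leI) fact
  finally show ?thesis .
next
  case True
  let ?n = "CARD('n)"
  let ?l = "2 powi j :: real"
  define a where "a = ((\<chi> i. ?l * of_int (cube_index j x $ i)) :: real ^ 'n)"
  \<comment> \<open>The slab sits at the upper or at the lower face according to the sign of
    \<open>h $ i\<close>.\<close>
  define S where "S i = cbox (\<chi> k. if k = i \<and> h $ i \<ge> 0 then a $ k + ?l - h $ i else a $ k)
      (\<chi> k. if k = i \<and> h $ i < 0 then a $ k - h $ i else a $ k + ?l)" for i
  have hi: "\<bar>h $ i\<bar> \<le> ?l" for i using component_le_norm_cart[of h i] True by linarith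
  have cube: "cube_of j x = {y. \<forall>i. a $ i \<le> y $ i \<and> y $ i < a $ i + ?l}"
    unfolding cube_of_box a_def by (simp add: algebra_simps)
  have sub: "{y. y \<in> cube_of j x \<and> y + h \<notin> cube_of j x} \<subseteq> (\<Union>i. S i)"
  proof
    fix y assume "y \<in> {y. y \<in> cube_of j x \<and> y + h \<notin> cube_of j x}"
    then have y: "\<And>i. a $ i \<le> y $ i \<and> y $ i < a $ i + ?l" and "\<not> (\<forall>i. a $ i \<le> (y + h) $ i \<and> (y + h) $ i < a $ i + ?l)"
      unfolding cube by auto
    then obtain i where i: "\<not> (a $ i \<le> y $ i + h $ i \<and> y $ i + h $ i < a $ i + ?l)" by auto
    have "y \<in> S i"
      unfolding S_def mem_box_cart using y i by (auto; smt (verit))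
    then show "y \<in> (\<Union>i. S i)" by auto
  qed
  have mS: "emeasure lborel (S i) = ennreal (\<bar>h $ i\<bar> * ?l ^ (?n - 1))" for i
  proof -
    have "emeasure lborel (S i) = ennreal (\<Prod>k\<in>UNIV. if k = i then \<bar>h $ i\<bar> else ?l)"
      unfolding S_def using hi[of i]
      by (subst emeasure_cbox_cart) (auto simp: abs_if intro!: arg_cong[where f=ennreal] prod.cong split: if_splits)
    also have "(\<Prod>k\<in>UNIV. if k = i then \<bar>h $ i\<bar> else ?l) = \<bar>h $ i\<bar> * (\<Prod>k\<in>UNIV - {i}. if k = i then \<bar>h $ i\<bar> else ?l)"
      by (subst prod.remove[of UNIV i]) auto
    also have "(\<Prod>k\<in>UNIV - {i}. if k = i then \<bar>h $ i\<bar> else ?l) = (\<Prod>k\<in>UNIV - {i}. ?l)"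
      by (intro prod.cong) auto
    also have "\<dots> = ?l ^ (?n - 1)" by (simp add: card_Diff_singleton)
    finally show ?thesis .
  qed
  have [measurable]: "S i \<in> sets borel" for i by (simp add: S_def)
  have "(\<integral>\<^sup>+y. indicator (cube_of j x) y * indicator (- cube_of j x) (y + h) \<partial>lborel) \<le> (\<integral>\<^sup>+y. indicator (\<Union>i. S i) y \<partial>lborel)"
    using sub by (intro nn_integral_mono) (auto simp: indicator_def)
  also have "\<dots> = emeasure lborel (\<Union>i. S i)" by simp
  also have "\<dots> \<le> (\<Sum>i\<in>UNIV. emeasure lborel (S i))"
    by (rule emeasure_subadditive_finite) auto
  also have "\<dots> \<le> (\<Sum>i\<in>(UNIV::'n set). ennreal (norm h * ?l ^ (?n - 1)))"
    unfolding mS by (intro sum_mono ennreal_leI mult_right_mono component_le_norm_cart) simp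
  also have "\<dots> = ennreal (real ?n * (norm h * ?l ^ (?n - 1)))"
    by (simp add: ennreal_mult' ennreal_of_nat_eq_real_of_nat)
  also have "norm h * ?l ^ (?n - 1) = (norm h / ?l) * cvol ?n j"
  proof -
    have "?l ^ ?n = ?l * ?l ^ (?n - 1)"
      by (metis One_nat_def Suc_pred power_Suc zero_less_card_finite)
    then show ?thesis unfolding cvol_def by simp
  qed
  finally show ?thesis by (simp add: mult_ac)
qed

lemma measurable_pred_cube_of [measurable (raw)]:
  fixes f g :: "_ \<Rightarrow> real ^ 'n"
  assumes [measurable]: "f \<in> borel_measurable M" "g \<in> borel_measurable M"
  shows "Measurable.pred M (\<lambda>x. g x \<in> cube_of j (f x))"
  unfolding cube_of_iff by measurable

section \<open>The measure dt/t\<close>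

definition dtt :: "real measure"
  where "dtt = density lborel (\<lambda>t. indicator {0<..} t * ennreal (1 / t))"

lemma sets_dtt [simp, measurable_cong]: "sets dtt = sets borel"
  by (simp add: dtt_def)

interpretation dtt: sigma_finite_measure dtt
  unfolding dtt_def
  by (subst sigma_finite_measure.sigma_finite_iff_density_finite[OF lborel.sigma_finite_measure_axioms]) (auto simp: indicator_def)

interpretation dtt_lborel: pair_sigma_finite dtt lborel ..

lemma nn_integral_dtt:
  assumes "F \<in> borel_measurable borel"
  shows "(\<integral>\<^sup>+t. F t \<partial>dtt) = (\<integral>\<^sup>+t. indicator {0<..} t * ennreal (1 / t) * F t \<partial>lborel)"
  unfolding dtt_def using assms by (subst nn_integral_density) auto

lemma AE_dtt_pos: "AE t in dtt. 0 < t"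
  unfolding dtt_def by (subst AE_density) (auto simp: indicator_def)

lemma nn_integral_dtt_mono:
  assumes "\<And>t. t > 0 \<Longrightarrow> F t \<le> G t"
  shows "(\<integral>\<^sup>+t. F t \<partial>dtt) \<le> (\<integral>\<^sup>+t. G t \<partial>dtt)"
  using AE_dtt_pos by (intro nn_integral_mono_AE) (auto elim!: eventually_mono intro: assms)

text \<open>Chosen so that the cubes of level \<open>lev t\<close> have side in (t, 2 t].\<close>

definition lev :: "real \<Rightarrow> int"
  where "lev t = \<lfloor>log 2 t\<rfloor> + 1"

lemma measurable_lev [measurable]: "lev \<in> measurable borel (count_space UNIV)"
  unfolding lev_def by measurable

lemma lev_iff: "t > 0 \<Longrightarrow> lev t = k \<longleftrightarrow> 2 powi (k - 1) \<le> t \<and> t < 2 powi k"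
proof -
  assume t: "t > 0"
  have "lev t = k \<longleftrightarrow> \<lfloor>log 2 t\<rfloor> = k - 1" by (auto simp: lev_def)
  also have "\<dots> \<longleftrightarrow> 2 powr real_of_int (k - 1) \<le> t \<and> t < 2 powr real_of_int ((k - 1) + 1)"
    using floor_log_eq_powr_iff[of t 2 "k - 1"] t by simp
  finally show ?thesis by (simp add: powr_real_of_int' del: of_int_diff)
qed

lemma lev_bounds: "t > 0 \<Longrightarrow> 2 powi (lev t - 1) \<le> t" "t > 0 \<Longrightarrow> t < 2 powi (lev t)"
  using lev_iff[of t "lev t"] by auto

lemma lev_bound2: "t > 0 \<Longrightarrow> 2 powi (lev t) \<le> 2 * t"
  using lev_bounds(1)[of t] by (simp add: power_int_diff)

text \<open>The exact value is ln 2; bounding 1/t by its maximum on the octave gives 1.\<close>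

lemma dtt_octave: "(\<integral>\<^sup>+t. indicator {t. lev t = k} t \<partial>dtt) \<le> 1"
proof -
  have "(\<integral>\<^sup>+t. indicator {t. lev t = k} t \<partial>dtt) =
      (\<integral>\<^sup>+t. indicator {0<..} t * ennreal (1 / t) * indicator {t. lev t = k} t \<partial>lborel)"
    by (rule nn_integral_dtt) measurable
  also have "\<dots> \<le> (\<integral>\<^sup>+t. ennreal (1 / 2 powi (k - 1)) * indicator {2 powi (k - 1)..2 powi k :: real} t \<partial>lborel)"
    by (intro nn_integral_mono) (auto simp: indicator_def lev_iff intro!: ennreal_leI divide_left_mono)
  also have "\<dots> = ennreal (1 / 2 powi (k - 1)) * ennreal (2 powi k - 2 powi (k - 1))"
    by (subst nn_integral_cmult_indicator) (auto simp: power_int_diff)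
  also have "\<dots> = 1"
    by (simp add: ennreal_mult'[symmetric] power_int_diff)
  finally show ?thesis .
qed

lemma dtt_split:
  assumes [measurable]: "F \<in> borel_measurable borel"
  shows "(\<integral>\<^sup>+t. F t \<partial>dtt) = (\<integral>\<^sup>+k. (\<integral>\<^sup>+t. indicator {t. lev t = k} t * F t \<partial>dtt) \<partial>count_space UNIV)"
proof -
  interpret C: sigma_finite_measure "count_space (UNIV :: int set)"
    by (rule sigma_finite_measure_count_space)
  interpret P: pair_sigma_finite "count_space (UNIV :: int set)" dtt ..
  have "F t = (\<integral>\<^sup>+k. indicator {t. lev t = k} t * F t \<partial>count_space UNIV)" for t
  proof -
    have "(\<integral>\<^sup>+k. indicator {t. lev t = k} t * F t \<partial>count_space UNIV) = (\<integral>\<^sup>+k. F t * indicator {lev t} k \<partial>count_space UNIV)"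
      by (intro nn_integral_cong) (auto simp: indicator_def)
    then show ?thesis by simp
  qed
  then have "(\<integral>\<^sup>+t. F t \<partial>dtt) = (\<integral>\<^sup>+t. (\<integral>\<^sup>+k. indicator {t. lev t = k} t * F t \<partial>count_space UNIV) \<partial>dtt)"
    by simp
  also have "\<dots> = (\<integral>\<^sup>+k. (\<integral>\<^sup>+t. indicator {t. lev t = k} t * F t \<partial>dtt) \<partial>count_space UNIV)"
    by (rule P.Fubini') (rule measurable_pair_measure_countable1, auto)
  finally show ?thesis .
qed

text \<open>Each octave has mass at most 1, and the shift by \<open>m\<close> is a bijection of the
  levels.\<close>

lemma dtt_lev_le:
  fixes G :: "int \<Rightarrow> ennreal"
  shows "(\<integral>\<^sup>+t. G (lev t + m) \<partial>dtt) \<le> (\<integral>\<^sup>+k. G k \<partial>count_space UNIV)"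
proof -
  have "(\<integral>\<^sup>+t. G (lev t + m) \<partial>dtt) = (\<integral>\<^sup>+k. (\<integral>\<^sup>+t. indicator {t. lev t = k} t * G (lev t + m) \<partial>dtt) \<partial>count_space UNIV)"
    by (rule dtt_split) measurable
  also have "\<dots> = (\<integral>\<^sup>+k. G (k + m) * (\<integral>\<^sup>+t. indicator {t. lev t = k} t \<partial>dtt) \<partial>count_space UNIV)"
    by (intro nn_integral_cong, subst nn_integral_cmult[symmetric])
       (auto intro!: nn_integral_cong simp: indicator_def)
  also have "\<dots> \<le> (\<integral>\<^sup>+k. G (k + m) * 1 \<partial>count_space UNIV)"
    by (intro nn_integral_mono mult_left_mono dtt_octave) simp
  also have "\<dots> = (\<integral>\<^sup>+k. G (k + m) \<partial>count_space UNIV)" by simp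
  also have "\<dots> = (\<integral>\<^sup>+k. G k \<partial>count_space UNIV)"
    by (rule nn_integral_bij_count_space) (rule bij_betwI[where g="\<lambda>k. k - m"], auto)
  finally show ?thesis .
qed

lemma dtt_powr_lower:
  assumes "b > 0" "l > 0"
  shows "(\<integral>\<^sup>+t. indicator {..l} t * ennreal ((t / l) powr b) \<partial>dtt) \<le> ennreal (1 / b)"
proof -
  have "(\<integral>\<^sup>+t. indicator {..l} t * ennreal ((t / l) powr b) \<partial>dtt)
      = (\<integral>\<^sup>+t. indicator {0<..} t * ennreal (1 / t) * (indicator {..l} t * ennreal ((t / l) powr b)) \<partial>lborel)"
    by (rule nn_integral_dtt) measurable
  also have "\<dots> = (\<integral>\<^sup>+t. ennreal (1 / l powr b) * (ennreal (t powr (b - 1)) * indicator {0..l} t) \<partial>lborel)"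
    by (intro nn_integral_cong) (auto simp: indicator_def powr_divide powr_diff ennreal_mult[symmetric])
  also have "\<dots> = ennreal (1 / l powr b) * (\<integral>\<^sup>+t. ennreal (t powr (b - 1)) * indicator {0..l} t \<partial>lborel)"
    by (rule nn_integral_cmult) measurable
  also have "(\<integral>\<^sup>+t. ennreal (t powr (b - 1)) * indicator {0..l} t \<partial>lborel) = ennreal (l powr (b - 1 + 1) / (b - 1 + 1))"
    using assms by (intro nn_integral_has_integral_lebesgue' has_integral_powr_from_0) auto
  also have "ennreal (1 / l powr b) * \<dots> = ennreal (1 / b)"
    using assms by (simp add: ennreal_mult[symmetric])
  finally show ?thesis by simp
qed

lemma dtt_powr_upper:
  assumes "b > 0" "l > 0"
  shows "(\<integral>\<^sup>+t. indicator {l..} t * ennreal ((l / t) powr b) \<partial>dtt) \<le> ennreal (1 / b)"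
proof -
  have "(\<integral>\<^sup>+t. indicator {l..} t * ennreal ((l / t) powr b) \<partial>dtt)
      = (\<integral>\<^sup>+t. indicator {0<..} t * ennreal (1 / t) * (indicator {l..} t * ennreal ((l / t) powr b)) \<partial>lborel)"
    by (rule nn_integral_dtt) measurable
  also have "\<dots> = (\<integral>\<^sup>+t. ennreal (l powr b) * (ennreal (t powr (- b - 1)) * indicator {l..} t) \<partial>lborel)"
  proof (rule nn_integral_cong)
    fix t
    have "t > 0 \<Longrightarrow> 1 / t * (l / t) powr b = l powr b * t powr (- b - 1)"
      using assms by (simp add: powr_divide powr_diff powr_minus_divide)
    then show "indicator {0<..} t * ennreal (1 / t) * (indicator {l..} t * ennreal ((l / t) powr b))
      = ennreal (l powr b) * (ennreal (t powr (- b - 1)) * indicator {l..} t)"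
      using assms by (auto simp: indicator_def ennreal_mult[symmetric])
  qed
  also have "\<dots> = ennreal (l powr b) * (\<integral>\<^sup>+t. ennreal (t powr (- b - 1)) * indicator {l..} t \<partial>lborel)"
    by (rule nn_integral_cmult) measurable
  also have "(\<integral>\<^sup>+t. ennreal (t powr (- b - 1)) * indicator {l..} t \<partial>lborel)
      = ennreal (- (l powr (- b - 1 + 1)) / (- b - 1 + 1))"
    using assms by (intro nn_integral_has_integral_lebesgue' has_integral_powr_to_inf) auto
  also have "ennreal (l powr b) * \<dots> = ennreal (1 / b)"
    using assms by (simp add: ennreal_mult[symmetric] powr_minus)
  finally show ?thesis by simp
qed

section \<open>Square function kernels with scalar values\<close>

lemma locint_bounded:
  fixes f :: "real ^ 'n \<Rightarrow> 'b::{banach,second_countable_topology}"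
  assumes "f \<in> borel_measurable borel" "\<And>y. norm (f y) \<le> c"
  shows "locint f"
  unfolding locint_def
proof (intro conjI allI)
  fix j and x :: "real ^ 'n"
  have "avn j (\<lambda>y. ennreal (norm (f y))) x \<le> avn j (\<lambda>y. ennreal c) x"
    by (rule avn_mono) (rule ennreal_leI[OF assms(2)])
  then show "avn j (\<lambda>y. ennreal (norm (f y))) x < \<infinity>"
    by (simp add: le_less_trans)
qed (rule assms)

lemma avg_diff_bound:
  fixes f :: "real ^ 'n \<Rightarrow> 'b::{banach,second_countable_topology}"
  assumes "locint f" and "\<And>z. cube_index j z = cube_index j y \<Longrightarrow> norm (f y - f z) \<le> B"
  shows "norm (f y - avg j f y) \<le> B"
proof -
  have B: "B \<ge> 0" using assms(2)[of y] by simp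
  have "f y - avg j f y = avg j (\<lambda>z. f y - f z) y"
    using avg_diff_fun[OF locint_bounded[of "\<lambda>_. f y" "norm (f y)"] assms(1), of j y] by simp
  then have "ennreal (norm (f y - avg j f y)) \<le> avn j (\<lambda>z. ennreal (norm (f y - f z))) y"
    using norm_avg_le[of j "\<lambda>z. f y - f z" y] by simp
  also have "\<dots> \<le> avn j (\<lambda>z. ennreal B) y"
    by (rule avn_mono) (rule ennreal_leI[OF assms(2)])
  finally show ?thesis using B by simp
qed

text \<open>Bound G by 1 + G^2: the first term sees the mass of the weight, the second its
  supremum.\<close>

lemma wt_L2_finite:
  fixes G :: "real ^ 'n \<Rightarrow> ennreal"
  assumes "t > 0" "b > 0" and [measurable]: "G \<in> borel_measurable borel" and "(\<integral>\<^sup>+y. (G y)\<^sup>2 \<partial>lborel) < \<infinity>"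
  shows "(\<integral>\<^sup>+y. ennreal (wt b t (x - y)) * G y \<partial>lborel) < \<infinity>"
proof -
  have "(\<integral>\<^sup>+y. ennreal (wt b t (x - y)) * G y \<partial>lborel) \<le>
      (\<integral>\<^sup>+y. ennreal (wt b t (x - y)) + ennreal (1 / t ^ CARD('n)) * (G y)\<^sup>2 \<partial>lborel)"
  proof (intro nn_integral_mono)
    fix y
    have "ennreal (wt b t (x - y)) * G y \<le> ennreal (wt b t (x - y)) * (1 + (G y)\<^sup>2)"
      by (intro mult_left_mono ennreal_le_one_plus_sq) simp
    also have "\<dots> \<le> ennreal (wt b t (x - y)) + ennreal (1 / t ^ CARD('n)) * (G y)\<^sup>2"
      unfolding distrib_left
      by (intro add_mono mult_right_mono ennreal_leI wt_le_inverse assms) auto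
    finally show "ennreal (wt b t (x - y)) * G y \<le> ennreal (wt b t (x - y)) + ennreal (1 / t ^ CARD('n)) * (G y)\<^sup>2" .
  qed
  also have "\<dots> = (\<integral>\<^sup>+y. ennreal (wt b t (x - y)) \<partial>lborel) + ennreal (1 / t ^ CARD('n)) * (\<integral>\<^sup>+y. (G y)\<^sup>2 \<partial>lborel)"
    by (subst nn_integral_add) (auto simp: nn_integral_cmult)
  also have "\<dots> < \<infinity>"
    using nn_integral_wt[OF assms(1,2), of x] assms(4) by (auto simp: ennreal_mult_less_top intro: le_less_trans)
  finally show ?thesis .
qed

text \<open>An interpolation between the linear bound and the trivial one. Only a small power of |h|
  can be absorbed by the decay of the weight.\<close>

lemma cube_shift_powr:
  fixes x h :: "real ^ 'n"
  assumes "0 < b" "b \<le> 1"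
  shows "(\<integral>\<^sup>+y. indicator (cube_of j x) y * indicator (- cube_of j x) (y + h) \<partial>lborel)
    \<le> ennreal (real CARD('n) * (norm h / 2 powi j) powr b * cvol CARD('n) j)"
proof (cases "norm h \<le> 2 powi j")
  case True
  then have "norm h / 2 powi j \<le> (norm h / 2 powi j) powr b"
    using assms powr_mono'[of b 1 "norm h / 2 powi j"] by (cases "h = 0") auto
  then have "ennreal (real CARD('n) * (norm h / 2 powi j) * cvol CARD('n) j)
      \<le> ennreal (real CARD('n) * (norm h / 2 powi j) powr b * cvol CARD('n) j)"
    by (intro ennreal_leI mult_right_mono mult_left_mono) auto
  then show ?thesis using emeasure_cube_shift[of j x h] by (rule order_trans[rotated])
next
  case False
  have "(\<integral>\<^sup>+y. indicator (cube_of j x) y * indicator (- cube_of j x) (y + h) \<partial>lborel) \<le> (\<integral>\<^sup>+y. indicator (cube_of j x) y \<partial>lborel)"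
    by (intro nn_integral_mono) (auto simp: indicator_def)
  also have "\<dots> = ennreal (1 * 1 * cvol CARD('n) j)" by simp
  also have "\<dots> \<le> ennreal (real CARD('n) * (norm h / 2 powi j) powr b * cvol CARD('n) j)"
    using False assms by (intro ennreal_leI mult_right_mono mult_mono ge_one_powr_ge_zero) (auto simp: Suc_le_eq)
  finally show ?thesis .
qed

lemma nn_integral_translate:
  fixes f :: "'a::euclidean_space \<Rightarrow> ennreal"
  assumes [measurable]: "f \<in> borel_measurable borel"
  shows "(\<integral>\<^sup>+y. f y \<partial>lborel) = (\<integral>\<^sup>+h. f (z + h) \<partial>lborel)"
proof -
  have "(\<integral>\<^sup>+y. f y \<partial>lborel) = (\<integral>\<^sup>+y. f y \<partial>(distr lborel borel ((+) z)))"
    by (simp add: lborel_distr_plus)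
  also have "\<dots> = (\<integral>\<^sup>+h. f (z + h) \<partial>lborel)"
    by (rule nn_integral_distr) auto
  finally show ?thesis .
qed

text \<open>Averaged over a cube, the mass that the weight sends outside is small: with y = z + h,
  estimate for fixed \<open>h\<close> the measure of the z that leave the cube, and spend half of
  the decay exponent on the factor |h|^(a/2).\<close>

lemma avn_wt_outside:
  fixes x :: "real ^ 'n"
  assumes "t > 0" "0 < a" "a \<le> 1"
  shows "avn j (\<lambda>z. \<integral>\<^sup>+y. ennreal (wt a t (z - y)) * indicator (- cube_of j z) y \<partial>lborel) x
    \<le> ennreal (real CARD('n) * Wc CARD('n) (a / 2) * (t / 2 powi j) powr (a / 2))"
proof -
  let ?n = "CARD('n)" let ?C = "cube_of j x" let ?b = "a / 2"
  let ?c = "ennreal (1 / cvol ?n j)"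
  have "(\<integral>\<^sup>+z. indicator ?C z * (\<integral>\<^sup>+y. ennreal (wt a t (z - y)) * indicator (- cube_of j z) y \<partial>lborel) \<partial>lborel)
      = (\<integral>\<^sup>+z. (\<integral>\<^sup>+h. ennreal (wt a t h) * (indicator ?C z * indicator (- ?C) (z + h)) \<partial>lborel) \<partial>lborel)"
  proof (rule nn_integral_cong)
    fix z :: "real ^ 'n"
    have "(\<integral>\<^sup>+y. ennreal (wt a t (z - y)) * indicator (- cube_of j z) y \<partial>lborel)
        = (\<integral>\<^sup>+h. ennreal (wt a t (z - (z + h))) * indicator (- cube_of j z) (z + h) \<partial>lborel)"
      by (rule nn_integral_translate) measurable
    then have *: "(\<integral>\<^sup>+y. ennreal (wt a t (z - y)) * indicator (- cube_of j z) y \<partial>lborel)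
        = (\<integral>\<^sup>+h. ennreal (wt a t h) * indicator (- cube_of j z) (z + h) \<partial>lborel)" by simp
    show "indicator ?C z * (\<integral>\<^sup>+y. ennreal (wt a t (z - y)) * indicator (- cube_of j z) y \<partial>lborel)
        = (\<integral>\<^sup>+h. ennreal (wt a t h) * (indicator ?C z * indicator (- ?C) (z + h)) \<partial>lborel)"
    proof (cases "z \<in> ?C")
      case True
      then have "cube_of j z = ?C" by (simp add: cube_of_def)
      then show ?thesis using True * by simp
    qed simp
  qed
  also have "\<dots> = (\<integral>\<^sup>+h. (\<integral>\<^sup>+z. ennreal (wt a t h) * (indicator ?C z * indicator (- ?C) (z + h)) \<partial>lborel) \<partial>lborel)"
    by (rule lborel_pair.Fubini') measurable
  also have "\<dots> = (\<integral>\<^sup>+h. ennreal (wt a t h) * (\<integral>\<^sup>+z. indicator ?C z * indicator (- ?C) (z + h) \<partial>lborel) \<partial>lborel)"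
    by (intro nn_integral_cong nn_integral_cmult) measurable
  also have "\<dots> \<le> (\<integral>\<^sup>+h. ennreal (wt a t h) * ennreal (real ?n * (norm h / 2 powi j) powr ?b * cvol ?n j) \<partial>(lborel :: (real ^ 'n) measure))"
    by (rule nn_integral_mono, rule mult_left_mono, rule cube_shift_powr) (use assms in auto)
  also have "\<dots> \<le> (\<integral>\<^sup>+h. ennreal (real ?n * (t / 2 powi j) powr ?b * cvol ?n j) * ennreal (wt ?b t h) \<partial>(lborel :: (real ^ 'n) measure))"
  proof (rule nn_integral_mono)
    fix h :: "real ^ 'n"
    have "wt a t h * norm h powr ?b \<le> t powr ?b * wt ?b t h"
      using wt_mult_norm[of t ?b a h] assms by simp
    then have "(real ?n / (2 powi j) powr ?b * cvol ?n j) * (wt a t h * norm h powr ?b)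
        \<le> (real ?n / (2 powi j) powr ?b * cvol ?n j) * (t powr ?b * wt ?b t h)"
      by (rule mult_left_mono) simp
    then have "wt a t h * (real ?n * (norm h / 2 powi j) powr ?b * cvol ?n j) \<le> real ?n * (t / 2 powi j) powr ?b * cvol ?n j * wt ?b t h"
      using assms by (simp add: powr_divide mult_ac)
    then show "ennreal (wt a t h) * ennreal (real ?n * (norm h / 2 powi j) powr ?b * cvol ?n j)
        \<le> ennreal (real ?n * (t / 2 powi j) powr ?b * cvol ?n j) * ennreal (wt ?b t h)"
      by (simp add: ennreal_mult[symmetric] ennreal_leI)
  qed
  also have "\<dots> = ennreal (real ?n * (t / 2 powi j) powr ?b * cvol ?n j) * (\<integral>\<^sup>+h. ennreal (wt ?b t h) \<partial>(lborel :: (real ^ 'n) measure))"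
    by (rule nn_integral_cmult) measurable
  also have "\<dots> \<le> ennreal (real ?n * (t / 2 powi j) powr ?b * cvol ?n j) * ennreal (Wc ?n ?b)"
    using nn_integral_wt[of t ?b "0 :: real ^ 'n"] assms by (intro mult_left_mono) auto
  finally have "avn j (\<lambda>z. \<integral>\<^sup>+y. ennreal (wt a t (z - y)) * indicator (- cube_of j z) y \<partial>lborel) x
      \<le> ?c * (ennreal (real ?n * (t / 2 powi j) powr ?b * cvol ?n j) * ennreal (Wc ?n ?b))"
    unfolding avn_def by (rule mult_left_mono) simp
  also have "\<dots> = ennreal (real ?n * Wc ?n ?b * (t / 2 powi j) powr ?b)"
    using Wc_pos[of ?b ?n] assms by (simp add: ennreal_mult[symmetric] mult_ac)
  finally show ?thesis .
qed

text \<open>The regularity is required for increments up to \<open>2 n t\<close>, so that it covers any two points of a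
  dyadic cube of the level \<open>lev t\<close>.\<close>

locale kern =
  fixes \<alpha> A :: real and \<psi> :: "real \<Rightarrow> real ^ 'n \<Rightarrow> real ^ 'n \<Rightarrow> complex"
  assumes alpha: "0 < \<alpha>" "\<alpha> \<le> 1" and A: "0 \<le> A"
    and meas: "(\<lambda>(t, x, y). \<psi> t x y) \<in> borel_measurable (borel \<Otimes>\<^sub>M borel \<Otimes>\<^sub>M borel)"
    and size: "\<And>t x y. t > 0 \<Longrightarrow> norm (\<psi> t x y) \<le> A * wt \<alpha> t (x - y)"
    and smooth_y: "\<And>t x y y'. t > 0 \<Longrightarrow> norm (y - y') \<le> 2 * real CARD('n) * t \<Longrightarrow>
      norm (\<psi> t x y - \<psi> t x y') \<le> A * (norm (y - y') / t) powr \<alpha> * wt \<alpha> t (x - y)"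
    and smooth_x: "\<And>t x x' y. t > 0 \<Longrightarrow> norm (x - x') \<le> 2 * real CARD('n) * t \<Longrightarrow>
      norm (\<psi> t x y - \<psi> t x' y) \<le> A * (norm (x - x') / t) powr \<alpha> * wt \<alpha> t (x - y)"
begin

lemma measurable_psi [measurable (raw)]:
  assumes "f \<in> borel_measurable M" "g \<in> borel_measurable M" "h \<in> borel_measurable M"
  shows "(\<lambda>z. \<psi> (f z) (g z) (h z)) \<in> borel_measurable M"
  using measurable_compose[OF measurable_Pair[OF assms(1) measurable_Pair[OF assms(2,3)]] meas] by simp

definition Th :: "(real ^ 'n \<Rightarrow> complex) \<Rightarrow> real \<Rightarrow> real ^ 'n \<Rightarrow> complex"
  where "Th f t x = (LINT y|lborel. \<psi> t x y * f y)"

definition gam :: "real \<Rightarrow> real ^ 'n \<Rightarrow> complex"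
  where "gam t x = (LINT y|lborel. \<psi> t x y)"

lemma measurable_Th [measurable (raw)]:
  assumes [measurable]: "f \<in> borel_measurable borel" "g \<in> borel_measurable M" "h \<in> borel_measurable M"
  shows "(\<lambda>z. Th f (g z) (h z)) \<in> borel_measurable M"
  unfolding Th_def by (rule lborel.borel_measurable_lebesgue_integral) measurable

lemma measurable_gam [measurable (raw)]:
  assumes [measurable]: "g \<in> borel_measurable M" "h \<in> borel_measurable M"
  shows "(\<lambda>z. gam (g z) (h z)) \<in> borel_measurable M"
  unfolding gam_def by (rule lborel.borel_measurable_lebesgue_integral) measurable

lemma Th_integrable:
  assumes t: "t > 0" and [measurable]: "f \<in> borel_measurable borel"
    and fin: "(\<integral>\<^sup>+y. ennreal (wt \<alpha> t (x - y)) * ennreal (norm (f y)) \<partial>lborel) < \<infinity>"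
  shows "integrable lborel (\<lambda>y. \<psi> t x y * f y)"
proof (rule integrableI_bounded)
  have "(\<integral>\<^sup>+y. ennreal (norm (\<psi> t x y * f y)) \<partial>lborel)
      \<le> (\<integral>\<^sup>+y. ennreal A * (ennreal (wt \<alpha> t (x - y)) * ennreal (norm (f y))) \<partial>lborel)"
    using A size[OF t]
    by (intro nn_integral_mono) (auto simp: norm_mult ennreal_mult'[symmetric] mult.assoc[symmetric] intro!: ennreal_leI mult_right_mono)
  also have "\<dots> = ennreal A * (\<integral>\<^sup>+y. ennreal (wt \<alpha> t (x - y)) * ennreal (norm (f y)) \<partial>lborel)"
    by (rule nn_integral_cmult) measurable
  also have "\<dots> < \<infinity>" using fin by (simp add: ennreal_mult_less_top)
  finally show "(\<integral>\<^sup>+y. ennreal (norm (\<psi> t x y * f y)) \<partial>lborel) < \<infinity>" .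
qed measurable

lemma psi_integrable: "t > 0 \<Longrightarrow> integrable lborel (\<psi> t x)"
  using Th_integrable[of t "\<lambda>_. 1" x] le_less_trans[OF nn_integral_wt[of t \<alpha> x] ennreal_less_top] alpha by simp

lemma gam_eq_Th: "gam t x = Th (\<lambda>_. 1) t x"
  by (simp add: gam_def Th_def)

lemma norm_Th_le:
  assumes t: "t > 0" and [measurable]: "f \<in> borel_measurable borel"
  shows "ennreal (norm (Th f t x)) \<le> ennreal A * (\<integral>\<^sup>+y. ennreal (wt \<alpha> t (x - y)) * ennreal (norm (f y)) \<partial>lborel)"
proof -
  have "ennreal (norm (Th f t x)) \<le> (\<integral>\<^sup>+y. ennreal (norm (\<psi> t x y * f y)) \<partial>lborel)"
    unfolding Th_def by (rule norm_integral_le_nn)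
  also have "\<dots> \<le> (\<integral>\<^sup>+y. ennreal A * (ennreal (wt \<alpha> t (x - y)) * ennreal (norm (f y))) \<partial>lborel)"
    using A size[OF t]
    by (intro nn_integral_mono) (auto simp: norm_mult ennreal_mult'[symmetric] mult.assoc[symmetric] intro!: ennreal_leI mult_right_mono)
  also have "\<dots> = ennreal A * (\<integral>\<^sup>+y. ennreal (wt \<alpha> t (x - y)) * ennreal (norm (f y)) \<partial>lborel)"
    by (rule nn_integral_cmult) measurable
  finally show ?thesis .
qed

lemma norm_gam_le: "t > 0 \<Longrightarrow> norm (gam t x) \<le> A * Wc CARD('n) \<alpha>"
proof -
  assume t: "t > 0"
  have "ennreal (norm (gam t x)) \<le> ennreal A * (\<integral>\<^sup>+y. ennreal (wt \<alpha> t (x - y)) \<partial>lborel)"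
    unfolding gam_eq_Th using norm_Th_le[OF t, of "\<lambda>_. 1" x] by simp
  also have "\<dots> \<le> ennreal A * ennreal (Wc CARD('n) \<alpha>)"
    using t alpha by (intro mult_left_mono nn_integral_wt) auto
  also have "\<dots> = ennreal (A * Wc CARD('n) \<alpha>)"
    using A by (simp add: ennreal_mult')
  finally show ?thesis
    using A Wc_pos[OF alpha(1), of "CARD('n)"] by (simp add: ennreal_le_iff)
qed

lemma gam_diff:
  assumes t: "t > 0" and "norm (x - x') \<le> 2 * real CARD('n) * t"
  shows "norm (gam t x - gam t x') \<le> A * Wc CARD('n) \<alpha> * (norm (x - x') / t) powr \<alpha>"
proof -
  let ?c = "A * (norm (x - x') / t) powr \<alpha>"
  have "gam t x - gam t x' = (LINT y|lborel. \<psi> t x y - \<psi> t x' y)"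
    unfolding gam_def using psi_integrable[OF t] by simp
  then have "ennreal (norm (gam t x - gam t x')) \<le> (\<integral>\<^sup>+y. ennreal (norm (\<psi> t x y - \<psi> t x' y)) \<partial>lborel)"
    by (simp add: norm_integral_le_nn)
  also have "\<dots> \<le> (\<integral>\<^sup>+y. ennreal ?c * ennreal (wt \<alpha> t (x - y)) \<partial>lborel)"
    using smooth_x[OF assms] A by (intro nn_integral_mono) (auto simp: ennreal_mult'[symmetric] intro!: ennreal_leI)
  also have "\<dots> = ennreal ?c * (\<integral>\<^sup>+y. ennreal (wt \<alpha> t (x - y)) \<partial>lborel)"
    by (rule nn_integral_cmult) measurable
  also have "\<dots> \<le> ennreal ?c * ennreal (Wc CARD('n) \<alpha>)"
    using t alpha by (intro mult_left_mono nn_integral_wt) auto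
  also have "\<dots> = ennreal (A * Wc CARD('n) \<alpha> * (norm (x - x') / t) powr \<alpha>)"
    using A by (subst ennreal_mult'[symmetric]) (auto simp: mult_ac)
  finally show ?thesis
    using A Wc_pos[OF alpha(1), of "CARD('n)"] by (simp add: ennreal_le_iff)
qed

text \<open>Self-adjointness puts the averaging on the kernel, so the difference is the integral of
  \<open>f\<close> against \<psi> minus its average in y; regularity over cubes of diameter at most
  2 n t bounds the latter.\<close>

lemma Th_avg_diff:
  fixes f :: "real ^ 'n \<Rightarrow> complex"
  assumes t: "t > 0" and i: "2 powi i \<le> 2 * t" and [measurable]: "f \<in> borel_measurable borel"
    and fin1: "(\<integral>\<^sup>+y. ennreal (wt \<alpha> t (x - y)) * ennreal (norm (f y)) \<partial>lborel) < \<infinity>"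
    and fin2: "(\<integral>\<^sup>+y. ennreal (wt \<alpha> t (x - y)) * avn i (\<lambda>y. ennreal (norm (f y))) y \<partial>lborel) < \<infinity>"
  shows "ennreal (norm (Th f t x - Th (avg i f) t x))
    \<le> ennreal (A * (real CARD('n) * 2 powi i / t) powr \<alpha>) * (\<integral>\<^sup>+y. ennreal (wt \<alpha> t (x - y)) * ennreal (norm (f y)) \<partial>lborel)"
proof -
  let ?u = "\<psi> t x" let ?n = "real CARD('n)"
  let ?c = "A * (?n * 2 powi i / t) powr \<alpha>"
  have loc: "locint ?u"
  proof (rule locint_bounded)
    show "norm (?u y) \<le> A * (1 / t ^ CARD('n))" for y
      using size[OF t, of x y] mult_left_mono[OF wt_le_inverse[OF t alpha(1), of "x - y"] A] by linarith
  qed measurable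
  have "(\<integral>\<^sup>+y. ennreal (norm (?u y)) * avn i (\<lambda>y. ennreal (norm (f y))) y \<partial>lborel) \<le>
      (\<integral>\<^sup>+y. ennreal A * (ennreal (wt \<alpha> t (x - y)) * avn i (\<lambda>y. ennreal (norm (f y))) y) \<partial>lborel)"
    unfolding mult.assoc[symmetric] ennreal_mult'[OF A, symmetric]
    by (intro nn_integral_mono mult_right_mono ennreal_leI size t) simp
  also have "\<dots> = ennreal A * (\<integral>\<^sup>+y. ennreal (wt \<alpha> t (x - y)) * avn i (\<lambda>y. ennreal (norm (f y))) y \<partial>lborel)"
    by (rule nn_integral_cmult) measurable
  also have "\<dots> < \<infinity>" using fin2 by (simp add: ennreal_mult_less_top)
  finally have fin: "(\<integral>\<^sup>+y. ennreal (norm (?u y)) * avn i (\<lambda>y. ennreal (norm (f y))) y \<partial>lborel) < \<infinity>" .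
  note sa = avg_selfadjoint[OF _ _ fin, simplified]
  have "Th f t x - Th (avg i f) t x = (LINT y|lborel. ?u y * f y) - (LINT y|lborel. avg i ?u y * f y)"
    unfolding Th_def using sa(3) by simp
  also have "\<dots> = (LINT y|lborel. (?u y - avg i ?u y) * f y)"
    using Th_integrable[OF t _ fin1] sa(2) by (simp add: left_diff_distrib)
  finally have "ennreal (norm (Th f t x - Th (avg i f) t x)) \<le> (\<integral>\<^sup>+y. ennreal (norm ((?u y - avg i ?u y) * f y)) \<partial>lborel)"
    by (simp add: norm_integral_le_nn)
  also have "\<dots> \<le> (\<integral>\<^sup>+y. ennreal ?c * (ennreal (wt \<alpha> t (x - y)) * ennreal (norm (f y))) \<partial>lborel)"
  proof (rule nn_integral_mono)
    fix y
    have "norm (?u y - avg i ?u y) \<le> ?c * wt \<alpha> t (x - y)"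
    proof (rule avg_diff_bound[OF loc])
      fix z assume "cube_index i z = cube_index i y"
      then have d: "norm (y - z) \<le> ?n * 2 powi i" by (intro norm_diff_cube_index) simp
      also have "\<dots> \<le> 2 * ?n * t" using i by simp
      finally have "norm (?u y - ?u z) \<le> A * (norm (y - z) / t) powr \<alpha> * wt \<alpha> t (x - y)"
        by (rule smooth_y[OF t])
      also have "\<dots> \<le> ?c * wt \<alpha> t (x - y)"
        using A alpha t d by (intro mult_right_mono mult_left_mono powr_mono2 divide_right_mono) auto
      finally show "norm (?u y - ?u z) \<le> ?c * wt \<alpha> t (x - y)" .
    qed
    then have "norm ((?u y - avg i ?u y) * f y) \<le> ?c * (wt \<alpha> t (x - y) * norm (f y))"
      by (simp add: norm_mult mult_right_mono mult.assoc[symmetric])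
    then show "ennreal (norm ((?u y - avg i ?u y) * f y)) \<le> ennreal ?c * (ennreal (wt \<alpha> t (x - y)) * ennreal (norm (f y)))"
      using A by (simp add: ennreal_mult'[symmetric] ennreal_leI)
  qed
  also have "\<dots> = ennreal ?c * (\<integral>\<^sup>+y. ennreal (wt \<alpha> t (x - y)) * ennreal (norm (f y)) \<partial>lborel)"
    by (rule nn_integral_cmult) measurable
  finally show ?thesis .
qed

text \<open>As \<open>F\<close> is constant on cubes of level \<open>j\<close>, only y outside the
  cube of x contribute to the integral of \<psi> against F y - F x. Their mass is small on average
  over a cube, and by the constancy of \<open>F\<close> it may be replaced by that average.\<close>

lemma level_coarse:
  fixes F :: "real ^ 'n \<Rightarrow> complex"
  assumes t: "t > 0" and F: "L2 F" and lev: "\<And>x y. cube_index j x = cube_index j y \<Longrightarrow> F x = F y"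
  shows "(\<integral>\<^sup>+x. (ennreal (norm (Th F t x - gam t x * F x)))\<^sup>2 \<partial>lborel)
    \<le> ennreal (4 * A\<^sup>2 * Wc CARD('n) \<alpha> * real CARD('n) * Wc CARD('n) (\<alpha> / 2) * (t / 2 powi j) powr (\<alpha> / 2)) * sqn F"
proof -
  let ?n = "CARD('n)" let ?w = "\<lambda>x y. ennreal (wt \<alpha> t (x - y :: real ^ 'n))"
  let ?N = "\<lambda>x. (ennreal (norm (F x)))\<^sup>2"
  let ?X = "\<lambda>x y. indicator (- cube_of j x) y :: ennreal"
  note [measurable] = L2_measurable[OF F]
  have W: "Wc ?n \<alpha> > 0" "Wc ?n (\<alpha> / 2) > 0" using alpha by (auto intro: Wc_pos)
  have fin: "(\<integral>\<^sup>+y. ?w x y * ennreal (norm (F y)) \<partial>lborel) < \<infinity>" for x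
    using F alpha t by (intro wt_L2_finite) (auto simp: L2_def sqn_def)
  have 1: "(ennreal (norm (Th F t x - gam t x * F x)))\<^sup>2
      \<le> ennreal (A\<^sup>2 * Wc ?n \<alpha>) * (\<integral>\<^sup>+y. ?w x y * (2 * ?N x * ?X x y + 2 * ?N y * ?X x y) \<partial>lborel)" for x
  proof -
    have "Th F t x - gam t x * F x = (LINT y|lborel. \<psi> t x y * F y) - (LINT y|lborel. \<psi> t x y * F x)"
      unfolding Th_def gam_def by simp
    also have "\<dots> = (LINT y|lborel. \<psi> t x y * (F y - F x))"
      using Th_integrable[OF t _ fin] psi_integrable[OF t, of x] by (simp add: right_diff_distrib)
    also have "\<dots> = Th (\<lambda>y. F y - F x) t x" by (simp add: Th_def)
    finally have "ennreal (norm (Th F t x - gam t x * F x)) \<le> ennreal A * (\<integral>\<^sup>+y. ?w x y * ennreal (norm (F y - F x)) \<partial>lborel)"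
      using norm_Th_le[OF t, of "\<lambda>y. F y - F x" x] by simp
    then have "(ennreal (norm (Th F t x - gam t x * F x)))\<^sup>2 \<le> (ennreal A * (\<integral>\<^sup>+y. ?w x y * ennreal (norm (F y - F x)) \<partial>lborel))\<^sup>2"
      by (rule power_mono) simp
    also have "\<dots> = ennreal (A\<^sup>2) * (\<integral>\<^sup>+y. ?w x y * ennreal (norm (F y - F x)) \<partial>lborel)\<^sup>2"
      using A by (simp add: power_mult_distrib ennreal_power)
    also have "\<dots> \<le> ennreal (A\<^sup>2) * (ennreal (Wc ?n \<alpha>) * (\<integral>\<^sup>+y. ?w x y * (ennreal (norm (F y - F x)))\<^sup>2 \<partial>lborel))"
      using t alpha by (intro mult_left_mono wt_CS) auto
    also have "\<dots> = ennreal (A\<^sup>2 * Wc ?n \<alpha>) * (\<integral>\<^sup>+y. ?w x y * (ennreal (norm (F y - F x)))\<^sup>2 \<partial>lborel)"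
      by (simp add: ennreal_mult' mult.assoc)
    also have "\<dots> \<le> ennreal (A\<^sup>2 * Wc ?n \<alpha>) * (\<integral>\<^sup>+y. ?w x y * (2 * ?N x * ?X x y + 2 * ?N y * ?X x y) \<partial>lborel)"
    proof (intro mult_left_mono nn_integral_mono)
      fix y
      show "(ennreal (norm (F y - F x)))\<^sup>2 \<le> 2 * ?N x * ?X x y + 2 * ?N y * ?X x y"
      proof (cases "y \<in> cube_of j x")
        case True
        then have "F y = F x" by (intro lev) (simp add: cube_of_def)
        then show ?thesis by simp
      next
        case False
        then show ?thesis using norm_diff_sq_le[of "F y" "F x"] by (simp add: add.commute)
      qed
    qed auto
    finally show ?thesis .
  qed
  \<comment> \<open>The mass that the weight sends out of the cube of x. The weight and the relation
    of lying in different cubes are symmetric, so the terms with F x and with F y have the same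
    integral.\<close>
  define V where "V x = (\<integral>\<^sup>+y. ?w x y * ?X x y \<partial>lborel)" for x
  have [measurable]: "V \<in> borel_measurable borel" unfolding V_def by measurable
  have a: "(\<integral>\<^sup>+x. \<integral>\<^sup>+y. ?w x y * (?N x * ?X x y) \<partial>lborel \<partial>lborel) = (\<integral>\<^sup>+x. ?N x * V x \<partial>lborel)"
    unfolding V_def
    by (intro nn_integral_cong, subst nn_integral_cmult[symmetric]) (auto simp: mult_ac)
  have "(\<integral>\<^sup>+x. \<integral>\<^sup>+y. ?w x y * (?N y * ?X x y) \<partial>lborel \<partial>lborel) = (\<integral>\<^sup>+y. \<integral>\<^sup>+x. ?w x y * (?N y * ?X x y) \<partial>lborel \<partial>lborel)"
    by (rule lborel_pair.Fubini') measurable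
  also have "\<dots> = (\<integral>\<^sup>+y. \<integral>\<^sup>+x. ?w y x * (?N y * ?X y x) \<partial>lborel \<partial>lborel)"
    by (intro nn_integral_cong) (auto simp: wt_sym indicator_def cube_of_def)
  finally have b: "(\<integral>\<^sup>+x. \<integral>\<^sup>+y. ?w x y * (?N y * ?X x y) \<partial>lborel \<partial>lborel) = (\<integral>\<^sup>+x. ?N x * V x \<partial>lborel)"
    using a by simp
  have "(\<integral>\<^sup>+x. \<integral>\<^sup>+y. ?w x y * (2 * ?N x * ?X x y + 2 * ?N y * ?X x y) \<partial>lborel \<partial>lborel) =
      (\<integral>\<^sup>+x. \<integral>\<^sup>+y. 2 * (?w x y * (?N x * ?X x y)) + 2 * (?w x y * (?N y * ?X x y)) \<partial>lborel \<partial>lborel)"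
    by (simp add: distrib_left mult_ac)
  also have "\<dots> = (\<integral>\<^sup>+x. 2 * (\<integral>\<^sup>+y. ?w x y * (?N x * ?X x y) \<partial>lborel) + 2 * (\<integral>\<^sup>+y. ?w x y * (?N y * ?X x y) \<partial>lborel) \<partial>lborel)"
    by (intro nn_integral_cong, subst nn_integral_add) (auto simp: nn_integral_cmult)
  also have "\<dots> = 2 * (\<integral>\<^sup>+x. ?N x * V x \<partial>lborel) + 2 * (\<integral>\<^sup>+x. ?N x * V x \<partial>lborel)"
    by (subst nn_integral_add) (auto simp: nn_integral_cmult a b)
  also have "\<dots> = 4 * (\<integral>\<^sup>+x. ?N x * V x \<partial>lborel)"
    by (simp add: distrib_right[symmetric])
  also have "(\<integral>\<^sup>+x. ?N x * V x \<partial>lborel) = (\<integral>\<^sup>+x. ?N x * avn j V x \<partial>lborel)"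
    by (rule nn_integral_avn_weight[symmetric]) (auto dest: lev)
  also have "\<dots> \<le> (\<integral>\<^sup>+x. ?N x * ennreal (real ?n * Wc ?n (\<alpha> / 2) * (t / 2 powi j) powr (\<alpha> / 2)) \<partial>lborel)"
    unfolding V_def using t alpha by (intro nn_integral_mono mult_left_mono avn_wt_outside) auto
  also have "\<dots> = ennreal (real ?n * Wc ?n (\<alpha> / 2) * (t / 2 powi j) powr (\<alpha> / 2)) * sqn F"
    unfolding sqn_def by (subst nn_integral_multc) (auto simp: mult.commute)
  finally have 2: "(\<integral>\<^sup>+x. \<integral>\<^sup>+y. ?w x y * (2 * ?N x * ?X x y + 2 * ?N y * ?X x y) \<partial>lborel \<partial>lborel)
      \<le> 4 * (ennreal (real ?n * Wc ?n (\<alpha> / 2) * (t / 2 powi j) powr (\<alpha> / 2)) * sqn F)"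
    by (simp add: mult_left_mono)
  have "(\<integral>\<^sup>+x. (ennreal (norm (Th F t x - gam t x * F x)))\<^sup>2 \<partial>lborel)
      \<le> (\<integral>\<^sup>+x. ennreal (A\<^sup>2 * Wc ?n \<alpha>) * (\<integral>\<^sup>+y. ?w x y * (2 * ?N x * ?X x y + 2 * ?N y * ?X x y) \<partial>lborel) \<partial>lborel)"
    by (rule nn_integral_mono) (rule 1)
  also have "\<dots> = ennreal (A\<^sup>2 * Wc ?n \<alpha>) * (\<integral>\<^sup>+x. \<integral>\<^sup>+y. ?w x y * (2 * ?N x * ?X x y + 2 * ?N y * ?X x y) \<partial>lborel \<partial>lborel)"
    by (rule nn_integral_cmult) measurable
  also have "\<dots> \<le> ennreal (A\<^sup>2 * Wc ?n \<alpha>) * (4 * (ennreal (real ?n * Wc ?n (\<alpha> / 2) * (t / 2 powi j) powr (\<alpha> / 2)) * sqn F))"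
    by (rule mult_left_mono[OF 2]) simp
  also have "\<dots> = ennreal (A\<^sup>2 * Wc ?n \<alpha>) * (ennreal 4 * (ennreal (real ?n * Wc ?n (\<alpha> / 2) * (t / 2 powi j) powr (\<alpha> / 2)) * sqn F))"
    by simp
  also have "\<dots> = ennreal (4 * A\<^sup>2 * Wc ?n \<alpha> * real ?n * Wc ?n (\<alpha> / 2) * (t / 2 powi j) powr (\<alpha> / 2)) * sqn F"
    using W by (simp only: mult.assoc[symmetric], subst ennreal_mult[symmetric], simp, simp, subst ennreal_mult[symmetric], simp, simp, simp add: mult_ac)
  finally show ?thesis .
qed

end

section \<open>The L^2 estimate for the remainder\<close>

lemma suminf_sq_bound:
  fixes u :: "nat \<Rightarrow> 'a \<Rightarrow> ennreal" and g :: "nat \<Rightarrow> ennreal"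
  assumes r: "0 < r" "r < 1" and c: "c \<ge> 0" and [measurable]: "\<And>i. u i \<in> borel_measurable M"
    and u: "\<And>i. (\<integral>\<^sup>+x. (u i x)\<^sup>2 \<partial>M) \<le> ennreal (c * r ^ (2 * i)) * g i"
  shows "(\<integral>\<^sup>+x. (\<Sum>i. u i x)\<^sup>2 \<partial>M) \<le> ennreal (c / (1 - r)) * (\<Sum>i. ennreal (r ^ i) * g i)"
proof -
  \<comment> \<open>Cauchy--Schwarz with the weights r^i: half of the decay r^(2 i) makes the series
    of weights converge, the other half remains for summing \<open>g\<close>.\<close>
  have pt: "(\<Sum>i. u i x)\<^sup>2 \<le> ennreal (1 / (1 - r)) * (\<Sum>i. ennreal (1 / r ^ i) * (u i x)\<^sup>2)" for x
  proof -
    have "u i x = ennreal (sqrt (r ^ i)) * (ennreal (1 / sqrt (r ^ i)) * u i x)" for i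
      using r by (simp add: mult.assoc[symmetric] ennreal_mult[symmetric])
    then have "(\<Sum>i. u i x)\<^sup>2 = (\<integral>\<^sup>+i. ennreal (sqrt (r ^ i)) * (ennreal (1 / sqrt (r ^ i)) * u i x) \<partial>count_space UNIV)\<^sup>2"
      by (simp add: nn_integral_count_space_nat)
    also have "\<dots> \<le> (\<integral>\<^sup>+i. (ennreal (sqrt (r ^ i)))\<^sup>2 \<partial>count_space UNIV) *
        (\<integral>\<^sup>+i. (ennreal (1 / sqrt (r ^ i)) * u i x)\<^sup>2 \<partial>count_space UNIV)"
      by (rule Cauchy_Schwarz_nn_integral) auto
    also have "(\<integral>\<^sup>+i. (ennreal (sqrt (r ^ i)))\<^sup>2 \<partial>count_space UNIV) = (\<Sum>i. ennreal (r ^ i))"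
      using r by (simp add: nn_integral_count_space_nat ennreal_power)
    also have "\<dots> = ennreal (1 / (1 - r))"
      using r geometric_sums[of r] by (intro suminf_ennreal_eq) auto
    also have "(\<integral>\<^sup>+i. (ennreal (1 / sqrt (r ^ i)) * u i x)\<^sup>2 \<partial>count_space UNIV) = (\<Sum>i. ennreal (1 / r ^ i) * (u i x)\<^sup>2)"
      using r by (simp add: nn_integral_count_space_nat power_mult_distrib ennreal_power power_divide)
    finally show ?thesis .
  qed
  have "(\<integral>\<^sup>+x. (\<Sum>i. u i x)\<^sup>2 \<partial>M) \<le> (\<integral>\<^sup>+x. ennreal (1 / (1 - r)) * (\<Sum>i. ennreal (1 / r ^ i) * (u i x)\<^sup>2) \<partial>M)"
    by (rule nn_integral_mono) (rule pt)
  also have "\<dots> = ennreal (1 / (1 - r)) * (\<integral>\<^sup>+x. (\<Sum>i. ennreal (1 / r ^ i) * (u i x)\<^sup>2) \<partial>M)"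
    by (rule nn_integral_cmult) measurable
  also have "(\<integral>\<^sup>+x. (\<Sum>i. ennreal (1 / r ^ i) * (u i x)\<^sup>2) \<partial>M) = (\<Sum>i. \<integral>\<^sup>+x. ennreal (1 / r ^ i) * (u i x)\<^sup>2 \<partial>M)"
    by (rule nn_integral_suminf) measurable
  also have "\<dots> = (\<Sum>i. ennreal (1 / r ^ i) * (\<integral>\<^sup>+x. (u i x)\<^sup>2 \<partial>M))"
    by (simp add: nn_integral_cmult)
  also have "\<dots> \<le> (\<Sum>i. ennreal c * (ennreal (r ^ i) * g i))"
  proof (rule suminf_le)
    fix i
    have "ennreal (1 / r ^ i) * (\<integral>\<^sup>+x. (u i x)\<^sup>2 \<partial>M) \<le> ennreal (1 / r ^ i) * (ennreal (c * r ^ (2 * i)) * g i)"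
      by (rule mult_left_mono[OF u]) simp
    also have "\<dots> = ennreal c * (ennreal (r ^ i) * g i)"
    proof -
      have "1 / r ^ i * (c * r ^ (2 * i)) = c * r ^ i"
        using r by (simp add: mult_2 power_add)
      then show ?thesis
        using r c by (simp add: mult.assoc[symmetric] ennreal_mult[symmetric])
    qed
    finally show "ennreal (1 / r ^ i) * (\<integral>\<^sup>+x. (u i x)\<^sup>2 \<partial>M) \<le> ennreal c * (ennreal (r ^ i) * g i)" .
  qed auto
  also have "\<dots> = ennreal c * (\<Sum>i. ennreal (r ^ i) * g i)"
    by (rule ennreal_suminf_cmult)
  finally have "(\<integral>\<^sup>+x. (\<Sum>i. u i x)\<^sup>2 \<partial>M) \<le> ennreal (1 / (1 - r)) * (ennreal c * (\<Sum>i. ennreal (r ^ i) * g i))"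
    by (simp add: mult_left_mono)
  also have "\<dots> = ennreal (c / (1 - r)) * (\<Sum>i. ennreal (r ^ i) * g i)"
    using r c by (simp add: mult.assoc[symmetric] ennreal_mult[symmetric])
  finally show ?thesis .
qed

lemma ennreal_le_geometric_limit:
  assumes "0 \<le> q" "q < 1" and "\<And>M::nat. a \<le> ennreal (c * q ^ M) + S"
  shows "a \<le> (S :: ennreal)"
proof -
  have "(\<lambda>M. c * q ^ M) \<longlonglongrightarrow> c * 0"
    using assms by (intro tendsto_mult LIMSEQ_power_zero tendsto_const) auto
  then have "(\<lambda>M. ennreal (c * q ^ M)) \<longlonglongrightarrow> ennreal 0" by (intro tendsto_ennrealI) simp
  then have "(\<lambda>M. ennreal (c * q ^ M) + S) \<longlonglongrightarrow> 0 + S"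
    by (intro tendsto_add tendsto_const) simp
  then show ?thesis
    using assms(3) by (intro LIMSEQ_le_const[of _ S a]) auto
qed

lemma ennreal_norm_add_sum_le:
  fixes X a :: "'a::real_normed_vector"
  assumes "X = a + (\<Sum>i<M. d i)"
  shows "ennreal (norm X) \<le> ennreal (norm a) + (\<Sum>i. ennreal (norm (d i)))"
proof -
  have "norm X \<le> norm a + (\<Sum>i<M. norm (d i))"
    unfolding assms by (rule order_trans[OF norm_triangle_ineq]) (intro add_left_mono norm_sum)
  then have "ennreal (norm X) \<le> ennreal (norm a + (\<Sum>i<M. norm (d i)))"
    by (rule ennreal_leI)
  also have "\<dots> = ennreal (norm a) + (\<Sum>i<M. ennreal (norm (d i)))"
    by (simp add: sum_nonneg)
  also have "\<dots> \<le> ennreal (norm a) + (\<Sum>i. ennreal (norm (d i)))"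
    by (intro add_left_mono sum_le_suminf) auto
  finally show ?thesis .
qed

lemma norm_avg_sq_le:
  fixes f :: "real ^ 'n \<Rightarrow> 'b::{banach,second_countable_topology}"
  assumes [measurable]: "f \<in> borel_measurable borel"
  shows "(ennreal (norm (avg j f x)))\<^sup>2 \<le> ennreal (1 / cvol CARD('n) j) * sqn f"
proof -
  have "(ennreal (norm (avg j f x)))\<^sup>2 \<le> (avn j (\<lambda>y. ennreal (norm (f y))) x)\<^sup>2"
    by (intro power_mono norm_avg_le) simp
  also have "\<dots> \<le> avn j (\<lambda>y. (ennreal (norm (f y)))\<^sup>2) x"
    by (rule avn_CS) measurable
  also have "\<dots> \<le> ennreal (1 / cvol CARD('n) j) * sqn f"
    unfolding avn_def sqn_def
    by (rule mult_left_mono, rule nn_integral_mono) (auto simp: indicator_def)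
  finally show ?thesis .
qed

text \<open>Twice the sum of the constants for fine and coarse martingale differences. With r =
  2^(-\<alpha>/4), one factor 1 / (1 - r) comes from Cauchy--Schwarz and the other from summing over
  the distance of levels.\<close>

definition cR :: "nat \<Rightarrow> real \<Rightarrow> real \<Rightarrow> real"
  where "cR n \<alpha> A = 2 * ((A * (2 * real n) powr \<alpha> * Wc n \<alpha>)\<^sup>2 + 4 * A\<^sup>2 * Wc n \<alpha> * real n * Wc n (\<alpha> / 2))
    / (1 - 2 powr (- (\<alpha> / 4)))\<^sup>2"

context kern
begin

definition R :: "(real ^ 'n \<Rightarrow> complex) \<Rightarrow> real \<Rightarrow> real ^ 'n \<Rightarrow> complex"
  where "R f t x = Th f t x - gam t x * avg (lev t) f x"

lemma measurable_R [measurable (raw)]: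
  assumes [measurable]: "f \<in> borel_measurable borel" "g \<in> borel_measurable M" "h \<in> borel_measurable M"
  shows "(\<lambda>z. R f (g z) (h z)) \<in> borel_measurable M"
proof -
  have [measurable]: "(\<lambda>z. avg (lev (g z)) f (h z)) \<in> borel_measurable M"
    by (rule measurable_compose_countable[where f="\<lambda>k z. avg k f (h z)"]) measurable
  show ?thesis unfolding R_def by measurable
qed

lemma Th_L2_fin:
  assumes "t > 0" "L2 f"
  shows "(\<integral>\<^sup>+y. ennreal (wt \<alpha> t (x - y)) * ennreal (norm (f y)) \<partial>lborel) < \<infinity>"
  using assms alpha by (intro wt_L2_finite) (auto simp: L2_def sqn_def)

lemma Th_L2_fin_avn:
  assumes "t > 0" and f: "L2 f"
  shows "(\<integral>\<^sup>+y. ennreal (wt \<alpha> t (x - y)) * avn i (\<lambda>y. ennreal (norm (f y))) y \<partial>lborel) < \<infinity>"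
proof (rule wt_L2_finite)
  note [measurable] = L2_measurable[OF f]
  have "(\<integral>\<^sup>+y. (avn i (\<lambda>y. ennreal (norm (f y))) y)\<^sup>2 \<partial>lborel) \<le> (\<integral>\<^sup>+y. avn i (\<lambda>y. (ennreal (norm (f y)))\<^sup>2) y \<partial>lborel)"
    by (intro nn_integral_mono avn_CS) measurable
  also have "\<dots> = sqn f" unfolding sqn_def by (rule nn_integral_avn) measurable
  finally show "(\<integral>\<^sup>+y. (avn i (\<lambda>y. ennreal (norm (f y))) y)\<^sup>2 \<partial>lborel) < \<infinity>"
    using f by (auto simp: L2_def intro: le_less_trans)
qed (use assms alpha in auto)

lemma Th_L2_integrable: "t > 0 \<Longrightarrow> L2 f \<Longrightarrow> integrable lborel (\<lambda>y. \<psi> t x y * f y)"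
  by (rule Th_integrable[OF _ L2_measurable Th_L2_fin])

lemma Th_diff:
  assumes "t > 0" "L2 f" "L2 g"
  shows "Th (\<lambda>y. f y - g y) t x = Th f t x - Th g t x"
  using Th_L2_integrable[OF assms(1,2), of x] Th_L2_integrable[OF assms(1,3), of x]
  unfolding Th_def by (simp add: right_diff_distrib)

lemma L2_mdiff: "L2 f \<Longrightarrow> L2 (mdiff j f)"
  unfolding mdiff_def[abs_def] by (intro L2_diff L2_avg)

lemma Th_mdiff: "t > 0 \<Longrightarrow> L2 f \<Longrightarrow> Th (mdiff j f) t x = Th (avg j f) t x - Th (avg (j + 1) f) t x"
  unfolding mdiff_def[abs_def] by (intro Th_diff L2_avg)

text \<open>Telescoping from level \<open>k\<close> down to k - M leaves \<open>Th f\<close> minus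
  \<open>Th\<close> of the average at level k - M; this error decays geometrically in M by the
  regularity of the kernel.\<close>

lemma fine_sum:
  assumes t: "t > 0" and f: "L2 f" and k: "2 powi k \<le> 2 * t"
  shows "ennreal (norm (Th f t x - Th (avg k f) t x)) \<le> (\<Sum>i. ennreal (norm (Th (mdiff (k - 1 - int i) f) t x)))"
proof -
  let ?d = "\<lambda>i. Th (mdiff (k - 1 - int i) f) t x"
  let ?q = "2 powr (- \<alpha>) :: real"
  note [measurable] = L2_measurable[OF f]
  define I where "I = (\<integral>\<^sup>+y. ennreal (wt \<alpha> t (x - y)) * ennreal (norm (f y)) \<partial>lborel)"
  have "I < \<infinity>" unfolding I_def by (rule Th_L2_fin[OF t f])
  then obtain I' where I': "I = ennreal I'" "I' \<ge> 0" by (cases I) auto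
  define c where "c = A * (real CARD('n) * 2 powi k / t) powr \<alpha> * I'"
  have tel: "Th (avg (k - int M) f) t x - Th (avg k f) t x = (\<Sum>i<M. ?d i)" for M
  proof (induction M)
    case (Suc M)
    have "?d M = Th (avg (k - int (Suc M)) f) t x - Th (avg (k - int M) f) t x"
      using Th_mdiff[OF t f, of "k - 1 - int M" x] by (simp add: algebra_simps)
    then have "(\<Sum>i<Suc M. ?d i) = (\<Sum>i<M. ?d i) + (Th (avg (k - int (Suc M)) f) t x - Th (avg (k - int M) f) t x)"
      by (simp only: sum.lessThan_Suc)
    then show ?case unfolding Suc[symmetric] by simp
  qed simp
  have "ennreal (norm (Th f t x - Th (avg k f) t x)) \<le> ennreal (c * ?q ^ M) + (\<Sum>i. ennreal (norm (?d i)))" for M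
  proof -
    have e: "2 powi (k - int M) = 2 powi k * (1 / 2 ^ M :: real)"
      by (simp add: power_int_diff)
    have "2 powi (k - int M) \<le> 2 powi k * (1 :: real)"
      unfolding e by (intro mult_left_mono) auto
    then have le: "2 powi (k - int M) \<le> 2 * t" using k by simp
    have "ennreal (norm (Th f t x - Th (avg (k - int M) f) t x)) \<le> ennreal (A * (real CARD('n) * 2 powi (k - int M) / t) powr \<alpha>) * I"
      unfolding I_def by (rule Th_avg_diff[OF t le _ Th_L2_fin[OF t f] Th_L2_fin_avn[OF t f]]) measurable
    also have "\<dots> = ennreal (c * ?q ^ M)"
    proof -
      have "(real CARD('n) * 2 powi (k - int M) / t) powr \<alpha> = ((real CARD('n) * 2 powi k / t) * 2 powr (- real M)) powr \<alpha>"
        unfolding e by (simp add: powr_minus powr_realpow divide_inverse mult_ac)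
      also have "\<dots> = (real CARD('n) * 2 powi k / t) powr \<alpha> * ?q ^ M"
      proof -
        have "2 powr (- real M * \<alpha>) = ?q ^ M" by (simp add: powr_realpow[symmetric] powr_powr mult.commute)
        then show ?thesis by (simp only: powr_mult powr_powr)
      qed
      finally show ?thesis
        unfolding I'(1) c_def using A I'(2) by (subst ennreal_mult'[symmetric]) (auto simp: mult_ac)
    qed
    finally have 1: "ennreal (norm (Th f t x - Th (avg (k - int M) f) t x)) \<le> ennreal (c * ?q ^ M)" .
    have "P - Q = S \<Longrightarrow> F - Q = (F - P) + S" for P Q S F :: complex by auto
    from this[OF tel]
    have "ennreal (norm (Th f t x - Th (avg k f) t x))
        \<le> ennreal (norm (Th f t x - Th (avg (k - int M) f) t x)) + (\<Sum>i. ennreal (norm (?d i)))"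
      by (rule ennreal_norm_add_sum_le)
    also have "\<dots> \<le> ennreal (c * ?q ^ M) + (\<Sum>i. ennreal (norm (?d i)))"
      by (intro add_right_mono 1)
    finally show ?thesis .
  qed
  note * = this
  have q: "0 \<le> ?q" "?q < 1" using two_powr_less_one[OF alpha(1)] by simp_all
  show ?thesis by (rule ennreal_le_geometric_limit[OF q *])
qed

text \<open>Telescoping towards large cubes, where the averages tend to 0 uniformly: their square is
  at most the square norm over the volume. The ratio \<open>sqrt (1 / 2)\<close> reflects that the
  volume at least doubles with each level.\<close>

lemma coarse_sum:
  assumes t: "t > 0" and f: "L2 f"
  shows "ennreal (norm (Th (avg k f) t x - gam t x * avg k f x))
    \<le> (\<Sum>i. ennreal (norm (Th (mdiff (k + int i) f) t x - gam t x * mdiff (k + int i) f x)))"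
proof -
  let ?D = "\<lambda>g. Th g t x - gam t x * g x"
  let ?d = "\<lambda>i. ?D (mdiff (k + int i) f)"
  let ?q = "sqrt (1 / 2)" let ?W = "Wc CARD('n) \<alpha>"
  note [measurable] = L2_measurable[OF f]
  have W: "?W > 0" by (rule Wc_pos) (rule alpha)
  obtain s where s: "sqn f = ennreal s" "s \<ge> 0"
    using f unfolding L2_def by (cases "sqn f") auto
  define c where "c = 2 * (A * ?W) * sqrt (s / cvol CARD('n) k)"
  have tel: "?D (avg k f) - ?D (avg (k + int M) f) = (\<Sum>i<M. ?d i)" for M
  proof (induction M)
    case (Suc M)
    have "?d M = ?D (avg (k + int M) f) - ?D (avg (k + int (Suc M)) f)"
      using Th_mdiff[OF t f, of "k + int M" x] by (simp add: mdiff_def algebra_simps)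
    then have "(\<Sum>i<Suc M. ?d i) = (\<Sum>i<M. ?d i) + (?D (avg (k + int M) f) - ?D (avg (k + int (Suc M)) f))"
      by (simp only: sum.lessThan_Suc)
    then show ?case unfolding Suc[symmetric] by simp
  qed simp
  have "ennreal (norm (?D (avg k f))) \<le> ennreal (c * ?q ^ M) + (\<Sum>i. ennreal (norm (?d i)))" for M
  proof -
    let ?j = "k + int M"
    define b where "b = sqrt (s / cvol CARD('n) k) * ?q ^ M"
    have b0: "b \<ge> 0" unfolding b_def using s by simp
    have b: "norm (avg ?j f y) \<le> b" for y
    proof -
      have "cvol CARD('n) ?j \<ge> cvol CARD('n) k * 2 ^ M"
      proof -
        have "(2::real) ^ M \<le> (2 ^ M) ^ CARD('n)"
          by (rule self_le_power) auto
        then show ?thesis unfolding cvol_def by (simp add: power_int_add power_mult_distrib)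
      qed
      then have "1 / cvol CARD('n) ?j * s \<le> 1 / (cvol CARD('n) k * 2 ^ M) * s"
        using s by (intro mult_right_mono divide_left_mono) auto
      also have "\<dots> = b\<^sup>2"
      proof -
        have "(?q ^ M)\<^sup>2 = (?q\<^sup>2) ^ M" by (simp only: power_mult[symmetric] mult.commute)
        then show ?thesis unfolding b_def using s by (simp add: power_mult_distrib power_divide)
      qed
      finally have le: "1 / cvol CARD('n) ?j * s \<le> b\<^sup>2" .
      have "ennreal ((norm (avg ?j f y))\<^sup>2) \<le> ennreal (1 / cvol CARD('n) ?j * s)"
        using norm_avg_sq_le[of f ?j y] s by (simp add: ennreal_power ennreal_mult'[symmetric])
      also have "\<dots> \<le> ennreal (b\<^sup>2)" by (rule ennreal_leI[OF le])
      finally have "(norm (avg ?j f y))\<^sup>2 \<le> b\<^sup>2" by simp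
      then show ?thesis using b0 by (rule power2_le_imp_le)
    qed
    have "ennreal (norm (Th (avg ?j f) t x)) \<le> ennreal A * (\<integral>\<^sup>+y. ennreal (wt \<alpha> t (x - y)) * ennreal (norm (avg ?j f y)) \<partial>lborel)"
      by (rule norm_Th_le[OF t]) measurable
    also have "\<dots> \<le> ennreal A * (\<integral>\<^sup>+y. ennreal (wt \<alpha> t (x - y)) * ennreal b \<partial>lborel)"
      by (intro mult_left_mono nn_integral_mono ennreal_leI b) auto
    also have "\<dots> = ennreal A * ((\<integral>\<^sup>+y. ennreal (wt \<alpha> t (x - y)) \<partial>lborel) * ennreal b)"
      by (subst nn_integral_multc) auto
    also have "\<dots> \<le> ennreal A * (ennreal ?W * ennreal b)"
      by (intro mult_left_mono mult_right_mono nn_integral_wt t alpha) auto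
    also have "\<dots> = ennreal (A * ?W * b)"
      using A W b0 by (simp add: ennreal_mult[symmetric] mult_ac)
    finally have "norm (Th (avg ?j f) t x) \<le> A * ?W * b"
      using A W b0 by (simp add: ennreal_le_iff)
    moreover have "norm (gam t x * avg ?j f x) \<le> A * ?W * b"
      unfolding norm_mult using A W by (intro mult_mono norm_gam_le[OF t] b) auto
    ultimately have D: "norm (?D (avg ?j f)) \<le> c * ?q ^ M"
      using norm_triangle_ineq4[of "Th (avg ?j f) t x" "gam t x * avg ?j f x"]
      unfolding c_def b_def by (simp add: mult_ac)
    have "a - b = c \<Longrightarrow> a = b + c" for a b c :: complex by auto
    from this[OF tel]
    have "ennreal (norm (?D (avg k f))) \<le> ennreal (norm (?D (avg ?j f))) + (\<Sum>i. ennreal (norm (?d i)))"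
      by (rule ennreal_norm_add_sum_le)
    also have "\<dots> \<le> ennreal (c * ?q ^ M) + (\<Sum>i. ennreal (norm (?d i)))"
      by (intro add_right_mono ennreal_leI D)
    finally show ?thesis .
  qed
  note * = this
  have q: "0 \<le> ?q" "?q < 1" by simp_all
  show ?thesis by (rule ennreal_le_geometric_limit[OF q *])
qed

text \<open>The martingale difference has mean zero on the cubes of the next level, so
  \<open>Th_avg_diff\<close> gains (2^(j+1) / t)^\<alpha>. Most of the gain is given up in order to
  have the same ratio as in the coarse case.\<close>

lemma fine_L2:
  assumes t: "t > 0" and f: "L2 f" and k: "2 powi k \<le> 2 * t"
  shows "(\<integral>\<^sup>+x. (ennreal (norm (Th (mdiff (k - 1 - int i) f) t x)))\<^sup>2 \<partial>lborel)
    \<le> ennreal ((A * (2 * real CARD('n)) powr \<alpha> * Wc CARD('n) \<alpha>)\<^sup>2 * (2 powr (- (\<alpha> / 4))) ^ (2 * i)) * sqn (mdiff (k - 1 - int i) f)"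
proof -
  let ?j = "k - 1 - int i" let ?F = "mdiff (k - 1 - int i) f" let ?n = "real CARD('n)"
  let ?c = "A * (?n * 2 powi (?j + 1) / t) powr \<alpha>"
  have F: "L2 ?F" by (rule L2_mdiff[OF f])
  note [measurable] = L2_measurable[OF F]
  have e: "2 powi (?j + 1) = 2 powi k / (2 ^ i :: real)"
    by (simp add: power_int_diff)
  have "2 powi k / (2 ^ i :: real) \<le> 2 powi k / 1" by (intro divide_left_mono) auto
  then have le: "2 powi (?j + 1) \<le> 2 * t" using k e by simp
  have "avg (?j + 1) ?F y = 0" for y
    unfolding mdiff_def[abs_def]
    using avg_tower[OF L2_locint[OF f], of ?j "?j + 1" y] avg_tower[OF L2_locint[OF f], of "?j + 1" "?j + 1" y]
    by (subst avg_diff_fun) (auto intro: L2_locint L2_avg f)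
  then have "avg (?j + 1) ?F = (\<lambda>_. 0)" by (rule ext)
  then have "Th (avg (?j + 1) ?F) t x = 0" for x by (simp add: Th_def)
  then have 1: "ennreal (norm (Th ?F t x)) \<le> ennreal ?c * (\<integral>\<^sup>+y. ennreal (wt \<alpha> t (x - y)) * ennreal (norm (?F y)) \<partial>lborel)" for x
    using Th_avg_diff[OF t le _ Th_L2_fin[OF t F] Th_L2_fin_avn[OF t F], of x] by simp
  have cle: "(?c * Wc CARD('n) \<alpha>)\<^sup>2 \<le> (A * (2 * ?n) powr \<alpha> * Wc CARD('n) \<alpha>)\<^sup>2 * (2 powr (- (\<alpha> / 4))) ^ (2 * i)"
  proof -
    have "?n * 2 powi (?j + 1) / t \<le> (2 * ?n) * 2 powr (- real i)"
      unfolding e using k t by (simp add: powr_minus powr_realpow divide_simps mult_ac)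
    then have "(?n * 2 powi (?j + 1) / t) powr \<alpha> \<le> ((2 * ?n) * 2 powr (- real i)) powr \<alpha>"
      using t alpha by (intro powr_mono2) auto
    also have "\<dots> = (2 * ?n) powr \<alpha> * 2 powr (- (real i * \<alpha>))"
      by (simp add: powr_mult powr_powr)
    finally have "?c * Wc CARD('n) \<alpha> \<le> (A * (2 * ?n) powr \<alpha> * Wc CARD('n) \<alpha>) * 2 powr (- (real i * \<alpha>))"
      using A Wc_pos[OF alpha(1), of "CARD('n)"]
        mult_right_mono[OF mult_left_mono[OF _ A], of "(?n * 2 powi (?j + 1) / t) powr \<alpha>" "(2 * ?n) powr \<alpha> * 2 powr (- (real i * \<alpha>))" "Wc CARD('n) \<alpha>"]
      by (simp add: mult_ac)
    then have "(?c * Wc CARD('n) \<alpha>)\<^sup>2 \<le> ((A * (2 * ?n) powr \<alpha> * Wc CARD('n) \<alpha>) * 2 powr (- (real i * \<alpha>)))\<^sup>2"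
      using A Wc_pos[OF alpha(1), of "CARD('n)"] by (intro power_mono) auto
    also have "\<dots> = (A * (2 * ?n) powr \<alpha> * Wc CARD('n) \<alpha>)\<^sup>2 * 2 powr (- (2 * real i * \<alpha>))"
      by (simp add: power_mult_distrib powr_power mult_ac)
    also have "\<dots> \<le> (A * (2 * ?n) powr \<alpha> * Wc CARD('n) \<alpha>)\<^sup>2 * 2 powr (- (\<alpha> / 4) * real (2 * i))"
      using alpha by (intro mult_left_mono powr_mono) (auto simp: mult_le_cancel_right)
    also have "2 powr (- (\<alpha> / 4) * real (2 * i)) = (2 powr (- (\<alpha> / 4))) ^ (2 * i)"
      by (subst powr_powr[symmetric]) (rule powr_realpow, simp)
    finally show ?thesis .
  qed
  have "(\<integral>\<^sup>+x. (ennreal (norm (Th ?F t x)))\<^sup>2 \<partial>lborel)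
      \<le> (\<integral>\<^sup>+x. ennreal (?c\<^sup>2) * (\<integral>\<^sup>+y. ennreal (wt \<alpha> t (x - y)) * ennreal (norm (?F y)) \<partial>lborel)\<^sup>2 \<partial>lborel)"
  proof (rule nn_integral_mono)
    fix x
    have "(ennreal (norm (Th ?F t x)))\<^sup>2 \<le> (ennreal ?c * (\<integral>\<^sup>+y. ennreal (wt \<alpha> t (x - y)) * ennreal (norm (?F y)) \<partial>lborel))\<^sup>2"
      by (rule power_mono[OF 1]) simp
    then show "(ennreal (norm (Th ?F t x)))\<^sup>2 \<le> ennreal (?c\<^sup>2) * (\<integral>\<^sup>+y. ennreal (wt \<alpha> t (x - y)) * ennreal (norm (?F y)) \<partial>lborel)\<^sup>2"
      using A by (simp add: power_mult_distrib ennreal_power[symmetric] ennreal_mult')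
  qed
  also have "\<dots> = ennreal (?c\<^sup>2) * (\<integral>\<^sup>+x. (\<integral>\<^sup>+y. ennreal (wt \<alpha> t (x - y)) * ennreal (norm (?F y)) \<partial>lborel)\<^sup>2 \<partial>lborel)"
    by (rule nn_integral_cmult) measurable
  also have "\<dots> \<le> ennreal (?c\<^sup>2) * (ennreal ((Wc CARD('n) \<alpha>)\<^sup>2) * sqn ?F)"
    unfolding sqn_def by (intro mult_left_mono Schur_wt t alpha) auto
  also have "\<dots> = ennreal ((?c * Wc CARD('n) \<alpha>)\<^sup>2) * sqn ?F"
    by (simp add: power_mult_distrib ennreal_mult mult.assoc)
  also have "\<dots> \<le> ennreal ((A * (2 * ?n) powr \<alpha> * Wc CARD('n) \<alpha>)\<^sup>2 * (2 powr (- (\<alpha> / 4))) ^ (2 * i)) * sqn ?F"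
    by (intro mult_right_mono ennreal_leI cle) simp
  finally show ?thesis .
qed

text \<open>For the square, \<open>level_coarse\<close> gains (t / 2^(k+i))^(\<alpha>/2) \<le> r^(2
  i) with r = 2^(-\<alpha>/4); this dictates the common ratio.\<close>

lemma coarse_L2:
  assumes t: "t > 0" and f: "L2 f" and k: "t \<le> 2 powi k"
  shows "(\<integral>\<^sup>+x. (ennreal (norm (Th (mdiff (k + int i) f) t x - gam t x * mdiff (k + int i) f x)))\<^sup>2 \<partial>lborel)
    \<le> ennreal (4 * A\<^sup>2 * Wc CARD('n) \<alpha> * real CARD('n) * Wc CARD('n) (\<alpha> / 2) * (2 powr (- (\<alpha> / 4))) ^ (2 * i)) * sqn (mdiff (k + int i) f)"
proof -
  let ?j = "k + int i"
  have "(t / 2 powi ?j) powr (\<alpha> / 2) \<le> (2 powr (- (\<alpha> / 4))) ^ (2 * i)"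
  proof -
    have "t / 2 powi ?j \<le> 2 powr (- real i)"
      using k by (simp add: power_int_add powr_minus powr_realpow divide_simps)
    then have "(t / 2 powi ?j) powr (\<alpha> / 2) \<le> (2 powr (- real i)) powr (\<alpha> / 2)"
      using t alpha by (intro powr_mono2) auto
    also have "\<dots> = 2 powr (- (\<alpha> / 4) * real (2 * i))" by (simp add: powr_powr mult_ac)
    also have "\<dots> = (2 powr (- (\<alpha> / 4))) ^ (2 * i)"
      by (subst powr_powr[symmetric]) (rule powr_realpow, simp)
    finally show ?thesis .
  qed
  then have le: "4 * A\<^sup>2 * Wc CARD('n) \<alpha> * real CARD('n) * Wc CARD('n) (\<alpha> / 2) * (t / 2 powi ?j) powr (\<alpha> / 2)
      \<le> 4 * A\<^sup>2 * Wc CARD('n) \<alpha> * real CARD('n) * Wc CARD('n) (\<alpha> / 2) * (2 powr (- (\<alpha> / 4))) ^ (2 * i)"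
    using Wc_pos[of \<alpha> "CARD('n)"] Wc_pos[of "\<alpha> / 2" "CARD('n)"] alpha by (intro mult_left_mono) auto
  show ?thesis
  proof (rule order_trans[OF level_coarse[where j="?j", OF t L2_mdiff[OF f]]])
    show "mdiff ?j f x = mdiff ?j f y" if "cube_index ?j x = cube_index ?j y" for x y
      unfolding mdiff_def
      using avg_cong[OF that, of f] avg_cong[OF cube_index_mono[OF that], of "?j + 1" f] by simp
  qed (intro mult_right_mono ennreal_leI le, simp)
qed

text \<open>Split at the average of level \<open>lev t\<close>. Differences at distance i from this
  level contribute r^i times their square norm; integrating in dt/t turns these into sums over
  levels, to which Bessel's inequality applies for each i.\<close>

theorem R_L2:
  assumes f: "L2 f"
  shows "(\<integral>\<^sup>+t. (\<integral>\<^sup>+x. (ennreal (norm (R f t x)))\<^sup>2 \<partial>lborel) \<partial>dtt) \<le> ennreal (cR CARD('n) \<alpha> A) * sqn f"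
proof -
  let ?r = "2 powr (- (\<alpha> / 4)) :: real"
  define c1 where "c1 = (A * (2 * real CARD('n)) powr \<alpha> * Wc CARD('n) \<alpha>)\<^sup>2"
  define c2 where "c2 = 4 * A\<^sup>2 * Wc CARD('n) \<alpha> * real CARD('n) * Wc CARD('n) (\<alpha> / 2)"
  note [measurable] = L2_measurable[OF f]
  have r: "0 < ?r" "?r < 1" using two_powr_less_one[of "\<alpha> / 4"] alpha by auto
  have c: "c1 \<ge> 0" "c2 \<ge> 0"
    unfolding c1_def c2_def using Wc_pos[of \<alpha> "CARD('n)"] Wc_pos[of "\<alpha> / 2" "CARD('n)"] alpha by auto
  define S1 where "S1 t = (\<Sum>i. ennreal (?r ^ i) * sqn (mdiff (lev t + (- 1 - int i)) f))" for t
  define S2 where "S2 t = (\<Sum>i. ennreal (?r ^ i) * sqn (mdiff (lev t + int i) f))" for t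
  have [measurable]: "(\<lambda>t. sqn (mdiff (lev t + m) f)) \<in> borel_measurable borel" for m
    by (rule measurable_compose[OF measurable_lev]) simp
  have [measurable]: "S1 \<in> borel_measurable borel" "S2 \<in> borel_measurable borel"
    unfolding S1_def S2_def by measurable
  have main: "(\<integral>\<^sup>+x. (ennreal (norm (R f t x)))\<^sup>2 \<partial>lborel) \<le> 2 * (ennreal (c1 / (1 - ?r)) * S1 t) + 2 * (ennreal (c2 / (1 - ?r)) * S2 t)"
    if t: "t > 0" for t
  proof -
    let ?k = "lev t"
    have k1: "2 powi ?k \<le> 2 * t" by (rule lev_bound2[OF t])
    have k2: "t \<le> 2 powi ?k" using lev_bounds(2)[OF t] by simp
    define U1 where "U1 x = (\<Sum>i. ennreal (norm (Th (mdiff (?k - 1 - int i) f) t x)))" for x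
    define U2 where "U2 x = (\<Sum>i. ennreal (norm (Th (mdiff (?k + int i) f) t x - gam t x * mdiff (?k + int i) f x)))" for x
    have [measurable]: "mdiff j f \<in> borel_measurable borel" for j by (rule L2_measurable[OF L2_mdiff[OF f]])
    have [measurable]: "U1 \<in> borel_measurable borel" "U2 \<in> borel_measurable borel"
      unfolding U1_def U2_def by measurable
    have "(ennreal (norm (R f t x)))\<^sup>2 \<le> 2 * (U1 x)\<^sup>2 + 2 * (U2 x)\<^sup>2" for x
    proof -
      have "R f t x = (Th f t x - Th (avg ?k f) t x) + (Th (avg ?k f) t x - gam t x * avg ?k f x)"
        unfolding R_def by simp
      then have "ennreal (norm (R f t x)) \<le> ennreal (norm (Th f t x - Th (avg ?k f) t x) + norm (Th (avg ?k f) t x - gam t x * avg ?k f x))"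
        by (metis ennreal_leI norm_triangle_ineq)
      also have "\<dots> \<le> U1 x + U2 x"
        unfolding U1_def U2_def
        by (subst ennreal_plus) (auto intro!: add_mono fine_sum[OF t f k1] coarse_sum[OF t f])
      finally have "(ennreal (norm (R f t x)))\<^sup>2 \<le> (U1 x + U2 x)\<^sup>2" by (rule power_mono) simp
      also note ennreal_add_sq_le
      finally show ?thesis .
    qed
    then have "(\<integral>\<^sup>+x. (ennreal (norm (R f t x)))\<^sup>2 \<partial>lborel) \<le> (\<integral>\<^sup>+x. 2 * (U1 x)\<^sup>2 + 2 * (U2 x)\<^sup>2 \<partial>lborel)"
      by (rule nn_integral_mono)
    also have "\<dots> = 2 * (\<integral>\<^sup>+x. (U1 x)\<^sup>2 \<partial>lborel) + 2 * (\<integral>\<^sup>+x. (U2 x)\<^sup>2 \<partial>lborel)"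
      by (subst nn_integral_add) (auto simp: nn_integral_cmult)
    also have "\<dots> \<le> 2 * (ennreal (c1 / (1 - ?r)) * S1 t) + 2 * (ennreal (c2 / (1 - ?r)) * S2 t)"
    proof (intro add_mono mult_left_mono)
      show "(\<integral>\<^sup>+x. (U1 x)\<^sup>2 \<partial>lborel) \<le> ennreal (c1 / (1 - ?r)) * S1 t"
        unfolding U1_def S1_def
        by (rule suminf_sq_bound[OF r c(1)]) (measurable, use fine_L2[OF t f k1] in \<open>simp add: c1_def algebra_simps\<close>)
      show "(\<integral>\<^sup>+x. (U2 x)\<^sup>2 \<partial>lborel) \<le> ennreal (c2 / (1 - ?r)) * S2 t"
        unfolding U2_def S2_def
        by (rule suminf_sq_bound[OF r c(2)]) (measurable, use coarse_L2[OF t f k2] in \<open>simp add: c2_def\<close>)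
    qed auto
    finally show ?thesis .
  qed
  have S: "(\<integral>\<^sup>+t. (\<Sum>i. ennreal (?r ^ i) * sqn (mdiff (lev t + m i) f)) \<partial>dtt) \<le> ennreal (1 / (1 - ?r)) * sqn f" for m
  proof -
    have "(\<integral>\<^sup>+t. (\<Sum>i. ennreal (?r ^ i) * sqn (mdiff (lev t + m i) f)) \<partial>dtt)
        = (\<Sum>i. \<integral>\<^sup>+t. ennreal (?r ^ i) * sqn (mdiff (lev t + m i) f) \<partial>dtt)"
      by (rule nn_integral_suminf) measurable
    also have "\<dots> = (\<Sum>i. ennreal (?r ^ i) * (\<integral>\<^sup>+t. sqn (mdiff (lev t + m i) f) \<partial>dtt))"
      by (intro suminf_cong nn_integral_cmult) measurable
    also have "\<dots> \<le> (\<Sum>i. ennreal (?r ^ i) * sqn f)"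
    proof (intro suminf_le mult_left_mono)
      fix i
      show "(\<integral>\<^sup>+t. sqn (mdiff (lev t + m i) f) \<partial>dtt) \<le> sqn f"
        using dtt_lev_le[of "\<lambda>k. sqn (mdiff k f)" "m i"] mdiff_square_sum[OF f] by (rule order_trans)
    qed auto
    also have "\<dots> = (\<Sum>i. ennreal (?r ^ i)) * sqn f"
      by (rule ennreal_suminf_multc)
    also have "(\<Sum>i. ennreal (?r ^ i)) = ennreal (1 / (1 - ?r))"
      using r geometric_sums[of ?r] by (intro suminf_ennreal_eq) auto
    finally show ?thesis .
  qed
  have "(\<integral>\<^sup>+t. (\<integral>\<^sup>+x. (ennreal (norm (R f t x)))\<^sup>2 \<partial>lborel) \<partial>dtt)
      \<le> (\<integral>\<^sup>+t. 2 * (ennreal (c1 / (1 - ?r)) * S1 t) + 2 * (ennreal (c2 / (1 - ?r)) * S2 t) \<partial>dtt)"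
    by (rule nn_integral_dtt_mono) (rule main)
  also have "\<dots> = 2 * (ennreal (c1 / (1 - ?r)) * (\<integral>\<^sup>+t. S1 t \<partial>dtt)) + 2 * (ennreal (c2 / (1 - ?r)) * (\<integral>\<^sup>+t. S2 t \<partial>dtt))"
    by (subst nn_integral_add) (auto simp: nn_integral_cmult)
  also have "\<dots> \<le> 2 * (ennreal (c1 / (1 - ?r)) * (ennreal (1 / (1 - ?r)) * sqn f)) + 2 * (ennreal (c2 / (1 - ?r)) * (ennreal (1 / (1 - ?r)) * sqn f))"
    using S[of "\<lambda>i. - 1 - int i"] S[of int] unfolding S1_def S2_def by (intro add_mono mult_left_mono) auto
  also have "\<dots> = ennreal (cR CARD('n) \<alpha> A) * sqn f"
  proof -
    have "2 * (ennreal (a / (1 - ?r)) * (ennreal (1 / (1 - ?r)) * sqn f)) = ennreal (2 * a / (1 - ?r)\<^sup>2) * sqn f" if "a \<ge> 0" for a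
    proof -
      have "2 * (ennreal (a / (1 - ?r)) * (ennreal (1 / (1 - ?r)) * sqn f)) = ennreal 2 * ennreal (a / (1 - ?r)) * ennreal (1 / (1 - ?r)) * sqn f"
        by (simp add: mult.assoc)
      also have "\<dots> = ennreal (2 * (a / (1 - ?r)) * (1 / (1 - ?r))) * sqn f"
        using that r by (subst ennreal_mult[symmetric], simp, simp, subst ennreal_mult[symmetric]) auto
      finally show ?thesis by (simp add: power2_eq_square)
    qed
    then show ?thesis
      using c r by (simp add: distrib_right[symmetric] ennreal_plus[symmetric] cR_def c1_def[symmetric] c2_def[symmetric] add_divide_distrib del: ennreal_plus)
  qed
  finally show ?thesis .
qed

end

lemma sets_lev [measurable]: "{t. lev t \<in> X} \<in> sets borel"
proof -
  have "lev -` X \<inter> space borel \<in> sets borel"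
    by (rule measurable_sets[OF measurable_lev]) simp
  then show ?thesis by (simp add: vimage_def)
qed

section \<open>The Carleson embedding theorem\<close>

text \<open>Jensen's inequality for the jointly convex function u^2 / w.\<close>

lemma avn_CS2:
  fixes u :: "real ^ 'n \<Rightarrow> ennreal" and w :: "real ^ 'n \<Rightarrow> real"
  assumes [measurable]: "u \<in> borel_measurable borel" "w \<in> borel_measurable borel" and w: "\<And>y. w y > 0"
  shows "(avn i u x)\<^sup>2 \<le> avn i (\<lambda>y. (u y)\<^sup>2 * ennreal (1 / w y)) x * avn i (\<lambda>y. ennreal (w y)) x"
proof -
  let ?c = "ennreal (1 / cvol CARD('n) i)" let ?I = "indicator (cube_of i x) :: real ^ 'n \<Rightarrow> ennreal"
  have "?I y * u y = (?I y * (ennreal (1 / sqrt (w y)) * u y)) * (?I y * ennreal (sqrt (w y)))" for y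
  proof -
    have "ennreal (1 / sqrt (w y)) * ennreal (sqrt (w y)) = 1"
      using w[of y] by (simp add: ennreal_mult[symmetric])
    then have "u y = (ennreal (1 / sqrt (w y)) * u y) * ennreal (sqrt (w y))"
      by (metis mult.assoc mult.commute mult.right_neutral)
    then show ?thesis by (auto simp: indicator_def)
  qed
  then have "(\<integral>\<^sup>+y. ?I y * u y \<partial>lborel)\<^sup>2
      = (\<integral>\<^sup>+y. (?I y * (ennreal (1 / sqrt (w y)) * u y)) * (?I y * ennreal (sqrt (w y))) \<partial>lborel)\<^sup>2"
    by simp
  also have "\<dots> \<le> (\<integral>\<^sup>+y. (?I y * (ennreal (1 / sqrt (w y)) * u y))\<^sup>2 \<partial>lborel) * (\<integral>\<^sup>+y. (?I y * ennreal (sqrt (w y)))\<^sup>2 \<partial>lborel)"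
    by (rule Cauchy_Schwarz_nn_integral) measurable
  also have "(\<integral>\<^sup>+y. (?I y * (ennreal (1 / sqrt (w y)) * u y))\<^sup>2 \<partial>lborel) = (\<integral>\<^sup>+y. ?I y * ((u y)\<^sup>2 * ennreal (1 / w y)) \<partial>lborel)"
    using less_imp_le[OF w]
    by (intro nn_integral_cong) (auto simp: indicator_def power_mult_distrib ennreal_power power_divide mult.commute)
  also have "(\<integral>\<^sup>+y. (?I y * ennreal (sqrt (w y)))\<^sup>2 \<partial>lborel) = (\<integral>\<^sup>+y. ?I y * ennreal (w y) \<partial>lborel)"
    using less_imp_le[OF w] by (intro nn_integral_cong) (auto simp: indicator_def power_mult_distrib ennreal_power)
  finally have "(avn i u x)\<^sup>2 \<le> ?c\<^sup>2 * ((\<integral>\<^sup>+y. ?I y * ((u y)\<^sup>2 * ennreal (1 / w y)) \<partial>lborel) * (\<integral>\<^sup>+y. ?I y * ennreal (w y) \<partial>lborel))"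
    unfolding avn_def power_mult_distrib by (rule mult_left_mono) simp
  then show ?thesis
    unfolding avn_def by (simp add: power2_eq_square mult_ac)
qed

text \<open>The function \<open>4 N (F - f\<^sup>2 / (1 + M))\<close> of the averages \<open>F\<close>, \<open>f\<close> of \<open>f\<^sup>2\<close>, \<open>f\<close> and of the
  normalised Carleson mass \<open>M\<close> serves as a Bellman function; it is concave because
  \<open>f\<^sup>2 / (1 + M)\<close> is convex, which is Cauchy--Schwarz.\<close>

lemma bellman:
  fixes a :: "int \<Rightarrow> real ^ 'n \<Rightarrow> ennreal" and F :: "real ^ 'n \<Rightarrow> ennreal"
  assumes [measurable]: "\<And>k. a k \<in> borel_measurable borel" "F \<in> borel_measurable borel" and N: "N > 0"
    and Car: "\<And>j x. avn j (\<lambda>y. \<Sum>k\<in>{l..j}. a k y) x \<le> ennreal N"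
    and "l - 1 \<le> j"
  shows "avn j (\<lambda>y. \<Sum>k\<in>{l..j}. a k y * (avn k F y)\<^sup>2) x
      + ennreal (4 * N / (1 + enn2real (avn j (\<lambda>y. \<Sum>k\<in>{l..j}. a k y) x) / N)) * (avn j F x)\<^sup>2
    \<le> ennreal (4 * N) * avn j (\<lambda>y. (F y)\<^sup>2) x"
  using assms(5)
proof (induction j arbitrary: x rule: int_ge_induct)
  \<comment> \<open>At level \<open>l - 1\<close> the sums are empty and M = 0, so the claim is
    Jensen's inequality.\<close>
  case base
  have "(avn (l - 1) F x)\<^sup>2 \<le> avn (l - 1) (\<lambda>y. (F y)\<^sup>2) x" by (rule avn_CS) measurable
  then show ?case by (simp add: mult_left_mono)
next
  case (step j)
  define i where "i = j + 1"
  define T where "T y = (\<Sum>k\<in>{l..j}. a k y * (avn k F y)\<^sup>2)" for y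
  define B where "B y = (\<Sum>k\<in>{l..j}. a k y)" for y
  define m where "m y = enn2real (avn j B y) / N" for y
  have [measurable]: "T \<in> borel_measurable borel" "B \<in> borel_measurable borel" "m \<in> borel_measurable borel"
    unfolding T_def B_def m_def by measurable
  have ins: "{l..i} = insert i {l..j}" "i \<notin> {l..j}" using step.hyps by (auto simp: i_def)
  have B1: "(\<Sum>k\<in>{l..i}. a k y) = a i y + B y" for y unfolding ins(1) B_def using ins(2) by simp
  have T1: "(\<Sum>k\<in>{l..i}. a k y * (avn k F y)\<^sup>2) = (avn i F y)\<^sup>2 * a i y + T y" for y
    unfolding ins(1) T_def using ins(2) by (simp add: mult.commute)
  have finB: "avn j B y < top" for y
    using Car[of j y] unfolding B_def by (auto intro: le_less_trans)
  have sumB: "avn i (\<lambda>y. \<Sum>k\<in>{l..i}. a k y) x = avn i (a i) x + avn i B x"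
    unfolding B1 by (rule avn_add) measurable
  have le: "avn i (a i) x + avn i B x \<le> ennreal N" using Car[of i x] sumB by simp
  have fin: "avn i (a i) x < top" "avn i B x < top"
    using le_less_trans[OF le ennreal_less_top] by auto
  define a' where "a' = enn2real (avn i (a i) x)"
  define \<mu> where "\<mu> = enn2real (avn i B x) / N"
  have a': "avn i (a i) x = ennreal a'" "a' \<ge> 0" using fin by (auto simp: a'_def)
  have \<mu>: "avn i B x = ennreal (N * \<mu>)" "\<mu> \<ge> 0" using fin N by (auto simp: \<mu>_def)
  have le1: "a' + N * \<mu> \<le> N"
    using le a' \<mu> N by (simp add: ennreal_plus[symmetric] ennreal_le_iff del: ennreal_plus)
  have mi: "enn2real (avn i (\<lambda>y. \<Sum>k\<in>{l..i}. a k y) x) / N = \<mu> + a' / N"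
    unfolding sumB a'(1) \<mu>(1) using a' \<mu> N by (simp add: ennreal_plus[symmetric] add_divide_distrib del: ennreal_plus)
  have m0: "m y \<ge> 0" for y unfolding m_def using N by simp
  define X where "X = (avn i F x)\<^sup>2"
  define Z where "Z = avn i (\<lambda>y. (avn j F y)\<^sup>2 * ennreal (1 / (1 + m y))) x"
  have IH: "avn j T y + ennreal (4 * N) * ((avn j F y)\<^sup>2 * ennreal (1 / (1 + m y))) \<le> ennreal (4 * N) * avn j (\<lambda>y. (F y)\<^sup>2) y" for y
  proof -
    have "ennreal (4 * N / (1 + m y)) = ennreal (4 * N) * ennreal (1 / (1 + m y))"
      using N m0[of y] by (simp add: ennreal_mult[symmetric])
    then show ?thesis
      using step.IH[of y] unfolding T_def[symmetric] B_def[symmetric] m_def[symmetric] by (simp add: mult_ac)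
  qed
  have "avn i (avn j T) x + ennreal (4 * N) * Z = avn i (\<lambda>y. avn j T y + ennreal (4 * N) * ((avn j F y)\<^sup>2 * ennreal (1 / (1 + m y)))) x"
    unfolding Z_def by (subst avn_add, measurable, subst avn_cmult) auto
  also have "\<dots> \<le> avn i (\<lambda>y. ennreal (4 * N) * avn j (\<lambda>y. (F y)\<^sup>2) y) x"
    by (rule avn_mono) (rule IH)
  also have "\<dots> = ennreal (4 * N) * avn i (\<lambda>y. (F y)\<^sup>2) x"
    by (subst avn_cmult, measurable) (simp add: avn_tower i_def)
  also have "avn i (avn j T) x = avn i T x" by (rule avn_tower) (auto simp: i_def)
  finally have main: "avn i T x + ennreal (4 * N) * Z \<le> ennreal (4 * N) * avn i (\<lambda>y. (F y)\<^sup>2) x" .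
  \<comment> \<open>By the tower property the weight used in \<open>avn_CS2\<close> averages over
    the parent to 1 + \<mu>, with \<mu> the normalised mass of the levels up to j.\<close>
  have "avn i (\<lambda>y. ennreal (1 + m y)) x = avn i (\<lambda>y. 1 + ennreal (1 / N) * avn j B y) x"
  proof (rule avn_cong_fun)
    fix y
    have "ennreal (1 + m y) = 1 + ennreal (m y)" using m0 by simp
    also have "ennreal (m y) = ennreal (1 / N) * ennreal (enn2real (avn j B y))"
      unfolding m_def using N by (simp add: ennreal_mult[symmetric])
    finally show "ennreal (1 + m y) = 1 + ennreal (1 / N) * avn j B y" using finB by simp
  qed
  also have "\<dots> = 1 + ennreal (1 / N) * avn i (avn j B) x"
    by (subst avn_add, measurable, subst avn_cmult) auto
  also have "avn i (avn j B) x = ennreal (N * \<mu>)" unfolding \<mu>(1)[symmetric] by (rule avn_tower) (auto simp: i_def)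
  also have "1 + ennreal (1 / N) * ennreal (N * \<mu>) = ennreal (1 + \<mu>)"
    using N \<mu>(2) by (simp add: ennreal_mult[symmetric])
  finally have w: "avn i (\<lambda>y. ennreal (1 + m y)) x = ennreal (1 + \<mu>)" .
  have "X = (avn i (avn j F) x)\<^sup>2" unfolding X_def by (simp add: avn_tower i_def)
  also have "\<dots> \<le> Z * ennreal (1 + \<mu>)"
    unfolding Z_def w[symmetric]
    by (rule avn_CS2) (use m0 in \<open>auto intro: add_pos_nonneg\<close>)
  finally have XZ: "X * ennreal (1 / (1 + \<mu>)) \<le> Z * ennreal (1 + \<mu>) * ennreal (1 / (1 + \<mu>))" by (rule mult_right_mono) simp
  have "ennreal (1 + \<mu>) * ennreal (1 / (1 + \<mu>)) = 1" using \<mu>(2) by (subst ennreal_mult[symmetric]) auto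
  then have XZ: "X * ennreal (1 / (1 + \<mu>)) \<le> Z" using XZ by (simp add: mult.assoc)
  \<comment> \<open>Adding the mass s = a'/N lowers 4 / (1 + M) by 4 s over a product of two
    factors, each at most 2 by the Carleson bound. Hence the constant 4.\<close>
  have scal: "a' + 4 * N / (1 + (\<mu> + a' / N)) \<le> 4 * N / (1 + \<mu>)"
  proof -
    define s where "s = a' / N"
    have s: "s \<ge> 0" "\<mu> + s \<le> 1" "a' = N * s"
      using a' N le1 by (auto simp: s_def field_simps)
    have "(1 + \<mu>) * (1 + (\<mu> + s)) \<le> 2 * 2" using s \<mu>(2) by (intro mult_mono) auto
    then have "s * ((1 + \<mu>) * (1 + (\<mu> + s))) \<le> s * 4" using s(1) by (intro mult_left_mono) auto
    moreover have "4 / (1 + \<mu>) - 4 / (1 + (\<mu> + s)) = 4 * s / ((1 + \<mu>) * (1 + (\<mu> + s)))"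
      using s(1) \<mu>(2) by (simp add: divide_simps)
    moreover have "0 < (1 + \<mu>) * (1 + (\<mu> + s))" using s(1) \<mu>(2) by (intro mult_pos_pos) auto
    ultimately have "s \<le> 4 / (1 + \<mu>) - 4 / (1 + (\<mu> + s))" by (simp only: pos_le_divide_eq mult.commute)
    then have "s + 4 / (1 + (\<mu> + s)) \<le> 4 / (1 + \<mu>)" by linarith
    then have "N * (s + 4 / (1 + (\<mu> + s))) \<le> N * (4 / (1 + \<mu>))" using N by (intro mult_left_mono) auto
    then show ?thesis unfolding s(3) using N by (simp add: distrib_left mult.commute)
  qed
  have "X * ennreal a' + ennreal (4 * N / (1 + (\<mu> + a' / N))) * X = X * ennreal (a' + 4 * N / (1 + (\<mu> + a' / N)))"
    using a'(2) \<mu>(2) N by (simp add: distrib_left mult.commute)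
  also have "\<dots> \<le> X * ennreal (4 * N / (1 + \<mu>))"
    by (intro mult_left_mono ennreal_leI scal) simp
  also have "\<dots> = ennreal (4 * N) * (X * ennreal (1 / (1 + \<mu>)))"
    using N \<mu>(2) by (simp add: mult.left_commute[of _ X] ennreal_mult[symmetric])
  also have "\<dots> \<le> ennreal (4 * N) * Z"
    by (intro mult_left_mono XZ) simp
  finally have key: "X * ennreal a' + ennreal (4 * N / (1 + (\<mu> + a' / N))) * X \<le> ennreal (4 * N) * Z" .
  have "avn i (\<lambda>y. \<Sum>k\<in>{l..i}. a k y * (avn k F y)\<^sup>2) x = X * ennreal a' + avn i T x"
    unfolding T1 X_def a'(1)[symmetric]
    by (subst avn_add, measurable, subst avn_pull) (auto dest: avn_cong[of i _ _ F])
  then have "avn i (\<lambda>y. \<Sum>k\<in>{l..i}. a k y * (avn k F y)\<^sup>2) x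
      + ennreal (4 * N / (1 + enn2real (avn i (\<lambda>y. \<Sum>k\<in>{l..i}. a k y) x) / N)) * (avn i F x)\<^sup>2
      = avn i T x + (X * ennreal a' + ennreal (4 * N / (1 + (\<mu> + a' / N))) * X)"
    unfolding mi X_def[symmetric] by (simp add: add_ac)
  also have "\<dots> \<le> avn i T x + ennreal (4 * N) * Z" by (rule add_left_mono[OF key])
  also note main
  finally show ?case unfolding i_def .
qed

text \<open>The mass of one octave of \<open>t\<close> plays the role of \<open>a k\<close>.
  Integrating the Bellman inequality at the top level of a block bounds the sum over the block,
  uniformly in the block.\<close>

lemma carleson_embedding:
  fixes G :: "real \<Rightarrow> real ^ 'n \<Rightarrow> ennreal" and F :: "real ^ 'n \<Rightarrow> ennreal"
  assumes G [measurable]: "(\<lambda>(t, x). G t x) \<in> borel_measurable (borel \<Otimes>\<^sub>M borel)"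
    and [measurable]: "F \<in> borel_measurable borel" and N: "N > 0"
    and Car: "\<And>l j x. avn j (\<lambda>y. \<integral>\<^sup>+t. indicator {t. lev t \<in> {l..j}} t * G t y \<partial>dtt) x \<le> ennreal N"
  shows "(\<integral>\<^sup>+t. (\<integral>\<^sup>+x. G t x * (avn (lev t) F x)\<^sup>2 \<partial>lborel) \<partial>dtt) \<le> ennreal (4 * N) * (\<integral>\<^sup>+x. (F x)\<^sup>2 \<partial>lborel)"
proof -
  interpret C: sigma_finite_measure "count_space (UNIV :: int set)"
    by (rule sigma_finite_measure_count_space)
  interpret P: pair_sigma_finite "count_space (UNIV :: int set)" "lborel :: (real ^ 'n) measure" ..
  have [measurable (raw)]: "(\<lambda>z. G (g z) (h z)) \<in> borel_measurable M"
    if "g \<in> borel_measurable M" "h \<in> borel_measurable M" for g h and M :: "'z measure"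
    using measurable_compose[OF measurable_Pair[OF that] G] by simp
  have [measurable (raw)]: "(\<lambda>z. avn (lev (g z)) F (h z)) \<in> borel_measurable M"
    if [measurable]: "g \<in> borel_measurable M" "h \<in> borel_measurable M" for g h and M :: "'z measure"
    by (rule measurable_compose_countable[where f="\<lambda>k z. avn k F (h z)" and g="\<lambda>z. lev (g z)"]) measurable
  define a where "a k x = (\<integral>\<^sup>+t. indicator {t. lev t = k} t * G t x \<partial>dtt)" for k x
  have [measurable]: "a k \<in> borel_measurable borel" for k
    unfolding a_def by measurable
  have sum_a: "(\<Sum>k\<in>{l..j}. a k y) = (\<integral>\<^sup>+t. indicator {t. lev t \<in> {l..j}} t * G t y \<partial>dtt)" for l j y
  proof -
    have "(\<Sum>k\<in>{l..j}. a k y) = (\<integral>\<^sup>+t. (\<Sum>k\<in>{l..j}. indicator {t. lev t = k} t * G t y) \<partial>dtt)"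
      unfolding a_def by (subst nn_integral_sum) auto
    also have "\<dots> = (\<integral>\<^sup>+t. indicator {t. lev t \<in> {l..j}} t * G t y \<partial>dtt)"
    proof (rule nn_integral_cong)
      fix t
      have "(\<Sum>k\<in>{l..j}. indicator {t. lev t = k} t * G t y) = (\<Sum>k\<in>{l..j}. if k = lev t then G t y else 0)"
        by (intro sum.cong) (auto simp: indicator_def)
      then show "(\<Sum>k\<in>{l..j}. indicator {t. lev t = k} t * G t y) = indicator {t. lev t \<in> {l..j}} t * G t y"
        by (simp add: sum.delta indicator_def)
    qed
    finally show ?thesis .
  qed
  define H where "H k = (\<integral>\<^sup>+x. a k x * (avn k F x)\<^sup>2 \<partial>lborel)" for k
  have H: "(\<integral>\<^sup>+k. H k \<partial>count_space UNIV) \<le> ennreal (4 * N) * (\<integral>\<^sup>+x. (F x)\<^sup>2 \<partial>lborel)"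
  proof (rule nn_integral_count_space_int_le)
    fix l :: int and K :: nat
    let ?j = "l + int K - 1"
    have "(\<Sum>i<K. H (l + int i)) = (\<Sum>k\<in>{l..?j}. H k)"
      by (rule sum.reindex_bij_witness[of _ "\<lambda>k. nat (k - l)" "\<lambda>i. l + int i"]) auto
    also have "\<dots> = (\<integral>\<^sup>+x. (\<Sum>k\<in>{l..?j}. a k x * (avn k F x)\<^sup>2) \<partial>lborel)"
      unfolding H_def by (subst nn_integral_sum) auto
    also have "\<dots> = (\<integral>\<^sup>+x. avn ?j (\<lambda>y. \<Sum>k\<in>{l..?j}. a k y * (avn k F y)\<^sup>2) x \<partial>lborel)"
      by (rule nn_integral_avn[symmetric]) measurable
    also have "\<dots> \<le> (\<integral>\<^sup>+x. ennreal (4 * N) * avn ?j (\<lambda>y. (F y)\<^sup>2) x \<partial>lborel)"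
    proof (rule nn_integral_mono)
      fix x
      have "avn ?j (\<lambda>y. \<Sum>k\<in>{l..?j}. a k y * (avn k F y)\<^sup>2) x
        + ennreal (4 * N / (1 + enn2real (avn ?j (\<lambda>y. \<Sum>k\<in>{l..?j}. a k y) x) / N)) * (avn ?j F x)\<^sup>2
        \<le> ennreal (4 * N) * avn ?j (\<lambda>y. (F y)\<^sup>2) x"
      proof (rule bellman[OF _ _ N])
        show "avn j (\<lambda>y. \<Sum>k\<in>{l..j}. a k y) x \<le> ennreal N" for j x
          unfolding sum_a by (rule Car)
      qed auto
      then show "avn ?j (\<lambda>y. \<Sum>k\<in>{l..?j}. a k y * (avn k F y)\<^sup>2) x \<le> ennreal (4 * N) * avn ?j (\<lambda>y. (F y)\<^sup>2) x"
        by (rule order_trans[rotated]) simp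
    qed
    also have "\<dots> = ennreal (4 * N) * (\<integral>\<^sup>+x. (F x)\<^sup>2 \<partial>lborel)"
      by (subst nn_integral_cmult) (auto simp: nn_integral_avn)
    finally show "(\<Sum>i<K. H (l + int i)) \<le> ennreal (4 * N) * (\<integral>\<^sup>+x. (F x)\<^sup>2 \<partial>lborel)" .
  qed
  have "(\<integral>\<^sup>+t. (\<integral>\<^sup>+x. G t x * (avn (lev t) F x)\<^sup>2 \<partial>lborel) \<partial>dtt) = (\<integral>\<^sup>+x. (\<integral>\<^sup>+t. G t x * (avn (lev t) F x)\<^sup>2 \<partial>dtt) \<partial>lborel)"
    by (rule dtt_lborel.Fubini'[symmetric]) measurable
  also have "\<dots> = (\<integral>\<^sup>+x. (\<integral>\<^sup>+k. a k x * (avn k F x)\<^sup>2 \<partial>count_space UNIV) \<partial>lborel)"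
  proof (rule nn_integral_cong)
    fix x :: "real ^ 'n"
    have "(\<integral>\<^sup>+t. G t x * (avn (lev t) F x)\<^sup>2 \<partial>dtt) = (\<integral>\<^sup>+k. (\<integral>\<^sup>+t. indicator {t. lev t = k} t * (G t x * (avn (lev t) F x)\<^sup>2) \<partial>dtt) \<partial>count_space UNIV)"
      by (rule dtt_split) measurable
    also have "\<dots> = (\<integral>\<^sup>+k. a k x * (avn k F x)\<^sup>2 \<partial>count_space UNIV)"
      unfolding a_def
      by (intro nn_integral_cong, subst nn_integral_multc[symmetric])
         (auto intro!: nn_integral_cong simp: indicator_def)
    finally show "(\<integral>\<^sup>+t. G t x * (avn (lev t) F x)\<^sup>2 \<partial>dtt) = (\<integral>\<^sup>+k. a k x * (avn k F x)\<^sup>2 \<partial>count_space UNIV)" .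
  qed
  also have "\<dots> = (\<integral>\<^sup>+k. H k \<partial>count_space UNIV)"
    unfolding H_def by (rule P.Fubini') (rule measurable_pair_measure_countable1, auto)
  also note H
  finally show ?thesis .
qed

context kern
begin

text \<open>\<open>Th f\<close> is the remainder plus \<gamma>_t A_t f. Squaring the sum costs a
  factor 2, and the embedding contributes \<open>4 * N\<close>.\<close>

theorem carleson_imp_L2:
  assumes N: "N > 0"
    and Car: "\<And>l j x. avn j (\<lambda>y. \<integral>\<^sup>+t. indicator {t. lev t \<in> {l..j}} t * (ennreal (norm (gam t y)))\<^sup>2 \<partial>dtt) x \<le> ennreal N"
    and f: "L2 f"
  shows "(\<integral>\<^sup>+t. (\<integral>\<^sup>+x. (ennreal (norm (Th f t x)))\<^sup>2 \<partial>lborel) \<partial>dtt) \<le> ennreal (2 * cR CARD('n) \<alpha> A + 8 * N) * sqn f"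
proof -
  note [measurable] = L2_measurable[OF f]
  let ?F = "\<lambda>y. ennreal (norm (f y))"
  have [measurable (raw)]: "(\<lambda>z. avn (lev (g z)) ?F (h z)) \<in> borel_measurable M"
    if [measurable]: "g \<in> borel_measurable M" "h \<in> borel_measurable M" for g h and M :: "'z measure"
    by (rule measurable_compose_countable[where f="\<lambda>k z. avn k ?F (h z)" and g="\<lambda>z. lev (g z)"]) measurable
  have c: "cR CARD('n) \<alpha> A \<ge> 0"
    unfolding cR_def using Wc_pos[of \<alpha> "CARD('n)"] Wc_pos[of "\<alpha> / 2" "CARD('n)"] alpha by auto
  have "(ennreal (norm (Th f t x)))\<^sup>2 \<le> 2 * (ennreal (norm (R f t x)))\<^sup>2 + 2 * ((ennreal (norm (gam t x)))\<^sup>2 * (avn (lev t) ?F x)\<^sup>2)" for t x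
  proof -
    have "Th f t x = R f t x - (- (gam t x * avg (lev t) f x))" by (simp add: R_def)
    then have "(ennreal (norm (Th f t x)))\<^sup>2 \<le> 2 * (ennreal (norm (R f t x)))\<^sup>2 + 2 * (ennreal (norm (gam t x * avg (lev t) f x)))\<^sup>2"
      using norm_diff_sq_le[of "R f t x" "- (gam t x * avg (lev t) f x)"] by simp
    also have "\<dots> \<le> 2 * (ennreal (norm (R f t x)))\<^sup>2 + 2 * (ennreal (norm (gam t x)) * avn (lev t) ?F x)\<^sup>2"
      unfolding norm_mult ennreal_mult'[OF norm_ge_zero]
      by (intro add_left_mono mult_left_mono power_mono norm_avg_le) auto
    finally show ?thesis by (simp add: power_mult_distrib)
  qed
  then have "(\<integral>\<^sup>+t. (\<integral>\<^sup>+x. (ennreal (norm (Th f t x)))\<^sup>2 \<partial>lborel) \<partial>dtt) \<le>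
      (\<integral>\<^sup>+t. (\<integral>\<^sup>+x. 2 * (ennreal (norm (R f t x)))\<^sup>2 + 2 * ((ennreal (norm (gam t x)))\<^sup>2 * (avn (lev t) ?F x)\<^sup>2) \<partial>lborel) \<partial>dtt)"
    by (intro nn_integral_mono)
  also have "\<dots> = (\<integral>\<^sup>+t. 2 * (\<integral>\<^sup>+x. (ennreal (norm (R f t x)))\<^sup>2 \<partial>lborel) + 2 * (\<integral>\<^sup>+x. (ennreal (norm (gam t x)))\<^sup>2 * (avn (lev t) ?F x)\<^sup>2 \<partial>lborel) \<partial>dtt)"
    by (intro nn_integral_cong, subst nn_integral_add) (auto simp: nn_integral_cmult)
  also have "\<dots> = 2 * (\<integral>\<^sup>+t. (\<integral>\<^sup>+x. (ennreal (norm (R f t x)))\<^sup>2 \<partial>lborel) \<partial>dtt) + 2 * (\<integral>\<^sup>+t. (\<integral>\<^sup>+x. (ennreal (norm (gam t x)))\<^sup>2 * (avn (lev t) ?F x)\<^sup>2 \<partial>lborel) \<partial>dtt)"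
    by (subst nn_integral_add) (auto simp: nn_integral_cmult)
  also have "\<dots> \<le> 2 * (ennreal (cR CARD('n) \<alpha> A) * sqn f) + 2 * (ennreal (4 * N) * sqn f)"
    unfolding sqn_def using R_L2[OF f, unfolded sqn_def]
    by (intro add_mono mult_left_mono carleson_embedding[OF _ _ N Car]) auto
  also have "\<dots> = ennreal (2 * cR CARD('n) \<alpha> A + 8 * N) * sqn f"
  proof -
    have "2 * (ennreal s * sqn f) = ennreal (2 * s) * sqn f" for s
      by (simp add: ennreal_mult' mult.assoc)
    then show ?thesis using c N by (simp add: distrib_right)
  qed
  finally show ?thesis .
qed

end

section \<open>A John--Nirenberg lemma for Carleson measures\<close>

lemma sets_level:
  fixes P :: "real ^ 'n \<Rightarrow> bool"
  assumes "\<And>x y. cube_index j x = cube_index j y \<Longrightarrow> P x = P y"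
  shows "{x. P x} \<in> sets borel"
proof -
  have "(\<lambda>x. of_bool (P x) :: real) \<in> borel_measurable borel"
    by (rule measurable_cube_index_fun[of j], rule arg_cong[where f=of_bool], rule assms)
  then have "{x \<in> space borel. (of_bool (P x) :: real) = 1} \<in> sets borel" by measurable
  then show ?thesis by simp
qed

lemma nn_integral_level_le:
  fixes u :: "real ^ 'n \<Rightarrow> ennreal"
  assumes [measurable]: "u \<in> borel_measurable borel"
    and V: "\<And>x y. cube_index j x = cube_index j y \<Longrightarrow> x \<in> V \<longleftrightarrow> y \<in> V"
    and u: "\<And>x. x \<in> V \<Longrightarrow> avn j u x \<le> K"
  shows "(\<integral>\<^sup>+x. indicator V x * u x \<partial>lborel) \<le> K * emeasure lborel V"
proof -
  have [measurable]: "V \<in> sets borel" using sets_level[of j "\<lambda>x. x \<in> V", OF V] by simp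
  have "(\<integral>\<^sup>+x. indicator V x * u x \<partial>lborel) = (\<integral>\<^sup>+x. indicator V x * avn j u x \<partial>lborel)"
    by (rule nn_integral_avn_weight[symmetric]) (auto simp: indicator_def dest: V[THEN iffD1] V[THEN iffD2])
  also have "\<dots> \<le> (\<integral>\<^sup>+x. K * indicator V x \<partial>lborel)"
    by (intro nn_integral_mono) (use u in \<open>auto simp: indicator_def\<close>)
  also have "\<dots> = K * emeasure lborel V" by (rule nn_integral_cmult_indicator) simp
  finally show ?thesis .
qed

text \<open>Induction on the number of levels from \<open>l\<close> to \<open>q\<close>, with one
  constant for all of them. In a cube, stop at the maximal subcubes that miss the set
  \<open>F\<close> where S is at most N0. At scales above a stopping cube its parent meets
  \<open>F\<close>, and Hoelder continuity bounds the square function by a constant c; at scales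
  within it the induction hypothesis applies. Since the stopping cubes miss \<open>F\<close>, they
  fill at most the proportion 1 - \<eta>, and K = c / \<eta> is the fixed point of K = (1 - \<eta>)
  K + c.\<close>

lemma john_nirenberg:
  fixes u :: "real \<Rightarrow> real ^ 'n \<Rightarrow> real"
  assumes \<alpha>: "\<alpha> > 0" and H: "H \<ge> 0" and N0: "N0 \<ge> 0" and \<eta>: "0 < \<eta>" "\<eta> \<le> 1"
    and u [measurable]: "(\<lambda>(t, x). u t x) \<in> borel_measurable (borel \<Otimes>\<^sub>M borel)"
    and hoelder: "\<And>t x y. t > 0 \<Longrightarrow> norm (x - y) \<le> 2 * real CARD('n) * t \<Longrightarrow> \<bar>u t x - u t y\<bar> \<le> H * (norm (x - y) / t) powr \<alpha>"
  defines "S \<equiv> \<lambda>l q x. \<integral>\<^sup>+t. indicator {t. lev t \<in> {l..q}} t * ennreal ((u t x)\<^sup>2) \<partial>dtt"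
  assumes ample: "\<And>q x. l \<le> q \<Longrightarrow> ennreal (\<eta> * cvol CARD('n) q) \<le> emeasure lborel {y \<in> cube_of q x. S l q y \<le> ennreal N0}"
  shows "avn q (S l q) x \<le> ennreal ((2 * N0 + H\<^sup>2 * (2 * real CARD('n)) powr (2 * \<alpha>) / \<alpha>) / \<eta>)"
proof -
  \<comment> \<open>From u(x)^2 \<le> 2 u(y)^2 + 2 (u(x) - u(y))^2: the first term gives 2 N0, while
    in the second (2^j / t)^(2 \<alpha>) has integral 1 / (2 \<alpha>) over t \<ge> 2^j.\<close>
  define c where "c = 2 * N0 + H\<^sup>2 * (2 * real CARD('n)) powr (2 * \<alpha>) / \<alpha>"
  define K where "K = c / \<eta>"
  have c0: "c \<ge> 0" unfolding c_def using N0 \<alpha> by simp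
  have K0: "K \<ge> 0" unfolding K_def using c0 \<eta> by simp
  have [measurable (raw)]: "(\<lambda>z. u (g z) (h z)) \<in> borel_measurable M"
    if "g \<in> borel_measurable M" "h \<in> borel_measurable M" for g h and M :: "'z measure"
    using measurable_compose[OF measurable_Pair[OF that] u] by simp
  have [measurable]: "S l q \<in> borel_measurable borel" for l q
    unfolding S_def by measurable
  have S_mono: "S l' q x \<le> S l q x" if "l \<le> l'" for l l' q x
    unfolding S_def using that by (intro nn_integral_mono) (auto simp: indicator_def)
  have S_split: "S l q x = S l j x + S (j + 1) q x" if "l - 1 \<le> j" "j \<le> q" for l j q x
  proof -
    have "S l q x = (\<integral>\<^sup>+t. indicator {t. lev t \<in> {l..j}} t * ennreal ((u t x)\<^sup>2) + indicator {t. lev t \<in> {j + 1..q}} t * ennreal ((u t x)\<^sup>2) \<partial>dtt)"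
      unfolding S_def using that by (intro nn_integral_cong) (auto simp: indicator_def)
    also have "\<dots> = S l j x + S (j + 1) q x"
      unfolding S_def by (subst nn_integral_add) auto
    finally show ?thesis .
  qed
  \<comment> \<open>Two points of a cube of level j + 1 differ by at most 2 n 2^j, which is within
    the range of Hoelder continuity for every t \<ge> 2^j, that is, at all levels from j + 1
    on.\<close>
  have compare: "S (j + 1) q x \<le> ennreal c"
    if "cube_index (j + 1) x = cube_index (j + 1) y" "S (j + 1) q y \<le> ennreal N0" for j q x y
  proof -
    let ?n = "real CARD('n)" let ?l = "2 powi j :: real"
    let ?E = "\<lambda>t. indicator {?l..} t * ennreal ((?l / t) powr (2 * \<alpha>))"
    have d: "norm (x - y) \<le> 2 * ?n * ?l"
      using norm_diff_cube_index[OF that(1)] by (simp add: power_int_add)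
    have "S (j + 1) q x \<le> (\<integral>\<^sup>+t. 2 * (indicator {t. lev t \<in> {j + 1..q}} t * ennreal ((u t y)\<^sup>2)) + ennreal (2 * H\<^sup>2 * (2 * ?n) powr (2 * \<alpha>)) * ?E t \<partial>dtt)"
      unfolding S_def
    proof (rule nn_integral_dtt_mono)
      fix t :: real assume t: "t > 0"
      show "indicator {t. lev t \<in> {j + 1..q}} t * ennreal ((u t x)\<^sup>2) \<le>
        2 * (indicator {t. lev t \<in> {j + 1..q}} t * ennreal ((u t y)\<^sup>2)) + ennreal (2 * H\<^sup>2 * (2 * ?n) powr (2 * \<alpha>)) * ?E t"
      proof (cases "lev t \<in> {j + 1..q}")
        case True
        have "?l \<le> 2 powi (lev t - 1)" using True by (intro power_int_increasing) auto
        then have lt: "?l \<le> t" using lev_bounds(1)[OF t] by linarith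
        then have "2 * ?n * ?l \<le> 2 * ?n * t" by (intro mult_left_mono) auto
        then have "norm (x - y) \<le> 2 * ?n * t" using d by linarith
        then have "\<bar>u t x - u t y\<bar> \<le> H * (norm (x - y) / t) powr \<alpha>" by (rule hoelder[OF t])
        also have "\<dots> \<le> H * (2 * ?n * (?l / t)) powr \<alpha>"
          using H t \<alpha> d by (intro mult_left_mono powr_mono2) (auto simp: divide_right_mono)
        finally have "\<bar>u t x - u t y\<bar>\<^sup>2 \<le> (H * (2 * ?n * (?l / t)) powr \<alpha>)\<^sup>2" by (intro power_mono) auto
        also have "\<dots> = H\<^sup>2 * ((2 * ?n) powr (2 * \<alpha>) * (?l / t) powr (2 * \<alpha>))"
        proof -
          have sq: "(z powr \<alpha>)\<^sup>2 = z powr (2 * \<alpha>)" for z :: real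
            by (simp only: power2_eq_square powr_add[symmetric] mult_2)
          show ?thesis by (simp only: power_mult_distrib sq powr_mult)
        qed
        finally have "(u t x - u t y)\<^sup>2 \<le> H\<^sup>2 * ((2 * ?n) powr (2 * \<alpha>) * (?l / t) powr (2 * \<alpha>))" by simp
        moreover have "(u t x)\<^sup>2 \<le> 2 * (u t y)\<^sup>2 + 2 * (u t x - u t y)\<^sup>2"
          using zero_le_power2[of "2 * u t y - u t x"] by (simp add: power2_eq_square algebra_simps)
        ultimately have "(u t x)\<^sup>2 \<le> 2 * (u t y)\<^sup>2 + (2 * H\<^sup>2 * (2 * ?n) powr (2 * \<alpha>)) * (?l / t) powr (2 * \<alpha>)" by simp
        then have "ennreal ((u t x)\<^sup>2) \<le> ennreal (2 * (u t y)\<^sup>2 + (2 * H\<^sup>2 * (2 * ?n) powr (2 * \<alpha>)) * (?l / t) powr (2 * \<alpha>))"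
          by (rule ennreal_leI)
        also have "\<dots> = 2 * ennreal ((u t y)\<^sup>2) + ennreal (2 * H\<^sup>2 * (2 * ?n) powr (2 * \<alpha>)) * ennreal ((?l / t) powr (2 * \<alpha>))"
          by (subst ennreal_plus) (auto simp: ennreal_mult'[symmetric] ennreal_mult')
        finally show ?thesis using True lt by (simp add: indicator_def)
      qed (auto simp: indicator_def)
    qed
    also have "\<dots> = 2 * S (j + 1) q y + ennreal (2 * H\<^sup>2 * (2 * ?n) powr (2 * \<alpha>)) * (\<integral>\<^sup>+t. ?E t \<partial>dtt)"
      unfolding S_def by (subst nn_integral_add) (auto simp: nn_integral_cmult)
    also have "\<dots> \<le> 2 * ennreal N0 + ennreal (2 * H\<^sup>2 * (2 * ?n) powr (2 * \<alpha>)) * ennreal (1 / (2 * \<alpha>))"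
      using \<alpha> by (intro add_mono mult_left_mono that(2) dtt_powr_upper) auto
    also have "\<dots> = ennreal c"
    proof -
      have "2 * ennreal N0 = ennreal (2 * N0)" by (simp add: ennreal_mult')
      moreover have "ennreal (2 * H\<^sup>2 * (2 * ?n) powr (2 * \<alpha>)) * ennreal (1 / (2 * \<alpha>)) = ennreal (H\<^sup>2 * (2 * ?n) powr (2 * \<alpha>) / \<alpha>)"
        using \<alpha> by (subst ennreal_mult[symmetric]) auto
      ultimately show ?thesis
        unfolding c_def using N0 \<alpha> by (simp add: ennreal_plus[symmetric] del: ennreal_plus)
    qed
    finally show ?thesis .
  qed
  have claim: "avn q (S l q) x \<le> ennreal K" if "q = l - 1 + int i" for q i x
    using that
  proof (induction i arbitrary: q x rule: less_induct)
    case (less i)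
    show ?case
    proof (cases "i = 0")
      case True
      then have "S l q = (\<lambda>_. 0)" using less.prems by (simp add: S_def)
      then show ?thesis by simp
    next
      case False
      then have lq: "l \<le> q" using less.prems by simp
      define Q where "Q = cube_of q x"
      define F where "F = {y \<in> Q. S l q y \<le> ennreal N0}"
      have [measurable]: "Q \<in> sets borel" by (simp add: Q_def)
      have F [measurable]: "F \<in> sets borel" unfolding F_def by measurable
      have mF: "ennreal (\<eta> * cvol CARD('n) q) \<le> emeasure lborel F"
        using ample[OF lq, of x] unfolding F_def Q_def .
      define met where "met j z \<longleftrightarrow> (\<exists>y\<in>F. cube_index j y = cube_index j z)" for j z
      \<comment> \<open>The points not yet stopped: all their cubes of levels j to q meet
        \<open>F\<close>. So \<open>U j - U (j - 1)\<close> is the union of the stopping cubes of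
        level j - 1.\<close>
      define U where "U j = {z \<in> Q. \<forall>k\<in>{j..q}. met k z}" for j
      have "F \<noteq> {}"
      proof
        assume "F = {}"
        then have "\<eta> * cvol CARD('n) q \<le> 0" using mF by (simp add: ennreal_eq_0_iff)
        moreover have "\<eta> * cvol CARD('n) q > 0" using \<eta> by (intro mult_pos_pos) auto
        ultimately show False by linarith
      qed
      then have Uq: "U q = Q" by (auto simp: U_def met_def F_def Q_def cube_of_def)
      have Ulev: "z \<in> U j \<longleftrightarrow> z' \<in> U j" if "cube_index j z = cube_index j z'" "j \<le> q" for j z z'
      proof -
        have "cube_index k z = cube_index k z'" if "k \<ge> j" for k
          using cube_index_mono[OF \<open>cube_index j z = cube_index j z'\<close>] that by auto
        then show ?thesis using that(2) by (auto simp: U_def met_def Q_def cube_of_def)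
      qed
      have [measurable]: "U j \<in> sets borel" if "j \<le> q" for j
        using sets_level[of j "\<lambda>z. z \<in> U j", OF Ulev[OF _ that]] by simp
      have FU: "F \<subseteq> U j" for j by (auto simp: U_def met_def F_def)
      have dec: "U j \<subseteq> U (j + 1)" for j by (auto simp: U_def)
      have UQ: "U j \<subseteq> Q" for j by (auto simp: U_def)
      have bd: "S (j + 1) q z \<le> ennreal c" if z: "z \<in> U (j + 1)" and j: "l \<le> j + 1" "j + 1 \<le> q" for j z
      proof -
        have "met (j + 1) z" using z j by (auto simp: U_def)
        then obtain y where y: "y \<in> F" "cube_index (j + 1) y = cube_index (j + 1) z" by (auto simp: met_def)
        have "S (j + 1) q y \<le> S l q y" by (rule S_mono[OF j(1)])
        also have "\<dots> \<le> ennreal N0" using y(1) by (simp add: F_def)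
        finally show ?thesis by (rule compare[OF y(2)[symmetric]])
      qed
      \<comment> \<open>Downwards over the levels: relative to its measure, a stopping cube
        contributes at most K from the scales within it and c from those above.\<close>
      have step: "(\<integral>\<^sup>+z. indicator (Q - U j) z * S l q z \<partial>lborel) \<le> ennreal (c + K) * emeasure lborel (Q - U j)"
        if "j \<le> q" "l \<le> j" for j
        using that
      proof (induction j rule: int_le_induct)
        case base
        then show ?case by (simp add: Uq)
      next
        case (step j)
        let ?V = "U j - U (j - 1)"
        have lj: "l \<le> j" "l \<le> j - 1" "j \<le> q" using step by auto
        have [measurable]: "U j \<in> sets borel" "U (j - 1) \<in> sets borel" using lj by auto
        have V: "z \<in> ?V \<longleftrightarrow> z' \<in> ?V" if "cube_index (j - 1) z = cube_index (j - 1) z'" for z z'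
          using Ulev[OF that] Ulev[OF cube_index_mono[OF that, of j]] lj by auto
        have eq: "Q - U (j - 1) = (Q - U j) \<union> ?V" "(Q - U j) \<inter> ?V = {}" using dec[of "j - 1"] UQ[of j] by auto
        have "(\<integral>\<^sup>+z. indicator ?V z * S l q z \<partial>lborel) \<le> (\<integral>\<^sup>+z. indicator ?V z * S l (j - 1) z + ennreal c * indicator ?V z \<partial>lborel)"
        proof (intro nn_integral_mono)
          fix z
          show "indicator ?V z * S l q z \<le> indicator ?V z * S l (j - 1) z + ennreal c * indicator ?V z"
            using S_split[of l "j - 1" q z] bd[of z "j - 1"] lj by (auto simp: indicator_def add_left_mono)
        qed
        also have "\<dots> = (\<integral>\<^sup>+z. indicator ?V z * S l (j - 1) z \<partial>lborel) + ennreal c * emeasure lborel ?V"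
          by (subst nn_integral_add) (auto simp: nn_integral_cmult_indicator)
        also have "(\<integral>\<^sup>+z. indicator ?V z * S l (j - 1) z \<partial>lborel) \<le> ennreal K * emeasure lborel ?V"
        proof (rule nn_integral_level_le[OF _ V])
          fix z
          show "avn (j - 1) (S l (j - 1)) z \<le> ennreal K"
            by (rule less.IH[of "nat (j - l)"]) (use lj less.prems in auto)
        qed auto
        finally have 1: "(\<integral>\<^sup>+z. indicator ?V z * S l q z \<partial>lborel) \<le> ennreal (c + K) * emeasure lborel ?V"
          using c0 K0 by (simp add: distrib_right add.commute)
        have "(\<integral>\<^sup>+z. indicator (Q - U (j - 1)) z * S l q z \<partial>lborel) =
            (\<integral>\<^sup>+z. indicator (Q - U j) z * S l q z + indicator ?V z * S l q z \<partial>lborel)"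
          using eq by (intro nn_integral_cong) (auto simp: indicator_def)
        also have "\<dots> = (\<integral>\<^sup>+z. indicator (Q - U j) z * S l q z \<partial>lborel) + (\<integral>\<^sup>+z. indicator ?V z * S l q z \<partial>lborel)"
          by (rule nn_integral_add) measurable
        also have "\<dots> \<le> ennreal (c + K) * emeasure lborel (Q - U j) + ennreal (c + K) * emeasure lborel ?V"
          using lj by (intro add_mono 1 step.IH) auto
        also have "\<dots> = ennreal (c + K) * emeasure lborel (Q - U (j - 1))"
          unfolding eq(1) using eq(2) by (subst plus_emeasure[symmetric]) (auto simp: distrib_left)
        finally show ?case .
      qed
      have [measurable]: "U l \<in> sets borel" using lq by auto
      have "(\<integral>\<^sup>+z. indicator Q z * S l q z \<partial>lborel) \<le> (\<integral>\<^sup>+z. indicator (Q - U l) z * S l q z + ennreal c * indicator (U l) z \<partial>lborel)"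
      proof (intro nn_integral_mono)
        fix z
        show "indicator Q z * S l q z \<le> indicator (Q - U l) z * S l q z + ennreal c * indicator (U l) z"
          using bd[of z "l - 1"] lq by (auto simp: indicator_def)
      qed
      also have "\<dots> = (\<integral>\<^sup>+z. indicator (Q - U l) z * S l q z \<partial>lborel) + ennreal c * emeasure lborel (U l)"
        by (subst nn_integral_add) (auto simp: nn_integral_cmult_indicator)
      also have "\<dots> \<le> ennreal (c + K) * emeasure lborel (Q - U l) + ennreal c * emeasure lborel (U l)"
        using lq by (intro add_right_mono step) auto
      \<comment> \<open>The constant K is charged only to \<open>Q - U l\<close>, which misses
        \<open>F\<close>; c is charged to the whole cube.\<close>
      also have "\<dots> = ennreal K * emeasure lborel (Q - U l) + ennreal c * (emeasure lborel (Q - U l) + emeasure lborel (U l))"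
        using c0 K0 by (simp add: distrib_right distrib_left add_ac)
      also have "emeasure lborel (Q - U l) + emeasure lborel (U l) = emeasure lborel Q"
        using UQ[of l] by (subst plus_emeasure) (auto simp: Un_absorb2)
      also have "emeasure lborel (Q - U l) \<le> emeasure lborel (Q - F)"
        using FU[of l] by (intro emeasure_mono) auto
      also have "emeasure lborel (Q - F) \<le> ennreal ((1 - \<eta>) * cvol CARD('n) q)"
      proof -
        have "emeasure lborel (Q - F) = emeasure lborel Q - emeasure lborel F"
        proof (rule emeasure_Diff)
          have "emeasure lborel F \<le> emeasure lborel Q" by (rule emeasure_mono) (auto simp: F_def)
          then show "emeasure lborel F \<noteq> \<infinity>" unfolding Q_def by (auto simp: top_unique)
        qed (auto simp: F_def)
        also have "\<dots> \<le> ennreal (cvol CARD('n) q) - ennreal (\<eta> * cvol CARD('n) q)"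
          using mF by (simp add: Q_def ennreal_minus_mono)
        also have "\<dots> = ennreal ((1 - \<eta>) * cvol CARD('n) q)"
          using \<eta> by (simp add: ennreal_minus left_diff_distrib)
        finally show ?thesis .
      qed
      finally have "(\<integral>\<^sup>+z. indicator Q z * S l q z \<partial>lborel) \<le> ennreal K * ennreal ((1 - \<eta>) * cvol CARD('n) q) + ennreal c * ennreal (cvol CARD('n) q)"
        by (simp add: Q_def mult_left_mono add_right_mono)
      also have "\<dots> = ennreal (K * cvol CARD('n) q)"
      proof -
        have "K * ((1 - \<eta>) * cvol CARD('n) q) + c * cvol CARD('n) q = K * cvol CARD('n) q"
          unfolding K_def using \<eta> by (simp add: field_simps)
        then show ?thesis
          using K0 c0 \<eta> by (simp add: ennreal_mult'[symmetric] ennreal_plus[symmetric] del: ennreal_plus)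
      qed
      finally have "avn q (S l q) x \<le> ennreal (1 / cvol CARD('n) q) * ennreal (K * cvol CARD('n) q)"
        unfolding avn_def Q_def by (rule mult_left_mono) simp
      also have "\<dots> = ennreal K" using K0 by (simp add: ennreal_mult'[symmetric])
      finally show ?thesis .
    qed
  qed
  show ?thesis
  proof (cases "l \<le> q")
    case True
    then show ?thesis using claim[of q "nat (q - l + 1)" x] by (simp add: K_def c_def)
  next
    case False
    then have "S l q = (\<lambda>_. 0)" by (simp add: S_def)
    then show ?thesis by simp
  qed
qed

section \<open>Stopping cubes\<close>

text \<open>The gain (s/t)^a from cancellation is split: one half moves the weight from scale t to
  the side s of a cube, the other half stays for the integration in t.\<close>

lemma wt_fine_compare:
  fixes h :: "real ^ 'n"
  assumes "0 < s" "s \<le> 2 * t" "0 < a"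
  shows "(s / t) powr a * wt a t h \<le> 2 powr (real CARD('n) + a / 2) * ((s / t) powr (a / 2) * wt (a / 2) s h)"
proof -
  let ?n = "real CARD('n)" let ?h = "norm h"
  have t: "t > 0" using assms by simp
  have "s \<le> ?h + 2 * t" by (rule add_increasing[OF norm_ge_zero assms(2)])
  then have "(s + ?h) / 2 \<le> t + ?h" by simp
  then have "((s + ?h) / 2) powr (?n + a / 2) * t powr (a / 2) \<le> (t + ?h) powr (?n + a / 2) * (t + ?h) powr (a / 2)"
    using assms t by (intro mult_mono powr_mono2) auto
  also have "\<dots> = (t + ?h) powr (?n + a)"
    by (simp only: powr_add[symmetric] add.assoc field_sum_of_halves)
  finally have le: "(s + ?h) powr (?n + a / 2) * t powr (a / 2) \<le> 2 powr (?n + a / 2) * (t + ?h) powr (?n + a)"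
    by (simp add: powr_divide field_simps)
  have pos: "(s + ?h) powr (?n + a / 2) > 0" "(t + ?h) powr (?n + a) > 0" "t powr (a / 2) > 0"
    using assms t by simp_all
  have "(s / t) powr a * wt a t h = s powr a * (1 / (t + ?h) powr (?n + a))"
    unfolding wt_def using t assms by (simp add: powr_divide)
  also have "\<dots> \<le> s powr a * (2 powr (?n + a / 2) / ((s + ?h) powr (?n + a / 2) * t powr (a / 2)))"
  proof (intro mult_left_mono)
    show "1 / (t + ?h) powr (?n + a) \<le> 2 powr (?n + a / 2) / ((s + ?h) powr (?n + a / 2) * t powr (a / 2))"
      using le pos by (simp add: divide_simps)
  qed simp
  also have "s powr a = s powr (a / 2) * s powr (a / 2)" by (simp add: powr_add[symmetric])
  also have "s powr (a / 2) * s powr (a / 2) * (2 powr (?n + a / 2) / ((s + ?h) powr (?n + a / 2) * t powr (a / 2)))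
      = 2 powr (?n + a / 2) * ((s / t) powr (a / 2) * wt (a / 2) s h)"
    unfolding wt_def using t assms by (simp add: powr_divide mult_ac)
  finally show ?thesis .
qed

text \<open>At distance at least s, t + |h| is at least half of s + |h|, so passing to scale s gains
  (t/s)^a without any cancellation.\<close>

lemma wt_far_compare:
  fixes h :: "real ^ 'n"
  assumes "0 < s" "0 < t" "0 < a" "s \<le> norm h"
  shows "wt a t h \<le> 2 powr (real CARD('n) + a) * ((t / s) powr a * wt a s h)"
proof -
  let ?n = "real CARD('n)" let ?h = "norm h"
  have "((s + ?h) / 2) powr (?n + a) \<le> (t + ?h) powr (?n + a)"
    using assms by (intro powr_mono2) auto
  then have le: "(s + ?h) powr (?n + a) \<le> 2 powr (?n + a) * (t + ?h) powr (?n + a)"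
    by (simp add: powr_divide field_simps)
  have pos: "(s + ?h) powr (?n + a) > 0" "(t + ?h) powr (?n + a) > 0"
    using assms by simp_all
  have "wt a t h = t powr a * (1 / (t + ?h) powr (?n + a))"
    unfolding wt_def by simp
  also have "\<dots> \<le> t powr a * (2 powr (?n + a) / (s + ?h) powr (?n + a))"
    using le pos by (intro mult_left_mono) (auto simp: divide_simps)
  also have "\<dots> = 2 powr (?n + a) * ((t / s) powr a * wt a s h)"
    unfolding wt_def using assms by (simp add: powr_divide)
  finally show ?thesis .
qed

text \<open>A weight that varies little on each cube is bounded by a multiple of its average;
  self-adjointness then moves the averaging onto \<open>B\<close>.\<close>

lemma weight_avg:
  fixes w B :: "real ^ 'n \<Rightarrow> ennreal"
  assumes [measurable]: "w \<in> borel_measurable borel" "B \<in> borel_measurable borel"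
    and V: "\<And>x y. cube_index j x = cube_index j y \<Longrightarrow> x \<in> V \<longleftrightarrow> y \<in> V"
    and w: "\<And>x y. cube_index j x = cube_index j y \<Longrightarrow> w x \<le> c * w y"
  shows "(\<integral>\<^sup>+y. w y * (indicator V y * B y) \<partial>lborel) \<le> c * (\<integral>\<^sup>+y. w y * (indicator V y * avn j B y) \<partial>lborel)"
proof -
  have [measurable]: "V \<in> sets borel" using sets_level[of j "\<lambda>x. x \<in> V", OF V] by simp
  have "w y \<le> c * avn j w y" for y
  proof -
    have "w y = avn j (\<lambda>_. w y) y" by simp
    also have "\<dots> \<le> avn j (\<lambda>z. c * w z) y" by (rule avn_mono) (rule w, simp)
    also have "\<dots> = c * avn j w y" by (rule avn_cmult) measurable
    finally show ?thesis .
  qed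
  then have "(\<integral>\<^sup>+y. w y * (indicator V y * B y) \<partial>lborel) \<le> (\<integral>\<^sup>+y. c * (avn j w y * (indicator V y * B y)) \<partial>lborel)"
    unfolding mult.assoc[symmetric] by (intro nn_integral_mono mult_right_mono) auto
  also have "\<dots> = c * (\<integral>\<^sup>+y. avn j w y * (indicator V y * B y) \<partial>lborel)"
    by (rule nn_integral_cmult) measurable
  also have "(\<integral>\<^sup>+y. avn j w y * (indicator V y * B y) \<partial>lborel) = (\<integral>\<^sup>+y. w y * avn j (\<lambda>y. indicator V y * B y) y \<partial>lborel)"
    by (rule avn_selfadjoint[symmetric]) measurable
  also have "\<dots> = (\<integral>\<^sup>+y. w y * (indicator V y * avn j B y) \<partial>lborel)"
    by (intro nn_integral_cong arg_cong2[where f="(*)"] refl avn_pull)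
       (auto simp: indicator_def dest: V[THEN iffD1] V[THEN iffD2])
  finally show ?thesis .
qed

lemma avn_child_le: "avn j u x \<le> ennreal (2 ^ CARD('n)) * avn (j + 1) u x" for x :: "real ^ 'n"
proof -
  have c: "1 / cvol CARD('n) j = 2 ^ CARD('n) * (1 / cvol CARD('n) (j + 1))"
    unfolding cvol_def by (simp add: power_int_add power_mult_distrib)
  have "avn j u x \<le> ennreal (1 / cvol CARD('n) j) * (\<integral>\<^sup>+y. indicator (cube_of (j + 1) x) y * u y \<partial>lborel)"
    unfolding avn_def
    by (rule mult_left_mono, rule nn_integral_mono)
       (auto simp: indicator_def cube_of_def dest: cube_index_mono[where j="j + 1"])
  also have "\<dots> = ennreal (2 ^ CARD('n)) * avn (j + 1) u x"
  proof -
    have "ennreal (1 / cvol CARD('n) j) = ennreal (2 ^ CARD('n)) * ennreal (1 / cvol CARD('n) (j + 1))"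
      unfolding c by (rule ennreal_mult) auto
    then show ?thesis unfolding avn_def by (simp only: mult.assoc)
  qed
  finally show ?thesis .
qed

text \<open>\<open>B\<close> majorises all entries of a test function, so that a single family of
  stopping cubes at height \<open>K\<close> serves them all.\<close>

locale stopping =
  fixes l q :: int and x0 :: "real ^ 'n" and B :: "real ^ 'n \<Rightarrow> ennreal" and K :: real
  assumes lq: "l \<le> q" and K: "K > 0" and measurable_B [measurable]: "B \<in> borel_measurable borel"
    and Bfin: "\<And>j x. avn j B x < \<infinity>" and top_good: "avn q B x0 \<le> ennreal K"
begin

definition Q :: "(real ^ 'n) set"
  where "Q = cube_of q x0"

definition bad :: "int \<Rightarrow> real ^ 'n \<Rightarrow> bool"
  where "bad j y \<longleftrightarrow> ennreal K < avn j B y"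

text \<open>\<open>Vb j\<close> is the union of the maximal bad cubes of side \<open>2 powi j\<close>. The sets \<open>V j\<close> complete them to a
  partition of \<open>Q\<close> by counting the cubes of the lowest level that are in no bad cube as leaves.\<close>

definition V :: "int \<Rightarrow> (real ^ 'n) set"
  where "V j = {y \<in> Q. (j = l \<or> bad j y) \<and> (\<forall>i\<in>{j<..q}. \<not> bad i y)}"

definition Vb :: "int \<Rightarrow> (real ^ 'n) set"
  where "Vb j = {y \<in> Q. bad j y \<and> (\<forall>i\<in>{j<..q}. \<not> bad i y)}"

definition bad_set :: "(real ^ 'n) set"
  where "bad_set = {y \<in> Q. \<exists>j\<in>{l..q}. bad j y}"

lemma sets_Q [measurable]: "Q \<in> sets borel"
  by (simp add: Q_def)

lemma bad_cong: "cube_index j x = cube_index j y \<Longrightarrow> bad j x = bad j y"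
  unfolding bad_def using avn_cong by metis

lemma Q_level:
  assumes "cube_index j y = cube_index j z" "j \<le> q"
  shows "y \<in> Q \<longleftrightarrow> z \<in> Q"
  using cube_index_mono[OF assms] by (simp add: Q_def cube_of_def)

lemma bad_mono:
  assumes "cube_index j y = cube_index j z" "j \<le> i"
  shows "bad i y = bad i z"
  by (rule bad_cong) (rule cube_index_mono[OF assms])

lemma V_level:
  assumes "cube_index j y = cube_index j z" "j \<le> q"
  shows "y \<in> V j \<longleftrightarrow> z \<in> V j"
  using Q_level[OF assms] bad_mono[OF assms(1)] by (auto simp: V_def)

lemma Vb_level:
  assumes "cube_index j y = cube_index j z" "j \<le> q"
  shows "y \<in> Vb j \<longleftrightarrow> z \<in> Vb j"
  using Q_level[OF assms] bad_mono[OF assms(1)] by (auto simp: Vb_def)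

lemma sets_V [measurable]: "j \<in> {l..q} \<Longrightarrow> V j \<in> sets borel"
  using sets_level[of j "\<lambda>x. x \<in> V j", OF V_level] by simp

lemma sets_Vb [measurable]: "j \<in> {l..q} \<Longrightarrow> Vb j \<in> sets borel"
  using sets_level[of j "\<lambda>x. x \<in> Vb j", OF Vb_level] by simp

lemma Max_bad:
  assumes "i \<in> {l..q}" "bad i y"
  obtains j where "j \<in> {l..q}" "bad j y" "\<forall>i\<in>{j<..q}. \<not> bad i y"
proof -
  let ?S = "{j \<in> {l..q}. bad j y}"
  have "finite ?S" by (rule finite_subset[of _ "{l..q}"]) auto
  moreover have "?S \<noteq> {}" using assms by blast
  ultimately have fin: "finite ?S" "?S \<noteq> {}" by auto
  have "Max ?S \<in> ?S" using fin by (rule Max_in)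
  moreover have "\<not> bad i y" if "i \<in> {Max ?S<..q}" for i
  proof
    assume "bad i y"
    then have "i \<in> ?S" using that calculation by auto
    then show False using Max_ge[OF fin(1), of i] that by auto
  qed
  ultimately show ?thesis using that[of "Max ?S"] by blast
qed

lemma V_cover:
  assumes "y \<in> Q"
  obtains j where "j \<in> {l..q}" "y \<in> V j"
proof (cases "\<exists>i\<in>{l..q}. bad i y")
  case True
  then obtain i where i: "i \<in> {l..q}" "bad i y" by auto
  from Max_bad[OF i] obtain j where "j \<in> {l..q}" "bad j y" "\<forall>i\<in>{j<..q}. \<not> bad i y" .
  then show ?thesis using assms that[of j] by (auto simp: V_def)
next
  case False
  then show ?thesis using assms lq that[of l] by (auto simp: V_def)
qed

lemma V_disjoint:
  assumes "y \<in> V i" "y \<in> V j" "i \<in> {l..q}" "j \<in> {l..q}"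
  shows "i = j"
proof -
  have False if "y \<in> V i" "y \<in> V j" "i < j" "i \<in> {l..q}" "j \<in> {l..q}" for i j
    using that by (auto simp: V_def)
  then show ?thesis using assms by (meson linorder_neqE)
qed

lemma sum_indicator_V:
  fixes c :: "int \<Rightarrow> 'b::semiring_1"
  assumes "y \<in> V j" "j \<in> {l..q}"
  shows "(\<Sum>i\<in>{l..q}. indicator (V i) y * c i) = c j"
proof -
  have "(\<Sum>i\<in>{l..q}. indicator (V i) y * c i) = (\<Sum>i\<in>{l..q}. if i = j then c i else 0)"
  proof (intro sum.cong refl)
    fix i assume "i \<in> {l..q}"
    then show "indicator (V i) y * c i = (if i = j then c i else 0)"
      using V_disjoint[of y i j] assms by (cases "i = j") (auto simp: indicator_def)
  qed
  then show ?thesis using assms(2) by (simp add: sum.delta)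
qed

lemma V_sub: "V j \<subseteq> Q" "Vb j \<subseteq> Q" "Vb j \<subseteq> V j"
  by (auto simp: V_def Vb_def)

lemma sum_indicator_V_outside:
  assumes "y \<notin> Q"
  shows "(\<Sum>i\<in>{l..q}. indicator (V i) y * c i) = (0 :: 'b::semiring_1)"
  using assms V_sub by (intro sum.neutral) (auto simp: indicator_def)

lemma V_bad: "j \<noteq> l \<Longrightarrow> V j = Vb j"
  by (auto simp: V_def Vb_def)

lemma Vb_bad_set:
  assumes "y \<in> bad_set"
  obtains j where "j \<in> {l..q}" "y \<in> Vb j"
proof -
  obtain i where i: "i \<in> {l..q}" "bad i y" and y: "y \<in> Q" using assms by (auto simp: bad_set_def)
  from Max_bad[OF i] obtain j where "j \<in> {l..q}" "bad j y" "\<forall>i\<in>{j<..q}. \<not> bad i y" .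
  then show ?thesis using y that[of j] by (auto simp: Vb_def)
qed

text \<open>The parent of a leaf is not bad, and the average over a child is at most 2^n times the
  one over the parent; the top cube is good by assumption.\<close>

lemma avn_V_le:
  assumes "y \<in> V j" "j \<in> {l..q}"
  shows "avn j B y \<le> ennreal (2 ^ CARD('n) * K)"
proof (cases "j = q")
  case True
  have "avn q B y = avn q B x0"
    using assms V_sub by (intro avn_cong) (auto simp: Q_def cube_of_def)
  then have "avn j B y \<le> ennreal (1 * K)" using True top_good by simp
  also have "\<dots> \<le> ennreal (2 ^ CARD('n) * K)" using K by (intro ennreal_leI mult_right_mono) auto
  finally show ?thesis .
next
  case False
  then have "\<not> bad (j + 1) y" using assms by (auto simp: V_def)
  then have "avn (j + 1) B y \<le> ennreal K" by (simp add: bad_def)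
  then have "ennreal (2 ^ CARD('n)) * avn (j + 1) B y \<le> ennreal (2 ^ CARD('n)) * ennreal K"
    by (rule mult_left_mono) simp
  then show ?thesis
    using avn_child_le[of j B y] by (simp add: ennreal_mult')
qed

text \<open>Chebyshev's inequality cube by cube, since \<open>B\<close> averages to more than
  \<open>K\<close> on each bad cube.\<close>

lemma measure_Vb:
  assumes "j \<in> {l..q}"
  shows "ennreal K * emeasure lborel (Vb j) \<le> (\<integral>\<^sup>+y. indicator (Vb j) y * B y \<partial>lborel)"
proof -
  have [measurable]: "Vb j \<in> sets borel" using assms by (rule sets_Vb)
  have "ennreal K * emeasure lborel (Vb j) = (\<integral>\<^sup>+y. ennreal K * indicator (Vb j) y \<partial>lborel)"
    by (rule nn_integral_cmult_indicator[symmetric]) simp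
  also have "\<dots> \<le> (\<integral>\<^sup>+y. indicator (Vb j) y * avn j B y \<partial>lborel)"
    by (intro nn_integral_mono) (auto simp: indicator_def Vb_def bad_def less_imp_le)
  also have "\<dots> = (\<integral>\<^sup>+y. indicator (Vb j) y * B y \<partial>lborel)"
    by (rule nn_integral_avn_weight)
       (use assms in \<open>auto simp: indicator_def dest: Vb_level[THEN iffD1] Vb_level[THEN iffD2]\<close>)
  finally show ?thesis .
qed

text \<open>The weak type bound for the dyadic maximal function: disjointness of the leaves keeps
  the sum of their integrals below the integral over \<open>Q\<close>.\<close>

lemma measure_sum_Vb: "ennreal K * (\<Sum>j\<in>{l..q}. emeasure lborel (Vb j)) \<le> (\<integral>\<^sup>+y. indicator Q y * B y \<partial>lborel)"
proof -
  have "ennreal K * (\<Sum>j\<in>{l..q}. emeasure lborel (Vb j)) \<le> (\<Sum>j\<in>{l..q}. \<integral>\<^sup>+y. indicator (Vb j) y * B y \<partial>lborel)"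
    unfolding sum_distrib_left by (intro sum_mono measure_Vb)
  also have "\<dots> = (\<integral>\<^sup>+y. (\<Sum>j\<in>{l..q}. indicator (Vb j) y * B y) \<partial>lborel)"
    by (rule nn_integral_sum[symmetric]) auto
  also have "\<dots> \<le> (\<integral>\<^sup>+y. indicator Q y * B y \<partial>lborel)"
  proof (rule nn_integral_mono)
    fix y
    have "(\<Sum>j\<in>{l..q}. indicator (Vb j) y * B y) \<le> (\<Sum>j\<in>{l..q}. indicator (V j) y * B y)"
      using V_sub(3) by (intro sum_mono) (auto simp: indicator_def)
    also have "\<dots> \<le> indicator Q y * B y"
    proof (cases "y \<in> Q")
      case True
      from V_cover[OF True] obtain j where "j \<in> {l..q}" "y \<in> V j" .
      then show ?thesis using sum_indicator_V[of y j "\<lambda>_. B y"] True by simp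
    next
      case False
      then show ?thesis using sum_indicator_V_outside[of y "\<lambda>_. B y"] by simp
    qed
    finally show "(\<Sum>j\<in>{l..q}. indicator (Vb j) y * B y) \<le> indicator Q y * B y" .
  qed
  finally show ?thesis .
qed

text \<open>The Marcinkiewicz-type integral of the family of bad leaves. Where it is small, the point
  is far from every bad leaf, and the contribution of all leaves to the square function converges.\<close>

definition Phi :: "real \<Rightarrow> real ^ 'n \<Rightarrow> ennreal"
  where "Phi b x = (\<Sum>j\<in>{l..q}. \<integral>\<^sup>+y. indicator (Vb j) y * ennreal (wt b (2 powi j) (x - y)) \<partial>lborel)"

lemma measurable_Phi [measurable]: "Phi b \<in> borel_measurable borel"
  unfolding Phi_def by measurable

text \<open>Integrating in x first, every point of a bad leaf contributes the mass of its
  weight.\<close>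

lemma integral_Phi:
  assumes "b > 0"
  shows "(\<integral>\<^sup>+x. Phi b x \<partial>lborel) \<le> ennreal (Wc CARD('n) b) * (\<Sum>j\<in>{l..q}. emeasure lborel (Vb j))"
proof -
  have "(\<integral>\<^sup>+x. Phi b x \<partial>lborel) = (\<Sum>j\<in>{l..q}. \<integral>\<^sup>+x. \<integral>\<^sup>+y. indicator (Vb j) y * ennreal (wt b (2 powi j) (x - y)) \<partial>lborel \<partial>lborel)"
    unfolding Phi_def by (rule nn_integral_sum) measurable
  also have "\<dots> \<le> (\<Sum>j\<in>{l..q}. ennreal (Wc CARD('n) b) * emeasure lborel (Vb j))"
  proof (rule sum_mono)
    fix j assume j: "j \<in> {l..q}"
    then have [measurable]: "Vb j \<in> sets borel" by (rule sets_Vb)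
    have "(\<integral>\<^sup>+x. \<integral>\<^sup>+y. indicator (Vb j) y * ennreal (wt b (2 powi j) (x - y)) \<partial>lborel \<partial>lborel)
        = (\<integral>\<^sup>+y. \<integral>\<^sup>+x. indicator (Vb j) y * ennreal (wt b (2 powi j) (x - y)) \<partial>lborel \<partial>lborel)"
      by (rule lborel_pair.Fubini') measurable
    also have "\<dots> = (\<integral>\<^sup>+y. indicator (Vb j) y * (\<integral>\<^sup>+x. ennreal (wt b (2 powi j) (y - x)) \<partial>lborel) \<partial>lborel)"
      by (subst wt_sym) (simp add: nn_integral_cmult)
    also have "\<dots> \<le> (\<integral>\<^sup>+y. indicator (Vb j) y * ennreal (Wc CARD('n) b) \<partial>lborel)"
      using assms by (intro nn_integral_mono mult_left_mono nn_integral_wt) auto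
    also have "\<dots> = ennreal (Wc CARD('n) b) * emeasure lborel (Vb j)"
      by (subst nn_integral_multc) (auto simp: mult.commute)
    finally show "(\<integral>\<^sup>+x. \<integral>\<^sup>+y. indicator (Vb j) y * ennreal (wt b (2 powi j) (x - y)) \<partial>lborel \<partial>lborel)
        \<le> ennreal (Wc CARD('n) b) * emeasure lborel (Vb j)" .
  qed
  finally show ?thesis by (simp add: sum_distrib_left)
qed

text \<open>A bad cube of side s within distance s of x adds at least (2 + n)^(-(n+1)) to
  \<open>Phi\<close>: its points z satisfy s + |x - z| \<le> (2 + n) s, and \<open>b \<le> 1\<close>
  bounds the exponent. The threshold is half of that.\<close>

lemma far_from_bad:
  assumes b: "0 < b" "b \<le> 1" and Phi: "Phi b x \<le> ennreal ((2 + real CARD('n)) powr (- (real CARD('n) + 1)) / 2)"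
    and j: "j \<in> {l..q}" and y: "y \<in> Vb j"
  shows "2 powi j < norm (x - y)"
proof (rule ccontr)
  let ?n = "real CARD('n)" let ?s = "2 powi j :: real"
  assume "\<not> ?s < norm (x - y)"
  then have xy: "norm (x - y) \<le> ?s" by simp
  have [measurable]: "Vb j \<in> sets borel" using j by (rule sets_Vb)
  let ?c = "(2 + ?n) powr (- (?n + 1))"
  have low: "ennreal (?c * (1 / cvol CARD('n) j)) * indicator (cube_of j y) z \<le> indicator (Vb j) z * ennreal (wt b ?s (x - z))" for z
  proof (cases "z \<in> cube_of j y")
    case True
    then have z: "cube_index j y = cube_index j z" by (simp add: cube_of_def)
    then have "z \<in> Vb j" using Vb_level[OF z] y j by auto
    have "norm (x - z) \<le> norm (x - y) + norm (y - z)" using norm_triangle_ineq[of "x - y" "y - z"] by simp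
    also have "\<dots> \<le> ?s + ?n * ?s" using xy norm_diff_cube_index[OF z] by simp
    finally have "?s + norm (x - z) \<le> (2 + ?n) * ?s" by (simp add: distrib_right)
    then have "(?s + norm (x - z)) powr (?n + b) \<le> ((2 + ?n) * ?s) powr (?n + b)"
      using b by (intro powr_mono2) auto
    also have "\<dots> = (2 + ?n) powr (?n + b) * (?s powr ?n * ?s powr b)"
      by (simp add: powr_mult powr_add)
    also have "\<dots> \<le> (2 + ?n) powr (?n + 1) * (?s powr ?n * ?s powr b)"
      using b by (intro mult_right_mono powr_mono) auto
    finally have le: "(?s + norm (x - z)) powr (?n + b) \<le> (2 + ?n) powr (?n + 1) * (?s powr ?n * ?s powr b)" .
    have pos: "(?s + norm (x - z)) powr (?n + b) > 0" "?s powr b > 0" "?s powr ?n > 0" "(2 + ?n) powr (?n + 1) > 0"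
      by (auto simp: powr_gt_zero intro!: less_imp_neq[symmetric])
    have "?s powr ?n = cvol CARD('n) j" by (simp add: cvol_def powr_realpow)
    moreover have "?c = 1 / (2 + ?n) powr (?n + 1)" by (rule powr_minus_divide)
    ultimately have "?c * (1 / cvol CARD('n) j) = ?s powr b / ((2 + ?n) powr (?n + 1) * (?s powr ?n * ?s powr b))"
      using pos(2) by simp
    also have "\<dots> \<le> wt b ?s (x - z)"
      unfolding wt_def using le pos by (intro divide_left_mono mult_pos_pos) auto
    finally show ?thesis using True \<open>z \<in> Vb j\<close> by (simp add: ennreal_leI)
  qed simp
  have "ennreal ?c = ennreal (?c * (1 / cvol CARD('n) j)) * emeasure lborel (cube_of j y)"
    by (simp add: ennreal_mult[symmetric])
  also have "\<dots> = (\<integral>\<^sup>+z. ennreal (?c * (1 / cvol CARD('n) j)) * indicator (cube_of j y) z \<partial>lborel)"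
    by (rule nn_integral_cmult_indicator[symmetric]) simp
  also have "\<dots> \<le> (\<integral>\<^sup>+z. indicator (Vb j) z * ennreal (wt b ?s (x - z)) \<partial>lborel)"
    by (rule nn_integral_mono) (rule low)
  also have "\<dots> \<le> Phi b x"
    unfolding Phi_def using j by (intro member_le_sum) auto
  also have "\<dots> \<le> ennreal (?c / 2)" by (rule Phi)
  finally have "?c \<le> ?c / 2" by (subst (asm) ennreal_le_iff) auto
  moreover have "?c > 0" by simp
  ultimately show False by linarith
qed

lemma not_bad:
  assumes b: "0 < b" "b \<le> 1" and Phi: "Phi b x \<le> ennreal ((2 + real CARD('n)) powr (- (real CARD('n) + 1)) / 2)"
    and x: "x \<in> Q" and j: "j \<in> {l..q}"
  shows "\<not> bad j x"
proof
  assume "bad j x"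
  then have "x \<in> bad_set" using x j by (auto simp: bad_set_def)
  then obtain i where i: "i \<in> {l..q}" "x \<in> Vb i" by (rule Vb_bad_set)
  have "2 powi i < (0 :: real)" using far_from_bad[OF b Phi i] by simp
  moreover have "(0 :: real) < 2 powi i" by simp
  ultimately show False by linarith
qed

text \<open>In the Calderon--Zygmund decomposition the leaves of the lowest level that are not bad
  are averaged as well. This bounds the good part everywhere, and their atoms meet only scales t of
  at least half their side, where cancellation is available.\<close>

definition leaf :: "(real ^ 'n \<Rightarrow> complex) \<Rightarrow> int \<Rightarrow> real ^ 'n \<Rightarrow> complex"
  where "leaf f j y = indicator (V j) y * f y"

definition good_part :: "(real ^ 'n \<Rightarrow> complex) \<Rightarrow> real ^ 'n \<Rightarrow> complex"
  where "good_part f y = (\<Sum>j\<in>{l..q}. avg j (leaf f j) y)"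

definition atom_part :: "(real ^ 'n \<Rightarrow> complex) \<Rightarrow> real ^ 'n \<Rightarrow> complex"
  where "atom_part f y = (\<Sum>j\<in>{l..q}. leaf f j y - avg j (leaf f j) y)"

definition tail_part :: "(real ^ 'n \<Rightarrow> complex) \<Rightarrow> real ^ 'n \<Rightarrow> complex"
  where "tail_part f y = indicator (- Q) y * f y"

lemma sum_leaf: "(\<Sum>j\<in>{l..q}. leaf f j y) = indicator Q y * f y"
proof (cases "y \<in> Q")
  case True
  from V_cover[OF True] obtain j where "j \<in> {l..q}" "y \<in> V j" .
  then show ?thesis unfolding leaf_def using sum_indicator_V[of y j "\<lambda>_. f y"] True by simp
next
  case False
  then show ?thesis unfolding leaf_def using sum_indicator_V_outside[of y "\<lambda>_. f y"] by simp
qed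

lemma decomposition: "f y = atom_part f y + good_part f y + tail_part f y"
  unfolding atom_part_def good_part_def tail_part_def sum_subtractf sum_leaf
  by (simp add: indicator_def)

lemma measurable_leaf [measurable (raw)]:
  "j \<in> {l..q} \<Longrightarrow> f \<in> borel_measurable borel \<Longrightarrow> leaf f j \<in> borel_measurable borel"
  unfolding leaf_def by measurable

lemma measurable_good_part [measurable (raw)]: "good_part f \<in> borel_measurable borel"
  unfolding good_part_def by measurable

lemma measurable_tail_part [measurable (raw)]:
  "f \<in> borel_measurable borel \<Longrightarrow> tail_part f \<in> borel_measurable borel"
  unfolding tail_part_def by measurable

lemma norm_leaf_le:
  assumes "\<And>y. ennreal (norm (f y)) \<le> B y"
  shows "ennreal (norm (leaf f j y)) \<le> indicator (V j) y * B y"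
  using assms[of y] by (auto simp: leaf_def indicator_def)

lemma norm_avg_leaf_le:
  assumes "\<And>y. ennreal (norm (f y)) \<le> B y" and j: "j \<in> {l..q}"
  shows "ennreal (norm (avg j (leaf f j) y)) \<le> indicator (V j) y * avn j B y"
proof -
  have "ennreal (norm (avg j (leaf f j) y)) \<le> avn j (\<lambda>y. ennreal (norm (leaf f j y))) y"
    by (rule norm_avg_le)
  also have "\<dots> \<le> avn j (\<lambda>y. indicator (V j) y * B y) y"
    by (rule avn_mono) (rule norm_leaf_le[OF assms(1)])
  also have "\<dots> = indicator (V j) y * avn j B y"
    by (rule avn_pull) (use j in \<open>auto simp: indicator_def dest: V_level[THEN iffD1] V_level[THEN iffD2]\<close>)
  finally show ?thesis .
qed

lemma locint_leaf:
  assumes [measurable]: "f \<in> borel_measurable borel" and f: "\<And>y. ennreal (norm (f y)) \<le> B y" and j: "j \<in> {l..q}"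
  shows "locint (leaf f j)"
  unfolding locint_def
proof (intro conjI allI)
  show "leaf f j \<in> borel_measurable borel" using j by measurable
  fix i and x :: "real ^ 'n"
  have "avn i (\<lambda>y. ennreal (norm (leaf f j y))) x \<le> avn i B x"
    using f by (intro avn_mono) (auto simp: leaf_def indicator_def)
  then show "avn i (\<lambda>y. ennreal (norm (leaf f j y))) x < \<infinity>"
    using Bfin by (rule le_less_trans)
qed

text \<open>Only the leaf containing y contributes, and the average of \<open>B\<close> over it is
  at most 2^n K.\<close>

lemma norm_good_part_le:
  assumes "\<And>y. ennreal (norm (f y)) \<le> B y"
  shows "norm (good_part f y) \<le> indicator Q y * (2 ^ CARD('n) * K)"
proof (cases "y \<in> Q")
  case True
  from V_cover[OF True] obtain j where j: "j \<in> {l..q}" "y \<in> V j" .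
  have "avg i (leaf f i) y = 0" if "i \<in> {l..q}" "i \<noteq> j" for i
  proof -
    have "y \<notin> V i" using V_disjoint[of y i j] j that by blast
    then show ?thesis using norm_avg_leaf_le[OF assms that(1), of y] by simp
  qed
  then have "good_part f y = (\<Sum>i\<in>{l..q}. if i = j then avg j (leaf f j) y else 0)"
    unfolding good_part_def by (intro sum.cong) auto
  also have "\<dots> = avg j (leaf f j) y" using j by (simp add: sum.delta)
  finally have "ennreal (norm (good_part f y)) \<le> indicator (V j) y * avn j B y"
    using norm_avg_leaf_le[OF assms j(1), of y] by simp
  also have "\<dots> \<le> ennreal (2 ^ CARD('n) * K)"
    using avn_V_le[OF j(2,1)] j(2) by simp
  finally show ?thesis using True K by (simp add: ennreal_le_iff)
next
  case False
  have "avg i (leaf f i) y = 0" if "i \<in> {l..q}" for i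
  proof -
    have "y \<notin> V i" using V_sub(1)[of i] False by blast
    then show ?thesis using norm_avg_leaf_le[OF assms that, of y] by simp
  qed
  then have "good_part f y = 0" unfolding good_part_def by (intro sum.neutral) auto
  then show ?thesis using False by simp
qed

lemma sqn_good_part:
  assumes "\<And>y. ennreal (norm (f y)) \<le> B y"
  shows "sqn (good_part f) \<le> ennreal ((2 ^ CARD('n) * K)\<^sup>2 * cvol CARD('n) q)"
proof -
  have "sqn (good_part f) \<le> (\<integral>\<^sup>+y. ennreal ((2 ^ CARD('n) * K)\<^sup>2) * indicator Q y \<partial>lborel)"
    unfolding sqn_def
  proof (rule nn_integral_mono)
    fix y
    have "(norm (good_part f y))\<^sup>2 \<le> (indicator Q y * (2 ^ CARD('n) * K))\<^sup>2"
      by (rule power_mono[OF norm_good_part_le[OF assms]]) auto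
    then have "ennreal ((norm (good_part f y))\<^sup>2) \<le> ennreal ((indicator Q y * (2 ^ CARD('n) * K))\<^sup>2)" by (rule ennreal_leI)
    then show "(ennreal (norm (good_part f y)))\<^sup>2 \<le> ennreal ((2 ^ CARD('n) * K)\<^sup>2) * indicator Q y"
      by (auto simp: ennreal_power indicator_def)
  qed
  also have "\<dots> = ennreal ((2 ^ CARD('n) * K)\<^sup>2) * ennreal (cvol CARD('n) q)"
    by (subst nn_integral_cmult_indicator) (auto simp: Q_def)
  finally show ?thesis by (simp add: ennreal_mult'[symmetric])
qed

lemma L2_good_part:
  assumes "\<And>y. ennreal (norm (f y)) \<le> B y"
  shows "L2 (good_part f)"
  unfolding L2_def using le_less_trans[OF sqn_good_part[OF assms] ennreal_less_top] by simp

lemma avg_sum: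
  fixes F :: "int \<Rightarrow> real ^ 'n \<Rightarrow> complex"
  assumes "\<And>i. i \<in> I \<Longrightarrow> locint (F i)"
  shows "avg k (\<lambda>y. \<Sum>i\<in>I. F i y) x = (\<Sum>i\<in>I. avg k (F i) x)"
  using locint_integrable[OF assms]
  unfolding avg_def by (simp add: scaleR_sum_right)

text \<open>Leaves of level at most \<open>k\<close> are averaged within the cube of level
  \<open>k\<close>, which keeps its average. A larger leaf meeting that cube would contain x and be
  bad.\<close>

lemma avg_good_part:
  assumes [measurable]: "f \<in> borel_measurable borel" and f: "\<And>y. ennreal (norm (f y)) \<le> B y"
    and k: "k \<in> {l..q}" and x: "x \<in> Q" and nb: "\<And>j. j \<in> {l..q} \<Longrightarrow> \<not> bad j x"
  shows "avg k (good_part f) x = avg k f x"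
proof -
  have e: "avg k (avg j (leaf f j)) x = avg k (leaf f j) x" if j: "j \<in> {l..q}" for j
  proof (cases "j \<le> k")
    case True
    then show ?thesis using avg_tower[OF locint_leaf[OF _ f j]] by simp
  next
    case False
    then have jl: "j \<noteq> l" using k by auto
    have out: "y \<notin> V j" if "cube_index k y = cube_index k x" for y
    proof
      assume "y \<in> V j"
      then have "bad j y" using jl by (simp add: V_def)
      then have "bad j x" using bad_mono[OF that, of j] False by simp
      then show False using nb[OF j] by simp
    qed
    have "avg k (leaf f j) x = avg k (\<lambda>_. 0) x"
      by (rule avg_cong_fun) (use out in \<open>auto simp: leaf_def\<close>)
    moreover have "avg k (avg j (leaf f j)) x = avg k (\<lambda>_. 0) x"
    proof (rule avg_cong_fun)
      fix y assume "cube_index k y = cube_index k x"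
      then show "avg j (leaf f j) y = 0"
        using norm_avg_leaf_le[OF f j, of y] out[of y] by (simp add: indicator_def)
    qed
    ultimately show ?thesis by simp
  qed
  have "avg k (good_part f) x = (\<Sum>j\<in>{l..q}. avg k (avg j (leaf f j)) x)"
    unfolding good_part_def[abs_def] by (rule avg_sum) (intro locint_avg locint_leaf f, auto)
  also have "\<dots> = (\<Sum>j\<in>{l..q}. avg k (leaf f j) x)"
    by (intro sum.cong refl e)
  also have "\<dots> = avg k (\<lambda>y. \<Sum>j\<in>{l..q}. leaf f j y) x"
    by (rule avg_sum[symmetric]) (intro locint_leaf f, auto)
  also have "\<dots> = avg k f x"
  proof (rule avg_cong_fun)
    fix y assume "cube_index k y = cube_index k x"
    then have "y \<in> Q" using x Q_level[of k y x] k by auto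
    then show "(\<Sum>j\<in>{l..q}. leaf f j y) = f y" by (simp add: sum_leaf)
  qed
  finally show ?thesis .
qed

lemma integral_Q_B: "(\<integral>\<^sup>+y. indicator Q y * B y \<partial>lborel) < \<infinity>"
proof -
  have "avn q B x0 < \<infinity>" by (rule Bfin)
  then show ?thesis unfolding avn_def Q_def by (auto simp: ennreal_mult_less_top)
qed

end

section \<open>Contributions of the leaves and of the tail\<close>

definition cS :: "nat \<Rightarrow> real \<Rightarrow> real \<Rightarrow> real \<Rightarrow> real"
  where "cS n \<alpha> A K = A * K * 2 ^ n * ((1 + 2 * real n) powr (real n + \<alpha>) + 1) * 2 powr (real n + \<alpha>) * (real n powr \<alpha> + 1)"

text \<open>The interaction of a leaf of side \<open>s\<close> with the scale \<open>t\<close>: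
  cancellation helps for t \<ge> s/2, distance helps for t \<le> s. Its integral in dt/t is bounded
  independently of \<open>s\<close>.\<close>

definition rho :: "real \<Rightarrow> real \<Rightarrow> real \<Rightarrow> real"
  where "rho b s t = indicator {s / 2..} t * (s / t) powr b + indicator {..s} t * (t / s) powr b"

lemma rho_nonneg [simp]: "rho b s t \<ge> 0"
  unfolding rho_def by simp

lemma measurable_rho [measurable]: "rho b s \<in> borel_measurable borel"
  unfolding rho_def by measurable

lemma rho_le:
  assumes "0 < b" "b \<le> 1" "s > 0" "t > 0"
  shows "rho b s t \<le> 3"
proof -
  have "indicator {s / 2..} t * (s / t) powr b \<le> 2"
  proof (cases "s / 2 \<le> t")
    case True
    then have "(s / t) powr b \<le> 2 powr b" using assms by (intro powr_mono2) (auto simp: field_simps)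
    also have "\<dots> \<le> 2 powr 1" using assms by (intro powr_mono) auto
    finally show ?thesis using True by simp
  qed simp
  moreover have "indicator {..s} t * (t / s) powr b \<le> 1"
  proof (cases "t \<le> s")
    case True
    then show ?thesis using assms powr_le1[of b "t / s"] by simp
  qed simp
  ultimately show ?thesis unfolding rho_def by simp
qed

text \<open>The two regimes give 2^b / b \<le> 2 / b and 1 / b.\<close>

lemma rho_integral:
  assumes "0 < b" "b \<le> 1" "s > 0"
  shows "(\<integral>\<^sup>+t. ennreal (rho b s t) \<partial>dtt) \<le> ennreal (3 / b)"
proof -
  have "(\<integral>\<^sup>+t. ennreal (rho b s t) \<partial>dtt) =
      (\<integral>\<^sup>+t. ennreal (2 powr b) * (indicator {s / 2..} t * ennreal ((s / 2 / t) powr b)) + indicator {..s} t * ennreal ((t / s) powr b) \<partial>dtt)"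
  proof (rule nn_integral_cong)
    fix t :: real
    have "(s / t) powr b = 2 powr b * (s / 2 / t) powr b"
      by (subst powr_mult[symmetric]) simp
    then show "ennreal (rho b s t) = ennreal (2 powr b) * (indicator {s / 2..} t * ennreal ((s / 2 / t) powr b)) + indicator {..s} t * ennreal ((t / s) powr b)"
      unfolding rho_def by (auto simp: indicator_def ennreal_mult)
  qed
  also have "\<dots> = ennreal (2 powr b) * (\<integral>\<^sup>+t. indicator {s / 2..} t * ennreal ((s / 2 / t) powr b) \<partial>dtt) + (\<integral>\<^sup>+t. indicator {..s} t * ennreal ((t / s) powr b) \<partial>dtt)"
    by (subst nn_integral_add) (auto simp: nn_integral_cmult)
  also have "\<dots> \<le> ennreal 2 * ennreal (1 / b) + ennreal (1 / b)"
  proof (intro add_mono mult_mono dtt_powr_upper dtt_powr_lower)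
    show "ennreal (2 powr b) \<le> ennreal 2"
      using assms powr_mono[of b 1 2] by (intro ennreal_leI) auto
  qed (use assms in auto)
  also have "\<dots> = ennreal (3 / b)"
    using assms by (subst ennreal_mult'[symmetric], simp, subst ennreal_plus[symmetric]) (auto simp: field_simps)
  finally show ?thesis .
qed

context kern
begin

text \<open>At distance s the kernel gains (t/s)^\<alpha>. Of the majorant 1 + D, the constant meets
  the mass of the weight and D its supremum s^(-n).\<close>

lemma tail_bound:
  fixes f :: "real ^ 'n \<Rightarrow> complex" and D :: "real ^ 'n \<Rightarrow> ennreal" and x :: "real ^ 'n"
  assumes t: "t > 0" and s: "s > 0" and [measurable]: "f \<in> borel_measurable borel" "T \<in> sets borel" "D \<in> borel_measurable borel"
    and far: "\<And>y. y \<in> T \<Longrightarrow> s \<le> norm (x - y)" and f: "\<And>y. ennreal (norm (f y)) \<le> 1 + D y"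
  shows "ennreal (norm (Th (\<lambda>y. indicator T y * f y) t x))
    \<le> ennreal (A * 2 powr (real CARD('n) + \<alpha>) * (t / s) powr \<alpha>) * (ennreal (Wc CARD('n) \<alpha>) + ennreal (1 / s ^ CARD('n)) * (\<integral>\<^sup>+y. D y \<partial>lborel))"
proof -
  let ?c = "2 powr (real CARD('n) + \<alpha>) * (t / s) powr \<alpha>"
  have "ennreal (norm (Th (\<lambda>y. indicator T y * f y) t x))
      \<le> ennreal A * (\<integral>\<^sup>+y. ennreal (wt \<alpha> t (x - y)) * ennreal (norm (indicator T y * f y)) \<partial>lborel)"
    by (rule norm_Th_le[OF t]) measurable
  also have "\<dots> \<le> ennreal A * (\<integral>\<^sup>+y. ennreal ?c * (ennreal (wt \<alpha> s (x - y)) + ennreal (1 / s ^ CARD('n)) * D y) \<partial>lborel)"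
  proof (intro mult_left_mono nn_integral_mono)
    fix y :: "real ^ 'n"
    show "ennreal (wt \<alpha> t (x - y)) * ennreal (norm (indicator T y * f y))
      \<le> ennreal ?c * (ennreal (wt \<alpha> s (x - y)) + ennreal (1 / s ^ CARD('n)) * D y)"
    proof (cases "y \<in> T")
      case True
      have "ennreal (wt \<alpha> t (x - y)) * ennreal (norm (indicator T y * f y)) \<le> ennreal (?c * wt \<alpha> s (x - y)) * (1 + D y)"
        using True wt_far_compare[OF s t alpha(1) far[OF True]] f[of y]
        by (intro mult_mono ennreal_leI) (auto simp: mult.assoc)
      also have "\<dots> = ennreal ?c * (ennreal (wt \<alpha> s (x - y)) + ennreal (wt \<alpha> s (x - y)) * D y)"
        by (simp add: ennreal_mult' distrib_left mult.assoc)
      also have "\<dots> \<le> ennreal ?c * (ennreal (wt \<alpha> s (x - y)) + ennreal (1 / s ^ CARD('n)) * D y)"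
        using s alpha by (intro mult_left_mono add_left_mono mult_right_mono ennreal_leI wt_le_inverse) auto
      finally show ?thesis .
    qed simp
  qed simp
  also have "\<dots> = ennreal A * (ennreal ?c * ((\<integral>\<^sup>+y. ennreal (wt \<alpha> s (x - y)) \<partial>lborel) + ennreal (1 / s ^ CARD('n)) * (\<integral>\<^sup>+y. D y \<partial>lborel)))"
    by (subst nn_integral_cmult, measurable, subst nn_integral_add) (auto simp: nn_integral_cmult)
  also have "\<dots> \<le> ennreal A * (ennreal ?c * (ennreal (Wc CARD('n) \<alpha>) + ennreal (1 / s ^ CARD('n)) * (\<integral>\<^sup>+y. D y \<partial>lborel)))"
    using s alpha by (intro mult_left_mono add_right_mono nn_integral_wt) auto
  also have "\<dots> = ennreal (A * 2 powr (real CARD('n) + \<alpha>) * (t / s) powr \<alpha>) * (ennreal (Wc CARD('n) \<alpha>) + ennreal (1 / s ^ CARD('n)) * (\<integral>\<^sup>+y. D y \<partial>lborel))"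
    using A by (simp add: ennreal_mult' mult.assoc)
  finally show ?thesis .
qed

text \<open>Squaring leaves (t / ell)^(2 \<alpha>), which is integrable in dt/t up to
  \<open>ell\<close>. Points too close to the tail are excluded by the distance \<epsilon>
  ell.\<close>

lemma tail_square:
  fixes ell :: real and f :: "real ^ 'n \<Rightarrow> complex" and D :: "real ^ 'n \<Rightarrow> ennreal" and x :: "real ^ 'n"
  assumes ell: "ell > 0" and e: "\<epsilon> > 0" and c: "c \<ge> 0"
    and [measurable]: "f \<in> borel_measurable borel" "T \<in> sets borel" "D \<in> borel_measurable borel" "X \<in> sets borel"
    and far: "\<And>y. y \<in> T \<Longrightarrow> \<epsilon> * ell \<le> norm (x - y)" and f: "\<And>y. ennreal (norm (f y)) \<le> 1 + D y"
    and D: "(\<integral>\<^sup>+y. D y \<partial>lborel) \<le> ennreal (c * ell ^ CARD('n))" and X: "\<And>t. t \<in> X \<Longrightarrow> t > 0 \<Longrightarrow> t \<le> ell"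
  shows "(\<integral>\<^sup>+t. indicator X t * (ennreal (norm (Th (\<lambda>y. indicator T y * f y) t x)))\<^sup>2 \<partial>dtt)
    \<le> ennreal ((A * 2 powr (real CARD('n) + \<alpha>) * (1 / \<epsilon>) powr \<alpha> * (Wc CARD('n) \<alpha> + c / \<epsilon> ^ CARD('n)))\<^sup>2 / (2 * \<alpha>))"
proof -
  let ?k = "A * 2 powr (real CARD('n) + \<alpha>) * (1 / \<epsilon>) powr \<alpha> * (Wc CARD('n) \<alpha> + c / \<epsilon> ^ CARD('n))"
  have W: "Wc CARD('n) \<alpha> > 0" by (rule Wc_pos) (rule alpha)
  have "indicator X t * (ennreal (norm (Th (\<lambda>y. indicator T y * f y) t x)))\<^sup>2
      \<le> ennreal (?k\<^sup>2) * (indicator {..ell} t * ennreal ((t / ell) powr (2 * \<alpha>)))" if t: "t > 0" for t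
  proof (cases "t \<in> X")
    case True
    have s: "\<epsilon> * ell > 0" using e ell by simp
    have "ennreal (norm (Th (\<lambda>y. indicator T y * f y) t x))
      \<le> ennreal (A * 2 powr (real CARD('n) + \<alpha>) * (t / (\<epsilon> * ell)) powr \<alpha>) * (ennreal (Wc CARD('n) \<alpha>) + ennreal (1 / (\<epsilon> * ell) ^ CARD('n)) * (\<integral>\<^sup>+y. D y \<partial>lborel))"
      by (rule tail_bound[OF t s _ _ _ far f]) auto
    also have "\<dots> \<le> ennreal (A * 2 powr (real CARD('n) + \<alpha>) * (t / (\<epsilon> * ell)) powr \<alpha>) * (ennreal (Wc CARD('n) \<alpha>) + ennreal (1 / (\<epsilon> * ell) ^ CARD('n)) * ennreal (c * ell ^ CARD('n)))"
      by (intro mult_left_mono add_left_mono D) auto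
    also have "\<dots> = ennreal (?k * (t / ell) powr \<alpha>)"
    proof -
      have "1 / (\<epsilon> * ell) ^ CARD('n) * (c * ell ^ CARD('n)) = c / \<epsilon> ^ CARD('n)"
        using ell by (simp add: power_mult_distrib)
      then have 1: "ennreal (1 / (\<epsilon> * ell) ^ CARD('n)) * ennreal (c * ell ^ CARD('n)) = ennreal (c / \<epsilon> ^ CARD('n))"
        using e ell by (subst ennreal_mult'[symmetric]) auto
      have 2: "(t / (\<epsilon> * ell)) powr \<alpha> = (1 / \<epsilon>) powr \<alpha> * (t / ell) powr \<alpha>"
        by (subst powr_mult[symmetric]) simp
      show ?thesis
        unfolding 1 2 using A W c e
        by (subst ennreal_plus[symmetric], simp, simp, subst ennreal_mult'[symmetric]) (auto simp: mult_ac)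
    qed
    finally have "(ennreal (norm (Th (\<lambda>y. indicator T y * f y) t x)))\<^sup>2 \<le> (ennreal (?k * (t / ell) powr \<alpha>))\<^sup>2"
      by (rule power_mono) simp
    also have "\<dots> = ennreal ((?k * (t / ell) powr \<alpha>)\<^sup>2)"
      using A W c e by (intro ennreal_power) auto
    also have "(?k * (t / ell) powr \<alpha>)\<^sup>2 = ?k\<^sup>2 * (t / ell) powr (2 * \<alpha>)"
    proof -
      have "((t / ell) powr \<alpha>)\<^sup>2 = (t / ell) powr (2 * \<alpha>)"
        by (simp only: power2_eq_square powr_add[symmetric] mult_2)
      then show ?thesis by (simp only: power_mult_distrib)
    qed
    finally show ?thesis using True X[OF True t] by (simp add: ennreal_mult)
  qed simp
  then have "(\<integral>\<^sup>+t. indicator X t * (ennreal (norm (Th (\<lambda>y. indicator T y * f y) t x)))\<^sup>2 \<partial>dtt)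
      \<le> (\<integral>\<^sup>+t. ennreal (?k\<^sup>2) * (indicator {..ell} t * ennreal ((t / ell) powr (2 * \<alpha>))) \<partial>dtt)"
    by (rule nn_integral_dtt_mono)
  also have "\<dots> = ennreal (?k\<^sup>2) * (\<integral>\<^sup>+t. indicator {..ell} t * ennreal ((t / ell) powr (2 * \<alpha>)) \<partial>dtt)"
    by (rule nn_integral_cmult) measurable
  also have "\<dots> \<le> ennreal (?k\<^sup>2) * ennreal (1 / (2 * \<alpha>))"
    using alpha ell by (intro mult_left_mono dtt_powr_lower) auto
  also have "\<dots> = ennreal (?k\<^sup>2 / (2 * \<alpha>))"
    using alpha by (subst ennreal_mult'[symmetric]) auto
  finally show ?thesis .
qed

end

locale kern_stopping = kern \<alpha> A \<psi> + stopping l q x0 B K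
  for \<alpha> A :: real and \<psi> :: "real \<Rightarrow> real ^ 'n \<Rightarrow> real ^ 'n \<Rightarrow> complex"
    and l q :: int and x0 :: "real ^ 'n" and B :: "real ^ 'n \<Rightarrow> ennreal" and K :: real
begin

text \<open>The terms of \<open>Phi\<close> level by level, but over all leaves, so that the lowest
  level also covers its good cubes.\<close>

definition PhiV :: "int \<Rightarrow> real ^ 'n \<Rightarrow> ennreal"
  where "PhiV j x = (\<integral>\<^sup>+y. indicator (V j) y * ennreal (wt (\<alpha> / 2) (2 powi j) (x - y)) \<partial>lborel)"

text \<open>The weight is nearly constant on a cube of side at most 2 t, so \<open>B\<close> on a
  leaf may be replaced by its averages, which are at most 2^n K.\<close>

lemma leaf_weight:
  assumes f: "\<And>y. ennreal (norm (f y)) \<le> B y" and j: "j \<in> {l..q}" and t: "t > 0" "2 powi j \<le> 2 * t"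
  shows "(\<integral>\<^sup>+y. ennreal (wt \<alpha> t (x - y)) * ennreal (norm (leaf f j y)) \<partial>lborel)
      \<le> ennreal ((1 + 2 * real CARD('n)) powr (real CARD('n) + \<alpha>) * (2 ^ CARD('n) * K)) * (\<integral>\<^sup>+y. indicator (V j) y * ennreal (wt \<alpha> t (x - y)) \<partial>lborel)"
    and "(\<integral>\<^sup>+y. ennreal (wt \<alpha> t (x - y)) * ennreal (norm (avg j (leaf f j) y)) \<partial>lborel)
      \<le> ennreal (2 ^ CARD('n) * K) * (\<integral>\<^sup>+y. indicator (V j) y * ennreal (wt \<alpha> t (x - y)) \<partial>lborel)"
proof -
  let ?w = "\<lambda>y. ennreal (wt \<alpha> t (x - y))"
  let ?c = "(1 + 2 * real CARD('n)) powr (real CARD('n) + \<alpha>)" let ?K = "2 ^ CARD('n) * K"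
  have [measurable]: "V j \<in> sets borel" using j by (rule sets_V)
  have 2: "(\<integral>\<^sup>+y. ?w y * (indicator (V j) y * avn j B y) \<partial>lborel) \<le> ennreal ?K * (\<integral>\<^sup>+y. indicator (V j) y * ?w y \<partial>lborel)"
  proof -
    have "(\<integral>\<^sup>+y. ?w y * (indicator (V j) y * avn j B y) \<partial>lborel) \<le> (\<integral>\<^sup>+y. ennreal ?K * (indicator (V j) y * ?w y) \<partial>lborel)"
    proof (rule nn_integral_mono)
      fix y :: "real ^ 'n"
      show "?w y * (indicator (V j) y * avn j B y) \<le> ennreal ?K * (indicator (V j) y * ?w y)"
      proof (cases "y \<in> V j")
        case True
        then show ?thesis using mult_left_mono[OF avn_V_le[OF True j], of "?w y"] by (simp add: mult.commute)
      qed simp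
    qed
    also have "\<dots> = ennreal ?K * (\<integral>\<^sup>+y. indicator (V j) y * ?w y \<partial>lborel)"
      by (rule nn_integral_cmult) measurable
    finally show ?thesis .
  qed
  have "(\<integral>\<^sup>+y. ?w y * ennreal (norm (leaf f j y)) \<partial>lborel) \<le> (\<integral>\<^sup>+y. ?w y * (indicator (V j) y * B y) \<partial>lborel)"
    by (intro nn_integral_mono mult_left_mono norm_leaf_le f) simp
  also have "\<dots> \<le> ennreal ?c * (\<integral>\<^sup>+y. ?w y * (indicator (V j) y * avn j B y) \<partial>lborel)"
  proof (rule weight_avg)
    show "y \<in> V j \<longleftrightarrow> z \<in> V j" if "cube_index j y = cube_index j z" for y z
      using V_level[OF that] j by simp
    show "?w y \<le> ennreal ?c * ?w z" if "cube_index j y = cube_index j z" for y z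
    proof -
      have "norm (y - z) \<le> real CARD('n) * 2 powi j" by (rule norm_diff_cube_index[OF that])
      also have "\<dots> \<le> 2 * real CARD('n) * t" using mult_left_mono[OF t(2), of "real CARD('n)"] by simp
      finally have "norm ((x - y) - (x - z)) \<le> 2 * real CARD('n) * t" by (simp add: norm_minus_commute)
      then have "wt \<alpha> t (x - y) \<le> ?c * wt \<alpha> t (x - z)"
        by (intro wt_shift t(1) alpha) auto
      then show ?thesis by (simp add: ennreal_mult'[symmetric] ennreal_leI)
    qed
  qed auto
  also have "\<dots> \<le> ennreal ?c * (ennreal ?K * (\<integral>\<^sup>+y. indicator (V j) y * ?w y \<partial>lborel))"
    by (rule mult_left_mono[OF 2]) simp
  also have "\<dots> = ennreal (?c * ?K) * (\<integral>\<^sup>+y. indicator (V j) y * ?w y \<partial>lborel)"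
    by (simp add: ennreal_mult' mult.assoc)
  finally show "(\<integral>\<^sup>+y. ?w y * ennreal (norm (leaf f j y)) \<partial>lborel) \<le> ennreal (?c * ?K) * (\<integral>\<^sup>+y. indicator (V j) y * ?w y \<partial>lborel)" .
  have "(\<integral>\<^sup>+y. ?w y * ennreal (norm (avg j (leaf f j) y)) \<partial>lborel) \<le> (\<integral>\<^sup>+y. ?w y * (indicator (V j) y * avn j B y) \<partial>lborel)"
    by (intro nn_integral_mono mult_left_mono norm_avg_leaf_le f j) simp
  also note 2
  finally show "(\<integral>\<^sup>+y. ?w y * ennreal (norm (avg j (leaf f j) y)) \<partial>lborel) \<le> ennreal ?K * (\<integral>\<^sup>+y. indicator (V j) y * ?w y \<partial>lborel)" .
qed

lemma leaf_finite:
  assumes [measurable]: "f \<in> borel_measurable borel" and f: "\<And>y. ennreal (norm (f y)) \<le> B y" and j: "j \<in> {l..q}" and t: "t > 0"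
  shows "(\<integral>\<^sup>+y. ennreal (wt \<alpha> t (x - y)) * ennreal (norm (leaf f j y)) \<partial>lborel) < \<infinity>"
    and "(\<integral>\<^sup>+y. ennreal (wt \<alpha> t (x - y)) * avn j (\<lambda>y. ennreal (norm (leaf f j y))) y \<partial>lborel) < \<infinity>"
proof -
  let ?I = "\<integral>\<^sup>+y. ennreal (norm (leaf f j y)) \<partial>lborel" let ?c = "ennreal (1 / t ^ CARD('n))"
  have [measurable]: "leaf f j \<in> borel_measurable borel" using j by measurable
  have "?I \<le> (\<integral>\<^sup>+y. indicator Q y * B y \<partial>lborel)"
  proof (rule nn_integral_mono)
    fix y :: "real ^ 'n"
    show "ennreal (norm (leaf f j y)) \<le> indicator Q y * B y"
      using f[of y] V_sub(1)[of j] by (auto simp: leaf_def indicator_def)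
  qed
  also have "\<dots> < \<infinity>" by (rule integral_Q_B)
  finally have fin: "?c * ?I < \<infinity>" by (simp add: ennreal_mult_less_top)
  have "(\<integral>\<^sup>+y. ennreal (wt \<alpha> t (x - y)) * ennreal (norm (leaf f j y)) \<partial>lborel) \<le> (\<integral>\<^sup>+y. ?c * ennreal (norm (leaf f j y)) \<partial>lborel)"
    using t alpha by (intro nn_integral_mono mult_right_mono ennreal_leI wt_le_inverse) auto
  also have "\<dots> = ?c * ?I" by (rule nn_integral_cmult) measurable
  also note fin
  finally show "(\<integral>\<^sup>+y. ennreal (wt \<alpha> t (x - y)) * ennreal (norm (leaf f j y)) \<partial>lborel) < \<infinity>" .
  have "(\<integral>\<^sup>+y. ennreal (wt \<alpha> t (x - y)) * avn j (\<lambda>y. ennreal (norm (leaf f j y))) y \<partial>lborel) \<le> (\<integral>\<^sup>+y. ?c * avn j (\<lambda>y. ennreal (norm (leaf f j y))) y \<partial>lborel)"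
    using t alpha by (intro nn_integral_mono mult_right_mono ennreal_leI wt_le_inverse) auto
  also have "\<dots> = ?c * (\<integral>\<^sup>+y. avn j (\<lambda>y. ennreal (norm (leaf f j y))) y \<partial>lborel)" by (rule nn_integral_cmult) measurable
  also have "\<dots> = ?c * ?I" by (subst nn_integral_avn) auto
  also note fin
  finally show "(\<integral>\<^sup>+y. ennreal (wt \<alpha> t (x - y)) * avn j (\<lambda>y. ennreal (norm (leaf f j y))) y \<partial>lborel) < \<infinity>" .
qed

lemma leaf_avg_finite:
  assumes [measurable]: "f \<in> borel_measurable borel" and f: "\<And>y. ennreal (norm (f y)) \<le> B y" and j: "j \<in> {l..q}" and t: "t > 0"
  shows "(\<integral>\<^sup>+y. ennreal (wt \<alpha> t (x - y)) * ennreal (norm (avg j (leaf f j) y)) \<partial>lborel) < \<infinity>"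
  by (rule le_less_trans[OF _ leaf_finite(2)[OF assms, of x]]) (intro nn_integral_mono mult_left_mono norm_avg_le, simp)

text \<open>Two regimes. If the side is at most 2 t, the atom has mean zero and
  \<open>Th_avg_diff\<close> applies. If it is larger, the leaf and its average are estimated
  separately, since x is far from every bad leaf.\<close>

lemma leaf_bound:
  assumes [measurable]: "f \<in> borel_measurable borel" and f: "\<And>y. ennreal (norm (f y)) \<le> B y" and j: "j \<in> {l..q}"
    and Phi: "Phi (\<alpha> / 2) x \<le> ennreal ((2 + real CARD('n)) powr (- (real CARD('n) + 1)) / 2)"
    and t: "t > 0" and levt: "lev t \<in> {l..q}"
  shows "ennreal (norm (Th (leaf f j) t x - Th (avg j (leaf f j)) t x))
    \<le> ennreal (cS CARD('n) \<alpha> A K) * (ennreal (rho (\<alpha> / 2) (2 powi j) t) * PhiV j x)"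
proof -
  let ?n = "real CARD('n)" let ?s = "2 powi j :: real" let ?F = "leaf f j"
  let ?c1 = "(1 + 2 * ?n) powr (?n + \<alpha>)" let ?K = "2 ^ CARD('n) * K" let ?e = "2 powr (?n + \<alpha>)"
  have [measurable]: "V j \<in> sets borel" using j by (rule sets_V)
  have [measurable]: "?F \<in> borel_measurable borel" using j by measurable
  have c1: "?c1 > 0" by (simp add: add_pos_pos)
  show ?thesis
  proof (cases "?s \<le> 2 * t")
    case True
    have "ennreal (norm (Th ?F t x - Th (avg j ?F) t x))
        \<le> ennreal (A * (?n * ?s / t) powr \<alpha>) * (\<integral>\<^sup>+y. ennreal (wt \<alpha> t (x - y)) * ennreal (norm (?F y)) \<partial>lborel)"
      by (rule Th_avg_diff[OF t True _ leaf_finite[OF _ f j t]]) auto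
    also have "\<dots> \<le> ennreal (A * (?n * ?s / t) powr \<alpha>) * (ennreal (?c1 * ?K) * (\<integral>\<^sup>+y. indicator (V j) y * ennreal (wt \<alpha> t (x - y)) \<partial>lborel))"
      by (intro mult_left_mono leaf_weight(1) f j t True) auto
    also have "\<dots> = ennreal (A * ?n powr \<alpha> * (?c1 * ?K)) * (\<integral>\<^sup>+y. indicator (V j) y * ennreal ((?s / t) powr \<alpha> * wt \<alpha> t (x - y)) \<partial>lborel)"
    proof -
      have "(\<integral>\<^sup>+y. indicator (V j) y * ennreal ((?s / t) powr \<alpha> * wt \<alpha> t (x - y)) \<partial>lborel)
          = (\<integral>\<^sup>+y. ennreal ((?s / t) powr \<alpha>) * (indicator (V j) y * ennreal (wt \<alpha> t (x - y))) \<partial>lborel)"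
        by (simp add: ennreal_mult' mult_ac)
      also have "\<dots> = ennreal ((?s / t) powr \<alpha>) * (\<integral>\<^sup>+y. indicator (V j) y * ennreal (wt \<alpha> t (x - y)) \<partial>lborel)"
        by (rule nn_integral_cmult) measurable
      finally have 1: "(\<integral>\<^sup>+y. indicator (V j) y * ennreal ((?s / t) powr \<alpha> * wt \<alpha> t (x - y)) \<partial>lborel)
          = ennreal ((?s / t) powr \<alpha>) * (\<integral>\<^sup>+y. indicator (V j) y * ennreal (wt \<alpha> t (x - y)) \<partial>lborel)" .
      have 2: "(?n * ?s / t) powr \<alpha> = ?n powr \<alpha> * (?s / t) powr \<alpha>" by (subst powr_mult[symmetric]) simp
      show ?thesis unfolding 1 2 using A K by (simp add: ennreal_mult mult_ac)
    qed
    also have "\<dots> \<le> ennreal (A * ?n powr \<alpha> * (?c1 * ?K)) * (\<integral>\<^sup>+y. ennreal (?e * rho (\<alpha> / 2) ?s t) * (indicator (V j) y * ennreal (wt (\<alpha> / 2) ?s (x - y))) \<partial>lborel)"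
    proof (intro mult_left_mono nn_integral_mono)
      fix y :: "real ^ 'n"
      have "(?s / t) powr \<alpha> * wt \<alpha> t (x - y) \<le> 2 powr (?n + \<alpha> / 2) * ((?s / t) powr (\<alpha> / 2) * wt (\<alpha> / 2) ?s (x - y))"
        by (rule wt_fine_compare) (use True alpha in auto)
      also have "\<dots> \<le> ?e * (rho (\<alpha> / 2) ?s t * wt (\<alpha> / 2) ?s (x - y))"
        unfolding rho_def using True alpha by (intro mult_mono powr_mono mult_right_mono) auto
      finally show "indicator (V j) y * ennreal ((?s / t) powr \<alpha> * wt \<alpha> t (x - y))
          \<le> ennreal (?e * rho (\<alpha> / 2) ?s t) * (indicator (V j) y * ennreal (wt (\<alpha> / 2) ?s (x - y)))"
        by (auto simp: indicator_def ennreal_mult'[symmetric] mult.assoc intro!: ennreal_leI)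
    qed auto
    also have "\<dots> = ennreal (A * ?n powr \<alpha> * (?c1 * ?K)) * (ennreal (?e * rho (\<alpha> / 2) ?s t) * PhiV j x)"
      unfolding PhiV_def by (subst nn_integral_cmult) auto
    also have "\<dots> = ennreal (A * ?n powr \<alpha> * (?c1 * ?K) * ?e) * (ennreal (rho (\<alpha> / 2) ?s t) * PhiV j x)"
      using A K by (simp add: ennreal_mult mult_ac)
    also have "\<dots> \<le> ennreal (cS CARD('n) \<alpha> A K) * (ennreal (rho (\<alpha> / 2) ?s t) * PhiV j x)"
    proof (intro mult_right_mono ennreal_leI)
      have "A * ?K * ?e * (?n powr \<alpha> * ?c1) \<le> A * ?K * ?e * ((?n powr \<alpha> + 1) * (?c1 + 1))"
        using A K by (intro mult_left_mono mult_mono) auto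
      then show "A * ?n powr \<alpha> * (?c1 * ?K) * ?e \<le> cS CARD('n) \<alpha> A K"
        unfolding cS_def by (simp add: mult_ac)
    qed auto
    finally show ?thesis .
  next
    case False
    have "2 powi l \<le> 2 powi (lev t) * (1 :: real)" using levt by (auto intro: power_int_increasing)
    also have "\<dots> < ?s" using lev_bound2[OF t] False by simp
    \<comment> \<open>As \<open>lev t\<close> is at least \<open>l\<close>, a leaf with side above 2
      t is not of the lowest level, hence it is bad.\<close>
    finally have "j \<noteq> l" by auto
    then have VVb: "V j = Vb j" by (rule V_bad)
    have ts: "t \<le> ?s" using False t by simp
    have far: "?s \<le> norm (x - y)" if "y \<in> V j" for y
      using far_from_bad[of "\<alpha> / 2" x j y] alpha Phi j that VVb by auto
    let ?r = "?e * (t / ?s) powr \<alpha>"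
    have cmp: "ennreal (wt \<alpha> t (x - y)) * z \<le> ennreal ?r * (ennreal (wt \<alpha> ?s (x - y)) * z)" if "y \<in> V j" for y z
    proof -
      have "wt \<alpha> t (x - y) \<le> ?r * wt \<alpha> ?s (x - y)"
        using wt_far_compare[of ?s t \<alpha> "x - y"] far[OF that] t alpha by (simp add: mult.assoc)
      then show ?thesis unfolding mult.assoc[symmetric] ennreal_mult'[OF wt_nonneg, symmetric]
        by (intro mult_right_mono) (auto simp: ennreal_mult'[symmetric] ennreal_leI)
    qed
    have a: "(\<integral>\<^sup>+y. ennreal (wt \<alpha> t (x - y)) * ennreal (norm (G y)) \<partial>lborel)
        \<le> ennreal ?r * (\<integral>\<^sup>+y. ennreal (wt \<alpha> ?s (x - y)) * ennreal (norm (G y)) \<partial>lborel)"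
      if [measurable]: "G \<in> borel_measurable borel" and "\<And>y. y \<notin> V j \<Longrightarrow> G y = 0" for G :: "real ^ 'n \<Rightarrow> complex"
    proof -
      have "(\<integral>\<^sup>+y. ennreal (wt \<alpha> t (x - y)) * ennreal (norm (G y)) \<partial>lborel)
        \<le> (\<integral>\<^sup>+y. ennreal ?r * (ennreal (wt \<alpha> ?s (x - y)) * ennreal (norm (G y))) \<partial>lborel)"
      proof (rule nn_integral_mono)
        fix y :: "real ^ 'n"
        show "ennreal (wt \<alpha> t (x - y)) * ennreal (norm (G y)) \<le> ennreal ?r * (ennreal (wt \<alpha> ?s (x - y)) * ennreal (norm (G y)))"
          using cmp[of y "ennreal (norm (G y))"] that(2)[of y] by (cases "y \<in> V j") auto
      qed
      also have "\<dots> = ennreal ?r * (\<integral>\<^sup>+y. ennreal (wt \<alpha> ?s (x - y)) * ennreal (norm (G y)) \<partial>lborel)"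
        by (rule nn_integral_cmult) measurable
      finally show ?thesis .
    qed
    let ?P = "\<integral>\<^sup>+y. indicator (V j) y * ennreal (wt \<alpha> ?s (x - y)) \<partial>lborel"
    have PP: "?P \<le> PhiV j x"
      unfolding PhiV_def using alpha by (intro nn_integral_mono mult_left_mono ennreal_leI wt_mono_exponent) auto
    have z1: "?F y = 0" if "y \<notin> V j" for y using that by (simp add: leaf_def)
    have z2: "avg j ?F y = 0" if "y \<notin> V j" for y using norm_avg_leaf_le[OF f j, of y] that by simp
    have s2: "?s \<le> 2 * ?s" by simp
    have "ennreal (norm (Th ?F t x)) \<le> ennreal A * (\<integral>\<^sup>+y. ennreal (wt \<alpha> t (x - y)) * ennreal (norm (?F y)) \<partial>lborel)"
      by (rule norm_Th_le[OF t]) measurable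
    also have "\<dots> \<le> ennreal A * (ennreal ?r * (\<integral>\<^sup>+y. ennreal (wt \<alpha> ?s (x - y)) * ennreal (norm (?F y)) \<partial>lborel))"
      by (rule mult_left_mono[OF a]) (auto simp: z1)
    also have "\<dots> \<le> ennreal A * (ennreal ?r * (ennreal (?c1 * ?K) * PhiV j x))"
      by (intro mult_left_mono order_trans[OF leaf_weight(1)[OF f j _ s2] mult_left_mono[OF PP]]) auto
    finally have 1: "ennreal (norm (Th ?F t x)) \<le> ennreal A * (ennreal ?r * (ennreal (?c1 * ?K) * PhiV j x))" .
    have "ennreal (norm (Th (avg j ?F) t x)) \<le> ennreal A * (\<integral>\<^sup>+y. ennreal (wt \<alpha> t (x - y)) * ennreal (norm (avg j ?F y)) \<partial>lborel)"
      by (rule norm_Th_le[OF t]) measurable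
    also have "\<dots> \<le> ennreal A * (ennreal ?r * (\<integral>\<^sup>+y. ennreal (wt \<alpha> ?s (x - y)) * ennreal (norm (avg j ?F y)) \<partial>lborel))"
      by (rule mult_left_mono[OF a]) (auto simp: z2)
    also have "\<dots> \<le> ennreal A * (ennreal ?r * (ennreal ?K * PhiV j x))"
      by (intro mult_left_mono order_trans[OF leaf_weight(2)[OF f j _ s2] mult_left_mono[OF PP]]) auto
    finally have 2: "ennreal (norm (Th (avg j ?F) t x)) \<le> ennreal A * (ennreal ?r * (ennreal ?K * PhiV j x))" .
    have "ennreal (norm (Th ?F t x - Th (avg j ?F) t x)) \<le> ennreal (norm (Th ?F t x)) + ennreal (norm (Th (avg j ?F) t x))"
      by (simp add: ennreal_plus[symmetric] norm_triangle_ineq4 ennreal_leI del: ennreal_plus)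
    also have "\<dots> \<le> ennreal A * (ennreal ?r * (ennreal (?c1 * ?K) * PhiV j x)) + ennreal A * (ennreal ?r * (ennreal ?K * PhiV j x))"
      by (rule add_mono[OF 1 2])
    also have "\<dots> = ennreal (A * ?r * (?c1 * ?K + ?K)) * PhiV j x"
      using A K by (simp add: ennreal_mult distrib_left distrib_right mult_ac)
    also have "\<dots> \<le> ennreal (cS CARD('n) \<alpha> A K * rho (\<alpha> / 2) ?s t) * PhiV j x"
    proof (intro mult_right_mono ennreal_leI)
      have "(t / ?s) powr \<alpha> \<le> (t / ?s) powr (\<alpha> / 2)"
        using ts t alpha by (intro powr_mono') auto
      also have "\<dots> \<le> rho (\<alpha> / 2) ?s t" unfolding rho_def using ts by simp
      finally have "A * ?K * (?c1 + 1) * ?e * 1 * (t / ?s) powr \<alpha> \<le> A * ?K * (?c1 + 1) * ?e * (?n powr \<alpha> + 1) * rho (\<alpha> / 2) ?s t"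
        using A K c1 by (intro mult_mono) auto
      then show "A * ?r * (?c1 * ?K + ?K) \<le> cS CARD('n) \<alpha> A K * rho (\<alpha> / 2) ?s t"
        unfolding cS_def by (simp add: algebra_simps)
    qed simp
    also have "\<dots> = ennreal (cS CARD('n) \<alpha> A K) * (ennreal (rho (\<alpha> / 2) ?s t) * PhiV j x)"
      by (simp add: ennreal_mult'' mult.assoc)
    finally show ?thesis .
  qed
qed

text \<open>The bad leaves add up to \<open>Phi\<close>; the lowest level, bad or not, costs at most
  the full mass of one weight.\<close>

lemma sum_PhiV:
  assumes Phi: "Phi (\<alpha> / 2) x \<le> ennreal ((2 + real CARD('n)) powr (- (real CARD('n) + 1)) / 2)"
  shows "(\<Sum>j\<in>{l..q}. PhiV j x) \<le> ennreal (1 + Wc CARD('n) (\<alpha> / 2))"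
proof -
  let ?W = "Wc CARD('n) (\<alpha> / 2)"
  let ?b = "\<lambda>j. \<integral>\<^sup>+y. indicator (Vb j) y * ennreal (wt (\<alpha> / 2) (2 powi j) (x - y)) \<partial>lborel"
  have "PhiV j x \<le> ?b j + (if j = l then ennreal ?W else 0)" for j
  proof (cases "j = l")
    case True
    have "PhiV j x \<le> (\<integral>\<^sup>+y. ennreal (wt (\<alpha> / 2) (2 powi j) (x - y)) \<partial>lborel)"
      unfolding PhiV_def by (intro nn_integral_mono) (auto simp: indicator_def)
    also have "\<dots> \<le> ennreal ?W" using alpha by (intro nn_integral_wt) auto
    finally show ?thesis using True by (simp add: add_increasing)
  next
    case False
    then show ?thesis unfolding PhiV_def V_bad[OF False] by simp
  qed
  then have "(\<Sum>j\<in>{l..q}. PhiV j x) \<le> (\<Sum>j\<in>{l..q}. ?b j + (if j = l then ennreal ?W else 0))" by (rule sum_mono)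
  also have "\<dots> = Phi (\<alpha> / 2) x + ennreal ?W"
    unfolding sum.distrib Phi_def using lq by (simp add: sum.delta)
  also have "\<dots> \<le> ennreal 1 + ennreal ?W"
  proof (intro add_right_mono order_trans[OF Phi] ennreal_leI)
    have "(2 + real CARD('n)) powr (- (real CARD('n) + 1)) \<le> (2 + real CARD('n)) powr 0"
      by (intro powr_mono) auto
    then show "(2 + real CARD('n)) powr (- (real CARD('n) + 1)) / 2 \<le> 1" by simp
  qed
  also have "\<dots> = ennreal (1 + ?W)"
    using Wc_pos[of "\<alpha> / 2" "CARD('n)"] alpha by (intro ennreal_plus[symmetric]) auto
  finally show ?thesis .
qed

lemma Th_atom_part:
  assumes [measurable]: "f \<in> borel_measurable borel" and f: "\<And>y. ennreal (norm (f y)) \<le> B y" and t: "t > 0"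
  shows "integrable lborel (\<lambda>y. \<psi> t x y * atom_part f y)"
    and "Th (atom_part f) t x = (\<Sum>j\<in>{l..q}. Th (leaf f j) t x - Th (avg j (leaf f j)) t x)"
proof -
  have 1: "integrable lborel (\<lambda>y. \<psi> t x y * leaf f j y)" if "j \<in> {l..q}" for j
    using that by (intro Th_integrable[OF t _ leaf_finite(1)[OF _ f _ t]]) auto
  have 2: "integrable lborel (\<lambda>y. \<psi> t x y * avg j (leaf f j) y)" if "j \<in> {l..q}" for j
    using that by (intro Th_integrable[OF t _ leaf_avg_finite[OF _ f _ t]]) auto
  have e: "\<psi> t x y * atom_part f y = (\<Sum>j\<in>{l..q}. \<psi> t x y * leaf f j y - \<psi> t x y * avg j (leaf f j) y)" for y
    unfolding atom_part_def by (simp add: sum_distrib_left right_diff_distrib)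
  show "integrable lborel (\<lambda>y. \<psi> t x y * atom_part f y)"
    unfolding e using 1 2 by (intro Bochner_Integration.integrable_sum Bochner_Integration.integrable_diff) auto
  show "Th (atom_part f) t x = (\<Sum>j\<in>{l..q}. Th (leaf f j) t x - Th (avg j (leaf f j)) t x)"
    unfolding Th_def e using 1 2 by (subst Bochner_Integration.integral_sum) auto
qed

text \<open>For S, the sum of \<open>rho\<close> times \<open>PhiV\<close> over the levels, the
  integral of S^2 is at most the supremum of S times the integral of S. Both are finite because
  \<open>rho\<close> is bounded by 3 and has integral at most 6 / \<alpha>; this replaces an L^2
  estimate for the atoms and explains the factor 18 / \<alpha>.\<close>

lemma atom_square:
  assumes [measurable]: "f \<in> borel_measurable borel" and f: "\<And>y. ennreal (norm (f y)) \<le> B y"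
    and Phi: "Phi (\<alpha> / 2) x \<le> ennreal ((2 + real CARD('n)) powr (- (real CARD('n) + 1)) / 2)"
  shows "(\<integral>\<^sup>+t. indicator {t. lev t \<in> {l..q}} t * (ennreal (norm (Th (atom_part f) t x)))\<^sup>2 \<partial>dtt)
    \<le> ennreal (18 * (cS CARD('n) \<alpha> A K)\<^sup>2 * (1 + Wc CARD('n) (\<alpha> / 2))\<^sup>2 / \<alpha>)"
proof -
  let ?c = "cS CARD('n) \<alpha> A K" let ?W = "1 + Wc CARD('n) (\<alpha> / 2)"
  let ?r = "\<lambda>j t. rho (\<alpha> / 2) (2 powi j) t"
  have c: "?c \<ge> 0" unfolding cS_def using A K by simp
  have W: "?W \<ge> 0" using Wc_pos[of "\<alpha> / 2" "CARD('n)"] alpha by simp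
  have "indicator {t. lev t \<in> {l..q}} t * (ennreal (norm (Th (atom_part f) t x)))\<^sup>2
      \<le> ennreal (?c\<^sup>2 * (3 * ?W)) * (\<Sum>j\<in>{l..q}. PhiV j x * ennreal (?r j t))" if t: "t > 0" for t
  proof (cases "lev t \<in> {l..q}")
    case True
    define S where "S = (\<Sum>j\<in>{l..q}. ennreal (?r j t) * PhiV j x)"
    have "ennreal (norm (Th (atom_part f) t x)) \<le> ennreal (\<Sum>j\<in>{l..q}. norm (Th (leaf f j) t x - Th (avg j (leaf f j)) t x))"
      unfolding Th_atom_part(2)[OF _ f t, simplified] by (intro ennreal_leI norm_sum)
    also have "\<dots> = (\<Sum>j\<in>{l..q}. ennreal (norm (Th (leaf f j) t x - Th (avg j (leaf f j)) t x)))"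
      by (rule sum_ennreal[symmetric]) simp
    also have "\<dots> \<le> (\<Sum>j\<in>{l..q}. ennreal ?c * (ennreal (?r j t) * PhiV j x))"
      by (intro sum_mono leaf_bound[OF _ f _ Phi t True]) auto
    also have "\<dots> = ennreal ?c * S" by (simp add: S_def sum_distrib_left)
    finally have 1: "ennreal (norm (Th (atom_part f) t x)) \<le> ennreal ?c * S" .
    have "S \<le> (\<Sum>j\<in>{l..q}. ennreal 3 * PhiV j x)"
      unfolding S_def using alpha t by (intro sum_mono mult_right_mono ennreal_leI rho_le) auto
    also have "\<dots> = ennreal 3 * (\<Sum>j\<in>{l..q}. PhiV j x)" by (simp add: sum_distrib_left)
    also have "\<dots> \<le> ennreal 3 * ennreal ?W" by (intro mult_left_mono sum_PhiV[OF Phi]) simp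
    also have "\<dots> = ennreal (3 * ?W)" by (rule ennreal_mult'[symmetric]) simp
    finally have 2: "S \<le> ennreal (3 * ?W)" .
    have "(ennreal (norm (Th (atom_part f) t x)))\<^sup>2 \<le> (ennreal ?c * S)\<^sup>2"
      by (rule power_mono[OF 1]) simp
    also have "\<dots> = ennreal (?c\<^sup>2) * (S * S)"
      using c by (simp add: power_mult_distrib ennreal_power power2_eq_square[of S])
    also have "\<dots> \<le> ennreal (?c\<^sup>2) * (ennreal (3 * ?W) * S)"
      by (intro mult_left_mono mult_right_mono 2) auto
    also have "\<dots> = ennreal (?c\<^sup>2 * (3 * ?W)) * (\<Sum>j\<in>{l..q}. PhiV j x * ennreal (?r j t))"
    proof -
      have "S = (\<Sum>j\<in>{l..q}. PhiV j x * ennreal (?r j t))" by (simp add: S_def mult.commute)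
      then show ?thesis by (simp only: ennreal_mult'[OF zero_le_power2] mult.assoc)
    qed
    finally show ?thesis using True by simp
  qed simp
  then have "(\<integral>\<^sup>+t. indicator {t. lev t \<in> {l..q}} t * (ennreal (norm (Th (atom_part f) t x)))\<^sup>2 \<partial>dtt)
      \<le> (\<integral>\<^sup>+t. ennreal (?c\<^sup>2 * (3 * ?W)) * (\<Sum>j\<in>{l..q}. PhiV j x * ennreal (?r j t)) \<partial>dtt)"
    by (rule nn_integral_dtt_mono)
  also have "\<dots> = ennreal (?c\<^sup>2 * (3 * ?W)) * (\<Sum>j\<in>{l..q}. PhiV j x * (\<integral>\<^sup>+t. ennreal (?r j t) \<partial>dtt))"
    by (subst nn_integral_cmult, measurable, subst nn_integral_sum) (auto simp: nn_integral_cmult)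
  also have "\<dots> \<le> ennreal (?c\<^sup>2 * (3 * ?W)) * (\<Sum>j\<in>{l..q}. PhiV j x * ennreal (3 / (\<alpha> / 2)))"
    using alpha by (intro mult_left_mono sum_mono rho_integral) auto
  also have "\<dots> = ennreal (?c\<^sup>2 * (3 * ?W)) * ((\<Sum>j\<in>{l..q}. PhiV j x) * ennreal (6 / \<alpha>))"
    by (simp add: sum_distrib_right)
  also have "\<dots> \<le> ennreal (?c\<^sup>2 * (3 * ?W)) * (ennreal ?W * ennreal (6 / \<alpha>))"
    by (intro mult_left_mono mult_right_mono sum_PhiV[OF Phi]) auto
  also have "\<dots> = ennreal (?c\<^sup>2 * (3 * ?W) * (?W * (6 / \<alpha>)))"
  proof -
    have "ennreal ?W * ennreal (6 / \<alpha>) = ennreal (?W * (6 / \<alpha>))"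
      by (rule ennreal_mult[symmetric]) (use W alpha in auto)
    then show ?thesis using W alpha by (simp only:) (subst ennreal_mult[symmetric], auto)
  qed
  also have "?c\<^sup>2 * (3 * ?W) * (?W * (6 / \<alpha>)) = 18 * ?c\<^sup>2 * ?W\<^sup>2 / \<alpha>"
  proof -
    have "c\<^sup>2 * (3 * w) * (w * (6 / a)) = 18 * c\<^sup>2 * w\<^sup>2 / a" for c w a :: real
      by (simp add: power2_eq_square)
    then show ?thesis .
  qed
  finally show ?thesis .
qed

text \<open>At x the averages of \<open>f\<close> and of its good part agree, so the left-hand side
  is \<open>Th\<close> minus \<open>R\<close> of the good part; and \<open>Th\<close> of the good
  part is \<open>Th f\<close> without atoms and tail.\<close>

lemma gam_avg_identity:
  assumes [measurable]: "f \<in> borel_measurable borel" and f: "\<And>y. ennreal (norm (f y)) \<le> B y"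
    and fin: "(\<integral>\<^sup>+y. ennreal (wt \<alpha> t (x - y)) * ennreal (norm (f y)) \<partial>lborel) < \<infinity>"
    and Phi: "Phi (\<alpha> / 2) x \<le> ennreal ((2 + real CARD('n)) powr (- (real CARD('n) + 1)) / 2)"
    and t: "t > 0" and levt: "lev t \<in> {l..q}" and x: "x \<in> Q"
  shows "gam t x * avg (lev t) f x = Th f t x - Th (atom_part f) t x - Th (tail_part f) t x - R (good_part f) t x"
proof -
  have if_: "integrable lborel (\<lambda>y. \<psi> t x y * f y)" by (rule Th_integrable[OF t _ fin]) measurable
  have ia: "integrable lborel (\<lambda>y. \<psi> t x y * atom_part f y)" by (rule Th_atom_part(1)[OF _ f t]) measurable
  have ig: "integrable lborel (\<lambda>y. \<psi> t x y * good_part f y)" by (rule Th_L2_integrable[OF t L2_good_part[OF f]])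
  have e: "\<psi> t x y * tail_part f y = \<psi> t x y * f y - \<psi> t x y * atom_part f y - \<psi> t x y * good_part f y" for y
  proof -
    have "tail_part f y = f y - atom_part f y - good_part f y" using decomposition[of f y] by (simp add: algebra_simps)
    then show ?thesis by (simp add: right_diff_distrib)
  qed
  have T: "Th (tail_part f) t x = Th f t x - Th (atom_part f) t x - Th (good_part f) t x"
    unfolding Th_def e using if_ ia ig by simp
  have "avg (lev t) (good_part f) x = avg (lev t) f x"
  proof (rule avg_good_part[OF _ f levt x])
    show "\<not> bad j x" if "j \<in> {l..q}" for j
      by (rule not_bad[OF _ _ Phi x that]) (use alpha in auto)
  qed auto
  then show ?thesis unfolding R_def T by simp
qed

end

section \<open>Cones of directions\<close>

text \<open>A Lipschitz substitute for the restriction of the norm to the narrow cone of directions around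
  \<open>v\<close>, so that a John--Nirenberg argument applies to \<open>cone_fun \<kappa> v\<close> of a Hoelder function.\<close>

definition cone_fun :: "real \<Rightarrow> 'a::real_normed_vector \<Rightarrow> 'a \<Rightarrow> real"
  where "cone_fun \<kappa> v z = max 0 (\<kappa> * norm z - norm (z - norm z *\<^sub>R v))"

lemma cone_fun_nonneg: "cone_fun \<kappa> v z \<ge> 0"
  by (simp add: cone_fun_def)

lemma cone_fun_lipschitz:
  assumes "\<kappa> \<ge> 0" "norm v = 1"
  shows "\<bar>cone_fun \<kappa> v z - cone_fun \<kappa> v w\<bar> \<le> (\<kappa> + 2) * norm (z - w)"
proof -
  have 1: "\<bar>norm z - norm w\<bar> \<le> norm (z - w)" by (rule norm_triangle_ineq3)
  have "\<bar>norm (z - norm z *\<^sub>R v) - norm (w - norm w *\<^sub>R v)\<bar> \<le> norm ((z - norm z *\<^sub>R v) - (w - norm w *\<^sub>R v))"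
    by (rule norm_triangle_ineq3)
  also have "(z - norm z *\<^sub>R v) - (w - norm w *\<^sub>R v) = (z - w) - (norm z - norm w) *\<^sub>R v"
    by (simp add: scaleR_diff_left)
  also have "norm \<dots> \<le> norm (z - w) + \<bar>norm z - norm w\<bar>"
    using norm_triangle_ineq4[of "z - w" "(norm z - norm w) *\<^sub>R v"] assms by simp
  finally have 2: "\<bar>norm (z - norm z *\<^sub>R v) - norm (w - norm w *\<^sub>R v)\<bar> \<le> 2 * norm (z - w)" using 1 by linarith
  have 3: "\<bar>\<kappa> * norm z - \<kappa> * norm w\<bar> \<le> \<kappa> * norm (z - w)"
    using mult_left_mono[OF 1 assms(1)] assms(1) by (simp add: abs_mult right_diff_distrib[symmetric])
  have "\<bar>max 0 a - max 0 b\<bar> \<le> \<bar>a - b\<bar>" for a b :: real by linarith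
  then have "\<bar>cone_fun \<kappa> v z - cone_fun \<kappa> v w\<bar> \<le> \<bar>(\<kappa> * norm z - norm (z - norm z *\<^sub>R v)) - (\<kappa> * norm w - norm (w - norm w *\<^sub>R v))\<bar>"
    unfolding cone_fun_def .
  also have "\<dots> \<le> \<kappa> * norm (z - w) + 2 * norm (z - w)" using 2 3 by linarith
  finally show ?thesis by (simp add: distrib_right)
qed

text \<open>In directions within \<kappa>/2 of v, \<open>cone_fun\<close> is at least \<kappa>/2
  times the norm, whence the factor 4 / \<kappa>^2. Total boundedness of the sphere provides the
  finite set.\<close>

lemma cone_net:
  assumes "\<kappa> > 0"
  obtains S :: "'a::euclidean_space set" where "finite S" "\<And>v. v \<in> S \<Longrightarrow> norm v = 1"
    "\<And>z. (norm z)\<^sup>2 \<le> (4 / \<kappa>\<^sup>2) * (\<Sum>v\<in>S. (cone_fun \<kappa> v z)\<^sup>2)"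
proof -
  have "seq_compact (sphere (0::'a) 1)" by (intro compact_imp_seq_compact compact_sphere)
  then obtain S :: "'a set" where S: "finite S" "S \<subseteq> sphere 0 1" "sphere 0 1 \<subseteq> (\<Union>x\<in>S. ball x (\<kappa> / 2))"
    using seq_compact_imp_totally_bounded[of "sphere (0::'a) 1"] assms half_gt_zero by blast
  show ?thesis
  proof
    show "finite S" by fact
    show "norm v = 1" if "v \<in> S" for v using S(2) that by auto
    show "(norm z)\<^sup>2 \<le> (4 / \<kappa>\<^sup>2) * (\<Sum>v\<in>S. (cone_fun \<kappa> v z)\<^sup>2)" for z
    proof (cases "z = 0")
      case True
      then show ?thesis using assms by (simp add: sum_nonneg)
    next
      case False
      then have "z /\<^sub>R norm z \<in> sphere 0 1" by simp
      from subsetD[OF S(3) this] obtain v where "v \<in> S" "z /\<^sub>R norm z \<in> ball v (\<kappa> / 2)" by blast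
      then have v: "v \<in> S" "dist v (z /\<^sub>R norm z) < \<kappa> / 2" by simp_all
      have "norm (z - norm z *\<^sub>R v) = norm z * dist v (z /\<^sub>R norm z)"
      proof -
        have "z - norm z *\<^sub>R v = norm z *\<^sub>R (z /\<^sub>R norm z - v)" using False by (simp add: scaleR_diff_right)
        then show ?thesis by (simp add: dist_norm norm_minus_commute)
      qed
      also have "\<dots> \<le> norm z * (\<kappa> / 2)" using v(2) by (intro mult_left_mono) auto
      finally have "\<kappa> / 2 * norm z \<le> \<kappa> * norm z - norm (z - norm z *\<^sub>R v)" by (simp add: mult.commute)
      then have "\<kappa> / 2 * norm z \<le> cone_fun \<kappa> v z" unfolding cone_fun_def by (rule max.coboundedI2)
      then have "(\<kappa> / 2 * norm z)\<^sup>2 \<le> (cone_fun \<kappa> v z)\<^sup>2" using assms by (intro power_mono) auto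
      also have "\<dots> \<le> (\<Sum>v\<in>S. (cone_fun \<kappa> v z)\<^sup>2)" by (rule member_le_sum[OF v(1)]) (auto simp: S(1))
      finally have "(4 / \<kappa>\<^sup>2) * (\<kappa> / 2 * norm z)\<^sup>2 \<le> (4 / \<kappa>\<^sup>2) * (\<Sum>v\<in>S. (cone_fun \<kappa> v z)\<^sup>2)"
        by (intro mult_left_mono) auto
      then show ?thesis using assms by (simp add: power_mult_distrib power_divide)
    qed
  qed
qed

section \<open>Matrices, rows and accretivity\<close>

lemma norm_sq_vec: "(norm z)\<^sup>2 = (\<Sum>i\<in>UNIV. (norm (z $ i))\<^sup>2)" for z :: "'b::real_normed_vector ^ 'm"
  by (simp add: norm_vec_def L2_set_def sum_nonneg)

lemma norm_sum_mult_le: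
  fixes a c :: "'m::finite \<Rightarrow> complex"
  shows "(norm (\<Sum>i\<in>UNIV. a i * c i))\<^sup>2 \<le> (\<Sum>i\<in>UNIV. (norm (a i))\<^sup>2) * (\<Sum>i\<in>UNIV. (norm (c i))\<^sup>2)"
proof -
  have "norm (\<Sum>i\<in>UNIV. a i * c i) \<le> (\<Sum>i\<in>UNIV. \<bar>norm (a i)\<bar> * \<bar>norm (c i)\<bar>)"
    by (rule order_trans[OF norm_sum]) (simp add: norm_mult)
  also have "\<dots> \<le> L2_set (\<lambda>i. norm (a i)) UNIV * L2_set (\<lambda>i. norm (c i)) UNIV"
    by (rule L2_set_mult_ineq)
  finally have "(norm (\<Sum>i\<in>UNIV. a i * c i))\<^sup>2 \<le> (L2_set (\<lambda>i. norm (a i)) UNIV * L2_set (\<lambda>i. norm (c i)) UNIV)\<^sup>2"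
    by (rule power_mono) simp
  then show ?thesis by (simp add: power_mult_distrib L2_set_def sum_nonneg)
qed

lemma cdot_norm_le: "norm (cdot z w) \<le> norm z * norm w"
proof -
  have "(norm (cdot z w))\<^sup>2 \<le> (norm z * norm w)\<^sup>2"
    unfolding cdot_def power_mult_distrib norm_sq_vec by (rule norm_sum_mult_le)
  then show ?thesis by (rule power2_le_imp_le) simp
qed

lemma norm_vec_cnj [simp]: "norm (vec_cnj z) = norm z"
  by (simp add: vec_cnj_def norm_vec_def L2_set_def)

text \<open>The Hilbert--Schmidt norm dominates the operator norm of the row action, by
  Cauchy--Schwarz in each column.\<close>

lemma norm_vector_matrix_le: "norm (z v* M) \<le> norm z * norm M" for M :: "complex ^ 'm ^ 'm"
proof -
  have "(norm (z v* M))\<^sup>2 = (\<Sum>j\<in>UNIV. (norm (\<Sum>i\<in>UNIV. z $ i * M $ i $ j))\<^sup>2)"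
    by (simp add: norm_sq_vec vector_matrix_mult_def mult.commute)
  also have "\<dots> \<le> (\<Sum>j\<in>UNIV. (\<Sum>i\<in>UNIV. (norm (z $ i))\<^sup>2) * (\<Sum>i\<in>UNIV. (norm (M $ i $ j))\<^sup>2))"
    by (intro sum_mono norm_sum_mult_le)
  also have "\<dots> = (norm z)\<^sup>2 * (\<Sum>j\<in>UNIV. \<Sum>i\<in>UNIV. (norm (M $ i $ j))\<^sup>2)"
    by (simp add: sum_distrib_left norm_sq_vec[of z])
  also have "(\<Sum>j\<in>UNIV. \<Sum>i\<in>UNIV. (norm (M $ i $ j))\<^sup>2) = (norm M)\<^sup>2"
    by (subst sum.swap) (simp add: norm_sq_vec)
  finally have "(norm (z v* M))\<^sup>2 \<le> (norm z * norm M)\<^sup>2" by (simp add: power_mult_distrib)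
  then show ?thesis by (rule power2_le_imp_le) simp
qed

lemma norm_matrix_entry_le: "norm (M $ i $ j) \<le> norm M" for M :: "complex ^ 'm ^ 'm"
  using Finite_Cartesian_Product.norm_nth_le[of M i] Finite_Cartesian_Product.norm_nth_le[of "M $ i" j] by linarith

lemma cdot_matrix_vector: "cdot v (M *v w) = cdot (v v* M) w" for M :: "complex ^ 'm ^ 'm"
proof -
  have "cdot v (M *v w) = (\<Sum>i\<in>UNIV. \<Sum>j\<in>UNIV. v $ i * (M $ i $ j * w $ j))"
    by (simp add: cdot_def matrix_vector_mult_def sum_distrib_left)
  also have "\<dots> = (\<Sum>j\<in>UNIV. \<Sum>i\<in>UNIV. v $ i * (M $ i $ j * w $ j))" by (rule sum.swap)
  also have "\<dots> = cdot (v v* M) w"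
    by (simp add: cdot_def vector_matrix_mult_def sum_distrib_left sum_distrib_right mult_ac)
  finally show ?thesis .
qed

text \<open>A real linear functional of the matrix, so that it commutes with averages and can be
  stopped like a scalar function.\<close>

definition accr :: "complex ^ 'm \<Rightarrow> complex ^ 'm ^ 'm \<Rightarrow> real"
  where "accr v M = Re (cdot v (M *v vec_cnj v))"

lemma accr_alt: "accr v M = Re (cdot (v v* M) (vec_cnj v))"
  by (simp add: accr_def cdot_matrix_vector)

text \<open>This turns accretivity in the direction \<open>v\<close> into a lower bound for the
  length of a row.\<close>

lemma accr_le_row: "norm v = 1 \<Longrightarrow> accr v M \<le> norm (v v* M)"
  unfolding accr_alt
  using complex_Re_le_cmod[of "cdot (v v* M) (vec_cnj v)"] cdot_norm_le[of "v v* M" "vec_cnj v"] by simp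

lemma abs_accr_le: "norm v = 1 \<Longrightarrow> \<bar>accr v M\<bar> \<le> norm M"
  unfolding accr_alt
  using abs_Re_le_cmod[of "cdot (v v* M) (vec_cnj v)"] cdot_norm_le[of "v v* M" "vec_cnj v"] norm_vector_matrix_le[of v M]
  by simp

lemma bounded_linear_accr: "bounded_linear (accr v)"
proof -
  have "linear (accr v)"
  proof (rule linearI)
    show "accr v (M + N) = accr v M + accr v N" for M N
      by (simp add: accr_def cdot_def matrix_vector_mult_def distrib_left distrib_right sum.distrib)
    show "accr v (r *\<^sub>R M) = r *\<^sub>R accr v M" for r M
    proof -
      have "cdot v ((r *\<^sub>R M) *v w) = r *\<^sub>R cdot v (M *v w)" for w
        by (simp add: cdot_def matrix_vector_mult_def scaleR_sum_right[symmetric])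
      then show ?thesis by (simp add: accr_def)
    qed
  qed
  then show ?thesis by (simp add: linear_conv_bounded_linear)
qed

lemma measurable_accr [measurable (raw)]:
  "f \<in> borel_measurable M \<Longrightarrow> (\<lambda>x. accr v (f x)) \<in> borel_measurable M"
  by (rule measurable_compose[OF _ borel_measurable_continuous_onI])
     (auto intro: linear_continuous_on bounded_linear_accr)

text \<open>In the cone z = |z| v + e with |e| \<le> \<kappa> |z|. The row belonging to |z| v has
  length at least |z| \<delta>/2, and e changes it by at most \<kappa> K |z| = |z| \<delta>/4; hence
  the choice \<kappa> = \<delta> / (4 K).\<close>

lemma cone_fun_row_le:
  fixes M :: "complex ^ 'm ^ 'm"
  assumes v: "norm v = 1" and \<delta>: "\<delta> > 0" and K: "K > 0" and M: "norm M \<le> K" "\<delta> / 2 \<le> accr v M"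
  shows "cone_fun (\<delta> / (4 * K)) v z \<le> norm (z v* M) / K"
proof (cases "cone_fun (\<delta> / (4 * K)) v z = 0")
  case True
  then show ?thesis using K by simp
next
  case False
  let ?\<kappa> = "\<delta> / (4 * K)"
  define e where "e = z - norm z *\<^sub>R v"
  have e: "norm e \<le> ?\<kappa> * norm z" "cone_fun ?\<kappa> v z \<le> ?\<kappa> * norm z"
    using False unfolding cone_fun_def e_def by (auto simp: max_def split: if_splits)
  have "norm z * (\<delta> / 2) \<le> norm z * norm (v v* M)"
    using M(2) accr_le_row[OF v, of M] by (intro mult_left_mono) auto
  also have "\<dots> = norm ((norm z *\<^sub>R v) v* M)"
  proof -
    have "(norm z *\<^sub>R v) v* M = norm z *\<^sub>R (v v* M)"
      by (simp add: vec_eq_iff vector_matrix_mult_def scaleR_sum_right)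
    then show ?thesis by simp
  qed
  also have "(norm z *\<^sub>R v) v* M = z v* M - e v* M"
    unfolding e_def by (simp add: vec_eq_iff vector_matrix_mult_def sum_subtractf[symmetric] left_diff_distrib)
  also have "norm \<dots> \<le> norm (z v* M) + norm (e v* M)" by (rule norm_triangle_ineq4)
  also have "norm (e v* M) \<le> ?\<kappa> * norm z * K"
    using norm_vector_matrix_le[of e M] mult_mono[OF e(1) M(1)] \<delta> K by auto
  finally have "norm z * (\<delta> / 2) \<le> norm (z v* M) + ?\<kappa> * norm z * K" by simp
  then have "norm z * (\<delta> / 4) \<le> norm (z v* M)" using K by (simp add: field_simps)
  then have "norm z * (\<delta> / 4) / K \<le> norm (z v* M) / K" using K by (intro divide_right_mono) auto
  then show ?thesis using e(2) by (simp add: mult.commute)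
qed

section \<open>Measure estimates for stopping and boundary sets\<close>

text \<open>\<open>E\<close> is described by translates along the axes, so that
  \<open>emeasure_cube_shift\<close> measures its complement in the cube. As the index is monotone
  in each coordinate, a point closer to x than the shift lies in the same cube.\<close>

lemma measure_inside:
  fixes x0 :: "real ^ 'n" and q :: int
  assumes \<epsilon>: "\<epsilon> > 0"
  defines "E \<equiv> {x \<in> cube_of q x0. \<forall>i. x + axis i (\<epsilon> * 2 powi q) \<in> cube_of q x0 \<and> x + axis i (- (\<epsilon> * 2 powi q)) \<in> cube_of q x0}"
  shows "E \<in> sets borel"
    and "emeasure lborel (cube_of q x0 - E) \<le> ennreal (2 * (real CARD('n))\<^sup>2 * \<epsilon> * cvol CARD('n) q)"
    and "x \<in> E \<Longrightarrow> y \<notin> cube_of q x0 \<Longrightarrow> \<epsilon> * 2 powi q \<le> norm (x - y)"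
proof -
  let ?n = "real CARD('n)" let ?Q = "cube_of q x0" let ?s = "\<epsilon> * 2 powi q"
  have E: "E = ?Q \<inter> (\<Inter>i. {x. x + axis i ?s \<in> ?Q} \<inter> {x. x + axis i (- ?s) \<in> ?Q})"
    unfolding E_def by auto
  have m: "{x. x + h \<in> ?Q} \<in> sets borel" for h :: "real ^ 'n" by measurable
  show Em [measurable]: "E \<in> sets borel"
    unfolding E by (intro sets.Int sets.countable_INT' m) auto
  have n: "norm (axis i c :: real ^ 'n) = \<bar>c\<bar>" for i and c :: real by (simp add: norm_eq_sqrt_inner inner_axis_axis)
  define F where "F h = {x \<in> ?Q. x + h \<notin> ?Q}" for h :: "real ^ 'n"
  have [measurable]: "F h \<in> sets borel" for h unfolding F_def by measurable
  have F: "emeasure lborel (F h) \<le> ennreal (?n * \<epsilon> * cvol CARD('n) q)" if "norm h = ?s" for h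
  proof -
    have "emeasure lborel (F h) = (\<integral>\<^sup>+y. indicator (F h) y \<partial>lborel)" by simp
    also have "\<dots> = (\<integral>\<^sup>+y. indicator ?Q y * indicator (- ?Q) (y + h) \<partial>lborel)"
      by (intro nn_integral_cong) (auto simp: F_def indicator_def)
    also have "\<dots> \<le> ennreal (?n * (norm h / 2 powi q) * cvol CARD('n) q)" by (rule emeasure_cube_shift)
    finally show ?thesis using that by simp
  qed
  have "?Q - E \<subseteq> (\<Union>i. F (axis i ?s) \<union> F (axis i (- ?s)))" unfolding E_def F_def by auto
  then have "emeasure lborel (?Q - E) \<le> emeasure lborel (\<Union>i. F (axis i ?s) \<union> F (axis i (- ?s)))"
    by (intro emeasure_mono) auto
  also have "\<dots> \<le> (\<Sum>i\<in>UNIV. emeasure lborel (F (axis i ?s) \<union> F (axis i (- ?s))))"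
    by (rule emeasure_subadditive_finite) auto
  also have "\<dots> \<le> (\<Sum>i\<in>(UNIV::'n set). ennreal (?n * \<epsilon> * cvol CARD('n) q) + ennreal (?n * \<epsilon> * cvol CARD('n) q))"
  proof (rule sum_mono)
    fix i :: 'n
    have "emeasure lborel (F (axis i ?s) \<union> F (axis i (- ?s))) \<le> emeasure lborel (F (axis i ?s)) + emeasure lborel (F (axis i (- ?s)))"
      by (rule emeasure_subadditive) auto
    also have "\<dots> \<le> ennreal (?n * \<epsilon> * cvol CARD('n) q) + ennreal (?n * \<epsilon> * cvol CARD('n) q)"
      using \<epsilon> by (intro add_mono F) (auto simp: n)
    finally show "emeasure lborel (F (axis i ?s) \<union> F (axis i (- ?s))) \<le> ennreal (?n * \<epsilon> * cvol CARD('n) q) + ennreal (?n * \<epsilon> * cvol CARD('n) q)" .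
  qed
  also have "\<dots> = ennreal (2 * ?n\<^sup>2 * \<epsilon> * cvol CARD('n) q)"
    using \<epsilon> by (simp add: ennreal_plus[symmetric] ennreal_of_nat_eq_real_of_nat ennreal_mult'[symmetric] power2_eq_square del: ennreal_plus)
  finally show "emeasure lborel (?Q - E) \<le> ennreal (2 * ?n\<^sup>2 * \<epsilon> * cvol CARD('n) q)" .
  show "\<epsilon> * 2 powi q \<le> norm (x - y)" if x: "x \<in> E" and y: "y \<notin> ?Q"
  proof (rule ccontr)
    assume "\<not> ?s \<le> norm (x - y)"
    then have lt: "norm (x - y) < ?s" by simp
    have "\<lfloor>y $ i / 2 powi q\<rfloor> = \<lfloor>x0 $ i / 2 powi q\<rfloor>" for i
    proof -
      let ?f = "\<lambda>z. \<lfloor>z / 2 powi q\<rfloor>"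
      have "\<bar>(x - y) $ i\<bar> < ?s" using component_le_norm_cart[of "x - y" i] lt by linarith
      then have b: "x $ i - ?s \<le> y $ i" "y $ i \<le> x $ i + ?s" by (auto simp: abs_less_iff)
      have c: "cube_index q (x + axis i ?s) $ i = cube_index q x0 $ i" "cube_index q (x + axis i (- ?s)) $ i = cube_index q x0 $ i"
        using x by (auto simp: E_def cube_of_def)
      have "?f (x $ i - ?s) \<le> ?f (y $ i)" "?f (y $ i) \<le> ?f (x $ i + ?s)"
        using b by (auto intro!: floor_mono divide_right_mono)
      then show ?thesis using c by (simp add: cube_index_def)
    qed
    then have "y \<in> ?Q" by (simp add: cube_of_def cube_index_def vec_eq_iff)
    then show False using y by simp
  qed
qed

text \<open>The set is the disjoint union of the maximal cubes satisfying P, and \<open>g\<close>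
  has nonpositive integral over each. The induction adds these cubes level by level, from the empty
  set at \<open>q + 1\<close>.\<close>

lemma stopping_integral_le:
  fixes g :: "real ^ 'n \<Rightarrow> real"
  assumes g: "locint g" and P: "\<And>j x y. cube_index j x = cube_index j y \<Longrightarrow> P j x = P j y"
    and neg: "\<And>j x. P j x \<Longrightarrow> avg j g x \<le> 0" and "j \<le> q + 1"
  shows "{y \<in> cube_of q x0. \<exists>k\<in>{j..q}. P k y} \<in> sets borel \<and>
    integrable lborel (\<lambda>y. indicator {y \<in> cube_of q x0. \<exists>k\<in>{j..q}. P k y} y * g y) \<and>
    (LINT y|lborel. indicator {y \<in> cube_of q x0. \<exists>k\<in>{j..q}. P k y} y * g y) \<le> 0"
  using assms(4)
proof (induction j rule: int_le_induct)
  case base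
  then show ?case by simp
next
  case (step j)
  let ?Q = "cube_of q x0" let ?B = "\<lambda>j. {y \<in> ?Q. \<exists>k\<in>{j..q}. P k y}"
  let ?V = "{y \<in> ?Q. P (j - 1) y \<and> \<not> (\<exists>k\<in>{j..q}. P k y)}"
  have jq: "j - 1 \<le> q" using step.hyps by simp
  have [measurable]: "g \<in> borel_measurable borel" using g by (simp add: locint_def)
  have lev: "y \<in> ?V \<longleftrightarrow> z \<in> ?V" if "cube_index (j - 1) y = cube_index (j - 1) z" for y z
  proof -
    have "cube_index k y = cube_index k z" if "k \<ge> j - 1" for k
      using cube_index_mono[OF \<open>cube_index (j - 1) y = cube_index (j - 1) z\<close>] that by auto
    then have "P k y = P k z" if "k \<ge> j - 1" for k using P that by metis
    moreover have "y \<in> ?Q \<longleftrightarrow> z \<in> ?Q"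
      using cube_index_mono[OF that jq] by (simp add: cube_of_def)
    ultimately show ?thesis by auto
  qed
  have Vm [measurable]: "?V \<in> sets borel" using sets_level[of "j - 1" "\<lambda>y. y \<in> ?V", OF lev] by simp
  have un: "?B (j - 1) = ?B j \<union> ?V" and di: "?B j \<inter> ?V = {}"
  proof -
    have "{j - 1..q} = insert (j - 1) {j..q}" using jq by auto
    then show "?B (j - 1) = ?B j \<union> ?V" by auto
  qed auto
  have ind: "indicator (?B (j - 1)) y * g y = indicator (?B j) y * g y + indicator ?V y * g y" for y
    unfolding un using di by (auto simp: indicator_def)
  let ?u = "\<lambda>y. indicator ?V y :: real"
  have u: "avg (j - 1) ?u y = ?u y" for y
    by (rule avg_level) (auto simp: indicator_def dest: lev[THEN iffD1] lev[THEN iffD2])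
  have "(\<integral>\<^sup>+y. ennreal (norm (?u y)) * avn (j - 1) (\<lambda>y. ennreal (norm (g y))) y \<partial>lborel)
      = (\<integral>\<^sup>+y. ennreal (norm (?u y)) * ennreal (norm (g y)) \<partial>lborel)"
    by (rule nn_integral_avn_weight) (measurable, auto simp: indicator_def dest: lev[THEN iffD1] lev[THEN iffD2])
  also have "\<dots> \<le> (\<integral>\<^sup>+y. ennreal (norm (indicator ?Q y *\<^sub>R g y)) \<partial>lborel)"
    by (intro nn_integral_mono) (auto simp: indicator_def)
  also have "\<dots> < \<infinity>" using locint_integrable[OF g, of q x0] unfolding integrable_iff_bounded by simp
  finally have fin: "(\<integral>\<^sup>+y. ennreal (norm (?u y)) * avn (j - 1) (\<lambda>y. ennreal (norm (g y))) y \<partial>lborel) < \<infinity>" .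
  have um: "?u \<in> borel_measurable borel" by measurable
  have gm: "g \<in> borel_measurable borel" by measurable
  note sa = avg_selfadjoint[OF um gm fin, unfolded u]
  have iV: "integrable lborel (\<lambda>y. ?u y * g y)" using sa(2) by simp
  have "(LINT y|lborel. ?u y * g y) = (LINT y|lborel. ?u y * avg (j - 1) g y)" using sa(3) by simp
  also have "\<dots> \<le> 0"
  proof -
    have "?u y * avg (j - 1) g y \<le> 0" for y
      using neg[of "j - 1" y] by (auto simp: indicator_def)
    then have "(LINT y|lborel. ?u y * avg (j - 1) g y) \<le> (LINT y|(lborel :: (real ^ 'n) measure). 0)"
      using sa(1) by (intro integral_mono) auto
    then show ?thesis by simp
  qed
  finally have V0: "(LINT y|lborel. ?u y * g y) \<le> 0" .
  show ?case
  proof (intro conjI)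
    have "?B j \<in> sets borel" using step.IH by simp
    then show "?B (j - 1) \<in> sets borel" unfolding un by (rule sets.Un[OF _ Vm])
    show "integrable lborel (\<lambda>y. indicator (?B (j - 1)) y * g y)"
      unfolding ind using step.IH iV by (intro Bochner_Integration.integrable_add) auto
    show "(LINT y|lborel. indicator (?B (j - 1)) y * g y) \<le> 0"
      unfolding ind using step.IH iV V0 by (subst Bochner_Integration.integral_add) auto
  qed
qed

lemma markov_lborel:
  fixes f :: "'a::euclidean_space \<Rightarrow> ennreal"
  assumes [measurable]: "f \<in> borel_measurable borel" "E \<in> sets borel" and c: "c > 0"
    and le: "(\<integral>\<^sup>+x. indicator E x * f x \<partial>lborel) \<le> ennreal (c * d)"
  shows "emeasure lborel {x \<in> E. ennreal c < f x} \<le> ennreal d"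
proof -
  let ?S = "{x \<in> E. ennreal c < f x}"
  have "ennreal c * emeasure lborel ?S = (\<integral>\<^sup>+x. ennreal c * indicator ?S x \<partial>lborel)"
    by (rule nn_integral_cmult_indicator[symmetric]) measurable
  also have "\<dots> \<le> (\<integral>\<^sup>+x. indicator E x * f x \<partial>lborel)"
    by (intro nn_integral_mono) (auto simp: indicator_def less_imp_le)
  also note le
  finally have 1: "ennreal c * emeasure lborel ?S \<le> ennreal (c * d)" .
  then have "ennreal (1 / c) * (ennreal c * emeasure lborel ?S) \<le> ennreal (1 / c) * ennreal (c * d)"
    by (rule mult_left_mono) simp
  also have "ennreal (1 / c) * ennreal (c * d) = ennreal d"
    using c by (subst ennreal_mult'[symmetric]) auto
  also have "ennreal (1 / c) * (ennreal c * emeasure lborel ?S) = emeasure lborel ?S"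
    unfolding mult.assoc[symmetric] using c by (subst ennreal_mult[symmetric]) auto
  finally show ?thesis .
qed

text \<open>Above the height \<open>lam\<close> one has s = s^p s^(1-p) \<le> lam^(1-p) s^p. It
  takes the place of Hoelder's inequality.\<close>

lemma powr_split_le:
  fixes s lam p :: real
  assumes "s \<ge> 0" "lam > 0" "p > 1"
  shows "s \<le> lam + lam powr (1 - p) * s powr p"
proof (cases "s \<le> lam")
  case True
  then show ?thesis using assms by (simp add: add_increasing2)
next
  case False
  then have "lam powr (1 - p) * s powr p = s * (s / lam) powr (p - 1)"
    using assms by (simp add: powr_divide powr_diff)
  moreover have "1 \<le> (s / lam) powr (p - 1)"
    using False assms by (intro ge_one_powr_ge_zero) auto
  ultimately have "s * 1 \<le> lam powr (1 - p) * s powr p"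
    using assms by (metis mult_left_mono)
  then show ?thesis using assms by simp
qed

lemma avg_bounded_linear:
  fixes f :: "real ^ 'n \<Rightarrow> 'b::{banach,second_countable_topology}"
    and L :: "'b \<Rightarrow> 'c::{banach,second_countable_topology}"
  assumes L: "bounded_linear L" and f: "locint f"
  shows "avg j (\<lambda>y. L (f y)) x = L (avg j f x)"
proof -
  interpret bounded_linear L by fact
  have "avg j (\<lambda>y. L (f y)) x = (1 / cvol CARD('n) j) *\<^sub>R (LINT y|lborel. L (indicator (cube_of j x) y *\<^sub>R f y))"
    unfolding avg_def by (simp add: scaleR)
  also have "(LINT y|lborel. L (indicator (cube_of j x) y *\<^sub>R f y)) = L (LINT y|lborel. indicator (cube_of j x) y *\<^sub>R f y)"
    by (rule integral_bounded_linear[OF L locint_integrable[OF f]])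
  finally show ?thesis unfolding avg_def by (simp add: scaleR)
qed

section \<open>The local Tb argument on one cube\<close>

text \<open>The sum of \<open>th\<close> over i is kept whole, because the testing condition
  controls only this sum. The factor 6 m is 2 for separating it, 3 for three error terms and m for
  Cauchy--Schwarz over i.\<close>

lemma sum_sq_split_le:
  fixes th a s r :: "'m::finite \<Rightarrow> 'm \<Rightarrow> complex"
  shows "(\<Sum>j\<in>UNIV. (norm (\<Sum>i\<in>UNIV. th i j - a i j - s i j - r i j))\<^sup>2)
    \<le> 2 * (\<Sum>j\<in>UNIV. (norm (\<Sum>i\<in>UNIV. th i j))\<^sup>2)
      + 6 * real CARD('m) * (\<Sum>j\<in>UNIV. \<Sum>i\<in>UNIV. (norm (a i j))\<^sup>2 + (norm (s i j))\<^sup>2 + (norm (r i j))\<^sup>2)"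
proof -
  let ?m = "real CARD('m)"
  have col: "(norm (\<Sum>i\<in>UNIV. th i j - a i j - s i j - r i j))\<^sup>2
      \<le> 2 * (norm (\<Sum>i\<in>UNIV. th i j))\<^sup>2 + 6 * ?m * (\<Sum>i\<in>UNIV. (norm (a i j))\<^sup>2 + (norm (s i j))\<^sup>2 + (norm (r i j))\<^sup>2)" for j
  proof -
    define e where "e i = a i j + s i j + r i j" for i
    have e3: "(norm (e i))\<^sup>2 \<le> 3 * ((norm (a i j))\<^sup>2 + (norm (s i j))\<^sup>2 + (norm (r i j))\<^sup>2)" for i
    proof -
      have "norm (e i) \<le> norm (a i j) + norm (s i j) + norm (r i j)"
        unfolding e_def by (rule order_trans[OF norm_triangle_ineq]) (intro add_right_mono norm_triangle_ineq)
      then have "(norm (e i))\<^sup>2 \<le> (norm (a i j) + norm (s i j) + norm (r i j))\<^sup>2" by (rule power_mono) simp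
      also have "\<dots> \<le> 3 * ((norm (a i j))\<^sup>2 + (norm (s i j))\<^sup>2 + (norm (r i j))\<^sup>2)"
      proof -
        have "(x + y + z)\<^sup>2 \<le> 3 * (x\<^sup>2 + y\<^sup>2 + z\<^sup>2)" for x y z :: real
          using zero_le_power2[of "x - y"] zero_le_power2[of "x - z"] zero_le_power2[of "y - z"]
          by (simp add: power2_eq_square algebra_simps)
        then show ?thesis .
      qed
      finally show ?thesis .
    qed
    have "(\<Sum>i\<in>UNIV. th i j - a i j - s i j - r i j) = (\<Sum>i\<in>UNIV. th i j) - (\<Sum>i\<in>UNIV. e i)"
      unfolding sum_subtractf[symmetric] e_def by (intro sum.cong) auto
    then have "norm (\<Sum>i\<in>UNIV. th i j - a i j - s i j - r i j) \<le> norm (\<Sum>i\<in>UNIV. th i j) + norm (\<Sum>i\<in>UNIV. e i)"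
      by (simp add: norm_triangle_ineq4)
    then have "(norm (\<Sum>i\<in>UNIV. th i j - a i j - s i j - r i j))\<^sup>2 \<le> (norm (\<Sum>i\<in>UNIV. th i j) + norm (\<Sum>i\<in>UNIV. e i))\<^sup>2"
      by (rule power_mono) simp
    also have "\<dots> \<le> 2 * (norm (\<Sum>i\<in>UNIV. th i j))\<^sup>2 + 2 * (norm (\<Sum>i\<in>UNIV. e i))\<^sup>2"
      using sum_squares_bound[of "norm (\<Sum>i\<in>UNIV. th i j)" "norm (\<Sum>i\<in>UNIV. e i)"] by (simp add: power2_sum)
    also have "(norm (\<Sum>i\<in>UNIV. e i))\<^sup>2 \<le> (\<Sum>i\<in>UNIV. norm (e i))\<^sup>2"
      by (intro power_mono norm_sum) auto
    also have "\<dots> \<le> (\<Sum>i\<in>UNIV. (norm (e i))\<^sup>2) * ?m"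
      by (rule sum_squared_le_sum_of_squares)
    also have "\<dots> \<le> (\<Sum>i\<in>UNIV. 3 * ((norm (a i j))\<^sup>2 + (norm (s i j))\<^sup>2 + (norm (r i j))\<^sup>2)) * ?m"
      by (intro mult_right_mono sum_mono e3) simp
    also have "\<dots> = 3 * ?m * (\<Sum>i\<in>UNIV. (norm (a i j))\<^sup>2 + (norm (s i j))\<^sup>2 + (norm (r i j))\<^sup>2)"
      by (simp only: sum_distrib_left[symmetric]) (simp only: mult_ac)
    finally show ?thesis by simp
  qed
  have "(\<Sum>j\<in>UNIV. (norm (\<Sum>i\<in>UNIV. th i j - a i j - s i j - r i j))\<^sup>2)
    \<le> (\<Sum>j\<in>UNIV. 2 * (norm (\<Sum>i\<in>UNIV. th i j))\<^sup>2 + 6 * ?m * (\<Sum>i\<in>UNIV. (norm (a i j))\<^sup>2 + (norm (s i j))\<^sup>2 + (norm (r i j))\<^sup>2))"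
    by (intro sum_mono col)
  also have "\<dots> = 2 * (\<Sum>j\<in>UNIV. (norm (\<Sum>i\<in>UNIV. th i j))\<^sup>2)
      + 6 * ?m * (\<Sum>j\<in>UNIV. \<Sum>i\<in>UNIV. (norm (a i j))\<^sup>2 + (norm (s i j))\<^sup>2 + (norm (r i j))\<^sup>2)"
    unfolding sum.distrib[of "\<lambda>j. 2 * (norm (\<Sum>i\<in>UNIV. th i j))\<^sup>2"] sum_distrib_left[symmetric] ..
  finally show ?thesis .
qed

lemma borel_measurable_vec_lambda:
  fixes f :: "'i::finite \<Rightarrow> 'a \<Rightarrow> 'b::euclidean_space"
  assumes [measurable]: "\<And>i. f i \<in> borel_measurable M"
  shows "(\<lambda>z. \<chi> i. f i z) \<in> borel_measurable M"
  unfolding borel_measurable_euclidean_space[where f="\<lambda>z. \<chi> i. f i z"]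
  by (auto simp: Basis_vec_def inner_axis)

lemma measurable_ennreal_powr [measurable (raw)]:
  assumes [measurable]: "f \<in> borel_measurable M"
  shows "(\<lambda>x. ennreal_powr (f x) a) \<in> borel_measurable M"
  unfolding ennreal_powr_def by measurable

lemma ennreal_powr_less:
  assumes "ennreal c < u" "c > 0" "a > 0"
  shows "ennreal (c powr a) < ennreal_powr u a"
proof (cases u)
  case (real s)
  then have "c < s" using assms by (simp add: ennreal_less_iff)
  then have "c powr a < s powr a" using assms by (intro powr_less_mono2) auto
  then show ?thesis using real assms by (auto simp: ennreal_powr_def ennreal_less_iff)
qed (simp add: ennreal_powr_def)

definition cT :: "nat \<Rightarrow> real \<Rightarrow> real \<Rightarrow> real \<Rightarrow> real \<Rightarrow> real"
  where "cT n \<alpha> A C\<^sub>0 \<epsilon> = (A * 2 powr (real n + \<alpha>) * (1 / \<epsilon>) powr \<alpha> * (Wc n \<alpha> + C\<^sub>0 / \<epsilon> ^ n))\<^sup>2 / (2 * \<alpha>)"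

definition cA :: "nat \<Rightarrow> real \<Rightarrow> real \<Rightarrow> real \<Rightarrow> real"
  where "cA n \<alpha> A K = 18 * (cS n \<alpha> A K)\<^sup>2 * (1 + Wc n (\<alpha> / 2))\<^sup>2 / \<alpha>"

text \<open>The scalar theory is applied to each component of the kernel; \<open>TB\<close>
  recombines the components.\<close>

locale tb_kernel =
  fixes \<alpha> A :: real and \<Psi> :: "real \<Rightarrow> real ^ 'n \<Rightarrow> real ^ 'n \<Rightarrow> complex ^ 'm"
  assumes comp: "\<And>i. kern \<alpha> A (\<lambda>t x y. \<Psi> t x y $ i)"
begin

sublocale k: kern \<alpha> A "\<lambda>t x y. \<Psi> t x y $ i" for i
  by (rule comp)

definition Gam :: "real \<Rightarrow> real ^ 'n \<Rightarrow> complex ^ 'm"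
  where "Gam t x = (\<chi> i. k.gam i t x)"

definition TB :: "(real ^ 'n \<Rightarrow> complex ^ 'm ^ 'm) \<Rightarrow> real \<Rightarrow> real ^ 'n \<Rightarrow> complex ^ 'm"
  where "TB b t x = (\<chi> j. \<Sum>i\<in>UNIV. k.Th i (\<lambda>y. b y $ i $ j) t x)"

lemma measurable_entry [measurable (raw)]:
  assumes [measurable]: "b \<in> borel_measurable M"
  shows "(\<lambda>y. (b y :: complex ^ 'm ^ 'm) $ i $ j) \<in> borel_measurable M"
proof -
  have "continuous_on UNIV (\<lambda>M :: complex ^ 'm ^ 'm. M $ i $ j)" by (intro continuous_intros)
  then show ?thesis
    by (intro measurable_compose[OF assms borel_measurable_continuous_onI])
qed

lemma measurable_Gam [measurable (raw)]:
  assumes [measurable]: "f \<in> borel_measurable M" "g \<in> borel_measurable M"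
  shows "(\<lambda>z. Gam (f z) (g z)) \<in> borel_measurable M"
  unfolding Gam_def by (rule borel_measurable_vec_lambda) measurable

lemma norm_TB_sq: "(norm (TB b t x))\<^sup>2 = (\<Sum>j\<in>UNIV. (norm (\<Sum>i\<in>UNIV. k.Th i (\<lambda>y. b y $ i $ j) t x))\<^sup>2)"
  by (simp add: norm_sq_vec TB_def)

text \<open>A proportion \<eta> of the cube survives the stopping for accretivity, and four
  exceptional sets take away at most \<eta>/8 each. Elsewhere \<gamma>_t in the cone is dominated by
  \<gamma>_t A_t b, that is, by \<open>TB b\<close> and the errors from atoms, tail and remainder.
  Among the parameters \<open>lam\<close> fixes \<eta>, \<open>K\<close> makes \<open>Phi\<close>
  small, \<epsilon> keeps away from the boundary, and \<open>lam1\<close> and \<open>lam2\<close>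
  are the heights for the remainder and for the testing square function.\<close>

lemma ample:
  fixes b :: "real ^ 'n \<Rightarrow> complex ^ 'm ^ 'm" and x0 :: "real ^ 'n"
  assumes lq: "l \<le> q" and b [measurable]: "b \<in> borel_measurable borel" and v: "norm v = 1"
    and pos: "\<delta> > 0" "p > 1" "C\<^sub>0 \<ge> 0" "lam > 0" "\<epsilon> > 0" "lam1 > 0" "lam2 > 0" and K: "1 + C\<^sub>0 \<le> K"
    and int_p: "(\<integral>\<^sup>+y. ennreal (norm (b y) powr p) \<partial>lborel) \<le> ennreal (C\<^sub>0 * cvol CARD('n) q)"
    and acc: "\<delta> \<le> accr v (avg q b x0)"
    and sq: "(\<integral>\<^sup>+x. indicator (cube_of q x0) x * ennreal_powr (\<integral>\<^sup>+t. indicator {t. lev t \<in> {..q}} t * (ennreal (norm (TB b t x)))\<^sup>2 \<partial>dtt) (p / 2) \<partial>lborel)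
      \<le> ennreal (C\<^sub>0 * cvol CARD('n) q)"
    and par: "lam powr (1 - p) * C\<^sub>0 \<le> \<delta> / 4" "\<eta> = \<delta> / (4 * lam)"
      "Wc CARD('n) (\<alpha> / 2) * (1 + C\<^sub>0) \<le> K * ((2 + real CARD('n)) powr (- (real CARD('n) + 1)) / 2 * (\<eta> / 8))"
      "2 * (real CARD('n))\<^sup>2 * \<epsilon> \<le> \<eta> / 8"
      "(real CARD('m))\<^sup>2 * (cR CARD('n) \<alpha> A * (2 ^ CARD('n) * K)\<^sup>2) \<le> lam1 * (\<eta> / 8)"
      "C\<^sub>0 \<le> lam2 powr (p / 2) * (\<eta> / 8)"
  shows "ennreal (\<eta> / 2 * cvol CARD('n) q) \<le> emeasure lborel {y \<in> cube_of q x0.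
      (\<integral>\<^sup>+t. indicator {t. lev t \<in> {l..q}} t * ennreal ((cone_fun (\<delta> / (4 * K)) v (Gam t y))\<^sup>2) \<partial>dtt)
      \<le> ennreal ((2 * lam2 + 6 * real CARD('m) * ((real CARD('m))\<^sup>2 * (cA CARD('n) \<alpha> A K + cT CARD('n) \<alpha> A C\<^sub>0 \<epsilon>) + lam1)) / K\<^sup>2)}"
proof -
  let ?n = "CARD('n)" let ?m = "real CARD('m)" let ?vol = "cvol CARD('n) q" let ?Q = "cube_of q x0"
  let ?c0 = "(2 + real ?n) powr (- (real ?n + 1)) / 2"
  define B where "B y = ennreal (norm (b y))" for y
  define D where "D y = ennreal (norm (b y) powr p)" for y
  have [measurable]: "B \<in> borel_measurable borel" "D \<in> borel_measurable borel" unfolding B_def D_def by measurable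
  have K0: "K > 0" using K pos by simp
  have \<eta>: "\<eta> > 0" using par(2) pos by simp
  have alpha: "0 < \<alpha>" "\<alpha> \<le> 1" and A: "0 \<le> A" using k.alpha k.A by auto
  have intD: "(\<integral>\<^sup>+y. D y \<partial>lborel) \<le> ennreal (C\<^sub>0 * ?vol)" unfolding D_def by (rule int_p)
  \<comment> \<open>It makes the averages of |b| finite although only |b|^p is assumed
    integrable.\<close>
  have BD: "B y \<le> 1 + D y" for y
  proof -
    have "norm (b y) \<le> 1 + 1 powr (1 - p) * norm (b y) powr p"
      by (rule powr_split_le) (use pos in auto)
    then have "ennreal (norm (b y)) \<le> ennreal (1 + norm (b y) powr p)" by (intro ennreal_leI) simp
    then show ?thesis by (simp add: B_def D_def)
  qed
  have avD: "avn j D x \<le> ennreal (1 / cvol ?n j) * ennreal (C\<^sub>0 * ?vol)" for j x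
  proof -
    have "(\<integral>\<^sup>+y. indicator (cube_of j x) y * D y \<partial>lborel) \<le> (\<integral>\<^sup>+y. D y \<partial>lborel)"
      by (intro nn_integral_mono) (auto simp: indicator_def)
    also note intD
    finally show ?thesis unfolding avn_def by (rule mult_left_mono) simp
  qed
  have avB: "avn j B x \<le> 1 + ennreal (1 / cvol ?n j) * ennreal (C\<^sub>0 * ?vol)" for j x
  proof -
    have "avn j B x \<le> avn j (\<lambda>y. 1 + D y) x" by (rule avn_mono) (rule BD)
    also have "\<dots> = 1 + avn j D x" by (subst avn_add) auto
    also have "\<dots> \<le> 1 + ennreal (1 / cvol ?n j) * ennreal (C\<^sub>0 * ?vol)" by (intro add_left_mono avD)
    finally show ?thesis .
  qed
  have Bfin: "avn j B x < \<infinity>" for j x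
    by (rule le_less_trans[OF avB]) (simp add: ennreal_mult_less_top)
  have avBq: "avn q B x \<le> ennreal (1 + C\<^sub>0)" for x
  proof -
    have "ennreal (1 / ?vol) * ennreal (C\<^sub>0 * ?vol) = ennreal C\<^sub>0"
      using pos by (subst ennreal_mult'[symmetric]) auto
    then have "avn q B x \<le> 1 + ennreal C\<^sub>0" using avB[of q x] by (simp only:)
    then show ?thesis using pos by simp
  qed
  have topg: "avn q B x0 \<le> ennreal K"
    using avBq[of x0] ennreal_leI[OF K] by (rule order_trans)
  interpret S: stopping l q x0 B K
    by standard (use lq K0 Bfin topg in auto)
  interpret KS: kern_stopping \<alpha> A "\<lambda>t x y. \<Psi> t x y $ i" l q x0 B K for i
    by standard
  have Qeq: "S.Q = ?Q" by (simp add: S.Q_def)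
  define f where "f i j y = b y $ i $ j" for i j y
  have fm [measurable]: "f i j \<in> borel_measurable borel" for i j unfolding f_def by measurable
  have fB: "ennreal (norm (f i j y)) \<le> B y" for i j y
    unfolding f_def B_def by (intro ennreal_leI norm_matrix_entry_le)
  have fD: "ennreal (norm (f i j y)) \<le> 1 + D y" for i j y
    using fB BD by (rule order_trans)
  have gm [measurable]: "S.good_part (f i j) \<in> borel_measurable borel" for i j by measurable
  have locb: "locint b"
    unfolding locint_def using Bfin by (simp add: B_def[abs_def])
  define T where "T = {t. lev t \<in> {l..q}}"
  have [measurable]: "T \<in> sets borel" unfolding T_def by measurable
  define g where "g y = accr v (b y) - \<delta> / 2" for y
  have gmeas [measurable]: "g \<in> borel_measurable borel" unfolding g_def by measurable
  have avg_acc: "avg k (\<lambda>y. accr v (b y)) x = accr v (avg k b x)" for k x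
    by (rule avg_bounded_linear[OF bounded_linear_accr locb])
  have loca: "locint (\<lambda>y. accr v (b y))"
    unfolding locint_def
  proof (intro conjI allI)
    fix j and x :: "real ^ 'n"
    have "avn j (\<lambda>y. ennreal (norm (accr v (b y)))) x \<le> avn j B x"
      unfolding B_def by (intro avn_mono ennreal_leI) (simp add: abs_accr_le v)
    then show "avn j (\<lambda>y. ennreal (norm (accr v (b y)))) x < \<infinity>" using Bfin by (rule le_less_trans)
  qed measurable
  have locc: "locint (\<lambda>y::real ^ 'n. \<delta> / 2)" by (rule locint_bounded[of _ "\<delta> / 2"]) (use pos in auto)
  have avg_g: "avg k g x = accr v (avg k b x) - \<delta> / 2" for k x
    unfolding g_def using avg_diff_fun[OF loca locc, of k x] by (simp add: avg_acc)
  have locg: "locint g"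
    unfolding locint_def
  proof (intro conjI allI)
    fix j and x :: "real ^ 'n"
    have "avn j (\<lambda>y. ennreal (norm (g y))) x \<le> avn j (\<lambda>y. B y + ennreal (\<delta> / 2)) x"
    proof (intro avn_mono)
      fix y
      have "\<bar>g y\<bar> \<le> norm (b y) + \<delta> / 2" unfolding g_def using abs_accr_le[OF v, of "b y"] pos by linarith
      then show "ennreal (norm (g y)) \<le> B y + ennreal (\<delta> / 2)"
        unfolding B_def using pos by (simp add: ennreal_plus[symmetric] ennreal_leI del: ennreal_plus)
    qed
    also have "\<dots> = avn j B x + ennreal (\<delta> / 2)" by (subst avn_add) auto
    also have "\<dots> < \<infinity>" using Bfin by auto
    finally show "avn j (\<lambda>y. ennreal (norm (g y))) x < \<infinity>" .
  qed measurable
  \<comment> \<open>The union of the cubes on which accretivity in the direction \<open>v\<close>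
    has dropped to \<delta>/2 or less.\<close>
  define B1 where "B1 = {y \<in> ?Q. \<exists>k\<in>{l..q}. avg k g y \<le> 0}"
  have st: "B1 \<in> sets borel \<and> integrable lborel (\<lambda>y. indicator B1 y * g y) \<and> (LINT y|lborel. indicator B1 y * g y) \<le> 0"
    unfolding B1_def
  proof (rule stopping_integral_le[OF locg, where P="\<lambda>k y. avg k g y \<le> 0"])
    show "(avg j g x \<le> 0) = (avg j g y \<le> 0)" if "cube_index j x = cube_index j y" for j x y
      using avg_cong[OF that, of g] by simp
  qed (use lq in auto)
  have [measurable]: "B1 \<in> sets borel" using st by simp
  define X0 where "X0 = ?Q - B1"
  have [measurable]: "X0 \<in> sets borel" unfolding X0_def by measurable
  have acc_X0: "\<delta> / 2 \<le> accr v (avg k b x)" if "x \<in> X0" "k \<in> {l..q}" for x k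
  proof -
    have "\<not> avg k g x \<le> 0" using that unfolding X0_def B1_def by auto
    then show ?thesis by (simp add: avg_g)
  qed
  \<comment> \<open>The integral of \<open>g\<close> over \<open>B1\<close> is nonpositive, so over
    \<open>X0\<close> it is at least |Q| \<delta>/2. There g \<le> |b|, and splitting |b| at height
    \<open>lam\<close> bounds the integral by lam |X0| + |Q| \<delta>/4.\<close>
  have mX0: "ennreal (\<eta> * ?vol) \<le> emeasure lborel X0"
  proof -
    have iQ: "integrable lborel (\<lambda>y. indicator ?Q y * g y)" using locint_integrable[OF locg, of q x0] by simp
    have eX: "indicator X0 y * g y = indicator ?Q y * g y - indicator B1 y * g y" for y
      unfolding X0_def B1_def by (auto simp: indicator_def)
    have iX: "integrable lborel (\<lambda>y. indicator X0 y * g y)" unfolding eX using iQ st by auto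
    have iB: "integrable lborel (\<lambda>y. indicator X0 y * norm (b y))"
    proof (rule Bochner_Integration.integrable_bound[OF locint_integrable[OF locb, of q x0]])
      show "AE y in lborel. norm (indicator X0 y * norm (b y)) \<le> norm (indicator ?Q y *\<^sub>R b y)"
        unfolding X0_def by (auto simp: indicator_def)
    qed measurable
    have "?vol * (\<delta> / 2) \<le> ?vol * avg q g x0" using acc by (intro mult_left_mono) (auto simp: avg_g)
    also have "\<dots> = (LINT y|lborel. indicator ?Q y * g y)" unfolding avg_def by simp
    also have "\<dots> \<le> (LINT y|lborel. indicator X0 y * g y)" unfolding eX using iQ st by simp
    also have "\<dots> \<le> (LINT y|lborel. indicator X0 y * norm (b y))"
    proof (rule integral_mono[OF iX iB])
      fix y
      have "g y \<le> norm (b y)" unfolding g_def using abs_accr_le[OF v, of "b y"] pos by linarith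
      then show "indicator X0 y * g y \<le> indicator X0 y * norm (b y)" by (auto simp: indicator_def)
    qed
    finally have "ennreal (?vol * (\<delta> / 2)) \<le> ennreal (LINT y|lborel. indicator X0 y * norm (b y))" by (rule ennreal_leI)
    also have "\<dots> = (\<integral>\<^sup>+y. ennreal (indicator X0 y * norm (b y)) \<partial>lborel)"
      by (rule nn_integral_eq_integral[OF iB, symmetric]) auto
    also have "\<dots> \<le> (\<integral>\<^sup>+y. ennreal lam * indicator X0 y + ennreal (lam powr (1 - p)) * D y \<partial>lborel)"
    proof (rule nn_integral_mono)
      fix y
      have "ennreal (norm (b y)) \<le> ennreal (lam + lam powr (1 - p) * norm (b y) powr p)"
        by (intro ennreal_leI powr_split_le) (use pos in auto)
      also have "\<dots> = ennreal lam + ennreal (lam powr (1 - p)) * D y"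
        unfolding D_def using pos by (simp add: ennreal_mult')
      finally show "ennreal (indicator X0 y * norm (b y)) \<le> ennreal lam * indicator X0 y + ennreal (lam powr (1 - p)) * D y"
        by (auto simp: indicator_def)
    qed
    also have "\<dots> = ennreal lam * emeasure lborel X0 + ennreal (lam powr (1 - p)) * (\<integral>\<^sup>+y. D y \<partial>lborel)"
      by (subst nn_integral_add) (auto simp: nn_integral_cmult nn_integral_cmult_indicator)
    also have "\<dots> \<le> ennreal lam * emeasure lborel X0 + ennreal (lam powr (1 - p)) * ennreal (C\<^sub>0 * ?vol)"
      by (intro add_left_mono mult_left_mono intD) simp
    also have "ennreal (lam powr (1 - p)) * ennreal (C\<^sub>0 * ?vol) \<le> ennreal (\<delta> / 4 * ?vol)"
      using mult_right_mono[OF par(1), of ?vol] by (simp add: ennreal_mult'[symmetric] ennreal_leI mult.assoc)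
    finally have 1: "ennreal (?vol * (\<delta> / 2)) \<le> ennreal lam * emeasure lborel X0 + ennreal (\<delta> / 4 * ?vol)"
      by (simp add: add_left_mono)
    have "emeasure lborel X0 \<le> emeasure lborel ?Q" unfolding X0_def by (intro emeasure_mono) auto
    then have "emeasure lborel X0 \<noteq> top" by (auto simp: top_unique)
    then obtain r where r: "emeasure lborel X0 = ennreal r" "r \<ge> 0" by (cases "emeasure lborel X0") auto
    have "?vol * (\<delta> / 2) \<le> lam * r + \<delta> / 4 * ?vol"
    proof -
      have "ennreal (?vol * (\<delta> / 2)) \<le> ennreal (lam * r + \<delta> / 4 * ?vol)"
        using 1 r pos by (simp add: ennreal_mult'[symmetric] ennreal_plus[symmetric] del: ennreal_plus)
      then show ?thesis using r pos by (subst (asm) ennreal_le_iff) auto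
    qed
    then have "\<delta> / 4 * ?vol \<le> lam * r" by (simp add: algebra_simps)
    then have "\<eta> * ?vol \<le> r" unfolding par(2) using pos by (simp add: field_simps)
    then show ?thesis unfolding r(1) by (rule ennreal_leI)
  qed
  \<comment> \<open>The exceptional sets: close to bad leaves (\<open>Y1\<close>), close to the
    boundary (\<open>?Q - E\<close>), where the remainder of the good parts is large
    (\<open>Y3\<close>), and where the testing square function is large (\<open>Y4\<close>).\<close>
  define Y1 where "Y1 = {x \<in> ?Q. ennreal ?c0 < S.Phi (\<alpha> / 2) x}"
  define E where "E = {x \<in> ?Q. \<forall>i. x + axis i (\<epsilon> * 2 powi q) \<in> ?Q \<and> x + axis i (- (\<epsilon> * 2 powi q)) \<in> ?Q}"
  define SR where "SR x = (\<Sum>j\<in>UNIV. \<Sum>i\<in>UNIV. \<integral>\<^sup>+t. (ennreal (norm (k.R i (S.good_part (f i j)) t x)))\<^sup>2 \<partial>dtt)" for x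
  define Y3 where "Y3 = {x \<in> ?Q. ennreal lam1 < SR x}"
  define SB where "SB x = (\<integral>\<^sup>+t. indicator {t. lev t \<in> {..q}} t * (ennreal (norm (TB b t x)))\<^sup>2 \<partial>dtt)" for x
  define Y4 where "Y4 = {x \<in> ?Q. ennreal lam2 < SB x}"
  have TBm [measurable (raw)]: "(\<lambda>z. TB b (h1 z) (h2 z)) \<in> borel_measurable M"
    if [measurable]: "h1 \<in> borel_measurable M" "h2 \<in> borel_measurable M" for h1 h2 and M :: "'z measure"
    unfolding TB_def by (rule borel_measurable_vec_lambda) measurable
  have [measurable]: "SR \<in> borel_measurable borel" "SB \<in> borel_measurable borel"
    unfolding SR_def SB_def by measurable
  have sY [measurable]: "Y1 \<in> sets borel" "Y3 \<in> sets borel" "Y4 \<in> sets borel"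
    unfolding Y1_def Y3_def Y4_def by measurable
  have sE [measurable]: "E \<in> sets borel" unfolding E_def by (rule measure_inside(1)[OF pos(5)])
  have e8: "\<eta> / 8 * ?vol \<ge> 0" using \<eta> by simp
  have c0: "?c0 > 0" by simp
  have mY1: "emeasure lborel Y1 \<le> ennreal (\<eta> / 8 * ?vol)"
    unfolding Y1_def
  proof (rule markov_lborel)
    let ?W = "Wc ?n (\<alpha> / 2)" let ?s = "\<Sum>j\<in>{l..q}. emeasure lborel (S.Vb j)"
    have W: "?W > 0" using alpha by (intro Wc_pos) auto
    have "(\<integral>\<^sup>+y. indicator S.Q y * B y \<partial>lborel) = ennreal ?vol * avn q B x0"
      unfolding avn_def Qeq by (simp add: mult.assoc[symmetric] ennreal_mult'[symmetric])
    also have "\<dots> \<le> ennreal ?vol * ennreal (1 + C\<^sub>0)" by (intro mult_left_mono avBq) simp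
    finally have "ennreal K * ?s \<le> ennreal ?vol * ennreal (1 + C\<^sub>0)"
      using S.measure_sum_Vb by (rule order_trans[rotated])
    then have "ennreal (1 / K) * (ennreal K * ?s) \<le> ennreal (1 / K) * (ennreal ?vol * ennreal (1 + C\<^sub>0))"
      by (rule mult_left_mono) simp
    also have "ennreal (1 / K) * (ennreal K * ?s) = ?s"
      unfolding mult.assoc[symmetric] using K0 by (subst ennreal_mult[symmetric]) auto
    also have "ennreal (1 / K) * (ennreal ?vol * ennreal (1 + C\<^sub>0)) = ennreal (1 / K * (?vol * (1 + C\<^sub>0)))"
      using K0 pos by (subst ennreal_mult'[symmetric], simp, subst ennreal_mult'[symmetric]) auto
    finally have s: "?s \<le> ennreal (1 / K * (?vol * (1 + C\<^sub>0)))" .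
    have "(\<integral>\<^sup>+x. indicator ?Q x * S.Phi (\<alpha> / 2) x \<partial>lborel) \<le> (\<integral>\<^sup>+x. S.Phi (\<alpha> / 2) x \<partial>lborel)"
      by (intro nn_integral_mono) (auto simp: indicator_def)
    also have "\<dots> \<le> ennreal ?W * ?s" using alpha by (intro S.integral_Phi) auto
    also have "\<dots> \<le> ennreal ?W * ennreal (1 / K * (?vol * (1 + C\<^sub>0)))" by (intro mult_left_mono s) simp
    also have "\<dots> = ennreal (?W * (1 / K * (?vol * (1 + C\<^sub>0))))"
      using W by (subst ennreal_mult'[symmetric]) auto
    also have "\<dots> \<le> ennreal (?c0 * (\<eta> / 8 * ?vol))"
    proof (rule ennreal_leI)
      have "(?W * (1 + C\<^sub>0)) * (?vol / K) \<le> (K * (?c0 * (\<eta> / 8))) * (?vol / K)"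
        using par(3) K0 by (intro mult_right_mono) auto
      then show "?W * (1 / K * (?vol * (1 + C\<^sub>0))) \<le> ?c0 * (\<eta> / 8 * ?vol)"
        using K0 by (simp add: mult_ac)
    qed
    finally show "(\<integral>\<^sup>+x. indicator ?Q x * S.Phi (\<alpha> / 2) x \<partial>lborel) \<le> ennreal (?c0 * (\<eta> / 8 * ?vol))" .
  qed (use c0 in auto)
  have mY2: "emeasure lborel (?Q - E) \<le> ennreal (\<eta> / 8 * ?vol)"
  proof -
    have "emeasure lborel (?Q - E) \<le> ennreal (2 * (real ?n)\<^sup>2 * \<epsilon> * ?vol)"
      unfolding E_def by (rule measure_inside(2)[OF pos(5)])
    also have "\<dots> \<le> ennreal (\<eta> / 8 * ?vol)" by (intro ennreal_leI mult_right_mono par(4)) simp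
    finally show ?thesis .
  qed
  have mY3: "emeasure lborel Y3 \<le> ennreal (\<eta> / 8 * ?vol)"
    unfolding Y3_def
  proof (rule markov_lborel)
    let ?c = "cR ?n \<alpha> A * ((2 ^ ?n * K)\<^sup>2 * ?vol)"
    have cR0: "cR ?n \<alpha> A \<ge> 0"
      unfolding cR_def using Wc_pos[of \<alpha> ?n] Wc_pos[of "\<alpha> / 2" ?n] alpha by auto
    have "(\<integral>\<^sup>+x. indicator ?Q x * SR x \<partial>lborel) \<le> (\<integral>\<^sup>+x. SR x \<partial>lborel)"
      by (intro nn_integral_mono) (auto simp: indicator_def)
    also have "\<dots> = (\<Sum>j\<in>UNIV. \<Sum>i\<in>UNIV. \<integral>\<^sup>+x. \<integral>\<^sup>+t. (ennreal (norm (k.R i (S.good_part (f i j)) t x)))\<^sup>2 \<partial>dtt \<partial>lborel)"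
      unfolding SR_def by (subst nn_integral_sum, measurable, subst nn_integral_sum, measurable)
    also have "\<dots> \<le> (\<Sum>j\<in>(UNIV :: 'm set). \<Sum>i\<in>(UNIV :: 'm set). ennreal ?c)"
    proof (intro sum_mono)
      fix i j :: 'm
      have "(\<integral>\<^sup>+x. \<integral>\<^sup>+t. (ennreal (norm (k.R i (S.good_part (f i j)) t x)))\<^sup>2 \<partial>dtt \<partial>lborel)
          = (\<integral>\<^sup>+t. \<integral>\<^sup>+x. (ennreal (norm (k.R i (S.good_part (f i j)) t x)))\<^sup>2 \<partial>lborel \<partial>dtt)"
        by (rule dtt_lborel.Fubini') measurable
      also have "\<dots> \<le> ennreal (cR ?n \<alpha> A) * sqn (S.good_part (f i j))"
        by (rule k.R_L2[OF S.L2_good_part[OF fB]])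
      also have "\<dots> \<le> ennreal (cR ?n \<alpha> A) * ennreal ((2 ^ ?n * K)\<^sup>2 * ?vol)"
        by (intro mult_left_mono S.sqn_good_part fB) simp
      also have "\<dots> = ennreal ?c" using cR0 by (subst ennreal_mult'[symmetric]) auto
      finally show "(\<integral>\<^sup>+x. \<integral>\<^sup>+t. (ennreal (norm (k.R i (S.good_part (f i j)) t x)))\<^sup>2 \<partial>dtt \<partial>lborel) \<le> ennreal ?c" .
    qed
    also have "\<dots> = ennreal (?m * (?m * ?c))"
      by (simp add: ennreal_of_nat_eq_real_of_nat ennreal_mult')
    also have "\<dots> \<le> ennreal (lam1 * (\<eta> / 8 * ?vol))"
      using mult_right_mono[OF par(5), of ?vol] by (intro ennreal_leI) (simp add: power2_eq_square mult_ac)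
    finally show "(\<integral>\<^sup>+x. indicator ?Q x * SR x \<partial>lborel) \<le> ennreal (lam1 * (\<eta> / 8 * ?vol))" .
  qed (use pos in auto)
  \<comment> \<open>Chebyshev's inequality for the power p/2 of the square function, which is what
    the testing condition integrates.\<close>
  have mY4: "emeasure lborel Y4 \<le> ennreal (\<eta> / 8 * ?vol)"
  proof -
    have "Y4 \<subseteq> {x \<in> ?Q. ennreal (lam2 powr (p / 2)) < ennreal_powr (SB x) (p / 2)}"
      unfolding Y4_def using ennreal_powr_less[of lam2 _ "p / 2"] pos by auto
    then have "emeasure lborel Y4 \<le> emeasure lborel {x \<in> ?Q. ennreal (lam2 powr (p / 2)) < ennreal_powr (SB x) (p / 2)}"
      by (intro emeasure_mono) auto
    also have "\<dots> \<le> ennreal (\<eta> / 8 * ?vol)"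
    proof (rule markov_lborel)
      have "(\<integral>\<^sup>+x. indicator ?Q x * ennreal_powr (SB x) (p / 2) \<partial>lborel) \<le> ennreal (C\<^sub>0 * ?vol)"
        unfolding SB_def by (rule sq)
      also have "\<dots> \<le> ennreal (lam2 powr (p / 2) * (\<eta> / 8 * ?vol))"
        using mult_right_mono[OF par(6), of ?vol] by (intro ennreal_leI) (simp add: mult_ac)
      finally show "(\<integral>\<^sup>+x. indicator ?Q x * ennreal_powr (SB x) (p / 2) \<partial>lborel) \<le> ennreal (lam2 powr (p / 2) * (\<eta> / 8 * ?vol))" .
    qed (use pos in auto)
    finally show ?thesis .
  qed
  define Y where "Y = Y1 \<union> (?Q - E) \<union> Y3 \<union> Y4"
  have [measurable]: "Y \<in> sets borel" unfolding Y_def by measurable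
  have mY: "emeasure lborel Y \<le> ennreal (\<eta> / 2 * ?vol)"
  proof -
    have "emeasure lborel (Y1 \<union> (?Q - E)) \<le> emeasure lborel Y1 + emeasure lborel (?Q - E)"
      by (rule emeasure_subadditive) auto
    also have "\<dots> \<le> ennreal (\<eta> / 8 * ?vol) + ennreal (\<eta> / 8 * ?vol)" by (rule add_mono[OF mY1 mY2])
    finally have 2: "emeasure lborel (Y1 \<union> (?Q - E)) \<le> \<dots>" .
    have "emeasure lborel (Y1 \<union> (?Q - E) \<union> Y3) \<le> emeasure lborel (Y1 \<union> (?Q - E)) + emeasure lborel Y3"
      by (rule emeasure_subadditive) auto
    also have "\<dots> \<le> ennreal (\<eta> / 8 * ?vol) + ennreal (\<eta> / 8 * ?vol) + ennreal (\<eta> / 8 * ?vol)" by (rule add_mono[OF 2 mY3])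
    finally have 3: "emeasure lborel (Y1 \<union> (?Q - E) \<union> Y3) \<le> \<dots>" .
    have "emeasure lborel Y \<le> emeasure lborel (Y1 \<union> (?Q - E) \<union> Y3) + emeasure lborel Y4"
      unfolding Y_def by (rule emeasure_subadditive) auto
    also have "\<dots> \<le> ennreal (\<eta> / 8 * ?vol) + ennreal (\<eta> / 8 * ?vol) + ennreal (\<eta> / 8 * ?vol) + ennreal (\<eta> / 8 * ?vol)"
      by (rule add_mono[OF 3 mY4])
    also have "\<dots> = ennreal (\<eta> / 8 * ?vol + \<eta> / 8 * ?vol + \<eta> / 8 * ?vol + \<eta> / 8 * ?vol)"
      using e8 by (simp only: ennreal_plus add_nonneg_nonneg)
    also have "\<eta> / 8 * ?vol + \<eta> / 8 * ?vol + \<eta> / 8 * ?vol + \<eta> / 8 * ?vol = \<eta> / 2 * ?vol" by simp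
    finally show ?thesis .
  qed
  let ?N = "(2 * lam2 + 6 * ?m * (?m\<^sup>2 * (cA ?n \<alpha> A K + cT ?n \<alpha> A C\<^sub>0 \<epsilon>) + lam1)) / K\<^sup>2"
  let ?U = "\<lambda>x. \<integral>\<^sup>+t. indicator {t. lev t \<in> {l..q}} t * ennreal ((cone_fun (\<delta> / (4 * K)) v (Gam t x))\<^sup>2) \<partial>dtt"
  have cont: "continuous_on UNIV (cone_fun (\<delta> / (4 * K)) v)"
    unfolding cone_fun_def by (intro continuous_intros)
  have [measurable]: "cone_fun (\<delta> / (4 * K)) v \<in> borel_measurable borel"
    by (rule borel_measurable_continuous_onI[OF cont])
  have Um [measurable]: "{x \<in> ?Q. ?U x \<le> ennreal ?N} \<in> sets borel" by measurable
  have good: "X0 - Y \<subseteq> {x \<in> ?Q. ?U x \<le> ennreal ?N}"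
  proof
    fix x assume x: "x \<in> X0 - Y"
    then have xQ: "x \<in> ?Q" and xX: "x \<in> X0" and xE: "x \<in> E"
      and Phi: "S.Phi (\<alpha> / 2) x \<le> ennreal ?c0" and x3: "SR x \<le> ennreal lam1" and x4: "SB x \<le> ennreal lam2"
      by (auto simp: X0_def Y_def Y1_def Y3_def Y4_def not_less)
    let ?a = "\<lambda>i j t. k.Th i (S.atom_part (f i j)) t x"
    let ?s = "\<lambda>i j t. k.Th i (S.tail_part (f i j)) t x"
    let ?r = "\<lambda>i j t. k.R i (S.good_part (f i j)) t x"
    have fin: "(\<integral>\<^sup>+y. ennreal (wt \<alpha> t (x - y)) * ennreal (norm (f i j y)) \<partial>lborel) < \<infinity>" if t: "t > 0" for i j t
    proof -
      have "(\<integral>\<^sup>+y. ennreal (wt \<alpha> t (x - y)) * ennreal (norm (f i j y)) \<partial>lborel)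
          \<le> (\<integral>\<^sup>+y. ennreal (wt \<alpha> t (x - y)) + ennreal (1 / t ^ ?n) * D y \<partial>lborel)"
      proof (rule nn_integral_mono)
        fix y
        have "ennreal (wt \<alpha> t (x - y)) * ennreal (norm (f i j y)) \<le> ennreal (wt \<alpha> t (x - y)) * (1 + D y)"
          by (intro mult_left_mono fD) simp
        also have "\<dots> = ennreal (wt \<alpha> t (x - y)) + ennreal (wt \<alpha> t (x - y)) * D y" by (simp add: distrib_left)
        also have "\<dots> \<le> ennreal (wt \<alpha> t (x - y)) + ennreal (1 / t ^ ?n) * D y"
          by (intro add_left_mono mult_right_mono ennreal_leI wt_le_inverse t alpha) auto
        finally show "ennreal (wt \<alpha> t (x - y)) * ennreal (norm (f i j y)) \<le> ennreal (wt \<alpha> t (x - y)) + ennreal (1 / t ^ ?n) * D y" .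
      qed
      also have "\<dots> = (\<integral>\<^sup>+y. ennreal (wt \<alpha> t (x - y)) \<partial>lborel) + ennreal (1 / t ^ ?n) * (\<integral>\<^sup>+y. D y \<partial>lborel)"
        by (subst nn_integral_add) (auto simp: nn_integral_cmult)
      also have "\<dots> < \<infinity>"
        using le_less_trans[OF nn_integral_wt[OF t alpha(1), of x] ennreal_less_top] le_less_trans[OF intD ennreal_less_top]
        by (auto simp: ennreal_mult_less_top)
      finally show ?thesis .
    qed
    \<comment> \<open>Let \<open>M\<close> be the matrix of averages of b at scale t. It has |M|
      \<le> K because x lies in no bad cube, and it is accretive along \<open>v\<close> because x
      lies in \<open>X0\<close>. So the cone part of \<gamma>_t is bounded by the row of \<gamma>_t
      against \<open>M\<close>, whose entries \<open>gam_avg_identity\<close> expands.\<close>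
    have pt: "(cone_fun (\<delta> / (4 * K)) v (Gam t x))\<^sup>2 \<le> (1 / K\<^sup>2) * (2 * (norm (TB b t x))\<^sup>2
        + 6 * ?m * (\<Sum>j\<in>UNIV. \<Sum>i\<in>UNIV. (norm (?a i j t))\<^sup>2 + (norm (?s i j t))\<^sup>2 + (norm (?r i j t))\<^sup>2))"
      if t: "t > 0" and lt: "lev t \<in> {l..q}" for t
    proof -
      define M where "M = avg (lev t) b x"
      have entry: "avg (lev t) (f i j) x = M $ i $ j" for i j
      proof -
        have "bounded_linear (\<lambda>M :: complex ^ 'm ^ 'm. M $ i $ j)"
          using bounded_linear_compose[OF bounded_linear_vec_nth[of j] bounded_linear_vec_nth[of i]] by simp
        from avg_bounded_linear[OF this locb, of "lev t" x] show ?thesis unfolding f_def M_def by simp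
      qed
      have nb: "\<not> S.bad (lev t) x"
        by (rule S.not_bad[OF _ _ Phi]) (use alpha lt xQ Qeq in auto)
      have "ennreal (norm M) \<le> avn (lev t) B x" unfolding M_def B_def by (rule norm_avg_le)
      also have "\<dots> \<le> ennreal K" using nb unfolding S.bad_def by simp
      finally have MK: "norm M \<le> K" using K0 by simp
      have "cone_fun (\<delta> / (4 * K)) v (Gam t x) \<le> norm (Gam t x v* M) / K"
        using acc_X0[OF xX lt] by (intro cone_fun_row_le v pos(1) K0 MK) (simp add: M_def)
      then have "(cone_fun (\<delta> / (4 * K)) v (Gam t x))\<^sup>2 \<le> (norm (Gam t x v* M) / K)\<^sup>2"
        by (rule power_mono) (rule cone_fun_nonneg)
      also have "\<dots> = (1 / K\<^sup>2) * (norm (Gam t x v* M))\<^sup>2" by (simp add: power_divide)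
      finally have A1: "(cone_fun (\<delta> / (4 * K)) v (Gam t x))\<^sup>2 \<le> (1 / K\<^sup>2) * (norm (Gam t x v* M))\<^sup>2" .
      have "(norm (Gam t x v* M))\<^sup>2 = (\<Sum>j\<in>UNIV. (norm (\<Sum>i\<in>UNIV. k.Th i (f i j) t x - ?a i j t - ?s i j t - ?r i j t))\<^sup>2)"
      proof -
        have "(Gam t x v* M) $ j = (\<Sum>i\<in>UNIV. k.Th i (f i j) t x - ?a i j t - ?s i j t - ?r i j t)" for j
        proof -
          have "(Gam t x v* M) $ j = (\<Sum>i\<in>UNIV. k.gam i t x * avg (lev t) (f i j) x)"
            unfolding entry by (simp add: vector_matrix_mult_def Gam_def mult.commute)
          also have "\<dots> = (\<Sum>i\<in>UNIV. k.Th i (f i j) t x - ?a i j t - ?s i j t - ?r i j t)"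
            by (intro sum.cong refl KS.gam_avg_identity[OF fm fB fin[OF t] Phi t lt]) (simp add: Qeq xQ)
          finally show ?thesis .
        qed
        then show ?thesis by (simp add: norm_sq_vec)
      qed
      also have "\<dots> \<le> 2 * (norm (TB b t x))\<^sup>2
          + 6 * ?m * (\<Sum>j\<in>UNIV. \<Sum>i\<in>UNIV. (norm (?a i j t))\<^sup>2 + (norm (?s i j t))\<^sup>2 + (norm (?r i j t))\<^sup>2)"
        unfolding norm_TB_sq f_def[symmetric] by (rule sum_sq_split_le)
      finally have A2: "(norm (Gam t x v* M))\<^sup>2 \<le> \<dots>" .
      show ?thesis by (rule order_trans[OF A1 mult_left_mono[OF A2]]) simp
    qed
    let ?I = "\<lambda>t. indicator T t :: ennreal"
    have am [measurable]: "S.atom_part (f i j) \<in> borel_measurable borel" for i j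
      unfolding S.atom_part_def by measurable
    have tm [measurable]: "S.tail_part (f i j) \<in> borel_measurable borel" for i j by measurable
    have "?U x \<le> (\<integral>\<^sup>+t. ennreal (1 / K\<^sup>2) * (2 * (indicator {t. lev t \<in> {..q}} t * (ennreal (norm (TB b t x)))\<^sup>2)
        + ennreal (6 * ?m) * (\<Sum>j\<in>UNIV. \<Sum>i\<in>UNIV. ?I t * (ennreal (norm (?a i j t)))\<^sup>2 + ?I t * (ennreal (norm (?s i j t)))\<^sup>2 + (ennreal (norm (?r i j t)))\<^sup>2)) \<partial>dtt)"
    proof (rule nn_integral_dtt_mono)
      fix t :: real assume t: "t > 0"
      show "indicator {t. lev t \<in> {l..q}} t * ennreal ((cone_fun (\<delta> / (4 * K)) v (Gam t x))\<^sup>2)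
        \<le> ennreal (1 / K\<^sup>2) * (2 * (indicator {t. lev t \<in> {..q}} t * (ennreal (norm (TB b t x)))\<^sup>2)
        + ennreal (6 * ?m) * (\<Sum>j\<in>UNIV. \<Sum>i\<in>UNIV. ?I t * (ennreal (norm (?a i j t)))\<^sup>2 + ?I t * (ennreal (norm (?s i j t)))\<^sup>2 + (ennreal (norm (?r i j t)))\<^sup>2))"
      proof (cases "lev t \<in> {l..q}")
        case True
        then have I: "?I t = 1" "indicator {t. lev t \<in> {..q}} t = (1 :: ennreal)" by (auto simp: T_def)
        have "ennreal ((cone_fun (\<delta> / (4 * K)) v (Gam t x))\<^sup>2) \<le> ennreal ((1 / K\<^sup>2) * (2 * (norm (TB b t x))\<^sup>2
          + 6 * ?m * (\<Sum>j\<in>UNIV. \<Sum>i\<in>UNIV. (norm (?a i j t))\<^sup>2 + (norm (?s i j t))\<^sup>2 + (norm (?r i j t))\<^sup>2)))"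
          by (rule ennreal_leI[OF pt[OF t True]])
        also have "\<dots> = ennreal (1 / K\<^sup>2) * (2 * (ennreal (norm (TB b t x)))\<^sup>2
          + ennreal (6 * ?m) * (\<Sum>j\<in>UNIV. \<Sum>i\<in>UNIV. (ennreal (norm (?a i j t)))\<^sup>2 + (ennreal (norm (?s i j t)))\<^sup>2 + (ennreal (norm (?r i j t)))\<^sup>2))"
        proof -
          have s: "(\<Sum>j\<in>UNIV. \<Sum>i\<in>UNIV. (ennreal (norm (?a i j t)))\<^sup>2 + (ennreal (norm (?s i j t)))\<^sup>2 + (ennreal (norm (?r i j t)))\<^sup>2)
            = ennreal (\<Sum>j\<in>UNIV. \<Sum>i\<in>UNIV. (norm (?a i j t))\<^sup>2 + (norm (?s i j t))\<^sup>2 + (norm (?r i j t))\<^sup>2)"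
            by (simp add: ennreal_power sum_nonneg sum_ennreal[symmetric])
          have "2 * (ennreal (norm (TB b t x)))\<^sup>2 = ennreal (2 * (norm (TB b t x))\<^sup>2)"
            by (simp add: ennreal_mult' ennreal_power)
          then show ?thesis unfolding s
            by (simp only:) (subst ennreal_mult', simp, subst ennreal_plus, simp, simp add: sum_nonneg, subst ennreal_mult', simp_all)
        qed
        finally show ?thesis using True unfolding I by simp
      qed simp
    qed
    also have "\<dots> = ennreal (1 / K\<^sup>2) * (2 * SB x
        + ennreal (6 * ?m) * (\<Sum>j\<in>UNIV. \<Sum>i\<in>UNIV. (\<integral>\<^sup>+t. ?I t * (ennreal (norm (?a i j t)))\<^sup>2 \<partial>dtt) + (\<integral>\<^sup>+t. ?I t * (ennreal (norm (?s i j t)))\<^sup>2 \<partial>dtt) + (\<integral>\<^sup>+t. (ennreal (norm (?r i j t)))\<^sup>2 \<partial>dtt)))"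
      unfolding SB_def
      by (subst nn_integral_cmult, measurable, subst nn_integral_add, measurable, subst nn_integral_cmult, measurable,
          subst nn_integral_cmult, measurable, subst nn_integral_sum, measurable, subst nn_integral_sum, measurable,
          subst nn_integral_add, measurable, subst nn_integral_add, measurable)
    also have "\<dots> \<le> ennreal (1 / K\<^sup>2) * (2 * ennreal lam2
        + ennreal (6 * ?m) * ((\<Sum>j\<in>(UNIV::'m set). \<Sum>i\<in>(UNIV::'m set). ennreal (cA ?n \<alpha> A K) + ennreal (cT ?n \<alpha> A C\<^sub>0 \<epsilon>)) + ennreal lam1))"
    proof (intro mult_left_mono add_mono x4)
      have at: "(\<integral>\<^sup>+t. ?I t * (ennreal (norm (?a i j t)))\<^sup>2 \<partial>dtt) \<le> ennreal (cA ?n \<alpha> A K)" for i j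
        unfolding T_def cA_def by (rule KS.atom_square[OF fm fB Phi])
      have tl: "(\<integral>\<^sup>+t. ?I t * (ennreal (norm (?s i j t)))\<^sup>2 \<partial>dtt) \<le> ennreal (cT ?n \<alpha> A C\<^sub>0 \<epsilon>)" for i j
        unfolding cT_def S.tail_part_def
      proof (rule k.tail_square[where ell="2 powi q" and D=D])
        show "\<epsilon> * 2 powi q \<le> norm (x - y)" if "y \<in> - S.Q" for y
          using measure_inside(3)[OF pos(5), of x q x0 y] xE that by (simp add: E_def Qeq)
        show "t \<le> 2 powi q" if "t \<in> T" "t > 0" for t
        proof -
          have "t < 2 powi (lev t)" by (rule lev_bounds(2)[OF that(2)])
          also have "\<dots> \<le> 2 powi q" using that(1) by (intro power_int_increasing) (auto simp: T_def)
          finally show ?thesis by simp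
        qed
        show "(\<integral>\<^sup>+y. D y \<partial>lborel) \<le> ennreal (C\<^sub>0 * (2 powi q) ^ CARD('n))" using intD by (simp add: cvol_def)
      qed (use pos fD in auto)
      have "(\<Sum>j\<in>UNIV. \<Sum>i\<in>UNIV. (\<integral>\<^sup>+t. ?I t * (ennreal (norm (?a i j t)))\<^sup>2 \<partial>dtt) + (\<integral>\<^sup>+t. ?I t * (ennreal (norm (?s i j t)))\<^sup>2 \<partial>dtt) + (\<integral>\<^sup>+t. (ennreal (norm (?r i j t)))\<^sup>2 \<partial>dtt))
        = (\<Sum>j\<in>UNIV. \<Sum>i\<in>UNIV. (\<integral>\<^sup>+t. ?I t * (ennreal (norm (?a i j t)))\<^sup>2 \<partial>dtt) + (\<integral>\<^sup>+t. ?I t * (ennreal (norm (?s i j t)))\<^sup>2 \<partial>dtt)) + SR x"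
        unfolding SR_def by (simp add: sum.distrib)
      also have "\<dots> \<le> (\<Sum>j\<in>(UNIV::'m set). \<Sum>i\<in>(UNIV::'m set). ennreal (cA ?n \<alpha> A K) + ennreal (cT ?n \<alpha> A C\<^sub>0 \<epsilon>)) + ennreal lam1"
        by (intro add_mono sum_mono at tl x3)
      finally show "(\<Sum>j\<in>UNIV. \<Sum>i\<in>UNIV. (\<integral>\<^sup>+t. ?I t * (ennreal (norm (?a i j t)))\<^sup>2 \<partial>dtt) + (\<integral>\<^sup>+t. ?I t * (ennreal (norm (?s i j t)))\<^sup>2 \<partial>dtt) + (\<integral>\<^sup>+t. (ennreal (norm (?r i j t)))\<^sup>2 \<partial>dtt))
        \<le> (\<Sum>j\<in>(UNIV::'m set). \<Sum>i\<in>(UNIV::'m set). ennreal (cA ?n \<alpha> A K) + ennreal (cT ?n \<alpha> A C\<^sub>0 \<epsilon>)) + ennreal lam1" .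
    qed auto
    also have "\<dots> = ennreal ?N"
    proof -
      have cA0: "cA ?n \<alpha> A K \<ge> 0" unfolding cA_def using alpha by simp
      have cT0: "cT ?n \<alpha> A C\<^sub>0 \<epsilon> \<ge> 0" unfolding cT_def using alpha by simp
      define z where "z = cA ?n \<alpha> A K + cT ?n \<alpha> A C\<^sub>0 \<epsilon>"
      have z0: "z \<ge> 0" using cA0 cT0 by (simp add: z_def)
      have 1: "ennreal (cA ?n \<alpha> A K) + ennreal (cT ?n \<alpha> A C\<^sub>0 \<epsilon>) = ennreal z" using cA0 cT0 by (simp add: z_def)
      have 2: "(\<Sum>j\<in>(UNIV::'m set). \<Sum>i\<in>(UNIV::'m set). ennreal z) = ennreal (?m\<^sup>2 * z)"
        using z0 by (simp add: ennreal_of_nat_eq_real_of_nat ennreal_mult' power2_eq_square mult.assoc)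
      have 3: "ennreal (?m\<^sup>2 * z) + ennreal lam1 = ennreal (?m\<^sup>2 * z + lam1)" using z0 pos by simp
      have 4: "2 * ennreal lam2 = ennreal (2 * lam2)" by (simp add: ennreal_mult')
      have 5: "ennreal (6 * ?m) * ennreal (?m\<^sup>2 * z + lam1) = ennreal (6 * ?m * (?m\<^sup>2 * z + lam1))"
        by (rule ennreal_mult'[symmetric]) simp
      have 6: "ennreal (2 * lam2) + ennreal (6 * ?m * (?m\<^sup>2 * z + lam1)) = ennreal (2 * lam2 + 6 * ?m * (?m\<^sup>2 * z + lam1))"
        using z0 pos by (intro ennreal_plus[symmetric]) auto
      show ?thesis unfolding 1 2 3 4 5 6 z_def[symmetric]
        by (subst ennreal_mult'[symmetric]) auto
    qed
    finally show "x \<in> {x \<in> ?Q. ?U x \<le> ennreal ?N}" using xQ by simp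
  qed
  have "ennreal (\<eta> * ?vol) \<le> emeasure lborel X0" by (rule mX0)
  also have "\<dots> \<le> emeasure lborel (X0 - Y) + emeasure lborel Y"
  proof -
    have "emeasure lborel X0 \<le> emeasure lborel ((X0 - Y) \<union> Y)" by (intro emeasure_mono) auto
    also have "\<dots> \<le> emeasure lborel (X0 - Y) + emeasure lborel Y" by (rule emeasure_subadditive) auto
    finally show ?thesis .
  qed
  also have "\<dots> \<le> emeasure lborel (X0 - Y) + ennreal (\<eta> / 2 * ?vol)" by (intro add_left_mono mY)
  finally have "ennreal (\<eta> / 2 * ?vol) + ennreal (\<eta> / 2 * ?vol) \<le> emeasure lborel (X0 - Y) + ennreal (\<eta> / 2 * ?vol)"
    using \<eta> by (simp add: ennreal_plus[symmetric] del: ennreal_plus)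
  then have "ennreal (\<eta> / 2 * ?vol) \<le> emeasure lborel (X0 - Y)"
    by (simp add: add.commute ennreal_add_left_cancel_le)
  also have "\<dots> \<le> emeasure lborel {x \<in> ?Q. ?U x \<le> ennreal ?N}"
    by (rule emeasure_mono[OF good]) simp
  finally show ?thesis .
qed

end

section \<open>The Carleson measure estimate\<close>

lemma (in tb_kernel) norm_Gam_diff:
  assumes t: "t > 0" and xy: "norm (x - y) \<le> 2 * real CARD('n) * t"
  shows "norm (Gam t x - Gam t y) \<le> real CARD('m) * (A * Wc CARD('n) \<alpha>) * (norm (x - y) / t) powr \<alpha>"
proof -
  have "norm (Gam t x - Gam t y) \<le> (\<Sum>i\<in>UNIV. norm ((Gam t x - Gam t y) $ i))"
    unfolding norm_vec_def by (rule L2_set_le_sum) simp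
  also have "\<dots> \<le> (\<Sum>i\<in>(UNIV :: 'm set). A * Wc CARD('n) \<alpha> * (norm (x - y) / t) powr \<alpha>)"
    by (intro sum_mono) (simp add: Gam_def k.gam_diff[OF t xy])
  finally show ?thesis by (simp add: mult.assoc)
qed

text \<open>The order of quantifiers matters: \<open>N\<close> is obtained before the kernel and the
  test functions, whence the uniform constant of the theorem.\<close>

lemma carleson_of_testing:
  fixes \<alpha> A \<delta> p C\<^sub>0 :: real
  assumes alpha: "0 < \<alpha>" "\<alpha> \<le> 1" and A: "A \<ge> 0" and pos: "\<delta> > 0" "p > 1" "C\<^sub>0 \<ge> 0"
  obtains N where "N > 0" "\<And>\<Psi> :: real \<Rightarrow> real ^ 'n \<Rightarrow> real ^ 'n \<Rightarrow> complex ^ 'm. tb_kernel \<alpha> A \<Psi> \<Longrightarrow>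
    (\<And>q x0. \<exists>b. b \<in> borel_measurable borel \<and>
      (\<integral>\<^sup>+y. ennreal (norm (b y) powr p) \<partial>lborel) \<le> ennreal (C\<^sub>0 * cvol CARD('n) q) \<and>
      (\<forall>v. norm v = 1 \<longrightarrow> \<delta> \<le> accr v (avg q b x0)) \<and>
      (\<integral>\<^sup>+x. indicator (cube_of q x0) x * ennreal_powr (\<integral>\<^sup>+t. indicator {t. lev t \<in> {..q}} t * (ennreal (norm (tb_kernel.TB \<Psi> b t x)))\<^sup>2 \<partial>dtt) (p / 2) \<partial>lborel)
        \<le> ennreal (C\<^sub>0 * cvol CARD('n) q)) \<Longrightarrow>
    (\<And>l j x. avn j (\<lambda>y. \<integral>\<^sup>+t. indicator {t. lev t \<in> {l..j}} t * (ennreal (norm (tb_kernel.Gam \<Psi> t y)))\<^sup>2 \<partial>dtt) x \<le> ennreal N)"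
proof -
  let ?n = "CARD('n)" let ?m = "real CARD('m)"
  let ?c0 = "(2 + real ?n) powr (- (real ?n + 1)) / 2"
  \<comment> \<open>The solution of lam^(1-p) = \<delta> / (4 \<open>C\<^sub>0\<close> + 1); the
    added 1 keeps the base positive.\<close>
  define lam where "lam = ((4 * C\<^sub>0 + 1) / \<delta>) powr (1 / (p - 1))"
  define \<eta> where "\<eta> = \<delta> / (4 * lam)"
  \<comment> \<open>The first term makes the top cube good, the second makes the set of large
    \<open>Phi\<close> small.\<close>
  define K where "K = max (1 + C\<^sub>0) (Wc ?n (\<alpha> / 2) * (1 + C\<^sub>0) / (?c0 * (\<eta> / 8)))"
  define \<epsilon> where "\<epsilon> = \<eta> / (16 * (real ?n)\<^sup>2)"
  \<comment> \<open>In \<open>lam1\<close> and \<open>lam2\<close> the added 1 secures positivity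
    when the other term vanishes.\<close>
  define lam1 where "lam1 = ?m\<^sup>2 * (cR ?n \<alpha> A * (2 ^ ?n * K)\<^sup>2) / (\<eta> / 8) + 1"
  define lam2 where "lam2 = (C\<^sub>0 / (\<eta> / 8) + 1) powr (2 / p)"
  define N0 where "N0 = (2 * lam2 + 6 * ?m * (?m\<^sup>2 * (cA ?n \<alpha> A K + cT ?n \<alpha> A C\<^sub>0 \<epsilon>) + lam1)) / K\<^sup>2"
  define \<kappa> where "\<kappa> = \<delta> / (4 * K)"
  define H where "H = (\<kappa> + 2) * (?m * (A * Wc ?n \<alpha>))"
  \<comment> \<open>\<open>john_nirenberg\<close> asks for a proportion of at most 1.\<close>
  define \<eta>' where "\<eta>' = min (\<eta> / 2) 1"
  define J where "J = (2 * N0 + H\<^sup>2 * (2 * real ?n) powr (2 * \<alpha>) / \<alpha>) / \<eta>'"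
  have W: "Wc ?n \<alpha> > 0" "Wc ?n (\<alpha> / 2) > 0" using alpha by (auto intro: Wc_pos)
  have cR0: "cR ?n \<alpha> A \<ge> 0" unfolding cR_def using W by auto
  have lam: "lam > 0" unfolding lam_def using pos by simp
  have \<eta>: "\<eta> > 0" unfolding \<eta>_def using lam pos by simp
  have K0: "1 + C\<^sub>0 \<le> K" "K > 0" unfolding K_def using pos by (auto simp: less_max_iff_disj)
  have \<epsilon>: "\<epsilon> > 0" unfolding \<epsilon>_def using \<eta> by simp
  have lam1: "lam1 > 0" unfolding lam1_def using \<eta> cR0 by (intro add_nonneg_pos) auto
  have base2: "C\<^sub>0 / (\<eta> / 8) + 1 > 0" using \<eta> pos by (intro add_nonneg_pos) auto
  have lam2: "lam2 > 0" unfolding lam2_def using base2 by simp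
  have \<kappa>: "\<kappa> > 0" unfolding \<kappa>_def using pos K0 by simp
  have \<eta>': "0 < \<eta>'" "\<eta>' \<le> 1" unfolding \<eta>'_def using \<eta> by auto
  have H: "H \<ge> 0" unfolding H_def using \<kappa> A W by simp
  have cAT: "cA ?n \<alpha> A K \<ge> 0" "cT ?n \<alpha> A C\<^sub>0 \<epsilon> \<ge> 0" unfolding cA_def cT_def using alpha by auto
  have N0: "N0 \<ge> 0" unfolding N0_def using lam1 lam2 cAT by simp
  have J: "J \<ge> 0" unfolding J_def using N0 \<eta>' alpha by simp
  have c0: "?c0 > 0" by simp
  have par1: "lam powr (1 - p) * C\<^sub>0 \<le> \<delta> / 4"
  proof -
    have "lam powr (1 - p) = ((4 * C\<^sub>0 + 1) / \<delta>) powr (- 1)"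
      unfolding lam_def powr_powr using pos by (intro arg_cong[where f="\<lambda>e. _ powr e"]) (simp add: field_simps)
    also have "\<dots> = \<delta> / (4 * C\<^sub>0 + 1)" using pos by (simp add: powr_minus_divide)
    finally have "lam powr (1 - p) * C\<^sub>0 = \<delta> * C\<^sub>0 / (4 * C\<^sub>0 + 1)" by simp
    also have "\<dots> \<le> \<delta> / 4" using pos by (simp add: divide_simps)
    finally show ?thesis .
  qed
  have par3: "Wc ?n (\<alpha> / 2) * (1 + C\<^sub>0) \<le> K * (?c0 * (\<eta> / 8))"
  proof -
    have p: "?c0 * (\<eta> / 8) > 0" using c0 \<eta> by (intro mult_pos_pos) auto
    have "Wc ?n (\<alpha> / 2) * (1 + C\<^sub>0) / (?c0 * (\<eta> / 8)) \<le> K" unfolding K_def by simp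
    then show ?thesis using p by (simp only: pos_divide_le_eq)
  qed
  have par4: "2 * (real ?n)\<^sup>2 * \<epsilon> \<le> \<eta> / 8" unfolding \<epsilon>_def by (simp add: field_simps)
  have par5: "?m\<^sup>2 * (cR ?n \<alpha> A * (2 ^ ?n * K)\<^sup>2) \<le> lam1 * (\<eta> / 8)"
    unfolding lam1_def using \<eta> by (simp add: field_simps)
  have par6: "C\<^sub>0 \<le> lam2 powr (p / 2) * (\<eta> / 8)"
  proof -
    have "lam2 powr (p / 2) = C\<^sub>0 / (\<eta> / 8) + 1"
      unfolding lam2_def powr_powr using pos base2 by simp
    then show ?thesis using \<eta> by (simp add: field_simps)
  qed
  obtain S :: "(complex ^ 'm) set" where S: "finite S" "\<And>v. v \<in> S \<Longrightarrow> norm v = 1"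
      "\<And>z. (norm z)\<^sup>2 \<le> (4 / \<kappa>\<^sup>2) * (\<Sum>v\<in>S. (cone_fun \<kappa> v z)\<^sup>2)"
    using cone_net[OF \<kappa>] by blast
  define N where "N = 4 / \<kappa>\<^sup>2 * (real (card S) * J) + 1"
  show thesis
  proof (rule that[of N])
    show "N > 0" unfolding N_def using J by (intro add_nonneg_pos) auto
    fix \<Psi> :: "real \<Rightarrow> real ^ 'n \<Rightarrow> real ^ 'n \<Rightarrow> complex ^ 'm" and l j x
    assume "tb_kernel \<alpha> A \<Psi>"
    then interpret tb_kernel \<alpha> A \<Psi> .
    assume test: "\<And>q x0. \<exists>b. b \<in> borel_measurable borel \<and>
      (\<integral>\<^sup>+y. ennreal (norm (b y) powr p) \<partial>lborel) \<le> ennreal (C\<^sub>0 * cvol CARD('n) q) \<and>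
      (\<forall>v. norm v = 1 \<longrightarrow> \<delta> \<le> accr v (avg q b x0)) \<and>
      (\<integral>\<^sup>+x. indicator (cube_of q x0) x * ennreal_powr (\<integral>\<^sup>+t. indicator {t. lev t \<in> {..q}} t * (ennreal (norm (TB b t x)))\<^sup>2 \<partial>dtt) (p / 2) \<partial>lborel)
        \<le> ennreal (C\<^sub>0 * cvol CARD('n) q)"
    let ?u = "\<lambda>v t x. cone_fun \<kappa> v (Gam t x)"
    let ?I = "\<lambda>t. indicator {t. lev t \<in> {l..j}} t :: ennreal"
    have um [measurable]: "(\<lambda>(t, x). ?u v t x) \<in> borel_measurable (borel \<Otimes>\<^sub>M borel)" for v
    proof -
      have "cone_fun \<kappa> v \<in> borel_measurable borel"
        unfolding cone_fun_def by (intro borel_measurable_continuous_onI continuous_intros)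
      then show ?thesis by measurable
    qed
    have um' [measurable (raw)]: "(\<lambda>z. ?u v (g z) (h z)) \<in> borel_measurable M"
      if "g \<in> borel_measurable M" "h \<in> borel_measurable M" for g h v and M :: "'z measure"
      using measurable_compose[OF measurable_Pair[OF that] um] by simp
    have jn: "avn j (\<lambda>x. \<integral>\<^sup>+t. ?I t * ennreal ((?u v t x)\<^sup>2) \<partial>dtt) x \<le> ennreal J" if v: "v \<in> S" for v
      unfolding J_def
    proof (rule john_nirenberg[OF alpha(1) H N0 \<eta>' um])
      show "\<bar>?u v t x - ?u v t y\<bar> \<le> H * (norm (x - y) / t) powr \<alpha>"
        if "t > 0" "norm (x - y) \<le> 2 * real CARD('n) * t" for t x y
      proof -
        have "\<bar>?u v t x - ?u v t y\<bar> \<le> (\<kappa> + 2) * norm (Gam t x - Gam t y)"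
          using \<kappa> by (intro cone_fun_lipschitz S(2)[OF v]) simp
        also have "\<dots> \<le> (\<kappa> + 2) * (?m * (A * Wc ?n \<alpha>) * (norm (x - y) / t) powr \<alpha>)"
          using \<kappa> by (intro mult_left_mono norm_Gam_diff that) simp
        finally show ?thesis by (simp add: H_def mult.assoc)
      qed
      show "ennreal (\<eta>' * cvol CARD('n) q) \<le> emeasure lborel {y \<in> cube_of q x. (\<integral>\<^sup>+t. indicator {t. lev t \<in> {l..q}} t * ennreal ((?u v t y)\<^sup>2) \<partial>dtt) \<le> ennreal N0}"
        if lq: "l \<le> q" for q x
      proof -
        obtain b where b: "b \<in> borel_measurable borel"
          "(\<integral>\<^sup>+y. ennreal (norm (b y) powr p) \<partial>lborel) \<le> ennreal (C\<^sub>0 * cvol CARD('n) q)"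
          "\<And>v. norm v = 1 \<Longrightarrow> \<delta> \<le> accr v (avg q b x)"
          "(\<integral>\<^sup>+y. indicator (cube_of q x) y * ennreal_powr (\<integral>\<^sup>+t. indicator {t. lev t \<in> {..q}} t * (ennreal (norm (TB b t y)))\<^sup>2 \<partial>dtt) (p / 2) \<partial>lborel)
            \<le> ennreal (C\<^sub>0 * cvol CARD('n) q)"
          using test[of q x] by blast
        have "ennreal (\<eta>' * cvol CARD('n) q) \<le> ennreal (\<eta> / 2 * cvol CARD('n) q)"
          unfolding \<eta>'_def by (intro ennreal_leI mult_right_mono) auto
        also have "\<dots> \<le> emeasure lborel {y \<in> cube_of q x. (\<integral>\<^sup>+t. indicator {t. lev t \<in> {l..q}} t * ennreal ((?u v t y)\<^sup>2) \<partial>dtt) \<le> ennreal N0}"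
          unfolding \<kappa>_def N0_def
          by (rule ample[OF lq b(1) S(2)[OF v] pos(1-3) lam \<epsilon> lam1 lam2 K0(1) b(2) b(3)[OF S(2)[OF v]] b(4) par1 \<eta>_def par3 par4 par5 par6])
        finally show ?thesis .
      qed
    qed
    have "(\<integral>\<^sup>+t. ?I t * (ennreal (norm (Gam t y)))\<^sup>2 \<partial>dtt)
        \<le> ennreal (4 / \<kappa>\<^sup>2) * (\<Sum>v\<in>S. \<integral>\<^sup>+t. ?I t * ennreal ((?u v t y)\<^sup>2) \<partial>dtt)" for y
    proof -
      have "(\<integral>\<^sup>+t. ?I t * (ennreal (norm (Gam t y)))\<^sup>2 \<partial>dtt)
          \<le> (\<integral>\<^sup>+t. ennreal (4 / \<kappa>\<^sup>2) * (\<Sum>v\<in>S. ?I t * ennreal ((?u v t y)\<^sup>2)) \<partial>dtt)"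
      proof (rule nn_integral_mono)
        fix t
        have "ennreal ((norm (Gam t y))\<^sup>2) \<le> ennreal ((4 / \<kappa>\<^sup>2) * (\<Sum>v\<in>S. (?u v t y)\<^sup>2))"
          by (rule ennreal_leI[OF S(3)])
        also have "\<dots> = ennreal (4 / \<kappa>\<^sup>2) * (\<Sum>v\<in>S. ennreal ((?u v t y)\<^sup>2))"
          by (subst ennreal_mult') (auto simp: sum_ennreal)
        finally have 1: "?I t * ennreal ((norm (Gam t y))\<^sup>2) \<le> ?I t * (ennreal (4 / \<kappa>\<^sup>2) * (\<Sum>v\<in>S. ennreal ((?u v t y)\<^sup>2)))"
          by (rule mult_left_mono) simp
        also have "\<dots> = ennreal (4 / \<kappa>\<^sup>2) * (\<Sum>v\<in>S. ?I t * ennreal ((?u v t y)\<^sup>2))"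
          by (subst mult.left_commute) (simp only: sum_distrib_left)
        finally show "?I t * (ennreal (norm (Gam t y)))\<^sup>2 \<le> ennreal (4 / \<kappa>\<^sup>2) * (\<Sum>v\<in>S. ?I t * ennreal ((?u v t y)\<^sup>2))"
          by (simp add: ennreal_power)
      qed
      also have "\<dots> = ennreal (4 / \<kappa>\<^sup>2) * (\<Sum>v\<in>S. \<integral>\<^sup>+t. ?I t * ennreal ((?u v t y)\<^sup>2) \<partial>dtt)"
        by (subst nn_integral_cmult, measurable, subst nn_integral_sum, measurable)
      finally show ?thesis .
    qed
    then have "avn j (\<lambda>y. \<integral>\<^sup>+t. ?I t * (ennreal (norm (Gam t y)))\<^sup>2 \<partial>dtt) x
        \<le> avn j (\<lambda>y. ennreal (4 / \<kappa>\<^sup>2) * (\<Sum>v\<in>S. \<integral>\<^sup>+t. ?I t * ennreal ((?u v t y)\<^sup>2) \<partial>dtt)) x"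
      by (intro avn_mono)
    also have "\<dots> = ennreal (4 / \<kappa>\<^sup>2) * avn j (\<lambda>y. \<Sum>v\<in>S. \<integral>\<^sup>+t. ?I t * ennreal ((?u v t y)\<^sup>2) \<partial>dtt) x"
      by (rule avn_cmult) measurable
    also have "avn j (\<lambda>y. \<Sum>v\<in>S. \<integral>\<^sup>+t. ?I t * ennreal ((?u v t y)\<^sup>2) \<partial>dtt) x
        = (\<Sum>v\<in>S. avn j (\<lambda>y. \<integral>\<^sup>+t. ?I t * ennreal ((?u v t y)\<^sup>2) \<partial>dtt) x)"
      using S(1)
    proof (induction S)
      case (insert v F)
      then show ?case by (simp add: avn_add)
    qed simp
    also have "\<dots> \<le> (\<Sum>v\<in>S. ennreal J)" by (intro sum_mono jn)
    also have "\<dots> = ennreal (real (card S) * J)"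
      using J by (simp add: ennreal_of_nat_eq_real_of_nat ennreal_mult')
    finally have "avn j (\<lambda>y. \<integral>\<^sup>+t. ?I t * (ennreal (norm (Gam t y)))\<^sup>2 \<partial>dtt) x \<le> ennreal (4 / \<kappa>\<^sup>2) * ennreal (real (card S) * J)"
      by (simp add: mult_left_mono)
    also have "\<dots> = ennreal (4 / \<kappa>\<^sup>2 * (real (card S) * J))" by (rule ennreal_mult'[symmetric]) simp
    also have "\<dots> \<le> ennreal N" unfolding N_def by (intro ennreal_leI) simp
    finally show "avn j (\<lambda>y. \<integral>\<^sup>+t. ?I t * (ennreal (norm (Gam t y)))\<^sup>2 \<partial>dtt) x \<le> ennreal N" .
  qed
qed

section \<open>Borel representatives\<close>

lemma lebesgue_borel_representative:
  fixes f :: "'a::euclidean_space \<Rightarrow> 'b::euclidean_space"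
  assumes "f \<in> borel_measurable lebesgue"
  obtains g where "g \<in> borel_measurable borel" "AE x in lborel. f x = g x"
proof -
  have "\<exists>g. g \<in> borel_measurable lborel \<and> (AE x in lborel. f x \<bullet> b = g x)" for b
  proof -
    have "(\<lambda>x. f x \<bullet> b) \<in> borel_measurable lebesgue" using assms by measurable
    from completion_ex_borel_measurable_real[OF this] show ?thesis by auto
  qed
  then obtain G where G: "\<And>b. G b \<in> borel_measurable lborel" "\<And>b. AE x in lborel. f x \<bullet> b = G b x" by metis
  have "AE x in lborel. \<forall>b\<in>Basis. f x \<bullet> b = G b x"
    by (rule AE_finite_allI) (auto intro: G(2))
  then have "AE x in lborel. f x = (\<Sum>b\<in>Basis. G b x *\<^sub>R b)"
  proof eventually_elim
    case (elim x)
    have "f x = (\<Sum>b\<in>Basis. (f x \<bullet> b) *\<^sub>R b)" by (rule euclidean_representation[symmetric])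
    also have "\<dots> = (\<Sum>b\<in>Basis. G b x *\<^sub>R b)" using elim by (intro sum.cong) auto
    finally show ?case .
  qed
  moreover have "(\<lambda>x. \<Sum>b\<in>Basis. G b x *\<^sub>R b) \<in> borel_measurable borel"
    using G(1) by simp
  ultimately show ?thesis using that by blast
qed

text \<open>It provides good points inside prescribed cubes when the kernel is made Borel.\<close>

lemma AE_meets:
  assumes "AE x in M. P x" "S \<in> sets M" "emeasure M S \<noteq> 0"
  shows "\<exists>x\<in>S. P x"
proof (rule ccontr)
  assume "\<not> (\<exists>x\<in>S. P x)"
  then have "AE x in M. x \<notin> S" using assms(1) by (auto elim: eventually_mono)
  then have "emeasure M S = 0" using assms(2) by (subst (asm) AE_iff_measurable[of S]) (auto dest: sets.sets_into_space)
  then show False using assms(3) by simp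
qed

text \<open>Regularity is given for |h| \<le> t/2. For larger increments up to 2 n t, both values
  obey the size condition, \<open>wt_shift\<close> compares the two weights, and (d/t)^a \<ge> 1/2;
  this is the origin of the factor 2 in \<open>A\<close>.\<close>

lemma kernel_bounds:
  fixes \<Psi> :: "real \<Rightarrow> real ^ 'n \<Rightarrow> real ^ 'n \<Rightarrow> complex ^ 'm" and \<alpha> C :: real
  defines "a \<equiv> min \<alpha> 1"
  defines "A \<equiv> 2 * \<bar>C\<bar> * ((1 + 2 * real CARD('n)) powr (real CARD('n) + a) + 1)"
  assumes alpha: "\<alpha> > 0" and \<Psi>: "square_function_kernel \<alpha> C \<Psi>" and t: "t > 0"
  shows "norm (\<Psi> t x y) \<le> A * wt a t (x - y)"
    and "norm (y - y') \<le> 2 * real CARD('n) * t \<Longrightarrow> norm (\<Psi> t x y - \<Psi> t x y') \<le> A * (norm (y - y') / t) powr a * wt a t (x - y)"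
    and "norm (x - x') \<le> 2 * real CARD('n) * t \<Longrightarrow> norm (\<Psi> t x y - \<Psi> t x' y) \<le> A * (norm (x - x') / t) powr a * wt a t (x - y)"
proof -
  let ?n = "real CARD('n)" let ?c = "(1 + 2 * ?n) powr (?n + a)"
  have a: "0 < a" "a \<le> 1" "a \<le> \<alpha>" unfolding a_def using alpha by auto
  have c: "?c \<ge> 0" by simp
  have size0: "norm (\<Psi> t x y) \<le> \<bar>C\<bar> * wt a t (x - y)" for x y
  proof -
    have "norm (\<Psi> t x y) \<le> C * wt \<alpha> t (x - y)"
      using \<Psi> t unfolding square_function_kernel_def wt_def by auto
    also have "\<dots> \<le> \<bar>C\<bar> * wt \<alpha> t (x - y)" by (intro mult_right_mono) auto
    also have "\<dots> \<le> \<bar>C\<bar> * wt a t (x - y)" by (intro mult_left_mono wt_mono_exponent t a) auto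
    finally show ?thesis .
  qed
  have AC: "\<bar>C\<bar> \<le> A" unfolding A_def using mult_left_mono[of 1 "2 * (?c + 1)" "\<bar>C\<bar>"] c by (simp add: algebra_simps)
  show "norm (\<Psi> t x y) \<le> A * wt a t (x - y)"
    using size0 mult_right_mono[OF AC wt_nonneg] by (rule order_trans)
  have small: "norm (\<Psi> t x (y + h) - \<Psi> t x y) + norm (\<Psi> t (x + h) y - \<Psi> t x y) \<le> \<bar>C\<bar> * ((norm h / t) powr a * wt a t (x - y))"
    if h: "norm h \<le> t / 2" for h x y
  proof -
    have "norm (\<Psi> t x (y + h) - \<Psi> t x y) + norm (\<Psi> t (x + h) y - \<Psi> t x y) \<le> C * (norm h powr \<alpha> / (t + norm (x - y)) powr (?n + \<alpha>))"
      using \<Psi> t h unfolding square_function_kernel_def by blast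
    also have "norm h powr \<alpha> / (t + norm (x - y)) powr (?n + \<alpha>) = (norm h / t) powr \<alpha> * wt \<alpha> t (x - y)"
      unfolding wt_def using t by (simp add: powr_divide)
    also have "C * \<dots> \<le> \<bar>C\<bar> * ((norm h / t) powr \<alpha> * wt \<alpha> t (x - y))"
      by (intro mult_right_mono) auto
    also have "\<dots> \<le> \<bar>C\<bar> * ((norm h / t) powr a * wt a t (x - y))"
      using h t a by (intro mult_left_mono mult_mono wt_mono_exponent powr_mono') auto
    finally show ?thesis .
  qed
  have A1: "\<bar>C\<bar> * z \<le> A * z" if "z \<ge> 0" for z using mult_right_mono[OF AC that] .
  have large: "\<bar>C\<bar> * wt a t u + \<bar>C\<bar> * wt a t w \<le> A * (d / t) powr a * wt a t u"
    if "norm (u - w) \<le> 2 * ?n * t" "d > t / 2" for u w :: "real ^ 'n" and d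
  proof -
    have "wt a t w \<le> ?c * wt a t u"
      using that(1) by (intro wt_shift t a) (auto simp: norm_minus_commute)
    then have "\<bar>C\<bar> * wt a t u + \<bar>C\<bar> * wt a t w \<le> \<bar>C\<bar> * wt a t u + \<bar>C\<bar> * (?c * wt a t u)"
      by (intro add_left_mono mult_left_mono) auto
    also have "\<dots> = A * (1 / 2) * wt a t u" unfolding A_def by (simp add: algebra_simps)
    also have "\<dots> \<le> A * (d / t) powr a * wt a t u"
    proof (intro mult_right_mono mult_left_mono)
      have "1 / 2 = (1 / 2) powr (1 :: real)" by simp
      also have "\<dots> \<le> (1 / 2) powr a" using a by (intro powr_mono') auto
      also have "\<dots> \<le> (d / t) powr a" using that(2) t a by (intro powr_mono2) (auto simp: field_simps)
      finally show "1 / 2 \<le> (d / t) powr a" .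
      show "0 \<le> A" using AC by linarith
    qed simp
    finally show ?thesis .
  qed
  show "norm (\<Psi> t x y - \<Psi> t x y') \<le> A * (norm (y - y') / t) powr a * wt a t (x - y)"
    if d: "norm (y - y') \<le> 2 * ?n * t"
  proof (cases "norm (y' - y) \<le> t / 2")
    case True
    have "y + (y' - y) = y'" by simp
    with small[OF True, of x y] norm_ge_zero[of "\<Psi> t (x + (y' - y)) y - \<Psi> t x y"]
    have "norm (\<Psi> t x y' - \<Psi> t x y) \<le> \<bar>C\<bar> * ((norm (y' - y) / t) powr a * wt a t (x - y))"
      by (simp only:)
    also have "\<dots> \<le> A * ((norm (y' - y) / t) powr a * wt a t (x - y))" by (rule A1) simp
    finally show ?thesis by (simp add: norm_minus_commute mult.assoc)
  next
    case False
    have "norm (\<Psi> t x y - \<Psi> t x y') \<le> norm (\<Psi> t x y) + norm (\<Psi> t x y')" by (rule norm_triangle_ineq4)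
    also have "\<dots> \<le> \<bar>C\<bar> * wt a t (x - y) + \<bar>C\<bar> * wt a t (x - y')" by (intro add_mono size0)
    also have "\<dots> \<le> A * (norm (y - y') / t) powr a * wt a t (x - y)"
      using d False by (intro large) (auto simp: norm_minus_commute)
    finally show ?thesis .
  qed
  show "norm (\<Psi> t x y - \<Psi> t x' y) \<le> A * (norm (x - x') / t) powr a * wt a t (x - y)"
    if d: "norm (x - x') \<le> 2 * ?n * t"
  proof (cases "norm (x' - x) \<le> t / 2")
    case True
    have "x + (x' - x) = x'" by simp
    with small[OF True, of x y] norm_ge_zero[of "\<Psi> t x (y + (x' - x)) - \<Psi> t x y"]
    have "norm (\<Psi> t x' y - \<Psi> t x y) \<le> \<bar>C\<bar> * ((norm (x' - x) / t) powr a * wt a t (x - y))"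
      by (simp only:)
    also have "\<dots> \<le> A * ((norm (x' - x) / t) powr a * wt a t (x - y))" by (rule A1) simp
    finally show ?thesis by (simp add: norm_minus_commute mult.assoc)
  next
    case False
    have "norm (\<Psi> t x y - \<Psi> t x' y) \<le> norm (\<Psi> t x y) + norm (\<Psi> t x' y)" by (rule norm_triangle_ineq4)
    also have "\<dots> \<le> \<bar>C\<bar> * wt a t (x - y) + \<bar>C\<bar> * wt a t (x' - y)" by (intro add_mono size0)
    also have "\<dots> \<le> A * (norm (x - x') / t) powr a * wt a t (x - y)"
      using d False by (intro large) (auto simp: norm_minus_commute)
    finally show ?thesis .
  qed
qed

text \<open>A jointly Lebesgue measurable kernel that is continuous in \<open>(x, y)\<close> is Borel measurable off a
  null set of \<open>t\<close>: on almost every horizontal line it agrees with a Borel function, hence it does so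
  at a point of each product of dyadic cubes.\<close>

lemma kernel_borel_version:
  fixes \<Psi> :: "real \<Rightarrow> real ^ 'n \<Rightarrow> real ^ 'n \<Rightarrow> complex ^ 'm"
  assumes alpha: "\<alpha> > 0" and \<Psi>: "square_function_kernel \<alpha> C \<Psi>"
  obtains Z where "Z \<in> null_sets lborel"
    "tb_kernel (min \<alpha> 1) (2 * \<bar>C\<bar> * ((1 + 2 * real CARD('n)) powr (real CARD('n) + min \<alpha> 1) + 1))
      (\<lambda>t x y. if 0 < t \<and> t \<notin> Z then \<Psi> t x y else 0)"
proof -
  let ?a = "min \<alpha> 1" let ?n = "real CARD('n)"
  let ?A = "2 * \<bar>C\<bar> * ((1 + 2 * real CARD('n)) powr (real CARD('n) + min \<alpha> 1) + 1)"
  let ?F = "\<lambda>(x :: real ^ 'n, y :: real ^ 'n, t :: real). if 0 < t then \<Psi> t x y else 0"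
  note bounds = kernel_bounds[OF alpha \<Psi>]
  have "?F \<in> borel_measurable lebesgue"
  proof -
    let ?S = "(UNIV \<times> UNIV \<times> {0<..}) :: ((real ^ 'n) \<times> (real ^ 'n) \<times> real) set"
    have S: "?S \<in> sets lebesgue"
    proof -
      have "open ?S" by (intro open_Times) auto
      then show ?thesis by auto
    qed
    have "(\<lambda>(x, y, t). \<Psi> t x y) \<in> borel_measurable (lebesgue_on ?S)"
      using \<Psi> by (simp add: square_function_kernel_def)
    then have "(\<lambda>z. if z \<in> ?S then (\<lambda>(x, y, t). \<Psi> t x y) z else 0) \<in> borel_measurable lebesgue"
      using S by (simp add: borel_measurable_if)
    moreover have "(\<lambda>z. if z \<in> ?S then (\<lambda>(x, y, t). \<Psi> t x y) z else 0) = ?F"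
      by (auto simp: fun_eq_iff)
    ultimately show ?thesis by simp
  qed
  then obtain G where Gm: "G \<in> borel_measurable borel" and G: "AE z in lborel. ?F z = G z"
    by (rule lebesgue_borel_representative)
  have Gm' [measurable (raw)]: "(\<lambda>z. G (f z, g z, h z)) \<in> borel_measurable M"
    if "f \<in> borel_measurable M" "g \<in> borel_measurable M" "h \<in> borel_measurable M" for f g h and M :: "'z measure"
    by (rule measurable_compose[OF _ Gm]) (use that in measurable)
  let ?P = "\<lambda>x y t. ?F (x, y, t) = G (x, y, t)"
  have "AE z in lborel \<Otimes>\<^sub>M lborel. ?F z = G z" unfolding lborel_prod by (rule G)
  then have "AE x in lborel. AE z in lborel. ?F (x, z) = G (x, z)" by (rule lborel_pair.AE_pair)
  then have AEx: "AE x in lborel. AE y in lborel. AE t in lborel. ?P x y t"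
  proof eventually_elim
    case (elim x)
    then have "AE z in lborel \<Otimes>\<^sub>M lborel. ?F (x, z) = G (x, z)" unfolding lborel_prod .
    then show ?case by (rule lborel_pair.AE_pair)
  qed
  \<comment> \<open>Each cube supplies a point X whose sections are good for almost all y and t, and
    then a point Y good for this X. The choices depend only on indices, that is, on countably many
    data.\<close>
  define X where "X j k = (SOME x. cube_index j x = k \<and> (AE y in lborel. AE t in lborel. ?P x y t))" for j and k :: "int ^ 'n"
  define Y where "Y j k k' = (SOME y. cube_index j y = k' \<and> (AE t in lborel. ?P (X j k) y t))" for j and k k' :: "int ^ 'n"
  have pos: "emeasure lborel (cube_of j x) \<noteq> 0" for j and x :: "real ^ 'n" by (simp add: ennreal_eq_0_iff not_le)
  have X: "cube_index j (X j (cube_index j x)) = cube_index j x \<and> (AE y in lborel. AE t in lborel. ?P (X j (cube_index j x)) y t)" for j and x :: "real ^ 'n"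
    unfolding X_def by (rule someI_ex) (use AE_meets[OF AEx _ pos[of j x]] in \<open>auto simp: cube_of_def\<close>)
  have Y: "cube_index j (Y j (cube_index j x) (cube_index j y)) = cube_index j y \<and> (AE t in lborel. ?P (X j (cube_index j x)) (Y j (cube_index j x) (cube_index j y)) t)" for j and x y :: "real ^ 'n"
    unfolding Y_def[of j "cube_index j x" "cube_index j y"]
    by (rule someI_ex) (use AE_meets[OF conjunct2[OF X[of j x]] _ pos[of j y]] in \<open>auto simp: cube_of_def\<close>)
  \<comment> \<open>There are countably many levels and pairs of indices, so one null set of t
    serves them all.\<close>
  have "AE t in lborel. \<forall>jkk' :: int \<times> (int ^ 'n) \<times> (int ^ 'n). \<forall>x y. jkk' = (fst jkk', cube_index (fst jkk') x, cube_index (fst jkk') y) \<longrightarrow>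
      ?P (X (fst jkk') (cube_index (fst jkk') x)) (Y (fst jkk') (cube_index (fst jkk') x) (cube_index (fst jkk') y)) t"
  proof (subst AE_all_countable, rule allI)
    fix jkk' :: "int \<times> (int ^ 'n) \<times> (int ^ 'n)"
    let ?j = "fst jkk'"
    show "AE t in lborel. \<forall>x y. jkk' = (?j, cube_index ?j x, cube_index ?j y) \<longrightarrow>
      ?P (X ?j (cube_index ?j x)) (Y ?j (cube_index ?j x) (cube_index ?j y)) t"
    proof (cases "\<exists>x y. jkk' = (?j, cube_index ?j x, cube_index ?j y)")
      case True
      then obtain x y where xy: "jkk' = (?j, cube_index ?j x, cube_index ?j y)" by blast
      have "AE t in lborel. ?P (X ?j (cube_index ?j x)) (Y ?j (cube_index ?j x) (cube_index ?j y)) t" using Y by blast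
      then show ?thesis
      proof eventually_elim
        case (elim t)
        show ?case
        proof (intro allI impI)
          fix x' y' assume "jkk' = (?j, cube_index ?j x', cube_index ?j y')"
          then have "cube_index ?j x' = cube_index ?j x" "cube_index ?j y' = cube_index ?j y" using xy by (metis prod.inject)+
          then show "?P (X ?j (cube_index ?j x')) (Y ?j (cube_index ?j x') (cube_index ?j y')) t" using elim by simp
        qed
      qed
    qed auto
  qed
  then have "AE t in lborel. \<forall>j x y. ?P (X j (cube_index j x)) (Y j (cube_index j x) (cube_index j y)) t"
  proof eventually_elim
    case (elim t)
    show ?case
    proof (intro allI)
      fix j x y
      show "?P (X j (cube_index j x)) (Y j (cube_index j x) (cube_index j y)) t"
        using elim[rule_format, of "(j, cube_index j x, cube_index j y)" x y] by simp
    qed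
  qed
  then obtain Z where Z: "Z \<in> null_sets lborel"
    and ZP: "{t \<in> space lborel. \<not> (\<forall>j x y. ?P (X j (cube_index j x)) (Y j (cube_index j x) (cube_index j y)) t)} \<subseteq> Z"
    unfolding eventually_ae_filter by blast
  have Zt: "\<forall>j x y. ?P (X j (cube_index j x)) (Y j (cube_index j x) (cube_index j y)) t" if "t \<notin> Z" for t
    using subsetD[OF ZP, of t] that unfolding space_lborel space_borel by blast
  have [measurable]: "Z \<in> sets borel" using Z by auto
  define \<Phi> where "\<Phi> t x y = (if 0 < t \<and> t \<notin> Z then \<Psi> t x y else 0)" for t x y
  \<comment> \<open>The m-th approximation evaluates \<open>G\<close> at the points chosen in the
    cubes of side 2^(-m) around x and y; it is Borel because these points depend only on the
    indices.\<close>
  define g where "g m z = (case z of (t, x, y) \<Rightarrow> if 0 < t \<and> t \<notin> Z then G (X (- int m) (cube_index (- int m) x), Y (- int m) (cube_index (- int m) x) (cube_index (- int m) y), t) else 0)"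
    for m :: nat and z
  have gm: "g m \<in> borel_measurable (borel \<Otimes>\<^sub>M borel \<Otimes>\<^sub>M borel)" for m
  proof -
    let ?j = "- int m"
    have "(\<lambda>z. G (X ?j (cube_index ?j (fst (snd z))), Y ?j (cube_index ?j (fst (snd z))) (cube_index ?j (snd (snd z))), fst z)) \<in> borel_measurable (borel \<Otimes>\<^sub>M borel \<Otimes>\<^sub>M borel)"
      by (rule measurable_compose_countable[where f="\<lambda>k z. G (X ?j (fst k), Y ?j (fst k) (snd k), fst z)" and g="\<lambda>z. (cube_index ?j (fst (snd z)), cube_index ?j (snd (snd z)))", simplified])
         (measurable)
    then show ?thesis unfolding g_def by (simp add: case_prod_beta) measurable
  qed
  \<comment> \<open>For good t the values of \<open>G\<close> at the chosen points are values of
    \<Psi>, and these converge by the regularity in both variables.\<close>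
  have lim: "(\<lambda>m. g m (t, x, y)) \<longlonglongrightarrow> \<Phi> t x y" for t x y
  proof (cases "0 < t \<and> t \<notin> Z")
    case False
    then have "g m (t, x, y) = \<Phi> t x y" for m unfolding g_def \<Phi>_def by auto
    then show ?thesis by simp
  next
    case True
    then have t: "t > 0" by simp
    define xm where "xm m = X (- int m) (cube_index (- int m) x)" for m
    define ym where "ym m = Y (- int m) (cube_index (- int m) x) (cube_index (- int m) y)" for m
    have gval: "g m (t, x, y) = \<Psi> t (xm m) (ym m)" for m
      using Zt[of t] True unfolding g_def xm_def ym_def by auto
    have pw: "(2 :: real) powi (- int m) = (1 / 2) ^ m" for m by (simp add: power_int_minus power_divide inverse_eq_divide)
    have dx: "norm (x - xm m) \<le> ?n * (1 / 2) ^ m" for m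
      unfolding xm_def pw[symmetric] by (rule norm_diff_cube_index) (use X in simp)
    have dy: "norm (y - ym m) \<le> ?n * (1 / 2) ^ m" for m
      unfolding ym_def pw[symmetric] by (rule norm_diff_cube_index) (use Y in simp)
    have geo: "(\<lambda>m. ?n * (1 / 2) ^ m) \<longlonglongrightarrow> 0"
      using tendsto_mult[OF tendsto_const[of ?n] LIMSEQ_power_zero[of "1 / 2 :: real"]] by simp
    have "eventually (\<lambda>m. ?n * (1 / 2) ^ m < 2 * ?n * t) sequentially"
      by (rule order_tendstoD(2)[OF geo]) (use t in simp)
    then have ev: "eventually (\<lambda>m. norm (\<Psi> t x y - \<Psi> t (xm m) (ym m)) \<le> 2 * (?A * (1 / t ^ CARD('n))) * ((?n * (1 / 2) ^ m) / t) powr ?a) sequentially"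
    proof eventually_elim
      case (elim m)
      have A0: "?A \<ge> 0" by simp
      have a0: "?a > 0" using alpha by simp
      have st: "?A * (norm d / t) powr ?a * wt ?a t u \<le> (?A * (1 / t ^ CARD('n))) * ((?n * (1 / 2) ^ m) / t) powr ?a"
        if "norm d \<le> ?n * (1 / 2) ^ m" for d u :: "real ^ 'n"
      proof -
        have "?A * (norm d / t) powr ?a * wt ?a t u \<le> ?A * ((?n * (1 / 2) ^ m) / t) powr ?a * (1 / t ^ CARD('n))"
          using that t a0 by (intro mult_mono powr_mono2 wt_le_inverse divide_right_mono) auto
        then show ?thesis by (simp add: mult_ac)
      qed
      have "norm (\<Psi> t x y - \<Psi> t (xm m) y) \<le> ?A * (norm (x - xm m) / t) powr ?a * wt ?a t (x - y)"
        by (rule bounds(3)[OF t]) (use dx[of m] elim in linarith)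
      also note st[OF dx[of m]]
      finally have 1: "norm (\<Psi> t x y - \<Psi> t (xm m) y) \<le> (?A * (1 / t ^ CARD('n))) * ((?n * (1 / 2) ^ m) / t) powr ?a" .
      have "norm (\<Psi> t (xm m) y - \<Psi> t (xm m) (ym m)) \<le> ?A * (norm (y - ym m) / t) powr ?a * wt ?a t (xm m - y)"
        by (rule bounds(2)[OF t]) (use dy[of m] elim in linarith)
      also note st[OF dy[of m]]
      finally have 2: "norm (\<Psi> t (xm m) y - \<Psi> t (xm m) (ym m)) \<le> (?A * (1 / t ^ CARD('n))) * ((?n * (1 / 2) ^ m) / t) powr ?a" .
      show ?case
        using norm_triangle_ineq[of "\<Psi> t x y - \<Psi> t (xm m) y" "\<Psi> t (xm m) y - \<Psi> t (xm m) (ym m)"] 1 2 by simp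
    qed
    have "(\<lambda>m. ((?n * (1 / 2) ^ m) / t) powr ?a) \<longlonglongrightarrow> (0 / t) powr ?a"
      using alpha t by (intro tendsto_powr' tendsto_divide geo tendsto_const) auto
    then have "(\<lambda>m. 2 * (?A * (1 / t ^ CARD('n))) * ((?n * (1 / 2) ^ m) / t) powr ?a) \<longlonglongrightarrow> 2 * (?A * (1 / t ^ CARD('n))) * 0"
      by (intro tendsto_mult tendsto_const) simp
    then have "(\<lambda>m. \<Psi> t x y - \<Psi> t (xm m) (ym m)) \<longlonglongrightarrow> 0"
      by (intro Lim_null_comparison[OF ev]) simp
    then have "(\<lambda>m. \<Psi> t x y - (\<Psi> t x y - \<Psi> t (xm m) (ym m))) \<longlonglongrightarrow> \<Psi> t x y - 0"
      by (intro tendsto_diff tendsto_const)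
    then show ?thesis unfolding gval using True by (simp add: \<Phi>_def)
  qed
  have "(\<lambda>(t, x, y). \<Phi> t x y) \<in> borel_measurable (borel \<Otimes>\<^sub>M borel \<Otimes>\<^sub>M borel)"
    by (rule borel_measurable_LIMSEQ_metric[of g, OF gm]) (auto simp: lim)
  then have \<Phi>m: "(\<lambda>(t, x, y). \<Phi> t x y $ i) \<in> borel_measurable (borel \<Otimes>\<^sub>M borel \<Otimes>\<^sub>M borel)" for i
  proof -
    assume m: "(\<lambda>(t, x, y). \<Phi> t x y) \<in> borel_measurable (borel \<Otimes>\<^sub>M borel \<Otimes>\<^sub>M borel)"
    have "(\<lambda>z. z $ i) \<in> borel_measurable (borel :: (complex ^ 'm) measure)"
      by (intro borel_measurable_continuous_onI continuous_intros)
    from measurable_compose[OF m this] show ?thesis by (simp add: case_prod_beta)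
  qed
  have "tb_kernel ?a ?A \<Phi>"
  proof (unfold_locales)
    show "0 < ?a" "?a \<le> 1" using alpha by auto
    show "0 \<le> ?A" by simp
    fix i
    show "(\<lambda>(t, x, y). \<Phi> t x y $ i) \<in> borel_measurable (borel \<Otimes>\<^sub>M borel \<Otimes>\<^sub>M borel)" by (rule \<Phi>m)
    have le: "norm (\<Phi> t x y $ i) \<le> norm (\<Phi> t x y)" for t x y by (rule Finite_Cartesian_Product.norm_nth_le)
    have led: "norm (\<Phi> t x y $ i - \<Phi> t x' y' $ i) \<le> norm (\<Phi> t x y - \<Phi> t x' y')" for t x y x' y'
      using Finite_Cartesian_Product.norm_nth_le[of "\<Phi> t x y - \<Phi> t x' y'" i] by simp
    show "norm (\<Phi> t x y $ i) \<le> ?A * wt ?a t (x - y)" if t: "0 < t" for t x y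
    proof (rule order_trans[OF le])
      show "norm (\<Phi> t x y) \<le> ?A * wt ?a t (x - y)"
        using bounds(1)[OF t, of x y] by (auto simp: \<Phi>_def)
    qed
    show "norm (\<Phi> t x y $ i - \<Phi> t x y' $ i) \<le> ?A * (norm (y - y') / t) powr ?a * wt ?a t (x - y)"
      if t: "0 < t" and d: "norm (y - y') \<le> 2 * real CARD('n) * t" for t x y y'
    proof (rule order_trans[OF led])
      show "norm (\<Phi> t x y - \<Phi> t x y') \<le> ?A * (norm (y - y') / t) powr ?a * wt ?a t (x - y)"
        using bounds(2)[OF t d, of x] by (auto simp: \<Phi>_def)
    qed
    show "norm (\<Phi> t x y $ i - \<Phi> t x' y $ i) \<le> ?A * (norm (x - x') / t) powr ?a * wt ?a t (x - y)"
      if t: "0 < t" and d: "norm (x - x') \<le> 2 * real CARD('n) * t" for t x x' y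
    proof (rule order_trans[OF led])
      show "norm (\<Phi> t x y - \<Phi> t x' y) \<le> ?A * (norm (x - x') / t) powr ?a * wt ?a t (x - y)"
        using bounds(3)[OF t d, of y] by (auto simp: \<Phi>_def)
    qed
  qed
  then show ?thesis using that[OF Z] unfolding \<Phi>_def[abs_def] by simp
qed

section \<open>Transfer to Lebesgue measure\<close>

lemma integral_lebesgue_eq_lborel:
  fixes f g :: "'a::euclidean_space \<Rightarrow> 'b::euclidean_space"
  assumes "f \<in> borel_measurable lebesgue" "g \<in> borel_measurable borel" "AE x in lborel. f x = g x"
  shows "(LINT x|lebesgue. f x) = (LINT x|lborel. g x)"
proof -
  have "(LINT x|lebesgue. f x) = (LINT x|lebesgue. g x)"
    using assms by (intro integral_cong_AE AE_completion) (auto intro: measurable_completion)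
  also have "\<dots> = (LINT x|lborel. g x)" using assms(2) by (intro integral_completion) simp
  finally show ?thesis .
qed

lemma nn_integral_Lp_space:
  assumes f: "f \<in> Lp_space p" and fg: "AE x in lborel. f x = g x"
  shows "(\<integral>\<^sup>+x. ennreal (norm (g x) powr p) \<partial>lborel) = ennreal (LINT x|lebesgue. norm (f x) powr p)"
proof -
  have "(\<integral>\<^sup>+x. ennreal (norm (g x) powr p) \<partial>lborel) = (\<integral>\<^sup>+x. ennreal (norm (f x) powr p) \<partial>lborel)"
    using fg by (intro nn_integral_cong_AE) (auto elim!: eventually_mono)
  also have "\<dots> = (\<integral>\<^sup>+x. ennreal (norm (f x) powr p) \<partial>lebesgue)" by (simp add: nn_integral_completion)
  also have "\<dots> = ennreal (LINT x|lebesgue. norm (f x) powr p)"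
    using f by (intro nn_integral_eq_integral) (auto simp: Lp_space_def)
  finally show ?thesis .
qed

lemma lev_le_iff: "t > 0 \<Longrightarrow> lev t \<le> q \<longleftrightarrow> t < 2 powi q"
proof -
  assume t: "t > 0"
  have "t < 2 powi q" if "lev t \<le> q"
    using lev_bounds(2)[OF t] power_int_increasing[OF that, of "2 :: real"] by simp
  moreover have "\<not> t < 2 powi q" if "\<not> lev t \<le> q"
  proof -
    have "q \<le> lev t - 1" using that by simp
    from power_int_increasing[OF this, of "2 :: real"] show ?thesis using lev_bounds(1)[OF t] by simp
  qed
  ultimately show ?thesis by blast
qed

text \<open>The closed cubes of the hypotheses and the half-open cubes of the proof have equal
  measure.\<close>

lemma AE_in_cube_of: "AE x in lborel. x \<in> dyadic_cube q (cube_index q x0) \<longrightarrow> x \<in> cube_of q (x0 :: real ^ 'n)"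
proof -
  let ?Q = "dyadic_cube q (cube_index q x0)"
  have Q: "?Q \<in> sets lborel" by (simp add: dyadic_cube_def)
  have "emeasure lborel (?Q - cube_of q x0) = emeasure lborel ?Q - emeasure lborel (cube_of q x0)"
    using Q box_cube_of_cbox(2)[of q x0] by (intro emeasure_Diff) auto
  also have "\<dots> = 0" by (simp add: emeasure_dyadic_cube)
  finally have "?Q - cube_of q x0 \<in> null_sets lborel" using Q by (intro null_setsI) auto
  from AE_not_in[OF this] show ?thesis by eventually_elim auto
qed

context
  fixes \<Psi> \<Phi> :: "real \<Rightarrow> real ^ 'n \<Rightarrow> real ^ 'n \<Rightarrow> complex ^ 'm" and \<alpha> A :: real and Z :: "real set"
  assumes Z: "Z \<in> null_sets lborel"
    and \<Phi>_def: "\<Phi> = (\<lambda>t x y. if 0 < t \<and> t \<notin> Z then \<Psi> t x y else 0)"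
    and tbk: "tb_kernel \<alpha> A \<Phi>"
begin

interpretation tb_kernel \<alpha> A \<Phi> by (rule tbk)

text \<open>For t outside \<open>Z\<close> the kernels coincide, and changing the test function on a
  null set does not affect the integral.\<close>

lemma Theta_mat_eq_TB:
  assumes t: "0 < t" "t \<notin> Z" and b: "b \<in> borel_measurable lebesgue"
    and b' [measurable]: "b' \<in> borel_measurable borel" and bb': "AE y in lborel. b y = b' y"
  shows "Theta_mat \<Psi> t b x = TB b' t x"
proof -
  have "(LINT y|lebesgue. \<Psi> t x y $ i * b y $ i $ j) = k.Th i (\<lambda>y. b' y $ i $ j) t x" for i j
    unfolding k.Th_def
  proof (rule integral_lebesgue_eq_lborel)
    have "(\<lambda>y. \<Phi> t x y $ i) \<in> borel_measurable lborel" by measurable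
    then have "(\<lambda>y. \<Phi> t x y $ i) \<in> borel_measurable lebesgue" by (rule measurable_completion)
    then have "(\<lambda>y. \<Phi> t x y $ i * b y $ i $ j) \<in> borel_measurable lebesgue"
      by (intro borel_measurable_times measurable_entry b)
    then show "(\<lambda>y. \<Psi> t x y $ i * b y $ i $ j) \<in> borel_measurable lebesgue"
      using t by (simp add: \<Phi>_def)
    show "AE y in lborel. \<Psi> t x y $ i * b y $ i $ j = \<Phi> t x y $ i * b' y $ i $ j"
      using bb' t by (auto simp: \<Phi>_def elim!: eventually_mono)
  qed measurable
  then show ?thesis by (simp add: Theta_mat_def TB_def)
qed

lemma Theta_vec_eq_Th:
  assumes t: "0 < t" "t \<notin> Z" and f: "f \<in> borel_measurable lebesgue" and f': "L2 f'" and ff': "AE y in lborel. f y = f' y"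
  shows "Theta_vec \<Psi> t f x = (\<Sum>i\<in>UNIV. k.Th i (\<lambda>y. f' y $ i) t x)"
proof -
  note [measurable] = L2_measurable[OF f']
  have nth [measurable (raw)]: "(\<lambda>y. g y $ i) \<in> borel_measurable M"
    if "g \<in> borel_measurable M" for i and M :: "'z measure" and g :: "'z \<Rightarrow> complex ^ 'm"
    by (rule measurable_compose[OF that borel_measurable_continuous_onI]) (intro continuous_intros)
  have int: "integrable lborel (\<lambda>y. \<Phi> t x y $ i * f' y $ i)" for i
  proof (rule k.Th_L2_integrable[OF t(1)])
    show "L2 (\<lambda>y. f' y $ i)"
      unfolding L2_def
    proof
      have "sqn (\<lambda>y. f' y $ i) \<le> sqn f'"
        unfolding sqn_def by (intro nn_integral_mono power_mono ennreal_leI Finite_Cartesian_Product.norm_nth_le) simp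
      also have "\<dots> < \<infinity>" using f' by (simp add: L2_def)
      finally show "sqn (\<lambda>y. f' y $ i) < \<infinity>" .
    qed measurable
  qed
  have "Theta_vec \<Psi> t f x = (LINT y|lborel. (\<Sum>i\<in>UNIV. \<Phi> t x y $ i * f' y $ i))"
    unfolding Theta_vec_def cdot_def
  proof (rule integral_lebesgue_eq_lborel)
    have "(\<lambda>y. \<Phi> t x y $ i) \<in> borel_measurable lborel" for i by measurable
    then have "(\<lambda>y. \<Phi> t x y $ i) \<in> borel_measurable lebesgue" for i by (rule measurable_completion)
    then have "(\<lambda>y. \<Sum>i\<in>UNIV. \<Phi> t x y $ i * f y $ i) \<in> borel_measurable lebesgue"
      by (intro borel_measurable_sum borel_measurable_times nth[OF f])
    then show "(\<lambda>y. \<Sum>i\<in>UNIV. \<Psi> t x y $ i * f y $ i) \<in> borel_measurable lebesgue"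
      using t by (simp add: \<Phi>_def)
    show "AE y in lborel. (\<Sum>i\<in>UNIV. \<Psi> t x y $ i * f y $ i) = (\<Sum>i\<in>UNIV. \<Phi> t x y $ i * f' y $ i)"
      using ff' t by (auto simp: \<Phi>_def elim!: eventually_mono)
  qed measurable
  also have "\<dots> = (\<Sum>i\<in>UNIV. k.Th i (\<lambda>y. f' y $ i) t x)"
    unfolding k.Th_def using int by (intro Bochner_Integration.integral_sum) simp
  finally show ?thesis .
qed

text \<open>The hypotheses pass to half-open cubes and Borel representatives, which change every
  integral by null sets only. The constant \<open>C\<^sub>1\<close> leaves room for a nonnegative
  replacement of \<open>C\<^sub>0\<close>.\<close>

lemma testing_transfer:
  assumes test: "dyadic_testing_system p \<delta> C\<^sub>0 \<Psi> b" and C1: "C\<^sub>0 \<le> C\<^sub>1"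
  shows "\<exists>b'. b' \<in> borel_measurable borel \<and>
      (\<integral>\<^sup>+y. ennreal (norm (b' y) powr p) \<partial>lborel) \<le> ennreal (C\<^sub>1 * cvol CARD('n) q) \<and>
      (\<forall>v. norm v = 1 \<longrightarrow> \<delta> \<le> accr v (avg q b' x0)) \<and>
      (\<integral>\<^sup>+x. indicator (cube_of q x0) x * ennreal_powr (\<integral>\<^sup>+t. indicator {t. lev t \<in> {..q}} t * (ennreal (norm (TB b' t x)))\<^sup>2 \<partial>dtt) (p / 2) \<partial>lborel)
        \<le> ennreal (C\<^sub>1 * cvol CARD('n) q)"
proof -
  define Q where "Q = dyadic_cube q (cube_index q x0)"
  have Q [measurable]: "Q \<in> sets borel" unfolding Q_def dyadic_cube_def by simp
  have mQ: "measure lebesgue Q = cvol CARD('n) q"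
    using Q by (simp add: measure_def[of lborel] Q_def emeasure_dyadic_cube)
  have h: "b Q \<in> Lp_space p" "(LINT x|lebesgue. norm (b Q x) powr p) \<le> C\<^sub>0 * cvol CARD('n) q"
      "(\<integral>\<^sup>+x\<in>Q. ennreal_powr (\<integral>\<^sup>+t\<in>{0<..<2 powi q}. ennreal ((norm (Theta_mat \<Psi> t (b Q) x))\<^sup>2 / t) \<partial>lebesgue) (p / 2) \<partial>lebesgue)
        \<le> ennreal (C\<^sub>0 * cvol CARD('n) q)"
      "\<And>\<xi>. \<delta> * (norm \<xi>)\<^sup>2 \<le> accr \<xi> ((1 / cvol CARD('n) q) *\<^sub>R (LINT x:Q|lebesgue. b Q x))"
    using test[unfolded dyadic_testing_system_def Let_def, rule_format, of q "cube_index q x0", folded Q_def, unfolded mQ]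
    unfolding accr_def by blast+
  have CC: "ennreal (C\<^sub>0 * cvol CARD('n) q) \<le> ennreal (C\<^sub>1 * cvol CARD('n) q)"
    using C1 by (intro ennreal_leI mult_right_mono) auto
  have bm: "b Q \<in> borel_measurable lebesgue" using h(1) by (simp add: Lp_space_def)
  then obtain b' where b' [measurable]: "b' \<in> borel_measurable borel" and bb': "AE x in lborel. b Q x = b' x"
    by (rule lebesgue_borel_representative)
  have 1: "(\<integral>\<^sup>+y. ennreal (norm (b' y) powr p) \<partial>lborel) \<le> ennreal (C\<^sub>1 * cvol CARD('n) q)"
    unfolding nn_integral_Lp_space[OF h(1) bb'] by (rule order_trans[OF ennreal_leI[OF h(2)] CC])
  have "(LINT x:Q|lebesgue. b Q x) = (LINT x|lborel. indicator (cube_of q x0) x *\<^sub>R b' x)"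
    unfolding set_lebesgue_integral_def
  proof (rule integral_lebesgue_eq_lborel)
    show "(\<lambda>x. indicator Q x *\<^sub>R b Q x) \<in> borel_measurable lebesgue"
      by (intro borel_measurable_scaleR bm borel_measurable_indicator) (use Q in auto)
    show "AE x in lborel. indicator Q x *\<^sub>R b Q x = indicator (cube_of q x0) x *\<^sub>R b' x"
      using bb' AE_in_cube_of[of q x0, folded Q_def]
    proof eventually_elim
      case (elim x)
      then show ?case using box_cube_of_cbox(2)[of q x0, folded Q_def] by (auto simp: indicator_def)
    qed
  qed measurable
  then have "avg q b' x0 = (1 / cvol CARD('n) q) *\<^sub>R (LINT x:Q|lebesgue. b Q x)" by (simp add: avg_def)
  then have 2: "\<delta> \<le> accr v (avg q b' x0)" if "norm v = 1" for v using h(4)[of v] that by simp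
  have inner: "(\<integral>\<^sup>+t. indicator {t. lev t \<in> {..q}} t * (ennreal (norm (TB b' t x)))\<^sup>2 \<partial>dtt)
      = (\<integral>\<^sup>+t\<in>{0<..<2 powi q}. ennreal ((norm (Theta_mat \<Psi> t (b Q) x))\<^sup>2 / t) \<partial>lebesgue)" for x
  proof -
    have [measurable]: "(\<lambda>t. TB b' t x) \<in> borel_measurable borel"
      unfolding TB_def by (rule borel_measurable_vec_lambda) measurable
    have "(\<integral>\<^sup>+t. indicator {t. lev t \<in> {..q}} t * (ennreal (norm (TB b' t x)))\<^sup>2 \<partial>dtt)
        = (\<integral>\<^sup>+t. indicator {0<..} t * ennreal (1 / t) * (indicator {t. lev t \<in> {..q}} t * (ennreal (norm (TB b' t x)))\<^sup>2) \<partial>lborel)"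
      by (rule nn_integral_dtt) measurable
    also have "\<dots> = (\<integral>\<^sup>+t\<in>{0<..<2 powi q}. ennreal ((norm (Theta_mat \<Psi> t (b Q) x))\<^sup>2 / t) \<partial>lborel)"
    proof (rule nn_integral_cong_AE)
      show "AE t in lborel. indicator {0<..} t * ennreal (1 / t) * (indicator {t. lev t \<in> {..q}} t * (ennreal (norm (TB b' t x)))\<^sup>2)
          = ennreal ((norm (Theta_mat \<Psi> t (b Q) x))\<^sup>2 / t) * indicator {0<..<2 powi q} t"
        using AE_not_in[OF Z]
      proof eventually_elim
        case (elim t)
        show ?case
        proof (cases "0 < t")
          case True
          then show ?thesis using Theta_mat_eq_TB[OF True elim bm b' bb', of x] lev_le_iff[OF True, of q]
            by (auto simp: indicator_def ennreal_power ennreal_mult'[symmetric])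
        qed simp
      qed
    qed
    finally show ?thesis by (simp add: nn_integral_completion)
  qed
  have "(\<integral>\<^sup>+x. indicator (cube_of q x0) x * ennreal_powr (\<integral>\<^sup>+t. indicator {t. lev t \<in> {..q}} t * (ennreal (norm (TB b' t x)))\<^sup>2 \<partial>dtt) (p / 2) \<partial>lborel)
      \<le> (\<integral>\<^sup>+x\<in>Q. ennreal_powr (\<integral>\<^sup>+t\<in>{0<..<2 powi q}. ennreal ((norm (Theta_mat \<Psi> t (b Q) x))\<^sup>2 / t) \<partial>lebesgue) (p / 2) \<partial>lebesgue)"
    unfolding inner nn_integral_completion
    using box_cube_of_cbox(2)[of q x0, folded Q_def] by (intro nn_integral_mono) (auto simp: indicator_def)
  also note h(3)
  also note CC
  finally show ?thesis using 1 2 b' by blast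
qed

text \<open>Each component of \<gamma>_t is bounded by |\<gamma>_t|, so the scalar estimate holds
  for every component of the kernel; Cauchy--Schwarz over the components gives the factor m.\<close>

lemma square_function_bound:
  assumes N: "N > 0"
    and Car: "\<And>l j x. avn j (\<lambda>y. \<integral>\<^sup>+t. indicator {t. lev t \<in> {l..j}} t * (ennreal (norm (Gam t y)))\<^sup>2 \<partial>dtt) x \<le> ennreal N"
    and f: "f \<in> Lp_space 2"
  shows "(\<integral>\<^sup>+(x, t)\<in>UNIV \<times> {0<..}. ennreal ((norm (Theta_vec \<Psi> t f x))\<^sup>2 / t) \<partial>lebesgue)
    \<le> ennreal (real CARD('m) * (2 * cR CARD('n) \<alpha> A + 8 * N) * (Lp_norm 2 f)\<^sup>2)"
proof -
  let ?m = "real CARD('m)" let ?K = "2 * cR CARD('n) \<alpha> A + 8 * N"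
  have cR: "cR CARD('n) \<alpha> A \<ge> 0"
    unfolding cR_def using Wc_pos[of \<alpha> "CARD('n)"] Wc_pos[of "\<alpha> / 2" "CARD('n)"] k.alpha by auto
  have fm: "f \<in> borel_measurable lebesgue" using f by (simp add: Lp_space_def)
  then obtain f' where f' [measurable]: "f' \<in> borel_measurable borel" and ff': "AE x in lborel. f x = f' x"
    by (rule lebesgue_borel_representative)
  have nth [measurable (raw)]: "(\<lambda>y. g y $ i) \<in> borel_measurable M"
    if "g \<in> borel_measurable M" for i and M :: "'z measure" and g :: "'z \<Rightarrow> complex ^ 'm"
    by (rule measurable_compose[OF that borel_measurable_continuous_onI]) (intro continuous_intros)
  define I where "I = (LINT x|lebesgue. norm (f x) powr 2)"
  have I: "I \<ge> 0" unfolding I_def by simp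
  have sqf: "sqn f' = ennreal I"
    using nn_integral_Lp_space[OF f ff'] by (simp add: sqn_def I_def ennreal_power)
  have Lp: "(Lp_norm 2 f)\<^sup>2 = I"
    using I unfolding Lp_norm_def I_def[symmetric] by (simp add: powr_half_sqrt)
  have L2f: "L2 f'" using sqf by (simp add: L2_def)
  have sq: "(\<Sum>i\<in>UNIV. sqn (\<lambda>y. f' y $ i)) = sqn f'"
  proof -
    have "(\<Sum>i\<in>UNIV. sqn (\<lambda>y. f' y $ i)) = (\<integral>\<^sup>+y. (\<Sum>i\<in>UNIV. (ennreal (norm (f' y $ i)))\<^sup>2) \<partial>lborel)"
      unfolding sqn_def by (subst nn_integral_sum; measurable)
    also have "\<dots> = sqn f'" unfolding sqn_def by (intro nn_integral_cong) (simp add: ennreal_power norm_sq_vec)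
    finally show ?thesis .
  qed
  have L2i: "L2 (\<lambda>y. f' y $ i)" for i
  proof -
    have "sqn (\<lambda>y. f' y $ i) \<le> (\<Sum>i\<in>UNIV. sqn (\<lambda>y. f' y $ i))" by (rule member_le_sum) auto
    then show ?thesis unfolding sq using L2f by (auto simp: L2_def intro: le_less_trans)
  qed
  let ?T = "\<lambda>t x. \<Sum>i\<in>UNIV. k.Th i (\<lambda>y. f' y $ i) t x"
  have comp: "(\<integral>\<^sup>+t. (\<integral>\<^sup>+x. (ennreal (norm (k.Th i (\<lambda>y. f' y $ i) t x)))\<^sup>2 \<partial>lborel) \<partial>dtt) \<le> ennreal ?K * sqn (\<lambda>y. f' y $ i)" for i
  proof (rule k.carleson_imp_L2[OF N _ L2i])
    fix l j x
    have "norm (k.gam i t y) \<le> norm (Gam t y)" for t y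
      using Finite_Cartesian_Product.norm_nth_le[of "Gam t y" i] by (simp add: Gam_def)
    then have "avn j (\<lambda>y. \<integral>\<^sup>+t. indicator {t. lev t \<in> {l..j}} t * (ennreal (norm (k.gam i t y)))\<^sup>2 \<partial>dtt) x
        \<le> avn j (\<lambda>y. \<integral>\<^sup>+t. indicator {t. lev t \<in> {l..j}} t * (ennreal (norm (Gam t y)))\<^sup>2 \<partial>dtt) x"
      by (intro avn_mono nn_integral_mono mult_left_mono power_mono ennreal_leI) auto
    also note Car
    finally show "avn j (\<lambda>y. \<integral>\<^sup>+t. indicator {t. lev t \<in> {l..j}} t * (ennreal (norm (k.gam i t y)))\<^sup>2 \<partial>dtt) x \<le> ennreal N" .
  qed
  have pw: "(ennreal (norm (?T t x)))\<^sup>2 \<le> ennreal ?m * (\<Sum>i\<in>UNIV. (ennreal (norm (k.Th i (\<lambda>y. f' y $ i) t x)))\<^sup>2)" for t x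
  proof -
    have "(norm (?T t x))\<^sup>2 \<le> (\<Sum>i\<in>UNIV. norm (k.Th i (\<lambda>y. f' y $ i) t x))\<^sup>2"
      by (intro power_mono norm_sum) auto
    also have "\<dots> \<le> (\<Sum>i\<in>UNIV. (norm (k.Th i (\<lambda>y. f' y $ i) t x))\<^sup>2) * ?m" by (rule sum_squared_le_sum_of_squares)
    finally have "ennreal ((norm (?T t x))\<^sup>2) \<le> ennreal (?m * (\<Sum>i\<in>UNIV. (norm (k.Th i (\<lambda>y. f' y $ i) t x))\<^sup>2))"
      by (intro ennreal_leI) (simp add: mult.commute)
    then show ?thesis by (simp add: ennreal_power ennreal_mult' del: ennreal_of_nat_eq_real_of_nat)
  qed
  have "(\<integral>\<^sup>+(x, t)\<in>UNIV \<times> {0<..}. ennreal ((norm (Theta_vec \<Psi> t f x))\<^sup>2 / t) \<partial>lebesgue)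
      = (\<integral>\<^sup>+z. (case z of (x, t) \<Rightarrow> ennreal ((norm (Theta_vec \<Psi> t f x))\<^sup>2 / t)) * indicator (UNIV \<times> {0<..}) z \<partial>(lborel \<Otimes>\<^sub>M lborel))"
    unfolding nn_integral_completion lborel_prod ..
  also have "\<dots> = (\<integral>\<^sup>+z. (case z of (x, t) \<Rightarrow> indicator {0<..} t * ennreal (1 / t) * (ennreal (norm (?T t x)))\<^sup>2) \<partial>(lborel \<Otimes>\<^sub>M lborel))"
  proof (rule nn_integral_cong_AE)
    have "(UNIV :: (real ^ 'n) set) \<times> Z \<in> null_sets (lborel \<Otimes>\<^sub>M lborel)"
      using Z by (auto simp: null_sets_def lborel.emeasure_pair_measure_Times)
    then have "AE z in (lborel :: (real ^ 'n) measure) \<Otimes>\<^sub>M lborel. z \<notin> UNIV \<times> Z" by (rule AE_not_in)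
    then show "AE z in lborel \<Otimes>\<^sub>M lborel. (case z of (x, t) \<Rightarrow> ennreal ((norm (Theta_vec \<Psi> t f x))\<^sup>2 / t)) * indicator (UNIV \<times> {0<..}) z
        = (case z of (x, t) \<Rightarrow> indicator {0<..} t * ennreal (1 / t) * (ennreal (norm (?T t x)))\<^sup>2)"
    proof eventually_elim
      case (elim z)
      obtain x t where z: "z = (x, t)" by (cases z)
      show ?case
      proof (cases "0 < t")
        case True
        then show ?thesis using elim Theta_vec_eq_Th[OF True _ fm L2f ff', of x]
          by (simp add: z indicator_def ennreal_power ennreal_mult'[symmetric])
      qed (simp add: z)
    qed
  qed
  also have "\<dots> = (\<integral>\<^sup>+t. (\<integral>\<^sup>+x. indicator {0<..} t * ennreal (1 / t) * (ennreal (norm (?T t x)))\<^sup>2 \<partial>lborel) \<partial>lborel)"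
    by (subst lborel_pair.nn_integral_snd[symmetric]; measurable)
  also have "\<dots> = (\<integral>\<^sup>+t. indicator {0<..} t * ennreal (1 / t) * (\<integral>\<^sup>+x. (ennreal (norm (?T t x)))\<^sup>2 \<partial>lborel) \<partial>lborel)"
    by (intro nn_integral_cong nn_integral_cmult) measurable
  also have "\<dots> = (\<integral>\<^sup>+t. (\<integral>\<^sup>+x. (ennreal (norm (?T t x)))\<^sup>2 \<partial>lborel) \<partial>dtt)"
    by (rule nn_integral_dtt[symmetric]) measurable
  also have "\<dots> \<le> (\<integral>\<^sup>+t. (\<integral>\<^sup>+x. ennreal ?m * (\<Sum>i\<in>UNIV. (ennreal (norm (k.Th i (\<lambda>y. f' y $ i) t x)))\<^sup>2) \<partial>lborel) \<partial>dtt)"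
    by (intro nn_integral_mono pw)
  also have "\<dots> = ennreal ?m * (\<Sum>i\<in>UNIV. \<integral>\<^sup>+t. (\<integral>\<^sup>+x. (ennreal (norm (k.Th i (\<lambda>y. f' y $ i) t x)))\<^sup>2 \<partial>lborel) \<partial>dtt)"
    by (subst nn_integral_cmult, measurable, subst nn_integral_sum, measurable, subst nn_integral_cmult, measurable, subst nn_integral_sum, measurable)
  also have "\<dots> \<le> ennreal ?m * (\<Sum>i\<in>UNIV. ennreal ?K * sqn (\<lambda>y. f' y $ i))"
    by (intro mult_left_mono sum_mono comp) simp
  also have "\<dots> = ennreal ?m * (ennreal ?K * ennreal I)"
    by (simp only: sum_distrib_left[symmetric] sq sqf)
  also have "\<dots> = ennreal (?m * ?K * (Lp_norm 2 f)\<^sup>2)"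
    unfolding Lp using I cR N by (simp add: ennreal_mult mult.assoc del: ennreal_plus ennreal_of_nat_eq_real_of_nat)
  finally show ?thesis .
qed

end

theorem theorem2p1:
  fixes \<alpha> C \<delta> C\<^sub>0 p :: real
  assumes "\<alpha> > 0" and "\<delta> > 0" and "p > 1"
  shows "\<exists>C'::real.
    \<forall>(\<Psi> :: real \<Rightarrow> real ^ 'n \<Rightarrow> real ^ 'n \<Rightarrow> complex ^ 'm)
     (b :: (real ^ 'n) set \<Rightarrow> real ^ 'n \<Rightarrow> complex ^ 'm ^ 'm).
      square_function_kernel \<alpha> C \<Psi> \<longrightarrow>
      dyadic_testing_system p \<delta> C\<^sub>0 \<Psi> b \<longrightarrow>
      (\<forall>f \<in> Lp_space 2.
        (\<integral>\<^sup>+(x, t)\<in>UNIV \<times> {0<..}. ennreal ((norm (Theta_vec \<Psi> t f x))\<^sup>2 / t) \<partial>lebesgue)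
          \<le> ennreal (C' * (Lp_norm 2 f)\<^sup>2))"
proof -
  define A where "A = 2 * \<bar>C\<bar> * ((1 + 2 * real CARD('n)) powr (real CARD('n) + min \<alpha> 1) + 1)"
  have a: "0 < min \<alpha> 1" "min \<alpha> 1 \<le> 1" and A: "A \<ge> 0" and C0: "0 \<le> max C\<^sub>0 0" using assms by (auto simp: A_def)
  show ?thesis
  proof (rule carleson_of_testing[OF a A assms(2,3) C0, where 'n='n and 'm='m])
    fix N :: real
    assume N: "N > 0" and Car: "\<And>\<Psi> :: real \<Rightarrow> real ^ 'n \<Rightarrow> real ^ 'n \<Rightarrow> complex ^ 'm. tb_kernel (min \<alpha> 1) A \<Psi> \<Longrightarrow>
      (\<And>q x0. \<exists>b. b \<in> borel_measurable borel \<and>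
        (\<integral>\<^sup>+y. ennreal (norm (b y) powr p) \<partial>lborel) \<le> ennreal (max C\<^sub>0 0 * cvol CARD('n) q) \<and>
        (\<forall>v. norm v = 1 \<longrightarrow> \<delta> \<le> accr v (avg q b x0)) \<and>
        (\<integral>\<^sup>+x. indicator (cube_of q x0) x * ennreal_powr (\<integral>\<^sup>+t. indicator {t. lev t \<in> {..q}} t * (ennreal (norm (tb_kernel.TB \<Psi> b t x)))\<^sup>2 \<partial>dtt) (p / 2) \<partial>lborel)
          \<le> ennreal (max C\<^sub>0 0 * cvol CARD('n) q)) \<Longrightarrow>
      (\<And>l j x. avn j (\<lambda>y. \<integral>\<^sup>+t. indicator {t. lev t \<in> {l..j}} t * (ennreal (norm (tb_kernel.Gam \<Psi> t y)))\<^sup>2 \<partial>dtt) x \<le> ennreal N)"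
    \<comment> \<open>\<open>N\<close> is already fixed at this point, so the witness below depends
      on the data of the hypotheses and not on the kernel or the test functions.\<close>
    show ?thesis
    proof (intro exI[of _ "real CARD('m) * (2 * cR CARD('n) (min \<alpha> 1) A + 8 * N)"] allI impI ballI)
      fix \<Psi> :: "real \<Rightarrow> real ^ 'n \<Rightarrow> real ^ 'n \<Rightarrow> complex ^ 'm" and b :: "(real ^ 'n) set \<Rightarrow> real ^ 'n \<Rightarrow> complex ^ 'm ^ 'm"
        and f :: "real ^ 'n \<Rightarrow> complex ^ 'm"
      assume k: "square_function_kernel \<alpha> C \<Psi>" and test: "dyadic_testing_system p \<delta> C\<^sub>0 \<Psi> b" and f: "f \<in> Lp_space 2"
      obtain Z where Z: "Z \<in> null_sets lborel"
        and tb: "tb_kernel (min \<alpha> 1) A (\<lambda>t x y. if 0 < t \<and> t \<notin> Z then \<Psi> t x y else 0)"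
        using kernel_borel_version[OF assms(1) k] unfolding A_def by blast
      show "(\<integral>\<^sup>+(x, t)\<in>UNIV \<times> {0<..}. ennreal ((norm (Theta_vec \<Psi> t f x))\<^sup>2 / t) \<partial>lebesgue)
          \<le> ennreal (real CARD('m) * (2 * cR CARD('n) (min \<alpha> 1) A + 8 * N) * (Lp_norm 2 f)\<^sup>2)"
        by (rule square_function_bound[OF Z refl tb N Car[OF tb testing_transfer[OF Z refl tb test max.cobounded1]] f])
    qed
  qed
qed

end
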